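(* Let $g',g,d',d\in\mathbb N$ and let $f:\mathcal B_{g'\times g}\to\mathcal B_{d'\times d}$ be an NC ball map with $f(0)\notin\partial\mathcal B_{d'\times d}$. Then $$f(x)=\mathcal F_{f(0)}\big(\varphi(x)\big),\qquad(\mathrm i)$$ where $$\varphi(x)=\mathcal F_{f(0)}\big(f(x)\big)=V\begin{bmatrix}x&0\\0&\tilde\varphi(x)\end{bmatrix}U^*\qquad(\mathrm{ii})$$ for some unitaries $U:\mathbb C^d\to\mathbb C^d$ and $V:\mathbb C^{d'}\to\mathbb C^{d'}$ and an NC analytic contraction-valued map $\tilde\varphi$ with $\|\tilde\varphi(0)\|<1$. Conversely, every NC analytic $f$ satisfying (i) and (ii) for some unitaries $U:\mathbb C^d\to\mathbb C^d$ and $V:\mathbb C^{d'}\to\mathbb C^{d'}$ and some NC analytic contraction-valued map $\tilde\varphi$ with $\|\tilde\varphi(0)\|<1$ is an NC ball map $f:\mathcal B_{g'\times g}\to\mathcal B_{d'\times d}$ with $f(0)\notin\partial\mathcal B_{d'\times d}$.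
   Context: For $N\in\mathbb N$, $\mathcal M_{d'\times d}(N)$ is the set of $d'\times d$ block matrices $X=[X_{j\ell}]$ with $X_{j\ell}\in\mathbb C^{N\times N}$, regarded as $d'N\times dN$ matrices with the operator norm; $\mathcal M_{d'\times d}=\bigsqcup_N\mathcal M_{d'\times d}(N)$. Put $\mathcal B_{d'\times d}=\{\|X\|\le1\}$, $\operatorname{int}\mathcal B_{d'\times d}=\{\|X\|<1\}$, $\partial\mathcal B_{d'\times d}=\{\|X\|=1\}$ (subsets of $\mathcal M_{d'\times d}$). NC analytic functions: let $x=(x_{j\ell})$ be $g'g$ noncommuting variables and $\langle x\rangle$ the set of words in them; for $X\in\mathcal M_{g'\times g}(N)$, $w(X)\in\mathbb C^{N\times N}$ is the evaluation of the word $w$. An NC analytic function $f:\mathcal B_{g'\times g}\to\mathcal M_{d'\times d}$ assigns to each $X\in\operatorname{int}\mathcal B_{g'\times g}$ of size $N$ a matrix $f(X)\in\mathcal M_{d'\times d}(N)$, such that: (1) there are $a_w\in\mathbb C^{d'\times d}$ and $\varepsilon>0$ such that for all $N$ and all $X\in\mathcal M_{g'\times g}(N)$ with $\|X\|<\varepsilon$, $f(X)=\sum_{\alpha=0}^\infty\sum_{|w|=\alpha}a_w\otimes w(X)$, the outer sum converging; (2) for every analytic $a$ from a domain $W\subseteq\mathbb C^K$ into $\operatorname{int}\mathcal B_{g'\times g}$ (at a fixed size), $f\circ a$ is analytic on $W$, and continuous up to $\partial W$ whenever $a$ extends continuously to $\overline W$ with values in $\operatorname{int}\mathcal B_{g'\times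 g}$. $f(0)$ denotes $a_\emptyset\in\mathbb C^{d'\times d}$. For $\|X\|=1$ and $t\in\mathbb R$, $f(e^{it}X)$ denotes $\lim_{r\nearrow1}f(re^{it}X)$ when this limit exists. An NC ball map $f:\mathcal B_{g'\times g}\to\mathcal B_{d'\times d}$ is an NC analytic function with values in $\mathcal B_{d'\times d}$ such that $\|f(e^{it}X)\|=1$ whenever $\|X\|=1$ and $f(e^{it}X)$ exists. Contraction-valued means $\|\tilde\varphi(X)\|\le1$ for all $X$ in the interior. Linear fractional maps: for $v\in\mathbb C^{d'\times d}$ with $\|v\|<1$, $\mathcal F_v:\mathcal B_{d'\times d}\to\mathcal B_{d'\times d}$ is $$\mathcal F_v(u)=v-(I_{d'}-vv^* )^{1/2}\,u\,(I_d-v^*u)^{-1}(I_d-v^*v)^{1/2},$$ where for $u$ of size $N$ one replaces $v$ by $v\otimes I_N$ and $I_{d'},I_d$ by $I_{d'N},I_{dN}$. The identities (i), (ii) presuppose $\|f(0)\|<1$, so that $\mathcal F_{f(0)}$ is defined. The block form in (ii) evaluated at $X$ of size $N$ is $(V\otimes I_N)\begin{bmatrix}X&0\\0&\tilde\varphi(X)\end{bmatrix}(U\otimes I_N)^*$, where $\tilde\varphi$ takes values in $\mathcal M_{(d'-g')\times(d-g)}$; it is understood to include $g'\le d'$, $g\le d$, and block rows or columns of size zero are absent. *)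

theory Defs
  imports "HOL-Analysis.Analysis" "Jordan_Normal_Form.Schur_Decomposition"
begin

text \<open>
  An element of size \<open>N\<close> of \<open>\<M>\<close> with \<open>p\<close> block rows and \<open>q\<close> block columns is a complex
  matrix in \<open>carrier_mat (p * N) (q * N)\<close>; its block \<open>(j, l)\<close> consists of the entries
  \<open>(j * N + a, l * N + b)\<close> with \<open>a, b < N\<close>.  Sizes \<open>N\<close> range over the positive integers.
  Matrices with zero rows or columns are genuine objects here, so the degenerate
  block shapes need no separate treatment.
\<close>

section \<open>Matrices\<close>

definition vec_l2norm :: "complex vec \<Rightarrow> real" where
  "vec_l2norm x = L2_set (\<lambda>i. cmod (vec_index x i)) {..<dim_vec x}"

definition op_norm :: "complex mat \<Rightarrow> real" where
  "op_norm A = (SUP x\<in>{x \<in> carrier_vec (dim_col A). vec_l2norm x \<le> 1}. vec_l2norm (A *\<^sub>v x))"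

text \<open>Norm convergence; meaningful when \<open>L\<close> and all \<open>A x\<close> have the same format.\<close>

definition mat_tendsto :: "('b \<Rightarrow> complex mat) \<Rightarrow> complex mat \<Rightarrow> 'b filter \<Rightarrow> bool" where
  "mat_tendsto A L F \<longleftrightarrow> ((\<lambda>x. op_norm (A x - L)) \<longlongrightarrow> 0) F"

definition kron :: "complex mat \<Rightarrow> complex mat \<Rightarrow> complex mat" where
  "kron A B = Matrix.mat (dim_row A * dim_row B) (dim_col A * dim_col B)
     (\<lambda>(i, j). A $$ (i div dim_row B, j div dim_col B) * B $$ (i mod dim_row B, j mod dim_col B))"

definition unitary_mat :: "nat \<Rightarrow> complex mat \<Rightarrow> bool" where
  "unitary_mat n U \<longleftrightarrow> U \<in> carrier_mat n n
     \<and> U * mat_adjoint U = 1\<^sub>m n \<and> mat_adjoint U * U = 1\<^sub>m n"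

text \<open>The order on \<^typ>\<open>complex\<close> is that of \<^theory>\<open>HOL-Library.Complex_Order\<close>: \<open>0 \<le> z\<close> means
  that \<open>z\<close> is real and nonnegative.\<close>

definition psd_mat :: "complex mat \<Rightarrow> bool" where
  "psd_mat A \<longleftrightarrow> A \<in> carrier_mat (dim_row A) (dim_row A) \<and> mat_adjoint A = A
     \<and> (\<forall>x \<in> carrier_vec (dim_row A). 0 \<le> (A *\<^sub>v x) \<bullet>c x)"

text \<open>Only used for positive semidefinite \<open>A\<close>, where the root exists and is unique.\<close>

definition psd_sqrt :: "complex mat \<Rightarrow> complex mat" where
  "psd_sqrt A = (THE B. B \<in> carrier_mat (dim_row A) (dim_row A) \<and> psd_mat B \<and> B * B = A)"

section \<open>Balls\<close>

definition nc_ball :: "nat \<Rightarrow> nat \<Rightarrow> nat \<Rightarrow> complex mat set" where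
  "nc_ball p q N = {X \<in> carrier_mat (p * N) (q * N). op_norm X \<le> 1}"

definition nc_int_ball :: "nat \<Rightarrow> nat \<Rightarrow> nat \<Rightarrow> complex mat set" where
  "nc_int_ball p q N = {X \<in> carrier_mat (p * N) (q * N). op_norm X < 1}"

definition nc_bdry_ball :: "nat \<Rightarrow> nat \<Rightarrow> nat \<Rightarrow> complex mat set" where
  "nc_bdry_ball p q N = {X \<in> carrier_mat (p * N) (q * N). op_norm X = 1}"

section \<open>Words and power series in noncommuting variables\<close>

text \<open>The letter \<open>(j, l)\<close> stands for the variable \<open>x\<^bsub>jl\<^esub>\<close>.\<close>

type_synonym nc_word = "(nat \<times> nat) list"

definition nc_words :: "nat \<Rightarrow> nat \<Rightarrow> nat \<Rightarrow> nc_word set" where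
  "nc_words g' g \<alpha> = {w. set w \<subseteq> {..<g'} \<times> {..<g} \<and> length w = \<alpha>}"

definition nc_block :: "nat \<Rightarrow> complex mat \<Rightarrow> nat \<times> nat \<Rightarrow> complex mat" where
  "nc_block N X jl = Matrix.mat N N (\<lambda>(a, b). X $$ (fst jl * N + a, snd jl * N + b))"

definition word_eval :: "nat \<Rightarrow> nc_word \<Rightarrow> complex mat \<Rightarrow> complex mat" where
  "word_eval N w X = foldr (\<lambda>jl M. nc_block N X jl * M) w (1\<^sub>m N)"

definition nc_partial_sum ::
  "nat \<Rightarrow> nat \<Rightarrow> nat \<Rightarrow> nat \<Rightarrow> (nc_word \<Rightarrow> complex mat) \<Rightarrow> nat \<Rightarrow> complex mat \<Rightarrow> nat \<Rightarrow> complex mat" where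
  "nc_partial_sum g' g d' d a N X n = Matrix.mat (d' * N) (d * N)
     (\<lambda>ij. \<Sum>\<alpha><n. \<Sum>w\<in>nc_words g' g \<alpha>. kron (a w) (word_eval N w X) $$ ij)"

section \<open>Analytic functions of several complex variables\<close>

text \<open>The space \<open>\<complex>\<^sup>K\<close> is realised as the extensional functions on \<open>{..<K}\<close>, since \<open>K\<close>
  is quantified inside the definition of an NC analytic function.\<close>

abbreviation CK :: "nat \<Rightarrow> (nat \<Rightarrow> complex) topology" where
  "CK K \<equiv> product_topology (\<lambda>_. euclidean) {..<K}"

definition domain_CK :: "nat \<Rightarrow> (nat \<Rightarrow> complex) set \<Rightarrow> bool" where
  "domain_CK K W \<longleftrightarrow> W \<noteq> {} \<and> openin (CK K) W \<and> connectedin (CK K) W"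

text \<open>Complex (Frechet) differentiability at every point of the open set \<open>W\<close>, which is how
  \<^const>\<open>analytic_on\<close> and \<^const>\<open>holomorphic_on\<close> are introduced for one variable.\<close>

definition analytic_CK :: "nat \<Rightarrow> (nat \<Rightarrow> complex) set \<Rightarrow> ((nat \<Rightarrow> complex) \<Rightarrow> complex) \<Rightarrow> bool" where
  "analytic_CK K W h \<longleftrightarrow>
     (\<forall>c\<in>W. \<exists>l :: nat \<Rightarrow> complex. \<forall>e>0. \<exists>\<delta>>0. \<forall>z\<in>W.
        L2_set (\<lambda>i. cmod (z i - c i)) {..<K} < \<delta> \<longrightarrow>
        cmod (h z - h c - (\<Sum>i<K. l i * (z i - c i))) \<le> e * L2_set (\<lambda>i. cmod (z i - c i)) {..<K})"

definition mat_analytic_CK ::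
  "nat \<Rightarrow> (nat \<Rightarrow> complex) set \<Rightarrow> nat \<Rightarrow> nat \<Rightarrow> ((nat \<Rightarrow> complex) \<Rightarrow> complex mat) \<Rightarrow> bool" where
  "mat_analytic_CK K W m n A \<longleftrightarrow>
     (\<forall>i<m. \<forall>j<n. analytic_CK K W (\<lambda>z. A z $$ (i, j)))"

definition mat_continuous_CK ::
  "nat \<Rightarrow> (nat \<Rightarrow> complex) set \<Rightarrow> nat \<Rightarrow> nat \<Rightarrow> ((nat \<Rightarrow> complex) \<Rightarrow> complex mat) \<Rightarrow> bool" where
  "mat_continuous_CK K S m n A \<longleftrightarrow>
     (\<forall>i<m. \<forall>j<n. continuous_map (subtopology (CK K) S) euclidean (\<lambda>z. A z $$ (i, j)))"

section \<open>NC analytic functions and NC ball maps\<close>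

text \<open>The first argument of an NC map is the size \<open>N\<close>; only its values on the open balls matter.\<close>

type_synonym nc_map = "nat \<Rightarrow> complex mat \<Rightarrow> complex mat"

definition nc_expansion ::
  "nat \<Rightarrow> nat \<Rightarrow> nat \<Rightarrow> nat \<Rightarrow> nc_map \<Rightarrow> (nc_word \<Rightarrow> complex mat) \<Rightarrow> real \<Rightarrow> bool" where
  "nc_expansion g' g d' d f a \<epsilon> \<longleftrightarrow> \<epsilon> > 0 \<and> (\<forall>w. a w \<in> carrier_mat d' d) \<and>
     (\<forall>N\<ge>1. \<forall>X\<in>nc_int_ball g' g N. op_norm X < \<epsilon> \<longrightarrow>
        mat_tendsto (nc_partial_sum g' g d' d a N X) (f N X) sequentially)"

text \<open>In the last clause, the function \<open>a\<close> on the closure of \<open>W\<close> is the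
  continuous extension of its restriction to \<open>W\<close>.\<close>

definition nc_analytic :: "nat \<Rightarrow> nat \<Rightarrow> nat \<Rightarrow> nat \<Rightarrow> nc_map \<Rightarrow> bool" where
  "nc_analytic g' g d' d f \<longleftrightarrow>
     (\<forall>N\<ge>1. \<forall>X\<in>nc_int_ball g' g N. f N X \<in> carrier_mat (d' * N) (d * N)) \<and>
     (\<exists>a \<epsilon>. nc_expansion g' g d' d f a \<epsilon>) \<and>
     (\<forall>N\<ge>1. \<forall>K\<ge>1. \<forall>W a. domain_CK K W \<and> a ` W \<subseteq> nc_int_ball g' g N
          \<and> mat_analytic_CK K W (g' * N) (g * N) a \<longrightarrow>
        mat_analytic_CK K W (d' * N) (d * N) (f N \<circ> a) \<and>
        (a ` (CK K closure_of W) \<subseteq> nc_int_ball g' g N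
           \<and> mat_continuous_CK K (CK K closure_of W) (g' * N) (g * N) a \<longrightarrow>
         mat_continuous_CK K (CK K closure_of W) (d' * N) (d * N) (f N \<circ> a)))"

text \<open>\<open>f(0)\<close>: this is the coefficient of the empty word in any expansion of \<open>f\<close>, see
  \<open>nc_at_zero_eq\<close> below.\<close>

definition nc_at_zero :: "nat \<Rightarrow> nat \<Rightarrow> nc_map \<Rightarrow> complex mat" where
  "nc_at_zero g' g f = f 1 (0\<^sub>m g' g)"

definition nc_contraction_valued :: "nat \<Rightarrow> nat \<Rightarrow> nc_map \<Rightarrow> bool" where
  "nc_contraction_valued g' g f \<longleftrightarrow> (\<forall>N\<ge>1. \<forall>X\<in>nc_int_ball g' g N. op_norm (f N X) \<le> 1)"

definition nc_ball_map :: "nat \<Rightarrow> nat \<Rightarrow> nat \<Rightarrow> nat \<Rightarrow> nc_map \<Rightarrow> bool" where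
  "nc_ball_map g' g d' d f \<longleftrightarrow>
     nc_analytic g' g d' d f \<and>
     (\<forall>N\<ge>1. \<forall>X\<in>nc_int_ball g' g N. f N X \<in> nc_ball d' d N) \<and>
     (\<forall>N\<ge>1. \<forall>X\<in>nc_bdry_ball g' g N. \<forall>t::real. \<forall>L\<in>carrier_mat (d' * N) (d * N).
        mat_tendsto (\<lambda>r. f N ((complex_of_real r * cis t) \<cdot>\<^sub>m X)) L (at_left 1)
          \<longrightarrow> op_norm L = 1)"

section \<open>Linear fractional maps and the normal form\<close>

text \<open>\<open>lin_frac d' d v N u\<close> is \<open>\<F>\<^bsub>v\<^esub>(u)\<close> for \<open>u\<close> of size \<open>N\<close>; the inverse exists when
  \<open>\<parallel>v\<parallel> < 1\<close> and \<open>\<parallel>u\<parallel> \<le> 1\<close>.\<close>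

definition lin_frac :: "nat \<Rightarrow> nat \<Rightarrow> complex mat \<Rightarrow> nat \<Rightarrow> complex mat \<Rightarrow> complex mat" where
  "lin_frac d' d v N u = (let vN = kron v (1\<^sub>m N); vs = mat_adjoint vN in
     vN - psd_sqrt (1\<^sub>m (d' * N) - vN * vs) * u
          * the (mat_inverse (1\<^sub>m (d * N) - vs * u)) * psd_sqrt (1\<^sub>m (d * N) - vs * vN))"

definition nc_block_diag :: "nat \<Rightarrow> nat \<Rightarrow> nat \<Rightarrow> nat \<Rightarrow> nat \<Rightarrow> complex mat \<Rightarrow> complex mat \<Rightarrow> complex mat" where
  "nc_block_diag g' g d' d N X Y =
     four_block_mat X (0\<^sub>m (g' * N) ((d - g) * N)) (0\<^sub>m ((d' - g') * N) (g * N)) Y"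

text \<open>\<open>f\<close> satisfies (i) and (ii) with the data \<open>U\<close>, \<open>V\<close>, \<open>\<psi>\<close> (\<open>\<psi>\<close> is the lower right corner);
  \<open>op_norm (nc_at_zero g' g f) < 1\<close> is presupposed by the use of \<open>\<F>\<^bsub>f(0)\<^esub>\<close>.\<close>

definition nc_ball_normal_form ::
  "nat \<Rightarrow> nat \<Rightarrow> nat \<Rightarrow> nat \<Rightarrow> nc_map \<Rightarrow> complex mat \<Rightarrow> complex mat \<Rightarrow> nc_map \<Rightarrow> bool" where
  "nc_ball_normal_form g' g d' d f U V \<psi> \<longleftrightarrow>
     op_norm (nc_at_zero g' g f) < 1 \<and> g' \<le> d' \<and> g \<le> d \<and>
     unitary_mat d U \<and> unitary_mat d' V \<and>
     nc_analytic g' g (d' - g') (d - g) \<psi> \<and>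
     nc_contraction_valued g' g \<psi> \<and>
     op_norm (nc_at_zero g' g \<psi>) < 1 \<and>
     (let \<phi> = (\<lambda>N X. lin_frac d' d (nc_at_zero g' g f) N (f N X)) in
      \<forall>N\<ge>1. \<forall>X\<in>nc_int_ball g' g N.
        f N X = lin_frac d' d (nc_at_zero g' g f) N (\<phi> N X) \<and>
        \<phi> N X = kron V (1\<^sub>m N) * nc_block_diag g' g d' d N X (\<psi> N X)
                 * mat_adjoint (kron U (1\<^sub>m N)))"

section \<open>\<open>f(0)\<close> is the constant coefficient\<close>

lemma vec_l2norm_mult_le:
  assumes A: "A \<in> carrier_mat m n" and x: "x \<in> carrier_vec n" "vec_l2norm x \<le> 1"
  shows "vec_l2norm (A *\<^sub>v x) \<le> (\<Sum>i<m. \<Sum>j<n. cmod (A $$ (i, j)))"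
proof -
  have xj: "cmod (vec_index x j) \<le> 1" if "j < n" for j
  proof -
    have "cmod (vec_index x j) \<le> vec_l2norm x"
      unfolding vec_l2norm_def using x that by (intro member_le_L2_set) auto
    then show ?thesis using x by simp
  qed
  have "vec_l2norm (A *\<^sub>v x) \<le> (\<Sum>i<m. cmod (vec_index (A *\<^sub>v x) i))"
    using L2_set_le_sum[of "{..<m}" "\<lambda>i. cmod (vec_index (A *\<^sub>v x) i)"] A
    by (simp add: vec_l2norm_def)
  also have "\<dots> \<le> (\<Sum>i<m. \<Sum>j<n. cmod (A $$ (i, j)))"
  proof (rule sum_mono)
    fix i assume "i \<in> {..<m}"
    then have "vec_index (A *\<^sub>v x) i = (\<Sum>j<n. A $$ (i, j) * vec_index x j)"
      using A x by (auto simp: scalar_prod_def lessThan_atLeast0 intro!: sum.cong)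
    then have "cmod (vec_index (A *\<^sub>v x) i) \<le> (\<Sum>j<n. cmod (A $$ (i, j) * vec_index x j))"
      by (simp add: norm_sum)
    also have "\<dots> \<le> (\<Sum>j<n. cmod (A $$ (i, j)))"
      using xj by (intro sum_mono) (auto simp: norm_mult intro: mult_left_le)
    finally show "cmod (vec_index (A *\<^sub>v x) i) \<le> (\<Sum>j<n. cmod (A $$ (i, j)))" .
  qed
  finally show ?thesis .
qed

lemma norm_entry_le_op_norm:
  assumes A: "A \<in> carrier_mat m n" and i: "i < m" and j: "j < n"
  shows "cmod (A $$ (i, j)) \<le> op_norm A"
proof -
  let ?S = "{x \<in> carrier_vec (dim_col A). vec_l2norm x \<le> 1}"
  have bdd: "bdd_above ((\<lambda>x. vec_l2norm (A *\<^sub>v x)) ` ?S)"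
    using vec_l2norm_mult_le[OF A] A by (intro bdd_aboveI) auto
  have L: "L2_set (\<lambda>k. cmod (vec_index (unit_vec n j) k)) {..<n} \<le> 1"
    using L2_set_le_sum[of "{..<n}" "\<lambda>k. cmod (vec_index (unit_vec n j) k)"] j
    by (simp add: if_distrib cong: if_cong)
  have u: "(unit_vec n j :: complex vec) \<in> ?S"
    using A L by (simp add: vec_l2norm_def)
  have "vec_index (A *\<^sub>v unit_vec n j) i = A $$ (i, j)"
    using A i j by simp
  then have "cmod (A $$ (i, j)) \<le> vec_l2norm (A *\<^sub>v unit_vec n j)"
    unfolding vec_l2norm_def
    using member_le_L2_set[of "{..<m}" i "\<lambda>i. cmod (vec_index (A *\<^sub>v unit_vec n j) i)"] A i by simp
  also have "\<dots> \<le> op_norm A"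
    unfolding op_norm_def by (rule cSUP_upper[OF u bdd])
  finally show ?thesis .
qed

lemma op_norm_zero_mat: "op_norm (0\<^sub>m m n) = 0"
proof -
  let ?S = "{x \<in> carrier_vec n. vec_l2norm x \<le> (1 :: real)}"
  have "0\<^sub>v n \<in> ?S" by (simp add: vec_l2norm_def L2_set_def)
  then have "?S \<noteq> {}" by blast
  moreover have "vec_l2norm (0\<^sub>m m n *\<^sub>v x) = 0" if "x \<in> ?S" for x
    using that by (simp add: vec_l2norm_def L2_set_def)
  ultimately show ?thesis by (simp add: op_norm_def)
qed

lemma nc_at_zero_eq:
  assumes an: "nc_analytic g' g d' d f" and ex: "nc_expansion g' g d' d f a \<epsilon>"
  shows "nc_at_zero g' g f = a []"
proof -
  define L where "L = f 1 (0\<^sub>m g' g)"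
  let ?O = "0\<^sub>m g' g :: complex mat"
  have O: "?O \<in> nc_int_ball g' g 1" by (simp add: nc_int_ball_def op_norm_zero_mat)
  have Lc: "L \<in> carrier_mat d' d"
    using an O by (auto simp: nc_analytic_def L_def dest!: spec[of _ 1])
  have ac: "\<And>w. a w \<in> carrier_mat d' d" and e: "\<epsilon> > 0"
    using ex by (auto simp: nc_expansion_def)
  have lim: "mat_tendsto (nc_partial_sum g' g d' d a 1 ?O) L sequentially"
    using ex O e by (auto simp: nc_expansion_def L_def op_norm_zero_mat dest!: spec[of _ 1])
  have z: "kron (a w) (word_eval 1 w ?O) $$ (i, j) = 0"
    if w: "w \<noteq> []" "set w \<subseteq> {..<g'} \<times> {..<g}" and ij: "i < d'" "j < d" for w i j
  proof -
    have dims: "word_eval 1 w' ?O \<in> carrier_mat 1 1" for w'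
      by (induction w') (auto simp: word_eval_def nc_block_def)
    obtain jl w' where ww: "w = jl # w'" using w(1) by (cases w) auto
    have "nc_block 1 ?O jl = 0\<^sub>m 1 1"
      using w(2) by (intro eq_matI) (auto simp: nc_block_def ww)
    then have "word_eval 1 w ?O = 0\<^sub>m 1 1"
      using dims[of w'] by (simp add: word_eval_def ww)
    then show ?thesis using ij ac[of w] by (auto simp: kron_def)
  qed
  have k: "kron (a []) (1\<^sub>m 1) $$ (i, j) = a [] $$ (i, j)" if "i < d'" "j < d" for i j
    using ac[of "[]"] that by (auto simp: kron_def)
  have ps: "nc_partial_sum g' g d' d a 1 ?O n = a []" if n: "n \<ge> 1" for n
  proof (rule eq_matI)
    fix i j assume "i < dim_row (a [])" "j < dim_col (a [])"
    then have ij: "i < d'" "j < d" using ac[of "[]"] by auto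
    have s0: "(\<Sum>w\<in>nc_words g' g \<alpha>. kron (a w) (word_eval 1 w ?O) $$ (i, j))
                = (if \<alpha> = 0 then a [] $$ (i, j) else 0)" for \<alpha>
    proof (cases "\<alpha> = 0")
      case True
      then have "nc_words g' g \<alpha> = {[]}" by (auto simp: nc_words_def)
      then show ?thesis using True k[OF ij] by (simp add: word_eval_def)
    next
      case False
      then show ?thesis using z ij by (auto simp: nc_words_def intro!: sum.neutral)
    qed
    show "nc_partial_sum g' g d' d a 1 ?O n $$ (i, j) = a [] $$ (i, j)"
      using ij n unfolding nc_partial_sum_def by (simp add: s0 del: One_nat_def)
  qed (use ac[of "[]"] in \<open>auto simp: nc_partial_sum_def\<close>)
  have "((\<lambda>n. op_norm (a [] - L)) \<longlongrightarrow> 0) sequentially"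
    by (rule Lim_transform_eventually[OF lim[unfolded mat_tendsto_def]])
       (auto simp: eventually_sequentially ps simp del: One_nat_def intro!: exI[of _ 1])
  then have 0: "op_norm (a [] - L) = 0"
    by (simp add: tendsto_const_iff)
  have "L = a []"
  proof (rule eq_matI)
    fix i j assume "i < dim_row (a [])" "j < dim_col (a [])"
    then have ij: "i < d'" "j < d" using ac[of "[]"] by auto
    have "a [] - L \<in> carrier_mat d' d" using ac Lc by auto
    from norm_entry_le_op_norm[OF this ij] have "(a [] - L) $$ (i, j) = 0"
      unfolding 0 by simp
    then show "L $$ (i, j) = a [] $$ (i, j)" using ij ac[of "[]"] Lc by simp
  qed (use ac[of "[]"] Lc in auto)
  then show ?thesis by (simp add: nc_at_zero_def L_def)
qed

end

theory Submission
  imports Defs "HOL-Complex_Analysis.Laurent_Convergence"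
begin

text \<open>
  Write \<open>\<F>\<^sub>v\<close> for the linear fractional map with \<open>v = f(0)\<close>.  It is an involution of the closed ball
  of matrices, it maps matrices of norm one to matrices of norm one, and the norm identity behind this is the
  isometry of the Julia operator of \<open>v\<close> (\<open>mat_moebius_involution\<close>, \<open>mat_moebius_norm_1\<close>,
  \<open>Julia_isometry\<close>).  Moreover \<open>\<F>\<^sub>v \<circ> f\<close> is again NC analytic (\<open>nc_analytic_mat_moebius\<close>): analyticity
  and continuity survive because the values are rational expressions in those of \<open>f\<close>, and the Taylor
  coefficients of \<open>f (1 - v\<^sup>* f)\<^sup>-\<^sup>1\<close> satisfy a recursion that keeps them NC polynomials.  So the
  question is about \<open>\<phi> = \<F>\<^sub>v \<circ> f\<close>, which is contraction-valued, has \<open>\<phi>(0) = 0\<close> and satisfies the same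
  boundary condition.

  Let \<open>\<phi> = \<Sum> a\<^sub>w \<otimes> w\<close>.  On a matrix \<open>X\<close> that is annihilated by all long words, \<open>z \<mapsto> \<phi>(z X)\<close> is a polynomial,
  so that all boundary values exist and Parseval's identity bounds the sum of the squared norms of its
  coefficients.

  \<^item> For the rank one matrix \<open>X\<close> of norm one with blocks \<open>(g' g)\<^sup>-\<^sup>1\<^sup>/\<^sup>2 e\<^sub>j (e\<^bsub>g'+l\<^esub>)\<^sup>*\<close> all products of two
    blocks vanish.  The boundary condition says that the linear part of \<open>\<phi>\<close> has norm one at \<open>X\<close>; since each
    \<open>a\<^bsub>(j,l)\<^esub>\<close> is a contraction, equality must hold in the Cauchy-Schwarz inequality, and a maximizing vector
    yields unit vectors \<open>\<xi>\<^sub>l\<close>, \<open>\<zeta>\<^sub>j\<close> with \<open>a\<^bsub>(j,l)\<^esub> \<xi>\<^sub>l = \<zeta>\<^sub>j\<close> (\<open>extremal_vectors\<close>).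
  \<^item> For a zero-one matrix \<open>X\<close> that encodes a path labelled by a nonempty word \<open>v\<close>, Parseval's identity gives
    \<open>\<parallel>a\<^sub>v \<xi>\<parallel>\<^sup>2 + \<parallel>a\<^bsub>(j,m)\<^esub> \<xi>\<parallel>\<^sup>2 \<le> \<parallel>\<xi>\<parallel>\<^sup>2\<close> for some \<open>j\<close>, unless \<open>v\<close> is itself a letter of column \<open>m\<close>, and
    dually for adjoints (\<open>column_bound\<close>, \<open>row_bound\<close>).
    Hence \<open>a\<^sub>v \<xi>\<^sub>m = 0\<close> unless \<open>v\<close> is a letter \<open>(j, m)\<close>, and \<open>a\<^sub>v\<^sup>* \<zeta>\<^sub>k = 0\<close> unless \<open>v\<close> is a letter \<open>(k, l)\<close>;
    this also makes both families orthonormal (\<open>extremal_structure\<close>).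

  Extend \<open>\<xi>\<close> and \<open>\<zeta>\<close> to orthonormal bases, the columns of \<open>U\<close> and \<open>V\<close>.  In these coordinates the first
  \<open>g'\<close> rows and \<open>g\<close> columns of \<open>\<phi>(X)\<close> are those of \<open>X \<oplus> 0\<close> (\<open>normal_form\<close>), and the remaining
  block is \<open>\<psi>\<close>.

  Conversely, if \<open>\<F>\<^sub>v \<circ> f\<close> has this block form, then it is contraction-valued and so is \<open>f\<close>.  A radial limit \<open>L\<close> of
  \<open>f\<close> at \<open>e\<^sup>i\<^sup>t X\<close> makes \<open>\<F>\<^sub>v(L)\<close> a contraction with the corner \<open>e\<^sup>i\<^sup>t X\<close> of norm one, so that \<open>\<F>\<^sub>v(L)\<close> and
  therefore \<open>L\<close> have norm one (\<open>nc_ball_normal_form_imp_nc_ball_map\<close>).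
\<close>

unbundle no vec_syntax
unbundle no inner_syntax
unbundle no fps_syntax

section \<open>Euclidean norm and operator norm\<close>

text \<open>The square of the Euclidean norm, which keeps roots out of the estimates.\<close>

definition sqn :: "complex vec \<Rightarrow> real" where
  "sqn x = (\<Sum>i<dim_vec x. (cmod (x $ i))\<^sup>2)"

lemma sqn_nonneg [simp]: "0 \<le> sqn x"
  by (simp add: sqn_def sum_nonneg)

lemma vec_l2norm_sqn: "vec_l2norm x = sqrt (sqn x)"
  by (simp add: vec_l2norm_def L2_set_def sqn_def)

lemma vec_l2norm_le_1_iff: "vec_l2norm x \<le> 1 \<longleftrightarrow> sqn x \<le> 1"
  by (simp add: vec_l2norm_sqn)

lemma sqn_0_iff:
  assumes "x \<in> carrier_vec n"
  shows "sqn x = 0 \<longleftrightarrow> x = 0\<^sub>v n"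
  using assms by (auto simp: sqn_def sum_nonneg_eq_0_iff intro!: eq_vecI)

lemma sqn_zero_vec [simp]: "sqn (0\<^sub>v n) = 0"
  by (simp add: sqn_def)

lemma sqn_smult: "sqn (c \<cdot>\<^sub>v x) = (cmod c)\<^sup>2 * sqn x"
  by (simp add: sqn_def norm_mult power_mult_distrib sum_distrib_left)

lemma cscalar_prod_sum:
  "(x :: complex vec) \<in> carrier_vec n \<Longrightarrow> y \<in> carrier_vec n \<Longrightarrow> x \<bullet>c y = (\<Sum>i<n. x $ i * cnj (y $ i))"
  by (auto simp: scalar_prod_def lessThan_atLeast0 intro!: sum.cong)

lemma cscalar_prod_self:
  "x \<bullet>c x = complex_of_real (sqn x)"
  unfolding cscalar_prod_sum[OF carrier_vec_dim_vec carrier_vec_dim_vec]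
  by (simp add: sqn_def complex_norm_square del: of_real_power)

lemma cscalar_prod_commute:
  assumes "(x :: complex vec) \<in> carrier_vec n" "y \<in> carrier_vec n"
  shows "y \<bullet>c x = cnj (x \<bullet>c y)"
  using assms by (simp add: cscalar_prod_sum[of _ n] mult.commute)

lemma cscalar_prod_add_left:
  assumes "(x :: complex vec) \<in> carrier_vec n" "y \<in> carrier_vec n" "z \<in> carrier_vec n"
  shows "(x + y) \<bullet>c z = x \<bullet>c z + y \<bullet>c z"
  using assms by (simp add: cscalar_prod_sum[of _ n] sum.distrib algebra_simps)

lemma cscalar_prod_add_right:
  assumes "(x :: complex vec) \<in> carrier_vec n" "y \<in> carrier_vec n" "z \<in> carrier_vec n"
  shows "z \<bullet>c (x + y) = z \<bullet>c x + z \<bullet>c y"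
  using assms by (simp add: cscalar_prod_sum[of _ n] sum.distrib algebra_simps)

lemma cscalar_prod_smult_right:
  assumes "(x :: complex vec) \<in> carrier_vec n" "z \<in> carrier_vec n"
  shows "z \<bullet>c (c \<cdot>\<^sub>v x) = cnj c * (z \<bullet>c x)"
  using assms by (simp add: cscalar_prod_sum[of _ n] sum_distrib_left algebra_simps)

lemma sqn_add:
  assumes "x \<in> carrier_vec n" "y \<in> carrier_vec n"
  shows "sqn (x + y) = sqn x + sqn y + 2 * Re (x \<bullet>c y)"
proof -
  have "complex_of_real (sqn (x + y)) = (x + y) \<bullet>c (x + y)"
    by (rule cscalar_prod_self[symmetric])
  also have "\<dots> = of_real (sqn x) + of_real (sqn y) + (x \<bullet>c y + cnj (x \<bullet>c y))"
    using assms cscalar_prod_commute[OF assms]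
    by (simp add: cscalar_prod_add_left[of _ n] cscalar_prod_add_right[of _ n] cscalar_prod_self[symmetric])
  also have "\<dots> = of_real (sqn x + sqn y + 2 * Re (x \<bullet>c y))"
    by (simp add: complex_add_cnj)
  finally show ?thesis
    by (simp only: of_real_eq_iff)
qed

lemma sqn_diff:
  assumes "x \<in> carrier_vec n" "y \<in> carrier_vec n"
  shows "sqn (x - y) = sqn x + sqn y - 2 * Re (x \<bullet>c y)"
proof -
  have *: "x - y = x + (- 1) \<cdot>\<^sub>v y"
    using assms by (intro eq_vecI) auto
  have "sqn (x - y) = sqn x + sqn ((- 1) \<cdot>\<^sub>v y) + 2 * Re (x \<bullet>c ((- 1) \<cdot>\<^sub>v y))"
    unfolding * using assms by (intro sqn_add[of _ n]) auto
  then show ?thesis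
    using assms by (simp add: sqn_smult cscalar_prod_smult_right[of _ n])
qed

lemma dim_mat_adjoint [simp]:
  "dim_row (mat_adjoint A) = dim_col A" "dim_col (mat_adjoint A) = dim_row A"
  by (simp_all add: mat_adjoint_def)

lemma mat_adjoint_carrier [intro, simp]:
  "A \<in> carrier_mat m n \<Longrightarrow> mat_adjoint A \<in> carrier_mat n m"
  by (auto intro!: carrier_matI)

lemma mat_adjoint_index [simp]:
  fixes A :: "complex mat"
  shows "i < dim_col A \<Longrightarrow> j < dim_row A \<Longrightarrow> mat_adjoint A $$ (i, j) = cnj (A $$ (j, i))"
  by (simp add: mat_adjoint_def mat_of_rows_index)

lemma mat_adjoint_adjoint [simp]: "mat_adjoint (mat_adjoint A) = (A :: complex mat)"
  by (intro eq_matI) auto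

lemma mat_mult_index_sum:
  "A \<in> carrier_mat m n \<Longrightarrow> B \<in> carrier_mat n k \<Longrightarrow> i < m \<Longrightarrow> j < k \<Longrightarrow>
    (A * B) $$ (i, j) = (\<Sum>l<n. A $$ (i, l) * B $$ (l, j))"
  by (auto simp: scalar_prod_def lessThan_atLeast0 intro!: sum.cong)

lemma mult_mat_vec_index_sum:
  "A \<in> carrier_mat m n \<Longrightarrow> x \<in> carrier_vec n \<Longrightarrow> i < m \<Longrightarrow>
    (A *\<^sub>v x) $ i = (\<Sum>l<n. A $$ (i, l) * x $ l)"
  by (auto simp: scalar_prod_def lessThan_atLeast0 intro!: sum.cong)

lemma mat_adjoint_mult:
  fixes A B :: "complex mat"
  assumes "A \<in> carrier_mat m n" "B \<in> carrier_mat n k"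
  shows "mat_adjoint (A * B) = mat_adjoint B * mat_adjoint A"
proof (rule eq_matI)
  fix i j assume "i < dim_row (mat_adjoint B * mat_adjoint A)" "j < dim_col (mat_adjoint B * mat_adjoint A)"
  then have ij: "i < k" "j < m" using assms by auto
  show "mat_adjoint (A * B) $$ (i, j) = (mat_adjoint B * mat_adjoint A) $$ (i, j)"
    using assms ij
    by (simp add: mat_mult_index_sum[of "mat_adjoint B" k n "mat_adjoint A" m]
        mat_mult_index_sum[of A m n B k] mult.commute del: index_mult_mat(1))
qed (use assms in auto)

lemma mat_adjoint_one [simp]: "mat_adjoint (1\<^sub>m n :: complex mat) = 1\<^sub>m n"
  by (intro eq_matI) auto

lemma cscalar_prod_adjoint:
  fixes A :: "complex mat"
  assumes A: "A \<in> carrier_mat m n" and x: "x \<in> carrier_vec n" and y: "y \<in> carrier_vec m"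
  shows "(A *\<^sub>v x) \<bullet>c y = x \<bullet>c (mat_adjoint A *\<^sub>v y)"
proof -
  have "(A *\<^sub>v x) \<bullet>c y = (\<Sum>i<m. \<Sum>j<n. A $$ (i, j) * x $ j * cnj (y $ i))"
    using assms by (simp add: cscalar_prod_sum[of _ m] mult_mat_vec_index_sum[OF A x] sum_distrib_right
        del: index_mult_mat_vec)
  also have "\<dots> = (\<Sum>j<n. \<Sum>i<m. A $$ (i, j) * x $ j * cnj (y $ i))"
    by (rule sum.swap)
  also have "\<dots> = x \<bullet>c (mat_adjoint A *\<^sub>v y)"
    using assms mult_mat_vec_carrier[of "mat_adjoint A" n m y]
    by (simp add: cscalar_prod_sum[of _ n] mult_mat_vec_index_sum[of "mat_adjoint A" n m y]
        sum_distrib_left algebra_simps del: index_mult_mat_vec)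
  finally show ?thesis .
qed

lemma Cauchy_Schwarz_sum:
  fixes f g :: "'i \<Rightarrow> complex"
  shows "(cmod (\<Sum>i\<in>I. f i * g i))\<^sup>2 \<le> (\<Sum>i\<in>I. (cmod (f i))\<^sup>2) * (\<Sum>i\<in>I. (cmod (g i))\<^sup>2)"
proof -
  have "cmod (\<Sum>i\<in>I. f i * g i) \<le> (\<Sum>i\<in>I. \<bar>cmod (f i)\<bar> * \<bar>cmod (g i)\<bar>)"
    by (rule order.trans[OF norm_sum]) (simp add: norm_mult)
  also have "\<dots> \<le> L2_set (\<lambda>i. cmod (f i)) I * L2_set (\<lambda>i. cmod (g i)) I"
    by (rule L2_set_mult_ineq)
  finally have "(cmod (\<Sum>i\<in>I. f i * g i))\<^sup>2 \<le> (L2_set (\<lambda>i. cmod (f i)) I * L2_set (\<lambda>i. cmod (g i)) I)\<^sup>2"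
    by (rule power_mono) simp
  then show ?thesis
    by (simp add: power_mult_distrib L2_set_def sum_nonneg)
qed

lemma cscalar_prod_Cauchy_Schwarz:
  assumes "x \<in> carrier_vec n" "y \<in> carrier_vec n"
  shows "(cmod (x \<bullet>c y))\<^sup>2 \<le> sqn x * sqn y"
  using Cauchy_Schwarz_sum[of "\<lambda>i. x $ i" "\<lambda>i. cnj (y $ i)" "{..<n}"] assms
  by (simp add: cscalar_prod_sum sqn_def)

lemma op_norm_bdd:
  assumes "A \<in> carrier_mat m n"
  shows "bdd_above ((\<lambda>x. vec_l2norm (A *\<^sub>v x)) ` {x \<in> carrier_vec (dim_col A). vec_l2norm x \<le> 1})"
  using vec_l2norm_mult_le[OF assms] assms by (intro bdd_aboveI) auto

lemma op_norm_upper: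
  assumes "A \<in> carrier_mat m n" "x \<in> carrier_vec n" "sqn x \<le> 1"
  shows "vec_l2norm (A *\<^sub>v x) \<le> op_norm A"
  unfolding op_norm_def using assms
  by (intro cSUP_upper op_norm_bdd) (auto simp: vec_l2norm_le_1_iff)

lemma op_norm_nonneg [simp]:
  assumes "A \<in> carrier_mat m n"
  shows "0 \<le> op_norm A"
proof -
  have "0 \<le> vec_l2norm (A *\<^sub>v 0\<^sub>v n)" by (simp add: vec_l2norm_sqn)
  also have "\<dots> \<le> op_norm A" using assms by (intro op_norm_upper) auto
  finally show ?thesis .
qed

lemma op_norm_leI:
  assumes "A \<in> carrier_mat m n"
    and "\<And>x. x \<in> carrier_vec n \<Longrightarrow> sqn x \<le> 1 \<Longrightarrow> sqn (A *\<^sub>v x) \<le> K\<^sup>2" and "0 \<le> K"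
  shows "op_norm A \<le> K"
  unfolding op_norm_def
proof (rule cSUP_least)
  have "0\<^sub>v (dim_col A) \<in> {x \<in> carrier_vec (dim_col A). vec_l2norm x \<le> 1}"
    by (simp add: vec_l2norm_le_1_iff)
  then show "{x \<in> carrier_vec (dim_col A). vec_l2norm x \<le> 1} \<noteq> {}" by blast
next
  fix x assume "x \<in> {x \<in> carrier_vec (dim_col A). vec_l2norm x \<le> 1}"
  then have "sqn (A *\<^sub>v x) \<le> K\<^sup>2"
    using assms by (auto simp: vec_l2norm_le_1_iff)
  then show "vec_l2norm (A *\<^sub>v x) \<le> K"
    using assms(3) by (auto simp: vec_l2norm_sqn intro: real_le_lsqrt)
qed

lemma sqn_mult_mat_vec_le:
  assumes A: "A \<in> carrier_mat m n" and x: "x \<in> carrier_vec n"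
  shows "sqn (A *\<^sub>v x) \<le> (op_norm A)\<^sup>2 * sqn x"
proof (cases "sqn x = 0")
  case True
  then have "x = 0\<^sub>v n" using x sqn_0_iff by blast
  then show ?thesis using A by (simp add: sqn_def scalar_prod_def)
next
  case False
  define c where "c = complex_of_real (inverse (sqrt (sqn x)))"
  have pos: "sqn x > 0" using False sqn_nonneg[of x] by linarith
  have c2: "(cmod c)\<^sup>2 = inverse (sqn x)"
    using pos by (simp add: c_def norm_divide norm_inverse power_inverse abs_of_pos)
  have "sqn (c \<cdot>\<^sub>v x) \<le> 1"
    using pos by (simp add: sqn_smult c2)
  then have "vec_l2norm (A *\<^sub>v (c \<cdot>\<^sub>v x)) \<le> op_norm A"
    using A x by (intro op_norm_upper) auto
  then have "sqn (A *\<^sub>v (c \<cdot>\<^sub>v x)) \<le> (op_norm A)\<^sup>2"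
    by (auto simp: vec_l2norm_sqn sqrt_le_D)
  moreover have "A *\<^sub>v (c \<cdot>\<^sub>v x) = c \<cdot>\<^sub>v (A *\<^sub>v x)"
    using A x by (simp add: mult_mat_vec)
  ultimately show ?thesis
    using pos by (simp add: sqn_smult c2 field_simps)
qed

lemma contraction_iff:
  assumes A: "A \<in> carrier_mat m n"
  shows "op_norm A \<le> 1 \<longleftrightarrow> (\<forall>x\<in>carrier_vec n. sqn (A *\<^sub>v x) \<le> sqn x)"
proof
  assume *: "op_norm A \<le> 1"
  have 1: "(op_norm A)\<^sup>2 \<le> 1"
    using * A by (simp add: power_le_one)
  show "\<forall>x\<in>carrier_vec n. sqn (A *\<^sub>v x) \<le> sqn x"
  proof
    fix x :: "complex vec" assume x: "x \<in> carrier_vec n"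
    have "sqn (A *\<^sub>v x) \<le> (op_norm A)\<^sup>2 * sqn x"
      using sqn_mult_mat_vec_le[OF A x] .
    also have "\<dots> \<le> 1 * sqn x"
      using 1 by (intro mult_right_mono) auto
    finally show "sqn (A *\<^sub>v x) \<le> sqn x" by simp
  qed
next
  assume "\<forall>x\<in>carrier_vec n. sqn (A *\<^sub>v x) \<le> sqn x"
  then show "op_norm A \<le> 1"
    using A by (intro op_norm_leI[OF A]) force+
qed

lemma contractionD:
  assumes "A \<in> carrier_mat m n" "op_norm A \<le> 1" "x \<in> carrier_vec n"
  shows "sqn (A *\<^sub>v x) \<le> sqn x"
  using assms contraction_iff by blast

lemma op_norm_ge_1I:
  assumes A: "A \<in> carrier_mat m n" and x: "x \<in> carrier_vec n" "x \<noteq> 0\<^sub>v n" and le: "sqn x \<le> sqn (A *\<^sub>v x)"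
  shows "1 \<le> op_norm A"
proof -
  have pos: "sqn x > 0" using x sqn_0_iff[of x n] sqn_nonneg[of x] by linarith
  have "1 * sqn x \<le> (op_norm A)\<^sup>2 * sqn x"
    using sqn_mult_mat_vec_le[OF A x(1)] le by linarith
  then have "1 \<le> (op_norm A)\<^sup>2" using pos by simp
  then show ?thesis using op_norm_nonneg[OF A]
    using power2_le_imp_le[of 1 "op_norm A"] by simp
qed

lemma sqn_adjoint_mult_le:
  assumes A: "A \<in> carrier_mat m n" and y: "y \<in> carrier_vec m"
  shows "sqn (mat_adjoint A *\<^sub>v y) \<le> (op_norm A)\<^sup>2 * sqn y"
proof -
  define w where "w = mat_adjoint A *\<^sub>v y"
  have w: "w \<in> carrier_vec n" using A y unfolding w_def by (intro mult_mat_vec_carrier[of _ n m]) auto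
  have "complex_of_real (sqn w) = (A *\<^sub>v w) \<bullet>c y"
    using A y w by (simp add: cscalar_prod_adjoint[of A m n w y] cscalar_prod_self flip: w_def)
  then have "(sqn w)\<^sup>2 = (cmod ((A *\<^sub>v w) \<bullet>c y))\<^sup>2"
    by (simp flip: \<open>complex_of_real (sqn w) = _\<close>)
  also have "\<dots> \<le> sqn (A *\<^sub>v w) * sqn y"
    using A y w by (intro cscalar_prod_Cauchy_Schwarz[of _ m]) auto
  also have "\<dots> \<le> ((op_norm A)\<^sup>2 * sqn w) * sqn y"
    using sqn_mult_mat_vec_le[OF A w] by (intro mult_right_mono) auto
  finally have "sqn w * sqn w \<le> ((op_norm A)\<^sup>2 * sqn y) * sqn w"
    by (simp add: power2_eq_square algebra_simps)
  then have "sqn w \<le> (op_norm A)\<^sup>2 * sqn y"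
    using sqn_nonneg[of w] by (cases "sqn w = 0") (auto simp: mult_le_cancel_right)
  then show ?thesis by (simp add: w_def)
qed

lemma contraction_adjointD:
  assumes "A \<in> carrier_mat m n" "op_norm A \<le> 1" "y \<in> carrier_vec m"
  shows "sqn (mat_adjoint A *\<^sub>v y) \<le> sqn y"
proof -
  have "sqn (mat_adjoint A *\<^sub>v y) \<le> (op_norm A)\<^sup>2 * sqn y"
    using sqn_adjoint_mult_le assms by blast
  also have "\<dots> \<le> 1 * sqn y"
    using assms op_norm_nonneg[OF assms(1)] by (intro mult_right_mono) (auto simp: power_le_one)
  finally show ?thesis by simp
qed

lemma contraction_adjoint:
  assumes "A \<in> carrier_mat m n" "op_norm A \<le> 1"
  shows "op_norm (mat_adjoint A) \<le> 1"
  using assms contraction_adjointD[OF assms]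
  by (subst contraction_iff[of _ n m]) auto

lemma contraction_mult:
  assumes A: "A \<in> carrier_mat m n" "op_norm A \<le> 1" and B: "B \<in> carrier_mat n k" "op_norm B \<le> 1"
  shows "op_norm (A * B) \<le> 1"
proof -
  have "sqn (A * B *\<^sub>v x) \<le> sqn x" if x: "x \<in> carrier_vec k" for x
  proof -
    have "A * B *\<^sub>v x = A *\<^sub>v (B *\<^sub>v x)" using A B x by (intro assoc_mult_mat_vec) auto
    also have "sqn \<dots> \<le> sqn (B *\<^sub>v x)" using A B x by (intro contractionD[of _ m n]) auto
    also have "\<dots> \<le> sqn x" using B x by (intro contractionD[of _ n k]) auto
    finally show ?thesis .
  qed
  then show ?thesis using A B by (subst contraction_iff[of _ m k]) auto
qed

text \<open>Where a contraction preserves the norm, its adjoint is a left inverse, since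
  \<open>\<parallel>x - A\<^sup>* A x\<parallel>\<^sup>2 \<le> \<parallel>x\<parallel>\<^sup>2 - \<parallel>A x\<parallel>\<^sup>2\<close>.\<close>

lemma contraction_isometric_vec:
  assumes A: "A \<in> carrier_mat m n" "op_norm A \<le> 1" and x: "x \<in> carrier_vec n"
    and eq: "sqn (A *\<^sub>v x) = sqn x"
  shows "mat_adjoint A *\<^sub>v (A *\<^sub>v x) = x"
proof -
  define w where "w = mat_adjoint A *\<^sub>v (A *\<^sub>v x)"
  have Ax: "A *\<^sub>v x \<in> carrier_vec m" using A x by auto
  have w: "w \<in> carrier_vec n" unfolding w_def using A Ax by (intro mult_mat_vec_carrier[of _ n m]) auto
  have "x \<bullet>c w = of_real (sqn x)"
    using cscalar_prod_adjoint[OF A(1) x Ax] by (simp add: w_def cscalar_prod_self eq)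
  then have "sqn (x - w) = sqn x + sqn w - 2 * sqn x"
    using x w by (simp add: sqn_diff)
  moreover have "sqn w \<le> sqn x"
    using contraction_adjointD[OF A Ax] eq by (simp add: w_def)
  ultimately have "sqn (x - w) = 0"
    using sqn_nonneg[of "x - w"] by linarith
  then have "x - w = 0\<^sub>v n" using x w by (subst (asm) sqn_0_iff[of _ n]) auto
  then have "vec_index (x - w) i = 0" if "i < n" for i using that by simp
  then have "w = x" using x w by (intro eq_vecI) auto
  then show ?thesis by (simp add: w_def)
qed

lemma op_norm_Frobenius:
  assumes A: "A \<in> carrier_mat m n" and K: "(\<Sum>i<m. \<Sum>j<n. (cmod (A $$ (i, j)))\<^sup>2) \<le> K\<^sup>2" "0 \<le> K"
  shows "op_norm A \<le> K"
proof (rule op_norm_leI[OF A _ K(2)])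
  fix x :: "complex vec" assume x: "x \<in> carrier_vec n" "sqn x \<le> 1"
  have "sqn (A *\<^sub>v x) = (\<Sum>i<m. (cmod (\<Sum>j<n. A $$ (i, j) * x $ j))\<^sup>2)"
    using A x by (simp add: sqn_def mult_mat_vec_index_sum[OF A x(1)] del: index_mult_mat_vec)
  also have "\<dots> \<le> (\<Sum>i<m. (\<Sum>j<n. (cmod (A $$ (i, j)))\<^sup>2) * 1)"
  proof (rule sum_mono)
    fix i assume "i \<in> {..<m}"
    have "(cmod (\<Sum>j<n. A $$ (i, j) * x $ j))\<^sup>2
        \<le> (\<Sum>j<n. (cmod (A $$ (i, j)))\<^sup>2) * (\<Sum>j<n. (cmod (x $ j))\<^sup>2)"
      by (rule Cauchy_Schwarz_sum)
    also have "\<dots> \<le> (\<Sum>j<n. (cmod (A $$ (i, j)))\<^sup>2) * 1"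
      using x by (intro mult_left_mono) (auto simp: sqn_def sum_nonneg)
    finally show "(cmod (\<Sum>j<n. A $$ (i, j) * x $ j))\<^sup>2 \<le> (\<Sum>j<n. (cmod (A $$ (i, j)))\<^sup>2) * 1" .
  qed
  also have "\<dots> \<le> K\<^sup>2" using K by simp
  finally show "sqn (A *\<^sub>v x) \<le> K\<^sup>2" .
qed

lemma op_norm_le_sum:
  assumes A: "A \<in> carrier_mat m n"
  shows "op_norm A \<le> (\<Sum>i<m. \<Sum>j<n. cmod (A $$ (i, j)))"
proof -
  have "0\<^sub>v (dim_col A) \<in> {x \<in> carrier_vec (dim_col A). vec_l2norm x \<le> 1}"
    by (simp add: vec_l2norm_le_1_iff)
  then have "{x \<in> carrier_vec (dim_col A). vec_l2norm x \<le> 1} \<noteq> {}" by blast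
  then show ?thesis
    unfolding op_norm_def using A vec_l2norm_mult_le[OF A] by (intro cSUP_least) auto
qed

lemma op_norm_partial_permutation:
  assumes X: "X \<in> carrier_mat m n"
    and entries: "\<And>i j. i < m \<Longrightarrow> j < n \<Longrightarrow> X $$ (i, j) \<in> {0, 1}"
    and row: "\<And>i j j'. i < m \<Longrightarrow> j < n \<Longrightarrow> j' < n \<Longrightarrow> X $$ (i, j) \<noteq> 0 \<Longrightarrow> X $$ (i, j') \<noteq> 0 \<Longrightarrow> j = j'"
    and col: "\<And>i i' j. i < m \<Longrightarrow> i' < m \<Longrightarrow> j < n \<Longrightarrow> X $$ (i, j) \<noteq> 0 \<Longrightarrow> X $$ (i', j) \<noteq> 0 \<Longrightarrow> i = i'"
  shows "op_norm X \<le> 1"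
proof -
  define B where "B i = {j. j < n \<and> X $$ (i, j) \<noteq> 0}" for i
  have finB: "finite (B i)" for i by (auto simp: B_def)
  have "sqn (X *\<^sub>v x) \<le> sqn x" if x: "x \<in> carrier_vec n" for x
  proof -
    have "(cmod ((X *\<^sub>v x) $ i))\<^sup>2 = (\<Sum>j\<in>B i. (cmod (x $ j))\<^sup>2)" if i: "i < m" for i
    proof -
      have "(X *\<^sub>v x) $ i = (\<Sum>j<n. X $$ (i, j) * x $ j)"
        using mult_mat_vec_index_sum[OF X x i] .
      also have "\<dots> = (\<Sum>j\<in>B i. X $$ (i, j) * x $ j)"
        by (rule sum.mono_neutral_right) (auto simp: B_def)
      also have "\<dots> = (\<Sum>j\<in>B i. x $ j)"
        using entries[OF i] by (intro sum.cong) (auto simp: B_def)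
      finally have e: "(X *\<^sub>v x) $ i = (\<Sum>j\<in>B i. x $ j)" .
      show ?thesis
      proof (cases "B i = {}")
        case False
        then obtain j where "j \<in> B i" by blast
        then have "B i = {j}" using row[OF i] by (auto simp: B_def)
        then show ?thesis by (simp add: e del: index_mult_mat_vec)
      qed (simp add: e del: index_mult_mat_vec)
    qed
    then have "sqn (X *\<^sub>v x) = (\<Sum>i<m. \<Sum>j\<in>B i. (cmod (x $ j))\<^sup>2)"
      using X by (simp add: sqn_def del: index_mult_mat_vec)
    also have "\<dots> = (\<Sum>j\<in>(\<Union>i<m. B i). (cmod (x $ j))\<^sup>2)"
      using col finB by (intro sum.UNION_disjoint[symmetric]) (auto simp: B_def)
    also have "\<dots> \<le> (\<Sum>j<n. (cmod (x $ j))\<^sup>2)"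
      by (rule sum_mono2) (auto simp: B_def)
    finally show ?thesis using x by (simp add: sqn_def)
  qed
  then show ?thesis using X by (subst contraction_iff[OF X]) auto
qed

text \<open>By compactness of the unit ball the supremum defining the operator norm is attained.\<close>

lemma op_norm_attained:
  assumes A: "A \<in> carrier_mat m n"
  obtains x where "x \<in> carrier_vec n" "sqn x \<le> 1" "sqn (A *\<^sub>v x) = (op_norm A)\<^sup>2"
proof -
  define T :: "(nat \<Rightarrow> complex) topology" where "T = product_topology (\<lambda>_. euclidean) {..<n}"
  define B where "B = PiE {..<n} (\<lambda>_. cball (0::complex) 1)"
  define q where "q = (\<lambda>z :: nat \<Rightarrow> complex. \<Sum>i<n. (cmod (z i))\<^sup>2)"
  define h where "h = (\<lambda>z :: nat \<Rightarrow> complex. \<Sum>i<m. (cmod (\<Sum>j<n. A $$ (i, j) * z j))\<^sup>2)"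
  define S where "S = B \<inter> {z \<in> topspace T. q z \<in> {..1}}"
  have coord: "continuous_map T euclidean (\<lambda>z. z j)" if "j < n" for j
    unfolding T_def using that by (intro continuous_map_product_projection) auto
  have cmult: "continuous_map T euclidean (\<lambda>z. c * k z)" if "continuous_map T euclidean k"
    for c :: complex and k
    using continuous_map_compose[OF that, of euclidean "(*) c"]
    by (simp add: comp_def continuous_map_iff_continuous2 continuous_on_mult_left)
  have q: "continuous_map T euclideanreal q"
    unfolding q_def using coord
    by (intro continuous_map_sum continuous_map_real_pow continuous_map_norm) auto
  have h: "continuous_map T euclideanreal h"
    unfolding h_def using coord
    by (intro continuous_map_sum continuous_map_real_pow continuous_map_norm cmult) auto
  have "compactin T B" unfolding T_def B_def by (simp add: compactin_PiE)
  moreover have "closedin T {z \<in> topspace T. q z \<in> {..1}}"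
    by (rule closedin_continuous_map_preimage[OF q]) auto
  ultimately have S: "compactin T S" unfolding S_def by (simp add: compact_Int_closedin)
  have "compact (h ` S)" using image_compactin[OF S h] by simp
  moreover have "restrict (\<lambda>_. 0) {..<n} \<in> S"
    by (auto simp: S_def B_def q_def T_def)
  ultimately obtain z where z: "z \<in> S" "\<And>y. y \<in> S \<Longrightarrow> h y \<le> h z"
    using compact_attains_sup[of "h ` S"] by auto
  define x where "x = vec n z"
  have vh: "sqn (A *\<^sub>v vec n y) = h y" for y
    using A by (simp add: sqn_def h_def mult_mat_vec_index_sum[OF A] del: index_mult_mat_vec)
  have x: "x \<in> carrier_vec n" "sqn x \<le> 1"
    using z by (auto simp: x_def sqn_def S_def q_def)
  have le: "sqn (A *\<^sub>v y) \<le> sqn (A *\<^sub>v x)" if y: "y \<in> carrier_vec n" "sqn y \<le> 1" for y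
  proof -
    define w where "w = restrict (\<lambda>i. y $ i) {..<n}"
    have yw: "y = vec n w" using y by (intro eq_vecI) (auto simp: w_def)
    have "(cmod (w i))\<^sup>2 \<le> 1" if "i < n" for i
    proof -
      have "(cmod (w i))\<^sup>2 \<le> sqn y"
        using that y by (auto simp: sqn_def w_def intro!: member_le_sum)
      then show ?thesis using y by simp
    qed
    then have "cmod (w i) \<le> 1" if "i < n" for i
      using power2_le_imp_le[of "cmod (w i)" 1] that by simp
    moreover have "q w = sqn y" using y by (simp add: q_def sqn_def w_def)
    ultimately have "w \<in> S"
      using y by (auto simp: S_def B_def T_def w_def)
    then show ?thesis using z(2) by (simp add: x_def yw vh)
  qed
  have "op_norm A \<le> sqrt (sqn (A *\<^sub>v x))"
    using le by (intro op_norm_leI[OF A]) auto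
  moreover have "sqrt (sqn (A *\<^sub>v x)) \<le> op_norm A"
    using op_norm_upper[OF A x] by (simp add: vec_l2norm_sqn)
  ultimately have "(op_norm A)\<^sup>2 = sqn (A *\<^sub>v x)" by simp
  then show ?thesis using that x by simp
qed

lemma op_norm_1_attained:
  assumes A: "A \<in> carrier_mat m n" "op_norm A = 1"
  obtains x where "x \<in> carrier_vec n" "sqn x = 1" "sqn (A *\<^sub>v x) = 1"
proof -
  obtain x where x: "x \<in> carrier_vec n" "sqn x \<le> 1" "sqn (A *\<^sub>v x) = (op_norm A)\<^sup>2"
    using op_norm_attained[OF A(1)] by blast
  from x(3) have x3: "sqn (A *\<^sub>v x) = 1" by (simp add: A(2))
  have "1 \<le> sqn x" using sqn_mult_mat_vec_le[OF A(1) x(1)] x3 A(2) by simp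
  then show ?thesis using that x x3 by force
qed

lemma op_norm_smult_le:
  assumes A: "A \<in> carrier_mat m n"
  shows "op_norm (c \<cdot>\<^sub>m A) \<le> cmod c * op_norm A"
proof (rule op_norm_leI[of _ m n])
  fix x :: "complex vec" assume x: "x \<in> carrier_vec n" "sqn x \<le> 1"
  have "(c \<cdot>\<^sub>m A) *\<^sub>v x = c \<cdot>\<^sub>v (A *\<^sub>v x)"
    using A x by (intro eq_vecI) (auto simp: smult_scalar_prod_distrib[of _ n])
  then have "sqn ((c \<cdot>\<^sub>m A) *\<^sub>v x) \<le> (cmod c)\<^sup>2 * ((op_norm A)\<^sup>2 * sqn x)"
    using sqn_mult_mat_vec_le[OF A x(1)] by (simp add: sqn_smult mult_left_mono)
  also have "\<dots> \<le> (cmod c)\<^sup>2 * ((op_norm A)\<^sup>2 * 1)"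
    using x by (intro mult_left_mono) auto
  finally show "sqn ((c \<cdot>\<^sub>m A) *\<^sub>v x) \<le> (cmod c * op_norm A)\<^sup>2"
    by (simp add: power_mult_distrib)
qed (use A in auto)

section \<open>Kronecker products\<close>

lemma sum_lessThan_mult:
  fixes f :: "nat \<Rightarrow> 'a :: comm_monoid_add"
  shows "(\<Sum>i<p * N. f i) = (\<Sum>k<p. \<Sum>a<N. f (k * N + a))"
proof -
  have "(\<Sum>i<p * N. f i) = (\<Sum>k<p. sum f {k * N..<k * N + N})"
    by (simp add: sum.nat_group)
  also have "\<dots> = (\<Sum>k<p. \<Sum>a<N. f (k * N + a))"
  proof (rule sum.cong[OF refl])
    fix k
    show "sum f {k * N..<k * N + N} = (\<Sum>a<N. f (k * N + a))"
      using sum.shift_bounds_nat_ivl[of f 0 "k * N" N] by (simp only: lessThan_atLeast0 add.commute add_0)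
  qed
  finally show ?thesis .
qed

lemma block_index_less: "(k :: nat) < p \<Longrightarrow> a < N \<Longrightarrow> k * N + a < p * N"
proof -
  assume "k < p" "a < N"
  then have "k * N + a < (k + 1) * N" by simp
  also have "\<dots> \<le> p * N" using \<open>k < p\<close> by (intro mult_right_mono) auto
  finally show ?thesis .
qed

lemma block_index_cases:
  assumes "(i :: nat) < p * N"
  obtains k a where "k < p" "a < N" "i = k * N + a"
proof
  have N: "N > 0" using assms by (cases N) auto
  show "i div N < p" using assms N by (simp add: less_mult_imp_div_less)
  show "i mod N < N" using N by simp
qed simp

lemma kron_carrier [simp, intro]:
  "A \<in> carrier_mat p q \<Longrightarrow> B \<in> carrier_mat M N \<Longrightarrow> kron A B \<in> carrier_mat (p * M) (q * N)"
  by (auto simp: kron_def)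

lemma dim_kron [simp]:
  "dim_row (kron A B) = dim_row A * dim_row B" "dim_col (kron A B) = dim_col A * dim_col B"
  by (simp_all add: kron_def)

lemma kron_index:
  assumes "A \<in> carrier_mat p q" "B \<in> carrier_mat M N" "i < p" "a < M" "k < q" "b < N"
  shows "kron A B $$ (i * M + a, k * N + b) = A $$ (i, k) * B $$ (a, b)"
  using assms block_index_less[of i p a M] block_index_less[of k q b N]
  by (auto simp: kron_def)

lemma block_eq_matI:
  assumes A: "A \<in> carrier_mat (p * M) (q * N)" "B \<in> carrier_mat (p * M) (q * N)"
    and eq: "\<And>i a k b. i < p \<Longrightarrow> a < M \<Longrightarrow> k < q \<Longrightarrow> b < N \<Longrightarrow>
      A $$ (i * M + a, k * N + b) = B $$ (i * M + a, k * N + b)"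
  shows "A = B"
proof (rule eq_matI)
  fix i j assume "i < dim_row B" "j < dim_col B"
  then have i: "i < p * M" "j < q * N" using A by auto
  obtain k a where "k < p" "a < M" "i = k * M + a" using block_index_cases[OF i(1)] .
  moreover obtain l b where "l < q" "b < N" "j = l * N + b" using block_index_cases[OF i(2)] .
  ultimately show "A $$ (i, j) = B $$ (i, j)" using eq by simp
qed (use A in auto)

lemma kron_mult:
  assumes A: "A \<in> carrier_mat p q" "C \<in> carrier_mat q r"
    and B: "B \<in> carrier_mat L M" "D \<in> carrier_mat M N"
  shows "kron A B * kron C D = kron (A * C) (B * D)"
proof (rule block_eq_matI)
  fix i a k b assume i: "i < p" "a < L" "k < r" "b < N"
  have "(kron A B * kron C D) $$ (i * L + a, k * N + b)
      = (\<Sum>l<q * M. kron A B $$ (i * L + a, l) * kron C D $$ (l, k * N + b))"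
    using A B i by (intro mat_mult_index_sum[of _ "p * L" _ _ "r * N"] block_index_less) auto
  also have "\<dots> = (\<Sum>l<q. \<Sum>c<M. (A $$ (i, l) * B $$ (a, c)) * (C $$ (l, k) * D $$ (c, b)))"
    unfolding sum_lessThan_mult using A B i
    by (intro sum.cong refl) (simp add: kron_index[of _ p q _ L M] kron_index[of _ q r _ M N])
  also have "\<dots> = (\<Sum>l<q. A $$ (i, l) * C $$ (l, k)) * (\<Sum>c<M. B $$ (a, c) * D $$ (c, b))"
    by (simp add: sum_product algebra_simps)
  also have "\<dots> = kron (A * C) (B * D) $$ (i * L + a, k * N + b)"
    using A B i
    by (simp add: kron_index[of _ p r _ L N] mat_mult_index_sum[of A p q C r]
        mat_mult_index_sum[of B L M D N] del: index_mult_mat(1))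
  finally show "(kron A B * kron C D) $$ (i * L + a, k * N + b) = kron (A * C) (B * D) $$ (i * L + a, k * N + b)" .
qed (use A B in \<open>auto intro!: mult_carrier_mat kron_carrier\<close>)

lemma kron_1_mult:
  assumes "A \<in> carrier_mat p q" "C \<in> carrier_mat q r"
  shows "kron A (1\<^sub>m N) * kron C (1\<^sub>m N) = kron (A * C) (1\<^sub>m N)"
  using kron_mult[OF assms one_carrier_mat one_carrier_mat] by simp

lemma kron_adjoint_1:
  assumes A: "A \<in> carrier_mat p q"
  shows "mat_adjoint (kron A (1\<^sub>m N)) = kron (mat_adjoint A) (1\<^sub>m N)"
proof (rule block_eq_matI)
  fix i a k b assume i: "i < q" "a < N" "k < p" "b < N"
  have "mat_adjoint (kron A (1\<^sub>m N)) $$ (i * N + a, k * N + b) = cnj (kron A (1\<^sub>m N) $$ (k * N + b, i * N + a))"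
    using A i block_index_less[OF i(1,2)] block_index_less[OF i(3,4)]
    by (intro mat_adjoint_index) (auto simp: kron_def)
  also have "\<dots> = kron (mat_adjoint A) (1\<^sub>m N) $$ (i * N + a, k * N + b)"
    using A i by (simp add: kron_index[of _ p q _ N N] kron_index[of _ q p _ N N])
  finally show "mat_adjoint (kron A (1\<^sub>m N)) $$ (i * N + a, k * N + b) = kron (mat_adjoint A) (1\<^sub>m N) $$ (i * N + a, k * N + b)" .
qed (use A in auto)

lemma kron_one_one: "kron (1\<^sub>m p) (1\<^sub>m N) = 1\<^sub>m (p * N)"
proof (rule block_eq_matI)
  fix i a k b assume i: "i < p" "a < N" "k < p" "b < (N :: nat)"
  have "(i * N + a = k * N + b) \<longleftrightarrow> i = k \<and> a = b"
  proof
    assume e: "i * N + a = k * N + b"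
    have "(i * N + a) div N = i" "(k * N + b) div N = k" using i by auto
    then show "i = k \<and> a = b" using e by auto
  qed auto
  then show "kron (1\<^sub>m p) (1\<^sub>m N) $$ (i * N + a, k * N + b) = 1\<^sub>m (p * N) $$ (i * N + a, k * N + b)"
    using i block_index_less[OF i(1,2)] block_index_less[OF i(3,4)]
    by (simp add: kron_index[of _ p p _ N N])
qed auto

lemma kron_zero_left [simp]: "kron (0\<^sub>m p q) (1\<^sub>m N) = 0\<^sub>m (p * N) (q * N)"
  by (rule block_eq_matI[of _ p N q N]) (auto simp: kron_index[of _ p q _ N N] block_index_less)

lemma kron_minus_left:
  assumes "A \<in> carrier_mat p q" "B \<in> carrier_mat p q"
  shows "kron (A - B) (1\<^sub>m N) = kron A (1\<^sub>m N) - kron B (1\<^sub>m N)"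
proof (rule block_eq_matI)
  fix i a k b assume i: "i < p" "a < N" "k < q" "b < N"
  show "kron (A - B) (1\<^sub>m N) $$ (i * N + a, k * N + b) = (kron A (1\<^sub>m N) - kron B (1\<^sub>m N)) $$ (i * N + a, k * N + b)"
    using i assms block_index_less[OF i(1,2)] block_index_less[OF i(3,4)]
      kron_carrier[OF assms(2), of "1\<^sub>m N" N N] minus_carrier_mat[OF assms(2), of A]
    by (simp add: kron_index[of _ p q _ N N] left_diff_distrib carrier_matD[OF assms(2)] del: index_one_mat(1))
qed (use assms in \<open>auto intro!: minus_carrier_mat kron_carrier\<close>)

lemma kron_1_size_1: "A \<in> carrier_mat p q \<Longrightarrow> kron A (1\<^sub>m 1) = A"
  by (rule block_eq_matI[where p = p and q = q and M = 1 and N = 1])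
     (auto simp: kron_def)

lemma op_norm_kron_1_le:
  assumes A: "A \<in> carrier_mat p q"
  shows "op_norm (kron A (1\<^sub>m N)) \<le> op_norm A"
proof (rule op_norm_leI[of _ "p * N" "q * N"])
  fix x :: "complex vec" assume x: "x \<in> carrier_vec (q * N)" "sqn x \<le> 1"
  define s where "s b = vec q (\<lambda>k. x $ (k * N + b))" for b
  have e: "(kron A (1\<^sub>m N) *\<^sub>v x) $ (i * N + b) = (A *\<^sub>v s b) $ i" if i: "i < p" "b < N" for i b
  proof -
    have "(kron A (1\<^sub>m N) *\<^sub>v x) $ (i * N + b) = (\<Sum>k<q. \<Sum>c<N. A $$ (i, k) * 1\<^sub>m N $$ (b, c) * x $ (k * N + c))"
      using A x i block_index_less[OF i]
      by (simp add: mult_mat_vec_index_sum[of _ "p * N" "q * N"] sum_lessThan_mult kron_index[of _ p q _ N N]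
          del: index_mult_mat_vec index_one_mat(1))
    also have "\<dots> = (\<Sum>k<q. A $$ (i, k) * x $ (k * N + b))"
      using i by (simp add: if_distrib if_distribR sum.delta cong: if_cong)
    also have "\<dots> = (A *\<^sub>v s b) $ i"
      using i by (subst mult_mat_vec_index_sum[OF A, of "s b"]) (simp_all add: s_def)
    finally show ?thesis .
  qed
  have "sqn (kron A (1\<^sub>m N) *\<^sub>v x) = (\<Sum>i<p. \<Sum>b<N. (cmod ((A *\<^sub>v s b) $ i))\<^sup>2)"
    using A by (simp add: sqn_def sum_lessThan_mult e del: index_mult_mat_vec)
  also have "\<dots> = (\<Sum>b<N. sqn (A *\<^sub>v s b))"
    using A by (subst sum.swap) (simp add: sqn_def)
  also have "\<dots> \<le> (\<Sum>b<N. (op_norm A)\<^sup>2 * sqn (s b))"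
    by (intro sum_mono sqn_mult_mat_vec_le[OF A]) (simp add: s_def)
  also have "\<dots> = (op_norm A)\<^sup>2 * sqn x"
  proof -
    have "(\<Sum>b<N. sqn (s b)) = (\<Sum>b<N. \<Sum>k<q. (cmod (x $ (k * N + b)))\<^sup>2)"
      by (simp add: sqn_def s_def)
    also have "\<dots> = (\<Sum>k<q. \<Sum>b<N. (cmod (x $ (k * N + b)))\<^sup>2)"
      by (rule sum.swap)
    also have "\<dots> = sqn x"
      unfolding sqn_def carrier_vecD[OF x(1)] by (rule sum_lessThan_mult[symmetric])
    finally have e: "(\<Sum>b<N. sqn (s b)) = sqn x" .
    have "(\<Sum>b<N. (op_norm A)\<^sup>2 * sqn (s b)) = (op_norm A)\<^sup>2 * (\<Sum>b<N. sqn (s b))"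
      by (rule sum_distrib_left[symmetric])
    then show ?thesis unfolding e .
  qed
  also have "\<dots> \<le> (op_norm A)\<^sup>2 * 1"
    using x by (intro mult_left_mono) auto
  finally show "sqn (kron A (1\<^sub>m N) *\<^sub>v x) \<le> (op_norm A)\<^sup>2" by simp
qed (use A in auto)

section \<open>Binomial series and positive square roots\<close>

lemma mat_inverse_exists:
  fixes A :: "complex mat"
  assumes A: "A \<in> carrier_mat n n"
    and inj: "\<And>x. x \<in> carrier_vec n \<Longrightarrow> A *\<^sub>v x = 0\<^sub>v n \<Longrightarrow> x = 0\<^sub>v n"
  shows "the (mat_inverse A) \<in> carrier_mat n n"
    and "A * the (mat_inverse A) = 1\<^sub>m n" and "the (mat_inverse A) * A = 1\<^sub>m n"
proof -
  have "det A \<noteq> 0"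
    using inj det_0_iff_vec_prod_zero_field[OF A] by auto
  then have "A \<in> Units (ring_mat TYPE(complex) n n)"
    by (rule det_non_zero_imp_unit[OF A])
  then obtain B where B: "mat_inverse A = Some B"
    using mat_inverse(1)[OF A, of n] by (cases "mat_inverse A") auto
  then show "the (mat_inverse A) \<in> carrier_mat n n"
    "A * the (mat_inverse A) = 1\<^sub>m n" "the (mat_inverse A) * A = 1\<^sub>m n"
    using mat_inverse(2)[OF A B] by auto
qed

lemma pow_mat_carrier [simp]: "A \<in> carrier_mat n n \<Longrightarrow> A ^\<^sub>m k \<in> carrier_mat n n"
  by (induction k) auto

lemma pow_mat_add:
  fixes A :: "complex mat"
  assumes "A \<in> carrier_mat n n"
  shows "A ^\<^sub>m (k + l) = A ^\<^sub>m k * A ^\<^sub>m l"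
  using assms
  by (induction l) (auto simp: assoc_mult_mat[of _ n n _ n _ n])

lemma pow_mat_commute:
  fixes A :: "complex mat"
  assumes "A \<in> carrier_mat n n"
  shows "A * A ^\<^sub>m k = A ^\<^sub>m k * A"
  using pow_mat_add[OF assms, of 1 k] pow_mat_add[OF assms, of k 1] assms
  by (simp add: add.commute)

lemma pow_mat_adjoint:
  fixes A :: "complex mat"
  assumes "A \<in> carrier_mat n n"
  shows "mat_adjoint (A ^\<^sub>m k) = mat_adjoint A ^\<^sub>m k"
proof (induction k)
  case (Suc k)
  have "mat_adjoint (A ^\<^sub>m Suc k) = mat_adjoint A * mat_adjoint (A ^\<^sub>m k)"
    using assms by (simp add: mat_adjoint_mult[of _ n n _ n])
  then show ?case using assms pow_mat_commute[of "mat_adjoint A" n k] by (simp add: Suc)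
qed (use assms in simp)

lemma pow_mat_kron:
  fixes A :: "complex mat"
  assumes "A \<in> carrier_mat n n"
  shows "kron A (1\<^sub>m N) ^\<^sub>m k = kron (A ^\<^sub>m k) (1\<^sub>m N)"
proof (induction k)
  case 0
  show ?case using assms by (simp add: kron_one_one kron_def[of A])
next
  case (Suc k)
  then show ?case using assms by (simp add: kron_1_mult[of _ n n _ n])
qed

lemma pow_mat_intertwine:
  fixes A :: "complex mat"
  assumes "A \<in> carrier_mat m m" "B \<in> carrier_mat n n" "c \<in> carrier_mat m n" "A * c = c * B"
  shows "A ^\<^sub>m k * c = c * B ^\<^sub>m k"
proof (induction k)
  case (Suc k)
  have "A ^\<^sub>m Suc k * c = A ^\<^sub>m k * (A * c)" using assms by (simp add: assoc_mult_mat[of _ m m _ m _ n])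
  also have "\<dots> = (A ^\<^sub>m k * c) * B" using assms by (simp add: assoc_mult_mat[of _ m m _ n _ n])
  also have "\<dots> = c * B ^\<^sub>m Suc k" using assms by (simp add: Suc assoc_mult_mat[of _ m n _ n _ n])
  finally show ?case .
qed (use assms in auto)

lemma op_norm_mult_le:
  assumes A: "A \<in> carrier_mat m n" and B: "B \<in> carrier_mat n k"
  shows "op_norm (A * B) \<le> op_norm A * op_norm B"
proof (rule op_norm_leI[of _ m k])
  fix x :: "complex vec" assume x: "x \<in> carrier_vec k" "sqn x \<le> 1"
  have "sqn (A * B *\<^sub>v x) = sqn (A *\<^sub>v (B *\<^sub>v x))"
    using A B x by (simp add: assoc_mult_mat_vec[of _ m n _ k])
  also have "\<dots> \<le> (op_norm A)\<^sup>2 * sqn (B *\<^sub>v x)"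
    using A B x by (intro sqn_mult_mat_vec_le[of _ m n]) auto
  also have "\<dots> \<le> (op_norm A)\<^sup>2 * ((op_norm B)\<^sup>2 * sqn x)"
    using B x by (intro mult_left_mono sqn_mult_mat_vec_le[of _ n k]) auto
  also have "\<dots> \<le> (op_norm A)\<^sup>2 * ((op_norm B)\<^sup>2 * 1)"
    using x by (intro mult_left_mono) auto
  finally show "sqn (A * B *\<^sub>v x) \<le> (op_norm A * op_norm B)\<^sup>2"
    by (simp add: power_mult_distrib)
qed (use A B op_norm_nonneg[OF A] op_norm_nonneg[OF B] in auto)

lemma op_norm_one_le: "op_norm (1\<^sub>m n) \<le> 1"
  by (subst contraction_iff[of _ n n]) auto

lemma op_norm_pow_mat_le:
  assumes A: "A \<in> carrier_mat n n"
  shows "op_norm (A ^\<^sub>m k) \<le> op_norm A ^ k"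
proof (induction k)
  case 0
  show ?case using A op_norm_one_le by simp
next
  case (Suc k)
  have "op_norm (A ^\<^sub>m Suc k) \<le> op_norm (A ^\<^sub>m k) * op_norm A"
    using A op_norm_mult_le[of "A ^\<^sub>m k" n n A n] by simp
  also have "\<dots> \<le> op_norm A ^ k * op_norm A"
    using Suc.IH op_norm_nonneg[OF A] by (rule mult_right_mono)
  finally show ?case by (simp add: mult.commute)
qed

lemma pow_mat_entry_le:
  assumes A: "A \<in> carrier_mat n n" and ij: "i < n" "j < n"
  shows "cmod ((A ^\<^sub>m k) $$ (i, j)) \<le> op_norm A ^ k"
  using norm_entry_le_op_norm[of "A ^\<^sub>m k" n n i j] op_norm_pow_mat_le[OF A, of k] A ij
  by simp

text \<open>The matrix \<open>(1 - T)\<^sup>s\<close> for \<open>\<parallel>T\<parallel> < 1\<close>, by the binomial series.\<close>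

definition binom_mat :: "real \<Rightarrow> complex mat \<Rightarrow> complex mat" where
  "binom_mat s T = mat (dim_row T) (dim_row T)
     (\<lambda>(i, j). \<Sum>k. of_real ((s gchoose k) * (-1) ^ k) * (T ^\<^sub>m k) $$ (i, j))"

lemma binom_mat_carrier [simp]: "T \<in> carrier_mat n n \<Longrightarrow> binom_mat s T \<in> carrier_mat n n"
  by (simp add: binom_mat_def)

lemma binom_mat_summable:
  assumes T: "T \<in> carrier_mat n n" "op_norm T < 1" and ij: "i < n" "j < n"
  shows "summable (\<lambda>k. norm (complex_of_real ((s gchoose k) * (-1) ^ k) * (T ^\<^sub>m k) $$ (i, j)))"
proof -
  define r where "r = (1 + op_norm T) / 2"
  have nn: "0 \<le> op_norm T" using T by simp
  have r: "norm r < 1" "norm (op_norm T) < norm r" using T nn by (auto simp: r_def)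
  have "summable (\<lambda>k. (s gchoose k) * r ^ k)"
    using gen_binomial_real[of r s] r by (auto simp: sums_iff)
  from powser_insidea[OF this r(2)] have "summable (\<lambda>k. norm ((s gchoose k) * op_norm T ^ k))" .
  then show ?thesis
  proof (rule summable_comparison_test[rotated], intro exI allI impI)
    fix k :: nat
    have "norm (norm (complex_of_real ((s gchoose k) * (-1) ^ k) * (T ^\<^sub>m k) $$ (i, j)))
        = \<bar>s gchoose k\<bar> * cmod ((T ^\<^sub>m k) $$ (i, j))"
      by (simp add: norm_mult norm_power)
    also have "\<dots> \<le> \<bar>s gchoose k\<bar> * op_norm T ^ k"
      using pow_mat_entry_le[OF T(1) ij] by (intro mult_left_mono) auto
    finally show "norm (norm (complex_of_real ((s gchoose k) * (-1) ^ k) * (T ^\<^sub>m k) $$ (i, j)))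
        \<le> norm ((s gchoose k) * op_norm T ^ k)"
      using nn by (simp add: abs_mult)
  qed
qed

lemma binom_mat_sums:
  assumes T: "T \<in> carrier_mat n n" "op_norm T < 1" and ij: "i < n" "j < n"
  shows "(\<lambda>k. complex_of_real ((s gchoose k) * (-1) ^ k) * (T ^\<^sub>m k) $$ (i, j)) sums (binom_mat s T $$ (i, j))"
proof -
  have "summable (\<lambda>k. complex_of_real ((s gchoose k) * (-1) ^ k) * (T ^\<^sub>m k) $$ (i, j))"
    using binom_mat_summable[OF assms] by (rule summable_norm_cancel)
  then show ?thesis using T ij by (simp add: binom_mat_def summable_sums)
qed

text \<open>Vandermonde's identity for generalized binomial coefficients.\<close>

lemma binom_mat_mult:
  assumes T: "T \<in> carrier_mat n n" "op_norm T < 1"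
  shows "binom_mat s T * binom_mat r T = binom_mat (s + r) T"
proof (rule eq_matI)
  fix i j assume "i < dim_row (binom_mat (s + r) T)" "j < dim_col (binom_mat (s + r) T)"
  then have ij: "i < n" "j < n" using T by (auto simp: binom_mat_def)
  define a where "a s k = complex_of_real ((s gchoose k) * (-1) ^ k)" for s k
  have S: "(\<lambda>k. a s k * (T ^\<^sub>m k) $$ (i, j)) sums (binom_mat s T $$ (i, j))" if "i < n" "j < n" for s i j
    using binom_mat_sums[OF T that] by (simp only: a_def)
  have A: "summable (\<lambda>k. norm (a s k * (T ^\<^sub>m k) $$ (i, j)))" if "i < n" "j < n" for s i j
    using binom_mat_summable[OF T that] by (simp only: a_def)
  have a_conv: "(\<Sum>k\<le>m. a s k * a r (m - k)) = a (s + r) m" for m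
  proof -
    have "(\<Sum>k\<le>m. a s k * a r (m - k))
        = (\<Sum>k\<le>m. complex_of_real ((s gchoose k) * (r gchoose (m - k)) * (-1) ^ m))"
    proof (intro sum.cong refl)
      fix k assume "k \<in> {..m}"
      then have "(-1 :: real) ^ m = (-1) ^ k * (-1) ^ (m - k)"
        by (simp flip: power_add)
      then show "a s k * a r (m - k) = complex_of_real ((s gchoose k) * (r gchoose (m - k)) * (-1) ^ m)"
        by (simp add: a_def)
    qed
    also have "\<dots> = complex_of_real ((\<Sum>k\<le>m. (s gchoose k) * (r gchoose (m - k))) * (-1) ^ m)"
      by (simp add: sum_distrib_right)
    also have "\<dots> = a (s + r) m"
      by (simp add: a_def gbinomial_Vandermonde atMost_atLeast0)
    finally show ?thesis .
  qed
  have "(\<lambda>m. \<Sum>l<n. \<Sum>k\<le>m. (a s k * (T ^\<^sub>m k) $$ (i, l)) * (a r (m - k) * (T ^\<^sub>m (m - k)) $$ (l, j)))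
      sums (\<Sum>l<n. binom_mat s T $$ (i, l) * binom_mat r T $$ (l, j))"
  proof (intro sums_sum)
    fix l assume "l \<in> {..<n}"
    then have l: "l < n" by simp
    show "(\<lambda>m. \<Sum>k\<le>m. (a s k * (T ^\<^sub>m k) $$ (i, l)) * (a r (m - k) * (T ^\<^sub>m (m - k)) $$ (l, j)))
      sums (binom_mat s T $$ (i, l) * binom_mat r T $$ (l, j))"
      using Cauchy_product_sums[OF A A, OF ij(1) l l ij(2), of s r]
        S[OF ij(1) l, of s] S[OF l ij(2), of r]
      by (simp add: sums_iff)
  qed
  also have "(\<lambda>m. \<Sum>l<n. \<Sum>k\<le>m. (a s k * (T ^\<^sub>m k) $$ (i, l)) * (a r (m - k) * (T ^\<^sub>m (m - k)) $$ (l, j)))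
      = (\<lambda>m. a (s + r) m * (T ^\<^sub>m m) $$ (i, j))"
  proof
    fix m
    have "(\<Sum>l<n. \<Sum>k\<le>m. (a s k * (T ^\<^sub>m k) $$ (i, l)) * (a r (m - k) * (T ^\<^sub>m (m - k)) $$ (l, j)))
        = (\<Sum>k\<le>m. a s k * a r (m - k) * (\<Sum>l<n. (T ^\<^sub>m k) $$ (i, l) * (T ^\<^sub>m (m - k)) $$ (l, j)))"
      by (subst sum.swap) (simp add: sum_distrib_left algebra_simps)
    also have "\<dots> = (\<Sum>k\<le>m. a s k * a r (m - k) * (T ^\<^sub>m m) $$ (i, j))"
    proof (intro sum.cong refl)
      fix k assume k: "k \<in> {..m}"
      have "(\<Sum>l<n. (T ^\<^sub>m k) $$ (i, l) * (T ^\<^sub>m (m - k)) $$ (l, j)) = (T ^\<^sub>m k * T ^\<^sub>m (m - k)) $$ (i, j)"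
        using T ij by (subst mat_mult_index_sum[of _ n n _ n]) auto
      also have "T ^\<^sub>m k * T ^\<^sub>m (m - k) = T ^\<^sub>m m"
        using pow_mat_add[OF T(1), of k "m - k"] k by simp
      finally show "a s k * a r (m - k) * (\<Sum>l<n. (T ^\<^sub>m k) $$ (i, l) * (T ^\<^sub>m (m - k)) $$ (l, j))
        = a s k * a r (m - k) * (T ^\<^sub>m m) $$ (i, j)" by simp
    qed
    also have "\<dots> = a (s + r) m * (T ^\<^sub>m m) $$ (i, j)"
      by (simp flip: a_conv add: sum_distrib_right)
    finally show "(\<Sum>l<n. \<Sum>k\<le>m. (a s k * (T ^\<^sub>m k) $$ (i, l)) * (a r (m - k) * (T ^\<^sub>m (m - k)) $$ (l, j)))
      = a (s + r) m * (T ^\<^sub>m m) $$ (i, j)" .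
  qed
  finally have "(\<Sum>l<n. binom_mat s T $$ (i, l) * binom_mat r T $$ (l, j)) = binom_mat (s + r) T $$ (i, j)"
    by (rule sums_unique2[OF _ S[OF ij, of "s + r"]])
  then show "(binom_mat s T * binom_mat r T) $$ (i, j) = binom_mat (s + r) T $$ (i, j)"
    using T ij by (subst mat_mult_index_sum[of _ n n _ n]) auto
qed (use T in \<open>auto simp: binom_mat_def\<close>)

lemma binom_mat_1:
  assumes T: "T \<in> carrier_mat n n" "op_norm T < 1"
  shows "binom_mat 1 T = 1\<^sub>m n - T"
proof (rule eq_matI)
  fix i j assume "i < dim_row (1\<^sub>m n - T)" "j < dim_col (1\<^sub>m n - T)"
  then have ij: "i < n" "j < n" using T by auto
  let ?f = "\<lambda>k. complex_of_real ((1 gchoose k) * (-1) ^ k) * (T ^\<^sub>m k) $$ (i, j)"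
  have z: "(1 :: real) gchoose k = 0" if "k \<notin> {0, 1}" for k
  proof -
    have "(1 :: nat) choose k = 0" using that by (intro binomial_eq_0) auto
    then show ?thesis using binomial_gbinomial[of 1 k, where 'a = real] by (simp only: of_nat_1 of_nat_0)
  qed
  have "?f sums (\<Sum>k\<in>{0, 1}. ?f k)"
    by (rule sums_finite) (use z in auto)
  also have "(\<Sum>k\<in>{0, 1}. ?f k) = (1\<^sub>m n - T) $$ (i, j)"
    using T ij by simp
  finally show "binom_mat 1 T $$ (i, j) = (1\<^sub>m n - T) $$ (i, j)"
    by (rule sums_unique2[OF binom_mat_sums[OF T ij, of 1]])
qed (use T in \<open>auto simp: binom_mat_def\<close>)

lemma binom_mat_adjoint:
  assumes T: "T \<in> carrier_mat n n" "op_norm T < 1" "mat_adjoint T = T"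
  shows "mat_adjoint (binom_mat s T) = binom_mat s T"
proof (rule eq_matI)
  fix i j assume "i < dim_row (binom_mat s T)" "j < dim_col (binom_mat s T)"
  then have ij: "i < n" "j < n" using T by (auto simp: binom_mat_def)
  have P: "cnj ((T ^\<^sub>m k) $$ (j, i)) = (T ^\<^sub>m k) $$ (i, j)" for k
  proof -
    have "cnj ((T ^\<^sub>m k) $$ (j, i)) = mat_adjoint (T ^\<^sub>m k) $$ (i, j)"
      using T ij by (subst mat_adjoint_index) auto
    then show ?thesis using pow_mat_adjoint[OF T(1), of k] T(3) by simp
  qed
  have "(\<lambda>k. cnj (complex_of_real ((s gchoose k) * (-1) ^ k) * (T ^\<^sub>m k) $$ (j, i))) sums cnj (binom_mat s T $$ (j, i))"
    using binom_mat_sums[OF T(1,2) ij(2,1)] by (simp only: sums_cnj)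
  then have "cnj (binom_mat s T $$ (j, i)) = binom_mat s T $$ (i, j)"
    using sums_unique2[OF _ binom_mat_sums[OF T(1,2) ij, of s]] by (simp add: P)
  then show "mat_adjoint (binom_mat s T) $$ (i, j) = binom_mat s T $$ (i, j)"
    using T ij by (subst mat_adjoint_index) (auto simp: binom_mat_def)
qed (use T in \<open>auto simp: binom_mat_def\<close>)

lemma binom_mat_intertwine:
  assumes A: "A \<in> carrier_mat m m" "op_norm A < 1" and B: "B \<in> carrier_mat n n" "op_norm B < 1"
    and c: "c \<in> carrier_mat m n" "A * c = c * B"
  shows "binom_mat s A * c = c * binom_mat s B"
proof (rule eq_matI)
  fix i j assume "i < dim_row (c * binom_mat s B)" "j < dim_col (c * binom_mat s B)"
  then have ij: "i < m" "j < n" using B c by (auto simp: binom_mat_def)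
  define a where "a k = complex_of_real ((s gchoose k) * (-1) ^ k)" for k
  have "(\<lambda>k. \<Sum>l<m. a k * (A ^\<^sub>m k) $$ (i, l) * c $$ (l, j)) sums (\<Sum>l<m. binom_mat s A $$ (i, l) * c $$ (l, j))"
    using binom_mat_sums[OF A ij(1)] by (intro sums_sum sums_mult2) (auto simp: a_def)
  moreover have "(\<lambda>k. \<Sum>l<n. c $$ (i, l) * (a k * (B ^\<^sub>m k) $$ (l, j))) sums (\<Sum>l<n. c $$ (i, l) * binom_mat s B $$ (l, j))"
    using binom_mat_sums[OF B _ ij(2)] by (intro sums_sum sums_mult) (auto simp: a_def)
  moreover have "(\<Sum>l<m. a k * (A ^\<^sub>m k) $$ (i, l) * c $$ (l, j)) = (\<Sum>l<n. c $$ (i, l) * (a k * (B ^\<^sub>m k) $$ (l, j)))" for k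
  proof -
    have "(\<Sum>l<m. a k * (A ^\<^sub>m k) $$ (i, l) * c $$ (l, j)) = a k * (A ^\<^sub>m k * c) $$ (i, j)"
      using A c ij by (subst mat_mult_index_sum[of _ m m _ n]) (auto simp: sum_distrib_left algebra_simps)
    also have "A ^\<^sub>m k * c = c * B ^\<^sub>m k"
      using A B c by (intro pow_mat_intertwine) auto
    also have "a k * (c * B ^\<^sub>m k) $$ (i, j) = (\<Sum>l<n. c $$ (i, l) * (a k * (B ^\<^sub>m k) $$ (l, j)))"
      using B c ij by (subst mat_mult_index_sum[of _ m n _ n]) (auto simp: sum_distrib_left algebra_simps)
    finally show ?thesis .
  qed
  ultimately have "(\<Sum>l<m. binom_mat s A $$ (i, l) * c $$ (l, j)) = (\<Sum>l<n. c $$ (i, l) * binom_mat s B $$ (l, j))"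
    by (simp only: sums_unique2)
  then show "(binom_mat s A * c) $$ (i, j) = (c * binom_mat s B) $$ (i, j)"
    using A B c ij by (simp add: mat_mult_index_sum[of _ m m _ n] mat_mult_index_sum[of _ m n _ n] del: index_mult_mat(1))
qed (use A B c in \<open>auto simp: binom_mat_def\<close>)

lemma binom_mat_kron:
  assumes T: "T \<in> carrier_mat n n" "op_norm T < 1"
  shows "binom_mat s (kron T (1\<^sub>m N)) = kron (binom_mat s T) (1\<^sub>m N)"
proof (rule block_eq_matI)
  fix i a k b assume i: "i < n" "a < N" "k < n" "b < N"
  have K: "kron T (1\<^sub>m N) \<in> carrier_mat (n * N) (n * N)" "op_norm (kron T (1\<^sub>m N)) < 1"
    using T op_norm_kron_1_le[OF T(1), of N] by auto
  let ?c = "\<lambda>l. complex_of_real ((s gchoose l) * (-1) ^ l)"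
  have "(\<lambda>l. ?c l * (kron T (1\<^sub>m N) ^\<^sub>m l) $$ (i * N + a, k * N + b)) sums
      (binom_mat s (kron T (1\<^sub>m N)) $$ (i * N + a, k * N + b))"
    by (rule binom_mat_sums[OF K block_index_less[OF i(1,2)] block_index_less[OF i(3,4)]])
  moreover have "(\<lambda>l. ?c l * (kron T (1\<^sub>m N) ^\<^sub>m l) $$ (i * N + a, k * N + b))
      = (\<lambda>l. ?c l * (T ^\<^sub>m l) $$ (i, k) * 1\<^sub>m N $$ (a, b))"
    using T i by (simp add: pow_mat_kron[OF T(1)] kron_index[of _ n n _ N N] mult.assoc del: index_one_mat(1))
  moreover have "(\<lambda>l. ?c l * (T ^\<^sub>m l) $$ (i, k) * 1\<^sub>m N $$ (a, b)) sums
      (binom_mat s T $$ (i, k) * 1\<^sub>m N $$ (a, b))"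
    using binom_mat_sums[OF T i(1,3), of s] by (rule sums_mult2)
  ultimately have "binom_mat s (kron T (1\<^sub>m N)) $$ (i * N + a, k * N + b) = binom_mat s T $$ (i, k) * 1\<^sub>m N $$ (a, b)"
    by (simp only: sums_unique2)
  then show "binom_mat s (kron T (1\<^sub>m N)) $$ (i * N + a, k * N + b) = kron (binom_mat s T) (1\<^sub>m N) $$ (i * N + a, k * N + b)"
    using T i by (simp add: kron_index[of _ n n _ N N])
qed (use T in auto)

lemma mat_minus_left_cancel:
  fixes A B C :: "complex mat"
  assumes "A \<in> carrier_mat m n" "B \<in> carrier_mat m n" "C \<in> carrier_mat m n" "A - B = A - C"
  shows "B = C"
proof (rule eq_matI)
  fix i j assume "i < dim_row C" "j < dim_col C"
  then have ij: "i < m" "j < n" using assms(3) by auto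
  have "(A - B) $$ (i, j) = (A - C) $$ (i, j)" by (simp only: assms(4))
  then have "A $$ (i, j) - B $$ (i, j) = A $$ (i, j) - C $$ (i, j)"
    using assms(1-3) ij by (simp only: index_minus_mat carrier_matD)
  then show "B $$ (i, j) = C $$ (i, j)" by simp
qed (use assms(2,3) in auto)

lemma zero_mat_mult_vec:
  "(x :: complex vec) \<in> carrier_vec n \<Longrightarrow> 0\<^sub>m m n *\<^sub>v x = 0\<^sub>v m"
  by (intro eq_vecI) auto

lemma mult_mat_zero_vec:
  "(A :: complex mat) \<in> carrier_mat m n \<Longrightarrow> A *\<^sub>v 0\<^sub>v n = 0\<^sub>v m"
  by (intro eq_vecI) auto

lemma mat_eq_by_vec:
  fixes A B :: "complex mat"
  assumes "A \<in> carrier_mat m n" "B \<in> carrier_mat m n"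
    and "\<And>x. x \<in> carrier_vec n \<Longrightarrow> A *\<^sub>v x = B *\<^sub>v x"
  shows "A = B"
proof (rule eq_matI)
  fix i j assume "i < dim_row B" "j < dim_col B"
  then have ij: "i < m" "j < n" using assms(2) by auto
  have "(A *\<^sub>v unit_vec n j) $ i = (B *\<^sub>v unit_vec n j) $ i"
    by (simp only: assms(3)[OF unit_vec_carrier])
  then show "A $$ (i, j) = B $$ (i, j)" using ij assms(1,2) by simp
qed (use assms(1,2) in auto)

lemma one_minus_inj:
  assumes T: "T \<in> carrier_mat n n" "op_norm T < 1" and x: "x \<in> carrier_vec n"
    and 0: "(1\<^sub>m n - T) *\<^sub>v x = 0\<^sub>v n"
  shows "x = 0\<^sub>v n"
proof -
  have e: "x - T *\<^sub>v x = 0\<^sub>v n"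
    using 0 unfolding minus_mult_distrib_mat_vec[OF one_carrier_mat T(1) x] one_mult_mat_vec[OF x] .
  have Tx: "T *\<^sub>v x = x"
  proof (rule eq_vecI)
    fix i assume "i < dim_vec x"
    then have i: "i < n" using x by simp
    have "x $ i - (T *\<^sub>v x) $ i = (x - T *\<^sub>v x) $ i"
      by (rule index_minus_vec(1)[symmetric]) (use i T(1) in simp)
    also have "\<dots> = 0" unfolding e using i by simp
    finally show "(T *\<^sub>v x) $ i = x $ i" unfolding right_minus_eq by (rule sym)
  qed (use T(1) x in simp)
  have le: "sqn x \<le> (op_norm T)\<^sup>2 * sqn x"
    using sqn_mult_mat_vec_le[OF T(1) x] unfolding Tx .
  have "(op_norm T)\<^sup>2 < 1\<^sup>2"
    by (rule power_strict_mono[OF T(2) op_norm_nonneg[OF T(1)]]) simp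
  then have lt: "(op_norm T)\<^sup>2 < 1" by simp
  have "\<not> sqn x > 0"
  proof
    assume "sqn x > 0"
    from mult_strict_right_mono[OF lt this] le show False by simp
  qed
  then have "sqn x = 0" using sqn_nonneg[of x] by linarith
  then show ?thesis by (simp only: sqn_0_iff[OF x])
qed

text \<open>The binomial series \<open>C\<close> for \<open>(1 - T)\<^sup>1\<^sup>/\<^sup>2\<close> is positive, being the square of the self-adjoint
  matrix \<open>(1 - T)\<^sup>1\<^sup>/\<^sup>4\<close>.  Any other positive root \<open>B\<close> commutes with \<open>T\<close>, hence with \<open>C\<close>, so that
  \<open>(B + C) (B - C) = 0\<close>; pairing with \<open>x = (B - C) y\<close> gives \<open>C x = 0\<close> and then \<open>x = 0\<close>.\<close>

lemma psd_sqrt_one_minus: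
  assumes T: "T \<in> carrier_mat n n" "op_norm T < 1" "mat_adjoint T = T"
  shows "psd_sqrt (1\<^sub>m n - T) = binom_mat (1/2) T"
proof -
  define C where "C = binom_mat (1/2) T"
  define R where "R = binom_mat (1/4) T"
  have C: "C \<in> carrier_mat n n" "mat_adjoint C = C" and R: "R \<in> carrier_mat n n" "mat_adjoint R = R"
    unfolding C_def R_def by (rule binom_mat_carrier[OF T(1)] binom_mat_adjoint[OF T])+
  have CC: "C * C = 1\<^sub>m n - T"
    using binom_mat_mult[OF T(1,2), of "1/2" "1/2"] binom_mat_1[OF T(1,2)] by (simp add: C_def)
  have RR: "R * R = C"
    using binom_mat_mult[OF T(1,2), of "1/4" "1/4"] by (simp add: C_def R_def)
  have Cx: "(C *\<^sub>v x) \<bullet>c x = complex_of_real (sqn (R *\<^sub>v x))" if x: "x \<in> carrier_vec n" for x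
  proof -
    have "(C *\<^sub>v x) \<bullet>c x = (R *\<^sub>v (R *\<^sub>v x)) \<bullet>c x"
      unfolding RR[symmetric] assoc_mult_mat_vec[OF R(1) R(1) x] ..
    also have "\<dots> = (R *\<^sub>v x) \<bullet>c (R *\<^sub>v x)"
      using cscalar_prod_adjoint[OF R(1) mult_mat_vec_carrier[OF R(1) x] x] unfolding R(2) .
    finally show ?thesis by (simp add: cscalar_prod_self)
  qed
  have inj: "x = 0\<^sub>v n" if x: "x \<in> carrier_vec n" and 0: "C *\<^sub>v x = 0\<^sub>v n" for x
  proof -
    have "(1\<^sub>m n - T) *\<^sub>v x = C *\<^sub>v (C *\<^sub>v x)" unfolding CC[symmetric] by (rule assoc_mult_mat_vec[OF C(1) C(1) x])
    also have "\<dots> = 0\<^sub>v n" using C(1) unfolding 0 by (intro eq_vecI) auto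
    finally show ?thesis by (rule one_minus_inj[OF T(1,2) x])
  qed
  have dim: "dim_row (1\<^sub>m n - T) = n" using T(1) by simp
  show ?thesis
    unfolding psd_sqrt_def C_def[symmetric] dim
  proof (rule the_equality)
    show "C \<in> carrier_mat n n \<and> psd_mat C \<and> C * C = 1\<^sub>m n - T"
    proof (intro conjI)
      have "dim_row C = n" using C(1) by simp
      then show "psd_mat C"
        unfolding psd_mat_def using C(1) C(2) Cx by (simp add: less_eq_complex_def)
    qed (rule C(1) CC)+
  next
    fix B assume asm: "B \<in> carrier_mat n n \<and> psd_mat B \<and> B * B = 1\<^sub>m n - T"
    note B = asm[THEN conjunct1] asm[THEN conjunct2, THEN conjunct2]
    note pB = asm[THEN conjunct2, THEN conjunct1]
    have dB: "dim_row B = n" using B(1) by simp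
    have psd: "0 \<le> (B *\<^sub>v x) \<bullet>c x" if "x \<in> carrier_vec n" for x
      using pB[unfolded psd_mat_def dB, THEN conjunct2, THEN conjunct2] that by (rule bspec)
    have BT: "B * (1\<^sub>m n - T) = (1\<^sub>m n - T) * B" 
      unfolding B(2)[symmetric] by (rule assoc_mult_mat[OF B(1) B(1) B(1), symmetric])
    have "T * B = B * T"
    proof -
      have "B - B * T = B - T * B"
        using BT unfolding mult_minus_distrib_mat[OF B(1) one_carrier_mat T(1)]
          minus_mult_distrib_mat[OF one_carrier_mat T(1) B(1)] right_mult_one_mat[OF B(1)] left_mult_one_mat[OF B(1)] .
      then show ?thesis
        by (rule mat_minus_left_cancel[OF B(1) mult_carrier_mat[OF B(1) T(1)] mult_carrier_mat[OF T(1) B(1)], symmetric])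
    qed
    then have comm: "C * B = B * C"
      unfolding C_def using T(1,2) B(1) \<open>T * B = B * T\<close> by (intro binom_mat_intertwine) auto
    show "B = C"
    proof (rule mat_eq_by_vec[OF B(1) C(1)])
      fix y :: "complex vec" assume y: "y \<in> carrier_vec n"
      define x where "x = (B - C) *\<^sub>v y"
      have x: "x \<in> carrier_vec n" 
        unfolding x_def by (rule mult_mat_vec_carrier[OF minus_carrier_mat[OF C(1)] y])
      have "(B + C) * (B - C) = 0\<^sub>m n n"
      proof -
        have "(B + C) * (B - C) = (B * B + C * B) - (B * C + C * C)"
          using B(1) C(1) by (simp add: add_mult_distrib_mat[of _ n n] mult_minus_distrib_mat[of _ n n])
        also have "\<dots> = 0\<^sub>m n n"
          unfolding CC B(2) comm using B(1) C(1) T(1) by (intro eq_matI) (simp_all del: index_mult_mat(1))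
        finally show ?thesis .
      qed
      then have "(B + C) *\<^sub>v x = 0\<^sub>v n"
        using assoc_mult_mat_vec[OF add_carrier_mat[OF C(1), of B] minus_carrier_mat[OF C(1), of B] y]
        by (simp add: x_def zero_mat_mult_vec[OF y])
      then have "B *\<^sub>v x + C *\<^sub>v x = 0\<^sub>v n"
        using B(1) C(1) x by (simp add: add_mult_distrib_mat_vec[of _ n n])
      then have "(B *\<^sub>v x) \<bullet>c x + (C *\<^sub>v x) \<bullet>c x = 0\<^sub>v n \<bullet>c x"
        using B(1) C(1) x by (subst cscalar_prod_add_left[of _ n, symmetric]) auto
      then have "(B *\<^sub>v x) \<bullet>c x + complex_of_real (sqn (R *\<^sub>v x)) = 0"
        using x by (simp add: Cx)
      then have "sqn (R *\<^sub>v x) \<le> 0" using psd[OF x]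
        by (auto simp: less_eq_complex_def complex_eq_iff)
      then have "sqn (R *\<^sub>v x) = 0"
        using sqn_nonneg[of "R *\<^sub>v x"] by linarith
      then have "R *\<^sub>v x = 0\<^sub>v n"
        by (simp only: sqn_0_iff[OF mult_mat_vec_carrier[OF R(1) x]])
      then have "C *\<^sub>v x = 0\<^sub>v n"
        unfolding RR[symmetric] assoc_mult_mat_vec[OF R(1) R(1) x] using R(1)
        by (simp) (intro eq_vecI, auto)
      then have "x = 0\<^sub>v n" by (rule inj[OF x])
      then have "B *\<^sub>v y - C *\<^sub>v y = 0\<^sub>v n"
        unfolding x_def minus_mult_distrib_mat_vec[OF B(1) C(1) y] .
      then have "(B *\<^sub>v y - C *\<^sub>v y) $ i = 0" if "i < n" for i using that by simp
      then show "B *\<^sub>v y = C *\<^sub>v y"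
        using B(1) C(1) by (intro eq_vecI) (simp_all del: index_mult_mat_vec)
    qed
  qed
qed

section \<open>Linear fractional maps of the matrix ball\<close>

lemma vec_cancel:
  fixes a b p q :: "complex vec"
  assumes "a \<in> carrier_vec n" "b \<in> carrier_vec n" "p \<in> carrier_vec n" "q \<in> carrier_vec n"
  shows "(a - b) + b = a" "b + (a - b) = a" "(a - p) + q = a - (p - q)" "a - ((a - q) - (b - q)) = b"
  using assms by (auto intro!: eq_vecI)

text \<open>The defect operator \<open>(1 - c\<^sup>* c)\<^sup>1\<^sup>/\<^sup>2\<close> of a strict contraction \<open>c\<close>.\<close>

definition defect :: "complex mat \<Rightarrow> complex mat" where
  "defect c = binom_mat (1/2) (mat_adjoint c * c)"

lemma op_norm_adjoint_le:
  assumes "A \<in> carrier_mat m n"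
  shows "op_norm (mat_adjoint A) \<le> op_norm A"
proof (rule op_norm_leI[of _ n m])
  fix x :: "complex vec" assume x: "x \<in> carrier_vec m" "sqn x \<le> 1"
  have "sqn (mat_adjoint A *\<^sub>v x) \<le> (op_norm A)\<^sup>2 * sqn x"
    by (rule sqn_adjoint_mult_le[OF assms x(1)])
  also have "\<dots> \<le> (op_norm A)\<^sup>2 * 1" using x by (intro mult_left_mono) auto
  finally show "sqn (mat_adjoint A *\<^sub>v x) \<le> (op_norm A)\<^sup>2" by simp
qed (use assms in auto)

lemma op_norm_adjoint:
  assumes "A \<in> carrier_mat m n"
  shows "op_norm (mat_adjoint A) = op_norm A"
  using op_norm_adjoint_le[OF assms] op_norm_adjoint_le[OF mat_adjoint_carrier[OF assms]] by simp

lemma strict_contraction_square: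
  assumes c: "c \<in> carrier_mat m n" "op_norm c < 1"
  shows "mat_adjoint c * c \<in> carrier_mat n n" "op_norm (mat_adjoint c * c) < 1"
    "mat_adjoint (mat_adjoint c * c) = mat_adjoint c * c"
proof -
  have "op_norm (mat_adjoint c * c) \<le> op_norm (mat_adjoint c) * op_norm c"
    by (rule op_norm_mult_le[OF mat_adjoint_carrier[OF c(1)] c(1)])
  also have "\<dots> \<le> 1 * op_norm c"
    using c op_norm_adjoint[OF c(1)] op_norm_nonneg[OF c(1)] by (intro mult_right_mono) auto
  finally show "op_norm (mat_adjoint c * c) < 1" using c(2) by simp
  show "mat_adjoint c * c \<in> carrier_mat n n" using c(1) by (intro mult_carrier_mat) auto
  show "mat_adjoint (mat_adjoint c * c) = mat_adjoint c * c"
    by (simp add: mat_adjoint_mult[OF mat_adjoint_carrier[OF c(1)] c(1)])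
qed

lemma psd_sqrt_defect:
  assumes "c \<in> carrier_mat m n" "op_norm c < 1"
  shows "psd_sqrt (1\<^sub>m n - mat_adjoint c * c) = defect c"
  unfolding defect_def by (rule psd_sqrt_one_minus[OF strict_contraction_square[OF assms]])

lemma defect_carrier [simp]:
  "c \<in> carrier_mat m n \<Longrightarrow> defect c \<in> carrier_mat n n"
  unfolding defect_def by (intro binom_mat_carrier mult_carrier_mat) auto

lemma defect_adjoint:
  assumes "c \<in> carrier_mat m n" "op_norm c < 1"
  shows "mat_adjoint (defect c) = defect c"
  unfolding defect_def by (rule binom_mat_adjoint[OF strict_contraction_square[OF assms]])

lemma defect_square:
  assumes "c \<in> carrier_mat m n" "op_norm c < 1"
  shows "defect c * defect c = 1\<^sub>m n - mat_adjoint c * c"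
  using binom_mat_mult[OF strict_contraction_square(1,2)[OF assms], of "1/2" "1/2"]
    binom_mat_1[OF strict_contraction_square(1,2)[OF assms]]
  by (simp add: defect_def)

lemma defect_square_vec:
  assumes c: "c \<in> carrier_mat m n" "op_norm c < 1" and y: "y \<in> carrier_vec n"
  shows "defect c *\<^sub>v (defect c *\<^sub>v y) = y - mat_adjoint c *\<^sub>v (c *\<^sub>v y)"
proof -
  note D = defect_carrier[OF c(1)]
  note T = strict_contraction_square(1)[OF c]
  have "defect c *\<^sub>v (defect c *\<^sub>v y) = (1\<^sub>m n - mat_adjoint c * c) *\<^sub>v y"
    by (simp only: assoc_mult_mat_vec[OF D D y, symmetric] defect_square[OF c])
  also have "\<dots> = y - (mat_adjoint c * c) *\<^sub>v y"
    by (simp only: minus_mult_distrib_mat_vec[OF one_carrier_mat T y] one_mult_mat_vec[OF y])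
  also have "(mat_adjoint c * c) *\<^sub>v y = mat_adjoint c *\<^sub>v (c *\<^sub>v y)"
    by (rule assoc_mult_mat_vec[OF mat_adjoint_carrier[OF c(1)] c(1) y])
  finally show ?thesis .
qed

lemma defect_inj:
  assumes c: "c \<in> carrier_mat m n" "op_norm c < 1" and y: "y \<in> carrier_vec n"
    and 0: "defect c *\<^sub>v y = 0\<^sub>v n"
  shows "y = 0\<^sub>v n"
proof (rule one_minus_inj[OF strict_contraction_square(1,2)[OF c] y])
  note D = defect_carrier[OF c(1)]
  have "(1\<^sub>m n - mat_adjoint c * c) *\<^sub>v y = defect c *\<^sub>v (defect c *\<^sub>v y)"
    by (simp only: assoc_mult_mat_vec[OF D D y, symmetric] defect_square[OF c])
  then show "(1\<^sub>m n - mat_adjoint c * c) *\<^sub>v y = 0\<^sub>v n"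
    by (simp only: 0 mult_mat_zero_vec[OF D])
qed

lemma defect_cancel:
  assumes c: "c \<in> carrier_mat m n" "op_norm c < 1" and x: "x \<in> carrier_vec n" and y: "y \<in> carrier_vec n"
    and eq: "defect c *\<^sub>v x = defect c *\<^sub>v y"
  shows "x = y"
proof -
  have "defect c *\<^sub>v (x - y) = 0\<^sub>v n"
    using mult_minus_distrib_mat_vec[OF defect_carrier[OF c(1)] x y] eq
      minus_cancel_vec[OF mult_mat_vec_carrier[OF defect_carrier[OF c(1)] y]] by simp
  then have "x - y = 0\<^sub>v n" by (rule defect_inj[OF c minus_carrier_vec[OF x y]])
  then have "(x - y) $ i = 0" if "i < n" for i using that by simp
  then show ?thesis using x y by (intro eq_vecI) simp_all
qed

lemma defect_intertwine:
  assumes c: "c \<in> carrier_mat m n" "op_norm c < 1"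
  shows "defect (mat_adjoint c) * c = c * defect c"
proof -
  have c': "mat_adjoint c \<in> carrier_mat n m" "op_norm (mat_adjoint c) < 1"
    using c op_norm_adjoint[OF c(1)] by auto
  show ?thesis
    unfolding defect_def
    by (rule binom_mat_intertwine[OF strict_contraction_square(1,2)[OF c']
          strict_contraction_square(1,2)[OF c] c(1)])
      (use assoc_mult_mat[OF c(1) c'(1) c(1)] in simp)
qed

lemma defect_intertwine_vec:
  assumes c: "c \<in> carrier_mat m n" "op_norm c < 1" and y: "y \<in> carrier_vec n"
  shows "defect (mat_adjoint c) *\<^sub>v (c *\<^sub>v y) = c *\<^sub>v (defect c *\<^sub>v y)"
  using assoc_mult_mat_vec[OF defect_carrier[OF mat_adjoint_carrier[OF c(1)]] c(1) y]
    assoc_mult_mat_vec[OF c(1) defect_carrier[OF c(1)] y] defect_intertwine[OF c]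
  by simp

lemma op_norm_kron_1_lt:
  "v \<in> carrier_mat p q \<Longrightarrow> op_norm v < 1 \<Longrightarrow> op_norm (kron v (1\<^sub>m N)) < 1"
  using op_norm_kron_1_le[of v p q N] by linarith

lemma defect_kron:
  assumes v: "v \<in> carrier_mat p q" "op_norm v < 1"
  shows "defect (kron v (1\<^sub>m N)) = kron (defect v) (1\<^sub>m N)"
  unfolding defect_def kron_adjoint_1[OF v(1)] kron_1_mult[OF mat_adjoint_carrier[OF v(1)] v(1)]
  by (rule binom_mat_kron[OF strict_contraction_square(1,2)[OF v]])

text \<open>The Moebius transformation \<open>\<F>\<^sub>c\<close> of the ball of rectangular matrices.\<close>

definition mat_moebius :: "complex mat \<Rightarrow> complex mat \<Rightarrow> complex mat" where
  "mat_moebius c u = c - defect (mat_adjoint c) * u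
     * the (mat_inverse (1\<^sub>m (dim_col c) - mat_adjoint c * u)) * defect c"

lemma lin_frac_eq_mat_moebius:
  assumes v: "v \<in> carrier_mat d' d" "op_norm v < 1"
  shows "lin_frac d' d v N u = mat_moebius (kron v (1\<^sub>m N)) u"
proof -
  define c where "c = kron v (1\<^sub>m N)"
  have c: "c \<in> carrier_mat (d' * N) (d * N)" "op_norm c < 1"
    using v op_norm_kron_1_lt[OF v] by (auto simp: c_def)
  have c': "mat_adjoint c \<in> carrier_mat (d * N) (d' * N)" "op_norm (mat_adjoint c) < 1"
    using c op_norm_adjoint[OF c(1)] by auto
  have "dim_col c = d * N" using c by simp
  then show ?thesis
    using psd_sqrt_defect[OF c] psd_sqrt_defect[OF c']
    by (simp add: lin_frac_def mat_moebius_def Let_def flip: c_def)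
qed

lemma mat_moebius_inverse:
  assumes c: "c \<in> carrier_mat m n" "op_norm c < 1" and u: "u \<in> carrier_mat m n" "op_norm u \<le> 1"
  defines "K \<equiv> 1\<^sub>m n - mat_adjoint c * u"
  shows "K \<in> carrier_mat n n" "the (mat_inverse K) \<in> carrier_mat n n"
    "K * the (mat_inverse K) = 1\<^sub>m n" "the (mat_inverse K) * K = 1\<^sub>m n"
proof -
  have cu: "mat_adjoint c * u \<in> carrier_mat n n" using c u by (intro mult_carrier_mat) auto
  have "op_norm (mat_adjoint c * u) \<le> op_norm c * op_norm u"
    using op_norm_mult_le[OF mat_adjoint_carrier[OF c(1)] u(1)] op_norm_adjoint[OF c(1)] by simp
  also have "\<dots> \<le> op_norm c * 1" using u op_norm_nonneg[OF c(1)] by (intro mult_left_mono) auto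
  finally have lt: "op_norm (mat_adjoint c * u) < 1" using c(2) by simp
  show K: "K \<in> carrier_mat n n" unfolding K_def by (rule minus_carrier_mat[OF cu])
  show "the (mat_inverse K) \<in> carrier_mat n n"
    "K * the (mat_inverse K) = 1\<^sub>m n" "the (mat_inverse K) * K = 1\<^sub>m n"
    using mat_inverse_exists[OF K] one_minus_inj[OF cu lt] unfolding K_def by blast+
qed

lemma mat_moebius_carrier [simp]:
  assumes "c \<in> carrier_mat m n"
  shows "mat_moebius c u \<in> carrier_mat m n"
  unfolding mat_moebius_def carrier_mat_def using assms by (simp add: defect_def binom_mat_def)

text \<open>Writing \<open>\<F>\<^sub>c(u) y\<close> through the solution \<open>x\<close> of \<open>(1 - c\<^sup>* u) x = (1 - c\<^sup>* c)\<^sup>1\<^sup>/\<^sup>2 y\<close> turns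
  every identity about \<open>\<F>\<^sub>c\<close> into a linear one.\<close>

lemma mat_moebius_apply:
  assumes c: "c \<in> carrier_mat m n" "op_norm c < 1" and u: "u \<in> carrier_mat m n" "op_norm u \<le> 1"
    and y: "y \<in> carrier_vec n" and x: "x \<in> carrier_vec n"
    and eq: "x - mat_adjoint c *\<^sub>v (u *\<^sub>v x) = defect c *\<^sub>v y"
  shows "mat_moebius c u *\<^sub>v y = c *\<^sub>v y - defect (mat_adjoint c) *\<^sub>v (u *\<^sub>v x)"
proof -
  define K where "K = 1\<^sub>m n - mat_adjoint c * u"
  define W where "W = the (mat_inverse K)"
  note KW = mat_moebius_inverse[OF c u, folded K_def, folded W_def]
  note D = defect_carrier[OF c(1)] and D' = defect_carrier[OF mat_adjoint_carrier[OF c(1)]]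
  have cu: "mat_adjoint c * u \<in> carrier_mat n n" using c u by (intro mult_carrier_mat) auto
  have Kx: "K *\<^sub>v x = defect c *\<^sub>v y"
    unfolding K_def minus_mult_distrib_mat_vec[OF one_carrier_mat cu x] one_mult_mat_vec[OF x]
      assoc_mult_mat_vec[OF mat_adjoint_carrier[OF c(1)] u(1) x] by (rule eq)
  have "W *\<^sub>v (defect c *\<^sub>v y) = (W * K) *\<^sub>v x"
    by (simp only: assoc_mult_mat_vec[OF KW(2) KW(1) x] Kx)
  also have "\<dots> = x" by (simp only: KW(4) one_mult_mat_vec[OF x])
  finally have Wx: "W *\<^sub>v (defect c *\<^sub>v y) = x" .
  have dim: "dim_col c = n" using c by simp
  have D'u: "defect (mat_adjoint c) * u \<in> carrier_mat m n" by (rule mult_carrier_mat[OF D' u(1)])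
  have D'uW: "defect (mat_adjoint c) * u * W \<in> carrier_mat m n" by (rule mult_carrier_mat[OF D'u KW(2)])
  have "mat_moebius c u *\<^sub>v y = c *\<^sub>v y - (defect (mat_adjoint c) * u * W * defect c) *\<^sub>v y"
    unfolding mat_moebius_def dim K_def[symmetric] W_def[symmetric]
    by (rule minus_mult_distrib_mat_vec[OF c(1) mult_carrier_mat[OF D'uW D] y])
  also have "(defect (mat_adjoint c) * u * W * defect c) *\<^sub>v y = defect (mat_adjoint c) *\<^sub>v (u *\<^sub>v x)"
    by (simp only: assoc_mult_mat_vec[OF D'uW D y] assoc_mult_mat_vec[OF D'u KW(2) mult_mat_vec_carrier[OF D y]]
        Wx assoc_mult_mat_vec[OF D' u(1) x])
  finally show ?thesis .
qed

text \<open>Since \<open>\<parallel>c\<^sup>* u\<parallel> < 1\<close>, the equation defining \<open>x\<close> can be solved for every right-hand side.\<close>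

lemma mat_moebius_solve:
  assumes c: "c \<in> carrier_mat m n" "op_norm c < 1" and u: "u \<in> carrier_mat m n" "op_norm u \<le> 1"
    and z: "z \<in> carrier_vec n"
  obtains x where "x \<in> carrier_vec n" "x - mat_adjoint c *\<^sub>v (u *\<^sub>v x) = z"
proof -
  define K where "K = 1\<^sub>m n - mat_adjoint c * u"
  define W where "W = the (mat_inverse K)"
  note KW = mat_moebius_inverse[OF c u, folded K_def, folded W_def]
  have cu: "mat_adjoint c * u \<in> carrier_mat n n" using c u by (intro mult_carrier_mat) auto
  define x where "x = W *\<^sub>v z"
  have x: "x \<in> carrier_vec n" unfolding x_def by (rule mult_mat_vec_carrier[OF KW(2) z])
  have "K *\<^sub>v x = z"
    unfolding x_def by (simp only: assoc_mult_mat_vec[OF KW(1,2) z, symmetric] KW(3) one_mult_mat_vec[OF z])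
  moreover have "K *\<^sub>v x = x - mat_adjoint c *\<^sub>v (u *\<^sub>v x)"
    unfolding K_def minus_mult_distrib_mat_vec[OF one_carrier_mat cu x] one_mult_mat_vec[OF x]
      assoc_mult_mat_vec[OF mat_adjoint_carrier[OF c(1)] u(1) x] ..
  ultimately show ?thesis using that[OF x] by simp
qed

text \<open>The Julia operator \<open>(y, s) \<mapsto> (c y - D' s, D y + c\<^sup>* s)\<close> is isometric, \<open>D\<close> and \<open>D'\<close> being the
  defect operators of \<open>c\<close> and \<open>c\<^sup>*\<close>.\<close>

lemma Julia_isometry:
  assumes c: "c \<in> carrier_mat m n" "op_norm c < 1" and y: "y \<in> carrier_vec n" and s: "s \<in> carrier_vec m"
  shows "sqn (c *\<^sub>v y - defect (mat_adjoint c) *\<^sub>v s) + sqn (defect c *\<^sub>v y + mat_adjoint c *\<^sub>v s)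
    = sqn y + sqn s"
proof -
  note c1 = mat_adjoint_carrier[OF c(1)]
  have c2: "op_norm (mat_adjoint c) < 1" using c op_norm_adjoint[OF c(1)] by simp
  note D = defect_carrier[OF c(1)] and D' = defect_carrier[OF c1]
  note cy = mult_mat_vec_carrier[OF c(1) y] and Dy = mult_mat_vec_carrier[OF D y]
  note cs = mult_mat_vec_carrier[OF c1 s] and D's = mult_mat_vec_carrier[OF D' s]
  have norm2: "sqn (a *\<^sub>v x) + sqn (defect a *\<^sub>v x) = sqn x"
    if a: "a \<in> carrier_mat k l" "op_norm a < 1" and x: "x \<in> carrier_vec l" for a k l x
  proof -
    note ax = mult_mat_vec_carrier[OF a(1) x] and Dx = mult_mat_vec_carrier[OF defect_carrier[OF a(1)] x]
    note aax = mult_mat_vec_carrier[OF mat_adjoint_carrier[OF a(1)] ax]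
    have "complex_of_real (sqn (a *\<^sub>v x)) = x \<bullet>c (mat_adjoint a *\<^sub>v (a *\<^sub>v x))"
      by (simp only: cscalar_prod_self[symmetric] cscalar_prod_adjoint[OF a(1) x ax])
    moreover have "complex_of_real (sqn (defect a *\<^sub>v x)) = x \<bullet>c (x - mat_adjoint a *\<^sub>v (a *\<^sub>v x))"
      by (simp only: cscalar_prod_self[symmetric] cscalar_prod_adjoint[OF defect_carrier[OF a(1)] x Dx]
          defect_adjoint[OF a] defect_square_vec[OF a x])
    moreover have "x \<bullet>c (mat_adjoint a *\<^sub>v (a *\<^sub>v x)) + x \<bullet>c (x - mat_adjoint a *\<^sub>v (a *\<^sub>v x)) = x \<bullet>c x"
      by (simp only: cscalar_prod_add_right[OF aax minus_carrier_vec[OF x aax] x, symmetric] vec_cancel(2)[OF x aax x x])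
    ultimately have "complex_of_real (sqn (a *\<^sub>v x) + sqn (defect a *\<^sub>v x)) = of_real (sqn x)"
      by (simp only: of_real_add cscalar_prod_self[symmetric])
    then show ?thesis by (simp only: of_real_eq_iff)
  qed
  have "(c *\<^sub>v y) \<bullet>c (defect (mat_adjoint c) *\<^sub>v s) = (defect (mat_adjoint c) *\<^sub>v (c *\<^sub>v y)) \<bullet>c s"
    by (simp only: cscalar_prod_adjoint[OF D' cy s] defect_adjoint[OF c1 c2])
  also have "\<dots> = (defect c *\<^sub>v y) \<bullet>c (mat_adjoint c *\<^sub>v s)"
    by (simp only: defect_intertwine_vec[OF c y] cscalar_prod_adjoint[OF c(1) Dy s])
  finally show ?thesis
    using norm2[OF c y] norm2[OF c1 c2 s] sqn_diff[OF cy D's] sqn_add[OF Dy cs] by simp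
qed

lemma mat_moebius_norm_identity:
  assumes c: "c \<in> carrier_mat m n" "op_norm c < 1" and u: "u \<in> carrier_mat m n" "op_norm u \<le> 1"
    and y: "y \<in> carrier_vec n" and x: "x \<in> carrier_vec n"
    and eq: "x - mat_adjoint c *\<^sub>v (u *\<^sub>v x) = defect c *\<^sub>v y"
  shows "sqn (mat_moebius c u *\<^sub>v y) + sqn x = sqn y + sqn (u *\<^sub>v x)"
proof -
  note ux = mult_mat_vec_carrier[OF u(1) x]
  have "defect c *\<^sub>v y + mat_adjoint c *\<^sub>v (u *\<^sub>v x) = x"
    unfolding eq[symmetric]
    by (rule vec_cancel(1)[OF x mult_mat_vec_carrier[OF mat_adjoint_carrier[OF c(1)] ux] x x])
  then show ?thesis
    using Julia_isometry[OF c y ux] by (simp add: mat_moebius_apply[OF c u y x eq])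
qed

lemma mat_moebius_contraction:
  assumes c: "c \<in> carrier_mat m n" "op_norm c < 1" and u: "u \<in> carrier_mat m n" "op_norm u \<le> 1"
  shows "op_norm (mat_moebius c u) \<le> 1"
proof (subst contraction_iff[OF mat_moebius_carrier[OF c(1)]], intro ballI)
  fix y :: "complex vec" assume y: "y \<in> carrier_vec n"
  obtain x where x: "x \<in> carrier_vec n" "x - mat_adjoint c *\<^sub>v (u *\<^sub>v x) = defect c *\<^sub>v y"
    using mat_moebius_solve[OF c u mult_mat_vec_carrier[OF defect_carrier[OF c(1)] y]] .
  show "sqn (mat_moebius c u *\<^sub>v y) \<le> sqn y"
    using mat_moebius_norm_identity[OF c u y x] contractionD[OF u x(1)] by linarith
qed

lemma mat_moebius_norm_1:
  assumes c: "c \<in> carrier_mat m n" "op_norm c < 1" and u: "u \<in> carrier_mat m n" "op_norm u = 1"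
  shows "op_norm (mat_moebius c u) = 1"
proof -
  have u1: "op_norm u \<le> 1" using u by simp
  note D = defect_carrier[OF c(1)]
  obtain x where x: "x \<in> carrier_vec n" "sqn x = 1" "sqn (u *\<^sub>v x) = 1"
    using op_norm_1_attained[OF u] .
  define z where "z = x - mat_adjoint c *\<^sub>v (u *\<^sub>v x)"
  have z: "z \<in> carrier_vec n"
    unfolding z_def using x u c by (intro minus_carrier_vec mult_mat_vec_carrier[of _ n m] mult_mat_vec_carrier[of _ m n]) auto
  define E where "E = the (mat_inverse (defect c))"
  note E = mat_inverse_exists[OF D defect_inj[OF c], folded E_def]
  define y where "y = E *\<^sub>v z"
  have y: "y \<in> carrier_vec n" unfolding y_def by (rule mult_mat_vec_carrier[OF E(1) z])
  have "defect c *\<^sub>v y = z"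
    unfolding y_def by (simp only: assoc_mult_mat_vec[OF D E(1) z, symmetric] E(2) one_mult_mat_vec[OF z])
  then have eq: "x - mat_adjoint c *\<^sub>v (u *\<^sub>v x) = defect c *\<^sub>v y" by (simp only: z_def)
  have e: "sqn (mat_moebius c u *\<^sub>v y) = sqn y"
    using mat_moebius_norm_identity[OF c u(1) u1 y x(1) eq] x by simp
  have "y \<noteq> 0\<^sub>v n"
  proof
    assume "y = 0\<^sub>v n"
    then have "x - mat_adjoint c *\<^sub>v (u *\<^sub>v x) = 0\<^sub>v n"
      using eq mult_mat_zero_vec[OF D] by simp
    then have "(1\<^sub>m n - mat_adjoint c * u) *\<^sub>v x = 0\<^sub>v n"
      using x(1) c u mult_carrier_mat[OF mat_adjoint_carrier[OF c(1)] u(1)]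
      by (simp only: minus_mult_distrib_mat_vec[OF one_carrier_mat] one_mult_mat_vec
          assoc_mult_mat_vec[OF mat_adjoint_carrier[OF c(1)] u(1)])
    then have "the (mat_inverse (1\<^sub>m n - mat_adjoint c * u)) *\<^sub>v ((1\<^sub>m n - mat_adjoint c * u) *\<^sub>v x) = 0\<^sub>v n"
      using mult_mat_zero_vec[OF mat_moebius_inverse(2)[OF c u(1) u1]] by simp
    then have "x = 0\<^sub>v n"
      using assoc_mult_mat_vec[OF mat_moebius_inverse(2,1)[OF c u(1) u1] x(1)]
        mat_moebius_inverse(4)[OF c u(1) u1] one_mult_mat_vec[OF x(1)] by simp
    then show False using x(2) by simp
  qed
  then have "1 \<le> op_norm (mat_moebius c u)"
    using e y by (intro op_norm_ge_1I[OF mat_moebius_carrier[OF c(1)]]) auto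
  then show ?thesis using mat_moebius_contraction[OF c u(1) u1] by simp
qed

text \<open>Solving for the outer transformation first and rewriting the inner one by \<open>mat_moebius_apply\<close>
  reduces the claim to identities between \<open>c\<close> and its defect operators.\<close>

lemma mat_moebius_involution:
  assumes c: "c \<in> carrier_mat m n" "op_norm c < 1" and u: "u \<in> carrier_mat m n" "op_norm u \<le> 1"
  shows "mat_moebius c (mat_moebius c u) = u"
proof (rule mat_eq_by_vec[OF mat_moebius_carrier[OF c(1)] u(1)])
  fix y :: "complex vec" assume y: "y \<in> carrier_vec n"
  define F where "F = mat_moebius c u"
  note c1 = mat_adjoint_carrier[OF c(1)]
  note D = defect_carrier[OF c(1)] and D' = defect_carrier[OF c1]
  have c2: "op_norm (mat_adjoint c) < 1" using c op_norm_adjoint[OF c(1)] by simp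
  have F: "F \<in> carrier_mat m n" "op_norm F \<le> 1"
    unfolding F_def by (rule mat_moebius_carrier[OF c(1)], rule mat_moebius_contraction[OF c u])
  obtain w where w: "w \<in> carrier_vec n" "w - mat_adjoint c *\<^sub>v (F *\<^sub>v w) = defect c *\<^sub>v y"
    using mat_moebius_solve[OF c F mult_mat_vec_carrier[OF D y]] .
  obtain x where x: "x \<in> carrier_vec n" "x - mat_adjoint c *\<^sub>v (u *\<^sub>v x) = defect c *\<^sub>v w"
    using mat_moebius_solve[OF c u mult_mat_vec_carrier[OF D w(1)]] .
  note ux = mult_mat_vec_carrier[OF u(1) x(1)]
  note cw = mult_mat_vec_carrier[OF c(1) w(1)] and Dw = mult_mat_vec_carrier[OF D w(1)]
  note cux = mult_mat_vec_carrier[OF c1 ux] and D'ux = mult_mat_vec_carrier[OF D' ux]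
  have Fw: "F *\<^sub>v w = c *\<^sub>v w - defect (mat_adjoint c) *\<^sub>v (u *\<^sub>v x)"
    unfolding F_def by (rule mat_moebius_apply[OF c u w(1) x])
  have i1: "mat_adjoint c *\<^sub>v (F *\<^sub>v w)
      = mat_adjoint c *\<^sub>v (c *\<^sub>v w) - defect c *\<^sub>v (mat_adjoint c *\<^sub>v (u *\<^sub>v x))"
    using defect_intertwine_vec[OF c1 c2 ux]
    by (simp only: Fw mult_minus_distrib_mat_vec[OF c1 cw D'ux] mat_adjoint_adjoint)
  have "defect c *\<^sub>v y = defect c *\<^sub>v x"
  proof -
    have "defect c *\<^sub>v x = defect c *\<^sub>v (defect c *\<^sub>v w + mat_adjoint c *\<^sub>v (u *\<^sub>v x))"
      by (simp only: x(2)[symmetric] vec_cancel(1)[OF x(1) cux x(1) x(1)])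
    also have "\<dots> = (w - mat_adjoint c *\<^sub>v (c *\<^sub>v w)) + defect c *\<^sub>v (mat_adjoint c *\<^sub>v (u *\<^sub>v x))"
      by (simp only: mult_add_distrib_mat_vec[OF D Dw cux] defect_square_vec[OF c w(1)])
    also have "\<dots> = w - mat_adjoint c *\<^sub>v (F *\<^sub>v w)"
      unfolding i1
      by (rule vec_cancel(3)[OF w(1) w(1) mult_mat_vec_carrier[OF c1 cw] mult_mat_vec_carrier[OF D cux]])
    also have "\<dots> = defect c *\<^sub>v y" by (rule w(2))
    finally show ?thesis by (rule sym)
  qed
  then have yx: "y = x" by (rule defect_cancel[OF c y x(1)])
  have "mat_moebius c F *\<^sub>v y = c *\<^sub>v y - defect (mat_adjoint c) *\<^sub>v (F *\<^sub>v w)"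
    by (rule mat_moebius_apply[OF c F y w])
  also have "defect (mat_adjoint c) *\<^sub>v (F *\<^sub>v w)
      = c *\<^sub>v (defect c *\<^sub>v w) - (u *\<^sub>v x - c *\<^sub>v (mat_adjoint c *\<^sub>v (u *\<^sub>v x)))"
    using defect_square_vec[OF c1 c2 ux]
    by (simp only: Fw mult_minus_distrib_mat_vec[OF D' cw D'ux] mat_adjoint_adjoint defect_intertwine_vec[OF c w(1)])
  also have "c *\<^sub>v (defect c *\<^sub>v w) = c *\<^sub>v x - c *\<^sub>v (mat_adjoint c *\<^sub>v (u *\<^sub>v x))"
    by (simp only: x(2)[symmetric] mult_minus_distrib_mat_vec[OF c(1) x(1) cux])
  also have "c *\<^sub>v y - (c *\<^sub>v x - c *\<^sub>v (mat_adjoint c *\<^sub>v (u *\<^sub>v x))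
      - (u *\<^sub>v x - c *\<^sub>v (mat_adjoint c *\<^sub>v (u *\<^sub>v x)))) = u *\<^sub>v y"
    unfolding yx
    by (rule vec_cancel(4)[OF mult_mat_vec_carrier[OF c(1) x(1)] ux ux mult_mat_vec_carrier[OF c(1) cux]])
  finally show "mat_moebius c (mat_moebius c u) *\<^sub>v y = u *\<^sub>v y" by (simp only: F_def)
qed

lemma mat_moebius_self:
  assumes c: "c \<in> carrier_mat m n" "op_norm c < 1"
  shows "mat_moebius c c = 0\<^sub>m m n"
proof (rule mat_eq_by_vec[OF mat_moebius_carrier[OF c(1)] zero_carrier_mat])
  fix y :: "complex vec" assume y: "y \<in> carrier_vec n"
  have c1: "op_norm c \<le> 1" using c by simp
  note D = defect_carrier[OF c(1)]
  obtain x where x: "x \<in> carrier_vec n" "x - mat_adjoint c *\<^sub>v (c *\<^sub>v x) = defect c *\<^sub>v y"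
    using mat_moebius_solve[OF c c(1) c1 mult_mat_vec_carrier[OF D y]] .
  have "defect c *\<^sub>v (defect c *\<^sub>v x) = defect c *\<^sub>v y"
    by (simp only: defect_square_vec[OF c x(1)] x(2))
  then have yx: "defect c *\<^sub>v x = y" by (rule defect_cancel[OF c mult_mat_vec_carrier[OF D x(1)] y])
  have "mat_moebius c c *\<^sub>v y = c *\<^sub>v y - defect (mat_adjoint c) *\<^sub>v (c *\<^sub>v x)"
    by (rule mat_moebius_apply[OF c c(1) c1 y x])
  also have "\<dots> = c *\<^sub>v y - c *\<^sub>v y"
    by (simp only: defect_intertwine_vec[OF c x(1)] yx)
  also have "\<dots> = 0\<^sub>m m n *\<^sub>v y"
    by (simp only: zero_mat_mult_vec[OF y] minus_cancel_vec[OF mult_mat_vec_carrier[OF c(1) y]])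
  finally show "mat_moebius c c *\<^sub>v y = 0\<^sub>m m n *\<^sub>v y" .
qed

section \<open>Algebras of functions and rational expressions in matrices\<close>

text \<open>Analytic functions, continuous functions and functions with a limit are treated at once: a
  class \<open>P\<close> of complex functions on \<open>S\<close> that contains the constants and is closed under sums,
  squares (hence products, by polarization) and inverses.\<close>

locale function_algebra =
  fixes S :: "'z set" and P :: "('z \<Rightarrow> complex) \<Rightarrow> bool"
  assumes const: "P (\<lambda>_. c)"
    and add: "P f \<Longrightarrow> P h \<Longrightarrow> P (\<lambda>z. f z + h z)"
    and square: "P f \<Longrightarrow> P (\<lambda>z. (f z)\<^sup>2)"
    and scale: "P f \<Longrightarrow> P (\<lambda>z. c * f z)"
    and inverse: "P f \<Longrightarrow> (\<And>z. z \<in> S \<Longrightarrow> f z \<noteq> 0) \<Longrightarrow> P (\<lambda>z. inverse (f z))"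
    and cong: "P f \<Longrightarrow> (\<And>z. z \<in> S \<Longrightarrow> f z = h z) \<Longrightarrow> P h"
begin

lemma diff: "P f \<Longrightarrow> P h \<Longrightarrow> P (\<lambda>z. f z - h z)"
  using add[OF _ scale[of h "-1"], of f] by simp

lemma mult:
  assumes "P f" "P h"
  shows "P (\<lambda>z. f z * h z)"
proof -
  have "P (\<lambda>z. (1/4) * ((f z + h z)\<^sup>2 - (f z - h z)\<^sup>2))"
    by (intro scale diff square add assms)
  then show ?thesis
    by (rule cong) (simp add: power2_eq_square algebra_simps)
qed

lemma sum: "(\<And>i. i \<in> I \<Longrightarrow> P (f i)) \<Longrightarrow> P (\<lambda>z. \<Sum>i\<in>I. f i z)"
  by (induction I rule: infinite_finite_induct) (auto intro: const add)

lemma prod: "(\<And>i. i \<in> I \<Longrightarrow> P (f i)) \<Longrightarrow> P (\<lambda>z. \<Prod>i\<in>I. f i z)"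
  by (induction I rule: infinite_finite_induct) (auto intro: const mult)

text \<open>Matrix functions of format \<open>m \<times> n\<close> on \<open>S\<close> all of whose entries belong to the class.\<close>

definition mat_in :: "nat \<Rightarrow> nat \<Rightarrow> ('z \<Rightarrow> complex mat) \<Rightarrow> bool" where
  "mat_in m n A \<longleftrightarrow> (\<forall>z\<in>S. A z \<in> carrier_mat m n) \<and> (\<forall>i<m. \<forall>j<n. P (\<lambda>z. A z $$ (i, j)))"

lemma mat_in_const: "A \<in> carrier_mat m n \<Longrightarrow> mat_in m n (\<lambda>_. A)"
  by (simp add: mat_in_def const)

lemma mat_in_mult:
  assumes "mat_in m n A" "mat_in n k B"
  shows "mat_in m k (\<lambda>z. A z * B z)"
  unfolding mat_in_def
proof (intro conjI ballI allI impI)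
  fix i j assume ij: "i < m" "j < k"
  have "P (\<lambda>z. \<Sum>l<n. A z $$ (i, l) * B z $$ (l, j))"
    using assms ij by (intro sum mult) (auto simp: mat_in_def)
  then show "P (\<lambda>z. (A z * B z) $$ (i, j))"
    by (rule cong, subst mat_mult_index_sum[of _ m n _ k]) (use assms ij in \<open>auto simp: mat_in_def\<close>)
qed (use assms in \<open>auto simp: mat_in_def\<close>)

lemma mat_in_minus:
  assumes "mat_in m n A" "mat_in m n B"
  shows "mat_in m n (\<lambda>z. A z - B z)"
  unfolding mat_in_def
proof (intro conjI ballI allI impI)
  fix i j assume ij: "i < m" "j < n"
  have "P (\<lambda>z. A z $$ (i, j) - B z $$ (i, j))"
    using assms ij by (intro diff) (auto simp: mat_in_def)
  then show "P (\<lambda>z. (A z - B z) $$ (i, j))"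
    by (rule cong) (use assms ij in \<open>auto simp: mat_in_def\<close>)
qed (use assms in \<open>auto simp: mat_in_def intro!: minus_carrier_mat\<close>)

lemma det_in:
  assumes "mat_in n n A"
  shows "P (\<lambda>z. Determinant.det (A z))"
proof -
  have "P (\<lambda>z. \<Sum>p\<in>{p. p permutes {0..<n}}. signof p * (\<Prod>i = 0..<n. A z $$ (i, p i)))"
  proof (intro sum mult const prod)
    fix p i assume "p \<in> {p. p permutes {0..<n}}" "i \<in> {0..<n}"
    moreover from this have "p i < n" using permutes_in_image[of p "{0..<n}" i] by auto
    ultimately show "P (\<lambda>z. A z $$ (i, p i))" using assms by (auto simp: mat_in_def)
  qed
  then show ?thesis
    by (rule cong) (use assms in \<open>auto simp: mat_in_def det_def'[of _ n]\<close>)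
qed

lemma mat_in_adj:
  assumes "mat_in n n A"
  shows "mat_in n n (\<lambda>z. adj_mat (A z))"
  unfolding mat_in_def
proof (intro conjI ballI allI impI)
  fix i j assume ij: "i < n" "j < n"
  have "mat_in (n - 1) (n - 1) (\<lambda>z. mat_delete (A z) j i)"
    unfolding mat_in_def
  proof (intro conjI ballI allI impI)
    fix k l assume kl: "k < n - 1" "l < n - 1"
    have "P (\<lambda>z. A z $$ (insert_index j k, insert_index i l))"
      using assms kl by (auto simp: mat_in_def insert_index_def)
    then show "P (\<lambda>z. mat_delete (A z) j i $$ (k, l))"
      by (rule cong) (use assms kl in \<open>auto simp: mat_in_def mat_delete_def insert_index_def\<close>)
  qed (use assms in \<open>auto simp: mat_in_def mat_delete_def\<close>)
  then have "P (\<lambda>z. (-1) ^ (j + i) * Determinant.det (mat_delete (A z) j i))"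
    by (intro scale det_in)
  then show "P (\<lambda>z. adj_mat (A z) $$ (i, j))"
    by (rule cong) (use assms ij in \<open>auto simp: mat_in_def adj_mat_def cofactor_def\<close>)
qed (use assms in \<open>auto simp: mat_in_def adj_mat\<close>)

text \<open>Cramer's rule.\<close>

lemma mat_in_inverse:
  assumes A: "mat_in n n A"
    and W: "\<And>z. z \<in> S \<Longrightarrow> W z \<in> carrier_mat n n" "\<And>z. z \<in> S \<Longrightarrow> A z * W z = 1\<^sub>m n"
  shows "mat_in n n W"
  unfolding mat_in_def
proof (intro conjI ballI allI impI W(1))
  have Az: "A z \<in> carrier_mat n n" if "z \<in> S" for z using A that by (auto simp: mat_in_def)
  have det: "Determinant.det (A z) \<noteq> 0" if z: "z \<in> S" for z
    using det_mult[OF Az[OF z] W(1)[OF z]] W(2)[OF z] by auto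
  fix i j assume ij: "i < n" "j < n"
  have "P (\<lambda>z. inverse (Determinant.det (A z)) * adj_mat (A z) $$ (i, j))"
    using mat_in_adj[OF A] ij by (intro mult inverse det_in[OF A] det) (auto simp: mat_in_def)
  then show "P (\<lambda>z. W z $$ (i, j))"
  proof (rule cong)
    fix z assume z: "z \<in> S"
    note adj = adj_mat[OF Az[OF z]]
    have "adj_mat (A z) = adj_mat (A z) * (A z * W z)"
      using adj(1) by (simp only: W(2)[OF z] right_mult_one_mat)
    also have "\<dots> = (adj_mat (A z) * A z) * W z"
      by (rule assoc_mult_mat[OF adj(1) Az[OF z] W(1)[OF z], symmetric])
    also have "\<dots> = Determinant.det (A z) \<cdot>\<^sub>m W z"
      using W(1)[OF z] by (simp add: adj(3) mult_smult_assoc_mat[of _ n n])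
    finally have "adj_mat (A z) $$ (i, j) = Determinant.det (A z) * W z $$ (i, j)"
      using W(1)[OF z] ij by simp
    then show "inverse (Determinant.det (A z)) * adj_mat (A z) $$ (i, j) = W z $$ (i, j)"
      using det[OF z] by simp
  qed
qed

lemma mat_in_mat_moebius:
  assumes c: "c \<in> carrier_mat m n" "op_norm c < 1"
    and u: "mat_in m n u" "\<And>z. z \<in> S \<Longrightarrow> op_norm (u z) \<le> 1"
  shows "mat_in m n (\<lambda>z. mat_moebius c (u z))"
proof -
  have uz: "u z \<in> carrier_mat m n" if "z \<in> S" for z using u(1) that by (auto simp: mat_in_def)
  have dim: "dim_col c = n" using c by simp
  define K where "K z = 1\<^sub>m n - mat_adjoint c * u z" for z
  have K: "mat_in n n K"
    unfolding K_def using c by (intro mat_in_minus mat_in_mult[OF _ u(1)] mat_in_const) auto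
  have W: "mat_in n n (\<lambda>z. the (mat_inverse (K z)))"
    by (rule mat_in_inverse[OF K]) (use mat_moebius_inverse[OF c uz u(2)] in \<open>auto simp: K_def\<close>)
  show ?thesis
    unfolding mat_moebius_def dim K_def[symmetric] using c
    by (intro mat_in_minus mat_in_const
        mat_in_mult[OF mat_in_mult[OF mat_in_mult[OF mat_in_const u(1)] W] mat_in_const]
        defect_carrier[of "mat_adjoint c" n m] defect_carrier[of c m n]) auto
qed

end

lemma analytic_CK_lipschitz:
  assumes h: "analytic_CK K W h" and c: "c \<in> W"
  obtains C \<delta> where "C > 0" "\<delta> > 0"
    "\<And>z. z \<in> W \<Longrightarrow> L2_set (\<lambda>i. cmod (z i - c i)) {..<K} < \<delta> \<Longrightarrow>
       cmod (h z - h c) \<le> C * L2_set (\<lambda>i. cmod (z i - c i)) {..<K}"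
proof -
  define \<rho> where "\<rho> z = L2_set (\<lambda>i. cmod (z i - c i)) {..<K}" for z
  obtain l where l: "\<And>e. e > 0 \<Longrightarrow> \<exists>\<delta>>0. \<forall>z\<in>W. \<rho> z < \<delta> \<longrightarrow>
      cmod (h z - h c - (\<Sum>i<K. l i * (z i - c i))) \<le> e * \<rho> z"
    using h c unfolding analytic_CK_def \<rho>_def by blast
  obtain \<delta> where \<delta>: "\<delta> > 0" "\<And>z. z \<in> W \<Longrightarrow> \<rho> z < \<delta> \<Longrightarrow>
      cmod (h z - h c - (\<Sum>i<K. l i * (z i - c i))) \<le> 1 * \<rho> z"
    using l[of 1] by auto
  define C where "C = 1 + (\<Sum>i<K. cmod (l i))"
  have lin: "cmod (\<Sum>i<K. l i * (z i - c i)) \<le> (\<Sum>i<K. cmod (l i)) * \<rho> z" for z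
  proof -
    have "cmod (\<Sum>i<K. l i * (z i - c i)) \<le> (\<Sum>i<K. cmod (l i * (z i - c i)))"
      by (rule norm_sum)
    also have "\<dots> \<le> (\<Sum>i<K. cmod (l i) * \<rho> z)"
      unfolding norm_mult \<rho>_def by (intro sum_mono mult_left_mono member_le_L2_set) auto
    finally show ?thesis by (simp add: sum_distrib_right)
  qed
  have "C > 0" unfolding C_def by (simp add: add_pos_nonneg sum_nonneg)
  moreover have "cmod (h z - h c) \<le> C * \<rho> z" if z: "z \<in> W" "\<rho> z < \<delta>" for z
  proof -
    have "cmod (h z - h c) \<le> cmod (h z - h c - (\<Sum>i<K. l i * (z i - c i))) + cmod (\<Sum>i<K. l i * (z i - c i))"
      using norm_triangle_ineq[of "h z - h c - (\<Sum>i<K. l i * (z i - c i))" "\<Sum>i<K. l i * (z i - c i)"]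
      by (simp only: diff_add_cancel)
    also have "\<dots> \<le> 1 * \<rho> z + (\<Sum>i<K. cmod (l i)) * \<rho> z"
      using \<delta>(2)[OF z] lin[of z] by linarith
    finally show ?thesis by (simp add: C_def algebra_simps)
  qed
  ultimately show ?thesis using that[of C \<delta>] \<delta>(1) unfolding \<rho>_def by blast
qed

text \<open>The chain rule for an outer function of one variable.  Squares, inverses and multiples of analytic
  functions arise in this way.\<close>

lemma analytic_CK_compose:
  assumes h: "analytic_CK K W h"
    and \<phi>: "\<And>c. c \<in> W \<Longrightarrow> \<exists>D. (\<phi> has_field_derivative D) (at (h c))"
  shows "analytic_CK K W (\<lambda>z. \<phi> (h z))"
  unfolding analytic_CK_def
proof
  fix c assume c: "c \<in> W"
  define \<rho> where "\<rho> z = L2_set (\<lambda>i. cmod (z i - c i)) {..<K}" for z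
  have \<rho>0: "\<rho> z \<ge> 0" for z by (simp add: \<rho>_def L2_set_nonneg)
  obtain D where D: "(\<phi> has_field_derivative D) (at (h c))" using \<phi>[OF c] by blast
  obtain C \<delta>0 where C: "C > 0" "\<delta>0 > 0" "\<And>z. z \<in> W \<Longrightarrow> \<rho> z < \<delta>0 \<Longrightarrow> cmod (h z - h c) \<le> C * \<rho> z"
    using analytic_CK_lipschitz[OF h c] unfolding \<rho>_def by metis
  obtain l where l: "\<And>e. e > 0 \<Longrightarrow> \<exists>\<delta>>0. \<forall>z\<in>W. \<rho> z < \<delta> \<longrightarrow>
      cmod (h z - h c - (\<Sum>i<K. l i * (z i - c i))) \<le> e * \<rho> z"
    using h c unfolding analytic_CK_def \<rho>_def by blast
  have "\<exists>\<delta>>0. \<forall>z\<in>W. \<rho> z < \<delta> \<longrightarrow>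
      cmod (\<phi> (h z) - \<phi> (h c) - (\<Sum>i<K. (D * l i) * (z i - c i))) \<le> e * \<rho> z" if e: "e > 0" for e
  proof -
    define e1 where "e1 = e / (2 * C)"
    define e2 where "e2 = e / (2 * (cmod D + 1))"
    have pos: "e1 > 0" "e2 > 0" using e C by (auto simp: e1_def e2_def add_nonneg_pos)
    have De2: "cmod D * e2 \<le> e / 2"
    proof -
      define q where "q = cmod D + 1"
      have q: "q > 0" "cmod D \<le> q" using norm_ge_zero[of D] by (simp_all add: q_def add_nonneg_pos)
      have "cmod D * e2 \<le> q * e2" using pos q(2) by (intro mult_right_mono) auto
      also have "\<dots> = e / 2" using q(1) by (simp add: e2_def flip: q_def)
      finally show ?thesis .
    qed
    obtain d where d: "d > 0" "\<And>y. cmod (y - h c) < d \<Longrightarrow> cmod (\<phi> y - \<phi> (h c) - D * (y - h c)) \<le> e1 * cmod (y - h c)"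
      using D[unfolded has_field_derivative_def has_derivative_at_alt] pos(1) by blast
    obtain \<delta>1 where \<delta>1: "\<delta>1 > 0" "\<And>z. z \<in> W \<Longrightarrow> \<rho> z < \<delta>1 \<Longrightarrow>
        cmod (h z - h c - (\<Sum>i<K. l i * (z i - c i))) \<le> e2 * \<rho> z"
      using l[OF pos(2)] by blast
    define \<delta> where "\<delta> = min (min \<delta>0 \<delta>1) (d / C)"
    have "cmod (\<phi> (h z) - \<phi> (h c) - (\<Sum>i<K. (D * l i) * (z i - c i))) \<le> e * \<rho> z" if z: "z \<in> W" "\<rho> z < \<delta>" for z
    proof -
      have z': "\<rho> z < \<delta>0" "\<rho> z < \<delta>1" "\<rho> z < d / C" using z(2) by (auto simp: \<delta>_def)
      have lip: "cmod (h z - h c) \<le> C * \<rho> z" by (rule C(3)[OF z(1) z'(1)])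
      have "C * \<rho> z < d" using z'(3) C(1) by (simp add: field_simps)
      then have "cmod (h z - h c) < d" using lip by linarith
      then have 1: "cmod (\<phi> (h z) - \<phi> (h c) - D * (h z - h c)) \<le> e1 * (C * \<rho> z)"
        using order.trans[OF d(2) mult_left_mono[OF lip]] pos(1) by simp
      have 2: "cmod (D * (h z - h c - (\<Sum>i<K. l i * (z i - c i)))) \<le> cmod D * (e2 * \<rho> z)"
        unfolding norm_mult using \<delta>1(2)[OF z(1) z'(2)] by (intro mult_left_mono) auto
      have "\<phi> (h z) - \<phi> (h c) - (\<Sum>i<K. (D * l i) * (z i - c i))
          = (\<phi> (h z) - \<phi> (h c) - D * (h z - h c)) + D * (h z - h c - (\<Sum>i<K. l i * (z i - c i)))"
        by (simp add: algebra_simps sum_distrib_left)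
      then have "cmod (\<phi> (h z) - \<phi> (h c) - (\<Sum>i<K. (D * l i) * (z i - c i)))
          \<le> cmod (\<phi> (h z) - \<phi> (h c) - D * (h z - h c))
            + cmod (D * (h z - h c - (\<Sum>i<K. l i * (z i - c i))))"
        by (simp only: norm_triangle_ineq)
      also have "\<dots> \<le> e1 * (C * \<rho> z) + cmod D * (e2 * \<rho> z)"
        by (rule add_mono[OF 1 2])
      also have "\<dots> \<le> e / 2 * \<rho> z + e / 2 * \<rho> z"
        using mult_right_mono[OF De2 \<rho>0[of z]] C(1) by (simp add: e1_def)
      finally show ?thesis by simp
    qed
    moreover have "\<delta> > 0" using C d \<delta>1 by (simp add: \<delta>_def)
    ultimately show ?thesis by blast
  qed
  then show "\<exists>l. \<forall>e>0. \<exists>\<delta>>0. \<forall>z\<in>W. L2_set (\<lambda>i. cmod (z i - c i)) {..<K} < \<delta> \<longrightarrow>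
      cmod (\<phi> (h z) - \<phi> (h c) - (\<Sum>i<K. l i * (z i - c i))) \<le> e * L2_set (\<lambda>i. cmod (z i - c i)) {..<K}"
    unfolding \<rho>_def by (intro exI[of _ "\<lambda>i. D * l i"]) blast
qed

lemma analytic_CK_add:
  assumes "analytic_CK K W f" "analytic_CK K W h"
  shows "analytic_CK K W (\<lambda>z. f z + h z)"
  unfolding analytic_CK_def
proof
  fix c assume c: "c \<in> W"
  define \<rho> where "\<rho> z = L2_set (\<lambda>i. cmod (z i - c i)) {..<K}" for z
  obtain l where l: "\<And>e. e > 0 \<Longrightarrow> \<exists>\<delta>>0. \<forall>z\<in>W. \<rho> z < \<delta> \<longrightarrow>
      cmod (f z - f c - (\<Sum>i<K. l i * (z i - c i))) \<le> e * \<rho> z"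
    using assms(1) c unfolding analytic_CK_def \<rho>_def by blast
  obtain k where k: "\<And>e. e > 0 \<Longrightarrow> \<exists>\<delta>>0. \<forall>z\<in>W. \<rho> z < \<delta> \<longrightarrow>
      cmod (h z - h c - (\<Sum>i<K. k i * (z i - c i))) \<le> e * \<rho> z"
    using assms(2) c unfolding analytic_CK_def \<rho>_def by blast
  have "\<exists>\<delta>>0. \<forall>z\<in>W. \<rho> z < \<delta> \<longrightarrow>
      cmod ((f z + h z) - (f c + h c) - (\<Sum>i<K. (l i + k i) * (z i - c i))) \<le> e * \<rho> z" if e: "e > 0" for e
  proof -
    obtain \<delta>1 where \<delta>1: "\<delta>1 > 0" "\<And>z. z \<in> W \<Longrightarrow> \<rho> z < \<delta>1 \<Longrightarrow>
        cmod (f z - f c - (\<Sum>i<K. l i * (z i - c i))) \<le> e / 2 * \<rho> z"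
      using l[of "e / 2"] e by auto
    obtain \<delta>2 where \<delta>2: "\<delta>2 > 0" "\<And>z. z \<in> W \<Longrightarrow> \<rho> z < \<delta>2 \<Longrightarrow>
        cmod (h z - h c - (\<Sum>i<K. k i * (z i - c i))) \<le> e / 2 * \<rho> z"
      using k[of "e / 2"] e by auto
    have "cmod ((f z + h z) - (f c + h c) - (\<Sum>i<K. (l i + k i) * (z i - c i))) \<le> e * \<rho> z"
      if z: "z \<in> W" "\<rho> z < min \<delta>1 \<delta>2" for z
    proof -
      have "(f z + h z) - (f c + h c) - (\<Sum>i<K. (l i + k i) * (z i - c i))
          = (f z - f c - (\<Sum>i<K. l i * (z i - c i))) + (h z - h c - (\<Sum>i<K. k i * (z i - c i)))"
        by (simp only: distrib_right sum.distrib) simp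
      then have "cmod ((f z + h z) - (f c + h c) - (\<Sum>i<K. (l i + k i) * (z i - c i)))
          \<le> cmod (f z - f c - (\<Sum>i<K. l i * (z i - c i))) + cmod (h z - h c - (\<Sum>i<K. k i * (z i - c i)))"
        by (simp only: norm_triangle_ineq)
      also have "\<dots> \<le> e / 2 * \<rho> z + e / 2 * \<rho> z"
        using \<delta>1(2)[OF z(1)] \<delta>2(2)[OF z(1)] z(2) by (intro add_mono) auto
      finally show ?thesis by simp
    qed
    then show ?thesis using \<delta>1(1) \<delta>2(1) by (intro exI[of _ "min \<delta>1 \<delta>2"]) auto
  qed
  then show "\<exists>l. \<forall>e>0. \<exists>\<delta>>0. \<forall>z\<in>W. L2_set (\<lambda>i. cmod (z i - c i)) {..<K} < \<delta> \<longrightarrow>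
      cmod ((f z + h z) - (f c + h c) - (\<Sum>i<K. l i * (z i - c i))) \<le> e * L2_set (\<lambda>i. cmod (z i - c i)) {..<K}"
    unfolding \<rho>_def by (intro exI[of _ "\<lambda>i. l i + k i"]) blast
qed

lemma analytic_CK_const: "analytic_CK K W (\<lambda>_. c)"
  unfolding analytic_CK_def
  by (intro ballI exI[of _ "\<lambda>_. 0"] allI impI exI[of _ 1]) (auto simp: L2_set_nonneg)

lemma analytic_CK_cong:
  "analytic_CK K W f \<Longrightarrow> (\<And>z. z \<in> W \<Longrightarrow> f z = h z) \<Longrightarrow> analytic_CK K W h"
  by (simp add: analytic_CK_def)

lemma analytic_CK_function_algebra: "function_algebra W (analytic_CK K W)"
proof
  fix f assume f: "analytic_CK K W f"
  show "analytic_CK K W (\<lambda>z. (f z)\<^sup>2)"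
    by (rule analytic_CK_compose[OF f, where \<phi> = "\<lambda>w. w\<^sup>2"]) (auto intro!: exI derivative_eq_intros)
  show "analytic_CK K W (\<lambda>z. c * f z)" for c
    by (rule analytic_CK_compose[OF f, where \<phi> = "\<lambda>w. c * w"]) (auto intro!: exI derivative_eq_intros)
  show "analytic_CK K W (\<lambda>z. inverse (f z))" if "\<And>z. z \<in> W \<Longrightarrow> f z \<noteq> 0"
    by (rule analytic_CK_compose[OF f, where \<phi> = inverse]) (use that in \<open>auto intro!: exI derivative_eq_intros\<close>)
qed (auto intro: analytic_CK_const analytic_CK_add analytic_CK_cong)

lemma continuous_map_function_algebra:
  "function_algebra (topspace T) (\<lambda>h :: 'z \<Rightarrow> complex. continuous_map T euclidean h)"
proof
  have comp: "continuous_map T euclidean (\<lambda>z. \<phi> (f z))"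
    if "continuous_map T euclidean f" "continuous_on UNIV \<phi>" for f :: "'z \<Rightarrow> complex" and \<phi> :: "complex \<Rightarrow> complex"
    using continuous_map_compose[OF that(1), of euclidean \<phi>] that(2)
    by (simp add: comp_def)
  fix f :: "'z \<Rightarrow> complex" assume f: "continuous_map T euclidean f"
  show "continuous_map T euclidean (\<lambda>z. (f z)\<^sup>2)"
    by (rule comp[OF f]) (intro continuous_intros)
  show "continuous_map T euclidean (\<lambda>z. c * f z)" for c
    by (rule comp[OF f]) (intro continuous_intros)
  show "continuous_map T euclidean (\<lambda>z. inverse (f z))" if nz: "\<And>z. z \<in> topspace T \<Longrightarrow> f z \<noteq> 0"
  proof -
    have "continuous_map T (top_of_set (- {0})) f"
      using f nz by (auto simp: continuous_map_in_subtopology)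
    moreover have "continuous_map (top_of_set (- {0})) euclidean (inverse :: complex \<Rightarrow> complex)"
      by (auto intro!: continuous_intros)
    ultimately show ?thesis
      using continuous_map_compose[of T "top_of_set (- {0})" f euclidean inverse] by (simp only: comp_def)
  qed
  show "continuous_map T euclidean h" if "\<And>z. z \<in> topspace T \<Longrightarrow> f z = h z" for h
    using continuous_map_eq[OF f that] .
  show "continuous_map T euclidean (\<lambda>z. f z + h z)" if "continuous_map T euclidean h" for h
    using f that by (rule continuous_map_add)
qed auto

text \<open>Convergence along a filter, the limit being adjoined as the value at \<^const>\<open>None\<close>.\<close>

lemma tendsto_function_algebra:
  assumes R: "eventually (\<lambda>r. r \<in> R) F"
  shows "function_algebra (insert None (Some ` R)) (\<lambda>h :: 'r option \<Rightarrow> complex. ((\<lambda>r. h (Some r)) \<longlongrightarrow> h None) F)"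
proof
  fix f h :: "'r option \<Rightarrow> complex"
  assume f: "((\<lambda>r. f (Some r)) \<longlongrightarrow> f None) F" and eq: "\<And>z. z \<in> insert None (Some ` R) \<Longrightarrow> f z = h z"
  have "eventually (\<lambda>r. f (Some r) = h (Some r)) F"
    using R by eventually_elim (use eq in auto)
  then show "((\<lambda>r. h (Some r)) \<longlongrightarrow> h None) F"
    using f eq[of None] by (auto intro: Lim_transform_eventually)
qed (auto intro!: tendsto_intros)

section \<open>Homogeneous noncommutative polynomials\<close>

text \<open>Finite sums of matrices of a given format, computed entrywise.\<close>

definition msum :: "nat \<Rightarrow> nat \<Rightarrow> 'i set \<Rightarrow> ('i \<Rightarrow> complex mat) \<Rightarrow> complex mat" where
  "msum p q I A = mat p q (\<lambda>ij. \<Sum>k\<in>I. A k $$ ij)"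

lemma msum_carrier [simp]: "msum p q I A \<in> carrier_mat p q"
  by (simp add: msum_def)

lemma dim_msum [simp]: "dim_row (msum p q I A) = p" "dim_col (msum p q I A) = q"
  by (simp_all add: msum_def)

lemma msum_index [simp]: "i < p \<Longrightarrow> j < q \<Longrightarrow> msum p q I A $$ (i, j) = (\<Sum>k\<in>I. A k $$ (i, j))"
  by (simp add: msum_def)

lemma msum_cong: "I = J \<Longrightarrow> (\<And>k. k \<in> J \<Longrightarrow> A k = B k) \<Longrightarrow> msum p q I A = msum p q J B"
  by (simp add: msum_def cong: sum.cong)

lemma msum_reindex: "inj_on h I \<Longrightarrow> msum p q (h ` I) A = msum p q I (\<lambda>k. A (h k))"
  by (simp add: msum_def sum.reindex)

lemma msum_mult:
  assumes A: "\<And>k. k \<in> I \<Longrightarrow> A k \<in> carrier_mat p q" and B: "\<And>l. l \<in> J \<Longrightarrow> B l \<in> carrier_mat q r"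
  shows "msum p q I A * msum q r J B = msum p r (I \<times> J) (\<lambda>(k, l). A k * B l)"
proof (rule eq_matI)
  fix i j assume "i < dim_row (msum p r (I \<times> J) (\<lambda>(k, l). A k * B l))"
    "j < dim_col (msum p r (I \<times> J) (\<lambda>(k, l). A k * B l))"
  then have ij: "i < p" "j < r" by auto
  have "(msum p q I A * msum q r J B) $$ (i, j) = (\<Sum>x<q. (\<Sum>k\<in>I. A k $$ (i, x)) * (\<Sum>l\<in>J. B l $$ (x, j)))"
    using ij by (simp add: mat_mult_index_sum[of _ p q _ r] del: index_mult_mat(1))
  also have "\<dots> = (\<Sum>x<q. \<Sum>kl\<in>I \<times> J. A (fst kl) $$ (i, x) * B (snd kl) $$ (x, j))"
    by (simp add: sum_product sum.cartesian_product case_prod_beta)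
  also have "\<dots> = (\<Sum>kl\<in>I \<times> J. \<Sum>x<q. A (fst kl) $$ (i, x) * B (snd kl) $$ (x, j))"
    by (rule sum.swap)
  also have "\<dots> = (\<Sum>kl\<in>I \<times> J. (A (fst kl) * B (snd kl)) $$ (i, j))"
    using A B ij by (intro sum.cong refl) (simp add: mat_mult_index_sum[of _ p q _ r] mem_Times_iff del: index_mult_mat(1))
  finally show "(msum p q I A * msum q r J B) $$ (i, j) = msum p r (I \<times> J) (\<lambda>(k, l). A k * B l) $$ (i, j)"
    using ij by (simp add: case_prod_beta)
qed auto

lemma finite_nc_words [simp]: "finite (nc_words g' g \<alpha>)"
proof -
  have "finite {w. set w \<subseteq> {..<g'} \<times> {..<g} \<and> length w = \<alpha>}"
    by (rule finite_lists_length_eq) simp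
  then show ?thesis by (simp add: nc_words_def)
qed

lemma nc_words_0 [simp]: "nc_words g' g 0 = {[]}"
  by (auto simp: nc_words_def)

lemma nc_words_add:
  "nc_words g' g (\<alpha> + \<beta>) = (\<lambda>(u, w). u @ w) ` (nc_words g' g \<alpha> \<times> nc_words g' g \<beta>)"
proof (intro equalityI subsetI)
  fix w assume w: "w \<in> nc_words g' g (\<alpha> + \<beta>)"
  then have "w = take \<alpha> w @ drop \<alpha> w" "take \<alpha> w \<in> nc_words g' g \<alpha>" "drop \<alpha> w \<in> nc_words g' g \<beta>"
    by (auto simp: nc_words_def dest: in_set_takeD in_set_dropD)
  then show "w \<in> (\<lambda>(u, w). u @ w) ` (nc_words g' g \<alpha> \<times> nc_words g' g \<beta>)"
    by (intro image_eqI[of _ _ "(take \<alpha> w, drop \<alpha> w)"]) auto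
qed (auto simp: nc_words_def)

lemma inj_on_append_words: "inj_on (\<lambda>(u, w). u @ w) (nc_words g' g \<alpha> \<times> nc_words g' g \<beta>)"
  by (auto simp: inj_on_def nc_words_def)

lemma nc_block_carrier [simp]: "nc_block N X jl \<in> carrier_mat N N"
  by (simp add: nc_block_def)

lemma word_eval_carrier [simp]: "word_eval N w X \<in> carrier_mat N N"
proof (induction w)
  case (Cons jl w)
  then show ?case using mult_carrier_mat[OF nc_block_carrier] by (auto simp: word_eval_def)
qed (simp add: word_eval_def)

lemma dim_word_eval [simp]: "dim_row (word_eval N w X) = N" "dim_col (word_eval N w X) = N"
  by (rule carrier_matD[OF word_eval_carrier])+

lemma word_eval_Nil [simp]: "word_eval N [] X = 1\<^sub>m N"
  by (simp add: word_eval_def)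

lemma word_eval_Cons: "word_eval N (jl # w) X = nc_block N X jl * word_eval N w X"
  by (simp add: word_eval_def)

lemma word_eval_append: "word_eval N (u @ w) X = word_eval N u X * word_eval N w X"
proof (induction u)
  case Nil
  show ?case by (simp add: left_mult_one_mat[OF word_eval_carrier])
next
  case (Cons a u)
  show ?case unfolding append_Cons word_eval_Cons Cons.IH
    by (rule assoc_mult_mat[OF nc_block_carrier word_eval_carrier word_eval_carrier, symmetric])
qed

lemma smult_smult_mat: "a \<cdot>\<^sub>m (b \<cdot>\<^sub>m A) = (a * b :: complex) \<cdot>\<^sub>m A"
  by (intro eq_matI) auto

lemma word_eval_smult:
  assumes X: "X \<in> carrier_mat (g' * N) (g * N)" and w: "set w \<subseteq> {..<g'} \<times> {..<g}"
  shows "word_eval N w (z \<cdot>\<^sub>m X) = z ^ length w \<cdot>\<^sub>m word_eval N w X"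
  using w
proof (induction w)
  case Nil
  show ?case by (intro eq_matI) auto
next
  case (Cons jl w)
  have "fst jl < g'" "snd jl < g" using Cons.prems by auto
  then have b: "nc_block N (z \<cdot>\<^sub>m X) jl = z \<cdot>\<^sub>m nc_block N X jl"
    using X block_index_less[of "fst jl" g' _ N] block_index_less[of "snd jl" g _ N]
    by (intro eq_matI) (auto simp: nc_block_def)
  have "word_eval N (jl # w) (z \<cdot>\<^sub>m X) = (z \<cdot>\<^sub>m nc_block N X jl) * (z ^ length w \<cdot>\<^sub>m word_eval N w X)"
    using Cons by (simp add: word_eval_Cons b)
  also have "\<dots> = z ^ length (jl # w) \<cdot>\<^sub>m (nc_block N X jl * word_eval N w X)"
  proof -
    note A = nc_block_carrier[of N X jl] and B = word_eval_carrier[of N w X]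
    have "(z \<cdot>\<^sub>m nc_block N X jl) * (z ^ length w \<cdot>\<^sub>m word_eval N w X)
        = z \<cdot>\<^sub>m (z ^ length w \<cdot>\<^sub>m (nc_block N X jl * word_eval N w X))"
      by (simp only: mult_smult_assoc_mat[OF A smult_carrier_mat[OF B]] mult_smult_distrib[OF A B])
    then show ?thesis by (simp only: smult_smult_mat power_Suc length_Cons)
  qed
  finally show ?case by (simp add: word_eval_Cons)
qed

text \<open>The homogeneous part \<open>\<Sum>\<^bsub>|w| = \<alpha>\<^esub> a\<^sub>w \<otimes> w(X)\<close> of degree \<open>\<alpha>\<close>.\<close>

definition homog :: "nat \<Rightarrow> nat \<Rightarrow> nat \<Rightarrow> nat \<Rightarrow> (nc_word \<Rightarrow> complex mat) \<Rightarrow> nat \<Rightarrow> complex mat \<Rightarrow> nat \<Rightarrow> complex mat" where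
  "homog g' g p q a N X \<alpha> = msum (p * N) (q * N) (nc_words g' g \<alpha>) (\<lambda>w. kron (a w) (word_eval N w X))"

lemma homog_carrier [simp]: "homog g' g p q a N X \<alpha> \<in> carrier_mat (p * N) (q * N)"
  by (simp add: homog_def)

lemma dim_homog [simp]:
  "dim_row (homog g' g p q a N X \<alpha>) = p * N" "dim_col (homog g' g p q a N X \<alpha>) = q * N"
  by (simp_all add: homog_def)

lemma homog_index:
  assumes "\<And>w. a w \<in> carrier_mat p q" and i: "i < p" "x < N" "k < q" "y < N"
  shows "homog g' g p q a N X \<alpha> $$ (i * N + x, k * N + y)
    = (\<Sum>w\<in>nc_words g' g \<alpha>. a w $$ (i, k) * word_eval N w X $$ (x, y))"
  using assms block_index_less[OF i(1,2)] block_index_less[OF i(3,4)]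
  by (simp add: homog_def kron_index[of _ p q _ N N])

lemma homog_smult:
  assumes a: "\<And>w. a w \<in> carrier_mat p q" and X: "X \<in> carrier_mat (g' * N) (g * N)"
  shows "homog g' g p q a N (z \<cdot>\<^sub>m X) \<alpha> = z ^ \<alpha> \<cdot>\<^sub>m homog g' g p q a N X \<alpha>"
proof (rule block_eq_matI[of _ p N q N])
  fix i x k y assume i: "i < p" "x < N" "k < q" "y < N"
  have "homog g' g p q a N (z \<cdot>\<^sub>m X) \<alpha> $$ (i * N + x, k * N + y)
      = (\<Sum>w\<in>nc_words g' g \<alpha>. a w $$ (i, k) * (z ^ \<alpha> * word_eval N w X $$ (x, y)))"
    unfolding homog_index[OF a i]
  proof (intro sum.cong refl arg_cong2[where f = "(*)"])
    fix w assume "w \<in> nc_words g' g \<alpha>"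
    then show "word_eval N w (z \<cdot>\<^sub>m X) $$ (x, y) = z ^ \<alpha> * word_eval N w X $$ (x, y)"
      using i word_eval_carrier[of N w X] by (simp add: nc_words_def word_eval_smult[OF X])
  qed
  also have "\<dots> = (z ^ \<alpha> \<cdot>\<^sub>m homog g' g p q a N X \<alpha>) $$ (i * N + x, k * N + y)"
    using block_index_less[OF i(1,2)] block_index_less[OF i(3,4)]
    by (simp add: homog_index[OF a i] sum_distrib_left mult.left_commute)
  finally show "homog g' g p q a N (z \<cdot>\<^sub>m X) \<alpha> $$ (i * N + x, k * N + y)
    = (z ^ \<alpha> \<cdot>\<^sub>m homog g' g p q a N X \<alpha>) $$ (i * N + x, k * N + y)" .
qed (auto simp: carrier_matI)

lemma homog_0:
  assumes "\<And>w. a w \<in> carrier_mat p q"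
  shows "homog g' g p q a N X 0 = kron (a []) (1\<^sub>m N)"
  using assms[of "[]"] by (intro eq_matI) (auto simp: homog_def)

lemma homog_mult:
  assumes a: "\<And>w. a w \<in> carrier_mat p q" and b: "\<And>w. b w \<in> carrier_mat q r"
  shows "homog g' g p q a N X \<alpha> * homog g' g q r b N X \<beta>
    = homog g' g p r (\<lambda>w. a (take \<alpha> w) * b (drop \<alpha> w)) N X (\<alpha> + \<beta>)"
proof -
  have "homog g' g p q a N X \<alpha> * homog g' g q r b N X \<beta>
      = msum (p * N) (r * N) (nc_words g' g \<alpha> \<times> nc_words g' g \<beta>)
         (\<lambda>(u, w). kron (a u) (word_eval N u X) * kron (b w) (word_eval N w X))"
    unfolding homog_def using a b by (intro msum_mult kron_carrier) auto
  also have "\<dots> = msum (p * N) (r * N) (nc_words g' g \<alpha> \<times> nc_words g' g \<beta>)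
         (\<lambda>uw. (\<lambda>w. kron (a (take \<alpha> w) * b (drop \<alpha> w)) (word_eval N w X)) ((\<lambda>(u, w). u @ w) uw))"
    by (intro msum_cong refl)
       (auto simp: nc_words_def word_eval_append kron_mult[OF a b word_eval_carrier word_eval_carrier])
  also have "\<dots> = homog g' g p r (\<lambda>w. a (take \<alpha> w) * b (drop \<alpha> w)) N X (\<alpha> + \<beta>)"
    unfolding homog_def nc_words_add by (rule msum_reindex[OF inj_on_append_words, symmetric])
  finally show ?thesis .
qed

text \<open>A family of matrix functions, one for each size, given by a homogeneous polynomial.\<close>

definition nc_hom :: "nat \<Rightarrow> nat \<Rightarrow> nat \<Rightarrow> nat \<Rightarrow> nat \<Rightarrow> (nat \<Rightarrow> complex mat \<Rightarrow> complex mat) \<Rightarrow> bool" where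
  "nc_hom g' g p q \<alpha> H \<longleftrightarrow> (\<exists>c. (\<forall>w. c w \<in> carrier_mat p q) \<and>
     (\<forall>N\<ge>1. \<forall>X\<in>carrier_mat (g' * N) (g * N). H N X = homog g' g p q c N X \<alpha>))"

lemma nc_hom_cong:
  assumes "nc_hom g' g p q \<alpha> H"
    and eq: "\<And>N X. N \<ge> 1 \<Longrightarrow> X \<in> carrier_mat (g' * N) (g * N) \<Longrightarrow> H N X = H' N X"
  shows "nc_hom g' g p q \<alpha> H'"
proof -
  obtain c where c: "\<And>w. c w \<in> carrier_mat p q"
    "\<And>N X. N \<ge> 1 \<Longrightarrow> X \<in> carrier_mat (g' * N) (g * N) \<Longrightarrow> H N X = homog g' g p q c N X \<alpha>"
    using assms(1) unfolding nc_hom_def by blast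
  show ?thesis
    unfolding nc_hom_def
  proof (intro exI[of _ c] conjI allI impI ballI c(1))
    fix N and X :: "complex mat" assume N: "1 \<le> N" "X \<in> carrier_mat (g' * N) (g * N)"
    show "H' N X = homog g' g p q c N X \<alpha>" unfolding eq[OF N, symmetric] by (rule c(2)[OF N])
  qed
qed

lemma nc_hom_const:
  assumes "A \<in> carrier_mat p q"
  shows "nc_hom g' g p q 0 (\<lambda>N X. kron A (1\<^sub>m N))"
  unfolding nc_hom_def
proof (intro exI[of _ "\<lambda>_. A"] conjI allI impI ballI assms)
  fix N and X :: "complex mat"
  show "kron A (1\<^sub>m N) = homog g' g p q (\<lambda>_. A) N X 0"
    by (rule homog_0[OF assms, symmetric])
qed

lemma nc_hom_mult:
  assumes "nc_hom g' g p q \<alpha> A" "nc_hom g' g q r \<beta> B"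
  shows "nc_hom g' g p r (\<alpha> + \<beta>) (\<lambda>N X. A N X * B N X)"
proof -
  obtain a where a: "\<And>w. a w \<in> carrier_mat p q"
    "\<And>N X. N \<ge> 1 \<Longrightarrow> X \<in> carrier_mat (g' * N) (g * N) \<Longrightarrow> A N X = homog g' g p q a N X \<alpha>"
    using assms(1) unfolding nc_hom_def by blast
  obtain b where b: "\<And>w. b w \<in> carrier_mat q r"
    "\<And>N X. N \<ge> 1 \<Longrightarrow> X \<in> carrier_mat (g' * N) (g * N) \<Longrightarrow> B N X = homog g' g q r b N X \<beta>"
    using assms(2) unfolding nc_hom_def by blast
  show ?thesis
    unfolding nc_hom_def
    by (intro exI[of _ "\<lambda>w. a (take \<alpha> w) * b (drop \<alpha> w)"] conjI allI impI ballI mult_carrier_mat[OF a(1) b(1)])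
       (simp add: a(2) b(2) homog_mult[OF a(1) b(1)])
qed

lemma nc_hom_msum:
  assumes "\<And>k. k \<in> I \<Longrightarrow> nc_hom g' g p q \<alpha> (A k)"
  shows "nc_hom g' g p q \<alpha> (\<lambda>N X. msum (p * N) (q * N) I (\<lambda>k. A k N X))"
proof -
  have "\<forall>k\<in>I. \<exists>c. (\<forall>w. c w \<in> carrier_mat p q) \<and>
     (\<forall>N\<ge>1. \<forall>X\<in>carrier_mat (g' * N) (g * N). A k N X = homog g' g p q c N X \<alpha>)"
    using assms by (simp add: nc_hom_def)
  then obtain c where c: "\<And>k w. k \<in> I \<Longrightarrow> c k w \<in> carrier_mat p q"
    "\<And>k N X. k \<in> I \<Longrightarrow> N \<ge> 1 \<Longrightarrow> X \<in> carrier_mat (g' * N) (g * N) \<Longrightarrow> A k N X = homog g' g p q (c k) N X \<alpha>"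
    by metis
  have "msum (p * N) (q * N) I (\<lambda>k. A k N X) = homog g' g p q (\<lambda>w. msum p q I (\<lambda>k. c k w)) N X \<alpha>"
    if N: "N \<ge> 1" "X \<in> carrier_mat (g' * N) (g * N)" for N X
  proof (rule block_eq_matI[of _ p N q N])
    fix i x k y assume i: "i < p" "x < N" "k < q" "y < N"
    have "msum (p * N) (q * N) I (\<lambda>k. A k N X) $$ (i * N + x, k * N + y)
        = (\<Sum>l\<in>I. \<Sum>w\<in>nc_words g' g \<alpha>. c l w $$ (i, k) * word_eval N w X $$ (x, y))"
      using i block_index_less[OF i(1,2)] block_index_less[OF i(3,4)]
      by (simp add: c N homog_index)
    also have "\<dots> = (\<Sum>w\<in>nc_words g' g \<alpha>. \<Sum>l\<in>I. c l w $$ (i, k) * word_eval N w X $$ (x, y))"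
      by (rule sum.swap)
    also have "\<dots> = homog g' g p q (\<lambda>w. msum p q I (\<lambda>k. c k w)) N X \<alpha> $$ (i * N + x, k * N + y)"
      using i by (simp add: homog_index sum_distrib_right)
    finally show "msum (p * N) (q * N) I (\<lambda>k. A k N X) $$ (i * N + x, k * N + y)
      = homog g' g p q (\<lambda>w. msum p q I (\<lambda>k. c k w)) N X \<alpha> $$ (i * N + x, k * N + y)" .
  qed auto
  then show ?thesis
    unfolding nc_hom_def by (intro exI[of _ "\<lambda>w. msum p q I (\<lambda>k. c k w)"]) auto
qed

lemma nc_hom_add:
  assumes "nc_hom g' g p q \<alpha> A" "nc_hom g' g p q \<alpha> B"
  shows "nc_hom g' g p q \<alpha> (\<lambda>N X. A N X + B N X)"
proof -
  have 1: "nc_hom g' g p q \<alpha> (\<lambda>N X. msum (p * N) (q * N) {False, True} (\<lambda>k. (if k then A else B) N X))"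
    using assms by (intro nc_hom_msum) auto
  show ?thesis
  proof (rule nc_hom_cong[OF 1])
    fix N and X :: "complex mat" assume "N \<ge> 1" "X \<in> carrier_mat (g' * N) (g * N)"
    then have "A N X \<in> carrier_mat (p * N) (q * N)" "B N X \<in> carrier_mat (p * N) (q * N)"
      using assms by (auto simp: nc_hom_def)
    then show "msum (p * N) (q * N) {False, True} (\<lambda>k. (if k then A else B) N X) = A N X + B N X"
      by (intro eq_matI) auto
  qed
qed

lemma nc_hom_zero: "nc_hom g' g p q \<alpha> (\<lambda>N X. 0\<^sub>m (p * N) (q * N))"
proof -
  have 1: "nc_hom g' g p q \<alpha> (\<lambda>N X. msum (p * N) (q * N) ({} :: nat set) (\<lambda>k. 1\<^sub>m 1))"
    by (rule nc_hom_msum) auto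
  show ?thesis by (rule nc_hom_cong[OF 1]) (auto intro!: eq_matI)
qed

text \<open>Homogeneous parts of all degrees assemble into one family of coefficients.\<close>

lemma nc_hom_coefficients:
  assumes "\<And>\<alpha>. nc_hom g' g p q \<alpha> (\<lambda>N X. H N X \<alpha>)"
  obtains c where "\<And>w. c w \<in> carrier_mat p q"
    "\<And>N X \<alpha>. N \<ge> 1 \<Longrightarrow> X \<in> carrier_mat (g' * N) (g * N) \<Longrightarrow> H N X \<alpha> = homog g' g p q c N X \<alpha>"
proof -
  have "\<forall>\<alpha>. \<exists>c. (\<forall>w. c w \<in> carrier_mat p q) \<and>
     (\<forall>N\<ge>1. \<forall>X\<in>carrier_mat (g' * N) (g * N). H N X \<alpha> = homog g' g p q c N X \<alpha>)"
    using assms by (simp add: nc_hom_def)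
  then obtain c where c: "\<And>\<alpha> w. c \<alpha> w \<in> carrier_mat p q"
    "\<And>\<alpha> N X. N \<ge> 1 \<Longrightarrow> X \<in> carrier_mat (g' * N) (g * N) \<Longrightarrow> H N X \<alpha> = homog g' g p q (c \<alpha>) N X \<alpha>"
    by metis
  show ?thesis
  proof (rule that[of "\<lambda>w. c (length w) w"])
    fix N and X :: "complex mat" and \<alpha> assume "N \<ge> 1" "X \<in> carrier_mat (g' * N) (g * N)"
    then have "H N X \<alpha> = homog g' g p q (c \<alpha>) N X \<alpha>" by (rule c(2))
    also have "\<dots> = homog g' g p q (\<lambda>w. c (length w) w) N X \<alpha>"
      unfolding homog_def by (intro msum_cong refl) (auto simp: nc_words_def)
    finally show "H N X \<alpha> = homog g' g p q (\<lambda>w. c (length w) w) N X \<alpha>" .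
  qed (rule c(1))
qed

section \<open>Slices and Taylor expansions\<close>

text \<open>The part of NC analyticity that does not mention power series.\<close>

definition nc_holo :: "nat \<Rightarrow> nat \<Rightarrow> nat \<Rightarrow> nat \<Rightarrow> nc_map \<Rightarrow> bool" where
  "nc_holo g' g d' d f \<longleftrightarrow>
     (\<forall>N\<ge>1. \<forall>X\<in>nc_int_ball g' g N. f N X \<in> carrier_mat (d' * N) (d * N)) \<and>
     (\<forall>N\<ge>1. \<forall>K\<ge>1. \<forall>W a. domain_CK K W \<and> a ` W \<subseteq> nc_int_ball g' g N
          \<and> mat_analytic_CK K W (g' * N) (g * N) a \<longrightarrow>
        mat_analytic_CK K W (d' * N) (d * N) (f N \<circ> a) \<and>
        (a ` (CK K closure_of W) \<subseteq> nc_int_ball g' g N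
           \<and> mat_continuous_CK K (CK K closure_of W) (g' * N) (g * N) a \<longrightarrow>
         mat_continuous_CK K (CK K closure_of W) (d' * N) (d * N) (f N \<circ> a)))"

lemma nc_analytic_iff:
  "nc_analytic g' g d' d f \<longleftrightarrow> nc_holo g' g d' d f \<and> (\<exists>a \<epsilon>. nc_expansion g' g d' d f a \<epsilon>)"
  unfolding nc_analytic_def nc_holo_def by argo

lemma nc_holo_carrier:
  "nc_holo g' g d' d f \<Longrightarrow> N \<ge> 1 \<Longrightarrow> X \<in> nc_int_ball g' g N \<Longrightarrow> f N X \<in> carrier_mat (d' * N) (d * N)"
  by (simp add: nc_holo_def)

lemma smult_int_ball:
  assumes X: "X \<in> carrier_mat (g' * N) (g * N)" and R: "0 < R" "R * op_norm X \<le> 1" and z: "cmod z < R"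
  shows "z \<cdot>\<^sub>m X \<in> nc_int_ball g' g N"
proof -
  have "op_norm (z \<cdot>\<^sub>m X) \<le> cmod z * op_norm X" by (rule op_norm_smult_le[OF X])
  also have "\<dots> < 1"
  proof (cases "op_norm X = 0")
    case False
    then have "op_norm X > 0" using op_norm_nonneg[OF X] by simp
    then have "cmod z * op_norm X < R * op_norm X" using z by simp
    then show ?thesis using R(2) by simp
  qed simp
  finally show ?thesis using X by (simp add: nc_int_ball_def)
qed

lemma domain_CK_disc:
  assumes "R > 0"
  shows "domain_CK 1 (PiE {..<1} (\<lambda>_. ball 0 R))"
  unfolding domain_CK_def
proof (intro conjI)
  show "PiE {..<1 :: nat} (\<lambda>_. ball (0 :: complex) R) \<noteq> {}"
    using assms by (simp add: PiE_eq_empty_iff)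
  show "openin (CK 1) (PiE {..<1} (\<lambda>_. ball 0 R))"
    by (subst openin_PiE_gen) simp
  show "connectedin (CK 1) (PiE {..<1} (\<lambda>_. ball 0 R))"
    by (subst connectedin_PiE) simp
qed

text \<open>Along complex lines through the origin an NC analytic function is holomorphic.\<close>

lemma nc_slice_holomorphic:
  assumes f: "nc_holo g' g d' d f" and N: "N \<ge> 1" and X: "X \<in> carrier_mat (g' * N) (g * N)"
    and R: "0 < R" "R * op_norm X \<le> 1" and ij: "i < d' * N" "j < d * N"
  shows "(\<lambda>z. f N (z \<cdot>\<^sub>m X) $$ (i, j)) holomorphic_on ball 0 R"
proof -
  define W where "W = PiE {..<1 :: nat} (\<lambda>_. ball (0 :: complex) R)"
  define a where "a w = w 0 \<cdot>\<^sub>m X" for w :: "nat \<Rightarrow> complex"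
  have W0: "cmod (w 0) < R" if "w \<in> W" for w
    using that PiE_mem[of w "{..<1}" "\<lambda>_. ball 0 R" 0] by (simp add: W_def)
  have aW: "a ` W \<subseteq> nc_int_ball g' g N"
    unfolding a_def by (intro image_subsetI smult_int_ball[OF X R] W0)
  have an: "mat_analytic_CK 1 W (g' * N) (g * N) a"
    unfolding mat_analytic_CK_def analytic_CK_def
  proof (intro allI impI ballI)
    fix k l c assume "k < g' * N" "l < g * N" "c \<in> W"
    then show "\<exists>m. \<forall>e>0. \<exists>\<delta>>0. \<forall>z\<in>W. L2_set (\<lambda>i. cmod (z i - c i)) {..<1} < \<delta> \<longrightarrow>
        cmod (a z $$ (k, l) - a c $$ (k, l) - (\<Sum>i<1. m i * (z i - c i))) \<le> e * L2_set (\<lambda>i. cmod (z i - c i)) {..<1}"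
      using X by (intro exI[of _ "\<lambda>_. X $$ (k, l)"] allI impI exI[of _ 1])
        (auto simp: a_def algebra_simps L2_set_nonneg)
  qed
  have "domain_CK 1 W" unfolding W_def by (rule domain_CK_disc[OF R(1)])
  then have W: "domain_CK 1 W \<and> a ` W \<subseteq> nc_int_ball g' g N \<and> mat_analytic_CK 1 W (g' * N) (g * N) a"
    using aW an by blast
  have "mat_analytic_CK 1 W (d' * N) (d * N) (f N \<circ> a)"
    using f[unfolded nc_holo_def, THEN conjunct2, rule_format, OF N _ W] by simp
  then have fa: "analytic_CK 1 W (\<lambda>w. f N (a w) $$ (i, j))"
    using ij by (simp add: mat_analytic_CK_def)
  have L2: "L2_set g {..<Suc 0} = \<bar>g 0\<bar>" for g by (simp add: L2_set_def)
  define h where "h z = f N (z \<cdot>\<^sub>m X) $$ (i, j)" for z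
  have "h field_differentiable (at c)" if c: "c \<in> ball 0 R" for c
  proof -
    define e0 where "e0 z = (\<lambda>i\<in>{..<1 :: nat}. z :: complex)" for z
    have e0W: "e0 z \<in> W" if "z \<in> ball 0 R" for z using that by (auto simp: W_def e0_def)
    have e00: "e0 z 0 = z" for z by (simp add: e0_def)
    obtain l where l: "\<And>e. e > 0 \<Longrightarrow> \<exists>\<delta>>0. \<forall>z\<in>W. cmod (z 0 - c) < \<delta> \<longrightarrow>
        cmod (h (z 0) - h c - l 0 * (z 0 - c)) \<le> e * cmod (z 0 - c)"
      using fa e0W[OF c] unfolding analytic_CK_def by (force simp: L2 e00 a_def h_def)
    have "(h has_derivative (\<lambda>y. l 0 * y)) (at c)"
      unfolding has_derivative_at_alt
    proof (intro conjI allI impI)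
      fix e :: real assume e: "e > 0"
      obtain \<delta> where \<delta>: "\<delta> > 0" "\<And>z. z \<in> W \<Longrightarrow> cmod (z 0 - c) < \<delta> \<Longrightarrow>
          cmod (h (z 0) - h c - l 0 * (z 0 - c)) \<le> e * cmod (z 0 - c)"
        using l[OF e] by blast
      obtain \<delta>' where \<delta>': "\<delta>' > 0" "ball c \<delta>' \<subseteq> ball 0 R"
        using c open_ball open_contains_ball by blast
      show "\<exists>d>0. \<forall>y. cmod (y - c) < d \<longrightarrow> cmod (h y - h c - l 0 * (y - c)) \<le> e * cmod (y - c)"
      proof (intro exI[of _ "min \<delta> \<delta>'"] conjI allI impI)
        fix y assume y: "cmod (y - c) < min \<delta> \<delta>'"
        then have "y \<in> ball c \<delta>'" by (simp add: dist_norm norm_minus_commute)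
        then have "y \<in> ball 0 R" using \<delta>'(2) by blast
        from \<delta>(2)[OF e0W[OF this]] show "cmod (h y - h c - l 0 * (y - c)) \<le> e * cmod (y - c)"
          using y by (simp add: e00)
      qed (use \<delta>(1) \<delta>'(1) in auto)
    qed (rule bounded_linear_mult_right)
    then show ?thesis
      unfolding field_differentiable_def has_field_derivative_def by blast
  qed
  then show ?thesis unfolding h_def[symmetric]
    by (simp add: holomorphic_on_def field_differentiable_at_within)
qed

text \<open>The expansion of a matrix function of one variable at the origin.\<close>

definition mat_fps :: "nat \<Rightarrow> nat \<Rightarrow> (complex \<Rightarrow> complex mat) \<Rightarrow> (nat \<Rightarrow> complex mat) \<Rightarrow> bool" where
  "mat_fps p q h H \<longleftrightarrow> (\<forall>\<alpha>. H \<alpha> \<in> carrier_mat p q) \<and>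
     (\<forall>i<p. \<forall>j<q. (\<lambda>z. h z $$ (i, j)) has_fps_expansion Abs_fps (\<lambda>\<alpha>. H \<alpha> $$ (i, j)))"

lemma mat_fps_carrier: "mat_fps p q h H \<Longrightarrow> H \<alpha> \<in> carrier_mat p q"
  by (simp add: mat_fps_def)

lemma mat_fps_unique:
  assumes "mat_fps p q h H" "mat_fps p q h H'"
  shows "H \<alpha> = H' \<alpha>"
proof (rule eq_matI)
  fix i j assume "i < dim_row (H' \<alpha>)" "j < dim_col (H' \<alpha>)"
  then have ij: "i < p" "j < q" using mat_fps_carrier[OF assms(2), of \<alpha>] by auto
  have "Abs_fps (\<lambda>\<alpha>. H \<alpha> $$ (i, j)) = Abs_fps (\<lambda>\<alpha>. H' \<alpha> $$ (i, j))"
    using assms ij unfolding mat_fps_def by (intro fps_expansion_unique_complex) auto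
  from arg_cong[OF this, of "\<lambda>F. fps_nth F \<alpha>"] show "H \<alpha> $$ (i, j) = H' \<alpha> $$ (i, j)" by simp
qed (use mat_fps_carrier[OF assms(1), of \<alpha>] mat_fps_carrier[OF assms(2), of \<alpha>] in auto)

lemma mat_fps_cong:
  assumes h: "mat_fps p q h H" and r: "r > 0" and eq: "\<And>z. cmod z < r \<Longrightarrow> h z = h' z"
  shows "mat_fps p q h' H"
  unfolding mat_fps_def
proof (intro conjI allI impI mat_fps_carrier[OF h])
  fix i j assume ij: "i < p" "j < q"
  have ev: "eventually (\<lambda>z. h z $$ (i, j) = h' z $$ (i, j)) (nhds 0)"
    unfolding eventually_nhds_metric using r eq by (intro exI[of _ r]) (auto simp: dist_norm)
  show "(\<lambda>z. h' z $$ (i, j)) has_fps_expansion Abs_fps (\<lambda>\<alpha>. H \<alpha> $$ (i, j))"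
    by (rule has_fps_expansion_cong[OF ev refl, THEN iffD1]) (use h ij in \<open>simp add: mat_fps_def\<close>)
qed

lemma mat_fps_const:
  assumes "A \<in> carrier_mat p q"
  shows "mat_fps p q (\<lambda>_. A) (\<lambda>\<alpha>. if \<alpha> = 0 then A else 0\<^sub>m p q)"
  unfolding mat_fps_def
proof (intro conjI allI impI)
  fix i j assume ij: "i < p" "j < q"
  have "Abs_fps (\<lambda>\<alpha>. (if \<alpha> = 0 then A else 0\<^sub>m p q) $$ (i, j)) = fps_const (A $$ (i, j))"
    using ij by (intro fps_ext) simp
  then show "(\<lambda>_. A $$ (i, j)) has_fps_expansion Abs_fps (\<lambda>\<alpha>. (if \<alpha> = 0 then A else 0\<^sub>m p q) $$ (i, j))"
    by simp
qed (use assms in auto)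

lemma mat_fps_add:
  assumes "mat_fps p q A HA" "mat_fps p q B HB" and r: "r > 0"
    and carr: "\<And>z. cmod z < r \<Longrightarrow> A z \<in> carrier_mat p q" "\<And>z. cmod z < r \<Longrightarrow> B z \<in> carrier_mat p q"
  shows "mat_fps p q (\<lambda>z. A z + B z) (\<lambda>\<alpha>. HA \<alpha> + HB \<alpha>)"
  unfolding mat_fps_def
proof (intro conjI allI impI add_carrier_mat mat_fps_carrier[OF assms(2)])
  fix i j assume ij: "i < p" "j < q"
  have "(A z + B z) $$ (i, j) = A z $$ (i, j) + B z $$ (i, j)" if "cmod z < r" for z
    using carr(1)[OF that] carr(2)[OF that] ij by simp
  then have ev: "eventually (\<lambda>z. (A z + B z) $$ (i, j) = A z $$ (i, j) + B z $$ (i, j)) (nhds 0)"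
    unfolding eventually_nhds_metric using r by (intro exI[of _ r]) (simp add: dist_norm)
  have "(HA \<alpha> + HB \<alpha>) $$ (i, j) = HA \<alpha> $$ (i, j) + HB \<alpha> $$ (i, j)" for \<alpha>
    using ij mat_fps_carrier[OF assms(2), of \<alpha>] by simp
  then have F: "Abs_fps (\<lambda>\<alpha>. (HA \<alpha> + HB \<alpha>) $$ (i, j)) = Abs_fps (\<lambda>\<alpha>. HA \<alpha> $$ (i, j)) + Abs_fps (\<lambda>\<alpha>. HB \<alpha> $$ (i, j))"
    by (intro fps_ext) simp
  have "(\<lambda>z. A z $$ (i, j) + B z $$ (i, j)) has_fps_expansion Abs_fps (\<lambda>\<alpha>. HA \<alpha> $$ (i, j)) + Abs_fps (\<lambda>\<alpha>. HB \<alpha> $$ (i, j))"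
    using assms(1,2) ij by (intro has_fps_expansion_add) (auto simp: mat_fps_def)
  then show "(\<lambda>z. (A z + B z) $$ (i, j)) has_fps_expansion Abs_fps (\<lambda>\<alpha>. (HA \<alpha> + HB \<alpha>) $$ (i, j))"
    using has_fps_expansion_cong[OF ev refl] by (simp only: F)
qed

lemma mat_fps_mult:
  assumes "mat_fps p q A HA" "mat_fps q r B HB" and \<rho>: "\<rho> > 0"
    and carr: "\<And>z. cmod z < \<rho> \<Longrightarrow> A z \<in> carrier_mat p q" "\<And>z. cmod z < \<rho> \<Longrightarrow> B z \<in> carrier_mat q r"
  shows "mat_fps p r (\<lambda>z. A z * B z) (\<lambda>\<alpha>. msum p r {0..\<alpha>} (\<lambda>\<beta>. HA \<beta> * HB (\<alpha> - \<beta>)))"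
  unfolding mat_fps_def
proof (intro conjI allI impI msum_carrier)
  fix i j assume ij: "i < p" "j < r"
  have ev: "eventually (\<lambda>z. (A z * B z) $$ (i, j) = (\<Sum>l<q. A z $$ (i, l) * B z $$ (l, j))) (nhds 0)"
    unfolding eventually_nhds_metric
    using \<rho> mat_mult_index_sum[OF carr ij] by (intro exI[of _ \<rho>]) (auto simp: dist_norm)
  have "(HA \<beta> * HB (\<alpha> - \<beta>)) $$ (i, j) = (\<Sum>l<q. HA \<beta> $$ (i, l) * HB (\<alpha> - \<beta>) $$ (l, j))" for \<alpha> \<beta>
    by (rule mat_mult_index_sum[OF mat_fps_carrier[OF assms(1)] mat_fps_carrier[OF assms(2)] ij])
  then have F: "Abs_fps (\<lambda>\<alpha>. msum p r {0..\<alpha>} (\<lambda>\<beta>. HA \<beta> * HB (\<alpha> - \<beta>)) $$ (i, j))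
      = (\<Sum>l<q. Abs_fps (\<lambda>\<alpha>. HA \<alpha> $$ (i, l)) * Abs_fps (\<lambda>\<alpha>. HB \<alpha> $$ (l, j)))"
    using ij by (intro fps_ext) (simp add: fps_sum_nth fps_mult_nth sum.swap[of _ "{0.._}"])
  have "(\<lambda>z. \<Sum>l<q. A z $$ (i, l) * B z $$ (l, j)) has_fps_expansion
      (\<Sum>l<q. Abs_fps (\<lambda>\<alpha>. HA \<alpha> $$ (i, l)) * Abs_fps (\<lambda>\<alpha>. HB \<alpha> $$ (l, j)))"
    using assms(1,2) ij by (intro has_fps_expansion_sum has_fps_expansion_mult) (auto simp: mat_fps_def)
  then show "(\<lambda>z. (A z * B z) $$ (i, j)) has_fps_expansion Abs_fps (\<lambda>\<alpha>. msum p r {0..\<alpha>} (\<lambda>\<beta>. HA \<beta> * HB (\<alpha> - \<beta>)) $$ (i, j))"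
    using has_fps_expansion_cong[OF ev refl] by (simp only: F)
qed

lemma mat_fps_mult_left:
  assumes A: "A \<in> carrier_mat p q" and B: "mat_fps q r B HB" and \<rho>: "\<rho> > 0"
    and carr: "\<And>z. cmod z < \<rho> \<Longrightarrow> B z \<in> carrier_mat q r"
  shows "mat_fps p r (\<lambda>z. A * B z) (\<lambda>\<alpha>. A * HB \<alpha>)"
proof -
  have 1: "mat_fps p r (\<lambda>z. A * B z) (\<lambda>\<alpha>. msum p r {0..\<alpha>} (\<lambda>\<beta>. (if \<beta> = 0 then A else 0\<^sub>m p q) * HB (\<alpha> - \<beta>)))"
    by (rule mat_fps_mult[OF mat_fps_const[OF A] B \<rho> A carr])
  have "msum p r {0..\<alpha>} (\<lambda>\<beta>. (if \<beta> = 0 then A else 0\<^sub>m p q) * HB (\<alpha> - \<beta>)) = A * HB \<alpha>" for \<alpha>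
  proof (rule eq_matI)
    note c = mat_fps_carrier[OF B]
    fix i j assume "i < dim_row (A * HB \<alpha>)" "j < dim_col (A * HB \<alpha>)"
    then have ij: "i < p" "j < r" using A c[of \<alpha>] by auto
    have "((if \<beta> = 0 then A else 0\<^sub>m p q) * HB (\<alpha> - \<beta>)) $$ (i, j) = (if \<beta> = 0 then (A * HB \<alpha>) $$ (i, j) else 0)" for \<beta>
      using ij c[of "\<alpha> - \<beta>"] by (auto simp: left_mult_zero_mat[of _ q r])
    then show "msum p r {0..\<alpha>} (\<lambda>\<beta>. (if \<beta> = 0 then A else 0\<^sub>m p q) * HB (\<alpha> - \<beta>)) $$ (i, j) = (A * HB \<alpha>) $$ (i, j)"
      using ij by simp
  qed (use A mat_fps_carrier[OF B, of \<alpha>] in auto)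
  then show ?thesis using 1 by simp
qed

lemma mat_fps_mult_right:
  assumes A: "mat_fps p q A HA" and B: "B \<in> carrier_mat q r" and \<rho>: "\<rho> > 0"
    and carr: "\<And>z. cmod z < \<rho> \<Longrightarrow> A z \<in> carrier_mat p q"
  shows "mat_fps p r (\<lambda>z. A z * B) (\<lambda>\<alpha>. HA \<alpha> * B)"
proof -
  have 1: "mat_fps p r (\<lambda>z. A z * B) (\<lambda>\<alpha>. msum p r {0..\<alpha>} (\<lambda>\<beta>. HA \<beta> * (if \<alpha> - \<beta> = 0 then B else 0\<^sub>m q r)))"
    by (rule mat_fps_mult[OF A mat_fps_const[OF B] \<rho> carr B])
  have "msum p r {0..\<alpha>} (\<lambda>\<beta>. HA \<beta> * (if \<alpha> - \<beta> = 0 then B else 0\<^sub>m q r)) = HA \<alpha> * B" for \<alpha>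
  proof (rule eq_matI)
    note c = mat_fps_carrier[OF A]
    fix i j assume "i < dim_row (HA \<alpha> * B)" "j < dim_col (HA \<alpha> * B)"
    then have ij: "i < p" "j < r" using B c[of \<alpha>] by auto
    have "(HA \<beta> * (if \<alpha> - \<beta> = 0 then B else 0\<^sub>m q r)) $$ (i, j) = (if \<beta> = \<alpha> then (HA \<alpha> * B) $$ (i, j) else 0)"
      if "\<beta> \<in> {0..\<alpha>}" for \<beta>
      using ij c[of \<beta>] that by (auto simp: right_mult_zero_mat[of _ p q])
    then have "(\<Sum>\<beta>\<in>{0..\<alpha>}. (HA \<beta> * (if \<alpha> - \<beta> = 0 then B else 0\<^sub>m q r)) $$ (i, j))
        = (\<Sum>\<beta>\<in>{0..\<alpha>}. if \<beta> = \<alpha> then (HA \<alpha> * B) $$ (i, j) else 0)"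
      by (intro sum.cong refl)
    then show "msum p r {0..\<alpha>} (\<lambda>\<beta>. HA \<beta> * (if \<alpha> - \<beta> = 0 then B else 0\<^sub>m q r)) $$ (i, j) = (HA \<alpha> * B) $$ (i, j)"
      using ij by simp
  qed (use B mat_fps_carrier[OF A, of \<alpha>] in auto)
  then show ?thesis using 1 by simp
qed

text \<open>The Taylor coefficients of \<open>z \<mapsto> f(z X)\<close>.\<close>

definition nc_taylor :: "nat \<Rightarrow> nat \<Rightarrow> nc_map \<Rightarrow> nat \<Rightarrow> complex mat \<Rightarrow> nat \<Rightarrow> complex mat" where
  "nc_taylor p q f N X \<alpha> = mat (p * N) (q * N)
     (\<lambda>ij. fps_nth (fps_expansion (\<lambda>z. f N (z \<cdot>\<^sub>m X) $$ ij) 0) \<alpha>)"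

lemma exists_slice_radius:
  assumes "X \<in> carrier_mat (g' * N) (g * N)"
  obtains R where "0 < R" "R * op_norm X \<le> 1"
proof (rule that[of "1 / (1 + op_norm X)"])
  have n: "op_norm X \<ge> 0" using op_norm_nonneg[OF assms] .
  show "0 < 1 / (1 + op_norm X)" using n by simp
  show "1 / (1 + op_norm X) * op_norm X \<le> 1" using n by (simp add: field_simps)
qed

lemma nc_taylor_mat_fps:
  assumes f: "nc_holo g' g p q f" and N: "N \<ge> 1" and X: "X \<in> carrier_mat (g' * N) (g * N)"
  shows "mat_fps (p * N) (q * N) (\<lambda>z. f N (z \<cdot>\<^sub>m X)) (nc_taylor p q f N X)"
  unfolding mat_fps_def
proof (intro conjI allI impI)
  fix i j assume ij: "i < p * N" "j < q * N"
  obtain R where R: "0 < R" "R * op_norm X \<le> 1" by (rule exists_slice_radius[OF X])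
  have "(\<lambda>z. f N (z \<cdot>\<^sub>m X) $$ (i, j)) has_fps_expansion fps_expansion (\<lambda>z. f N (z \<cdot>\<^sub>m X) $$ (i, j)) 0"
    using R(1) by (intro has_fps_expansion_fps_expansion[OF open_ball _ nc_slice_holomorphic[OF f N X R ij]]) auto
  moreover have "Abs_fps (\<lambda>\<alpha>. nc_taylor p q f N X \<alpha> $$ (i, j)) = fps_expansion (\<lambda>z. f N (z \<cdot>\<^sub>m X) $$ (i, j)) 0"
    using ij by (intro fps_ext) (simp add: nc_taylor_def)
  ultimately show "(\<lambda>z. f N (z \<cdot>\<^sub>m X) $$ (i, j)) has_fps_expansion Abs_fps (\<lambda>\<alpha>. nc_taylor p q f N X \<alpha> $$ (i, j))"
    by simp
qed (simp add: nc_taylor_def)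

lemma nc_taylor_sums:
  assumes f: "nc_holo g' g p q f" and N: "N \<ge> 1" and X: "X \<in> carrier_mat (g' * N) (g * N)"
    and R: "0 < R" "R * op_norm X \<le> 1" and ij: "i < p * N" "j < q * N" and z: "cmod z < R"
  shows "(\<lambda>\<alpha>. nc_taylor p q f N X \<alpha> $$ (i, j) * z ^ \<alpha>) sums (f N (z \<cdot>\<^sub>m X) $$ (i, j))"
proof -
  have "(\<lambda>z. f N (z \<cdot>\<^sub>m X) $$ (i, j)) has_fps_expansion Abs_fps (\<lambda>\<alpha>. nc_taylor p q f N X \<alpha> $$ (i, j))"
    using nc_taylor_mat_fps[OF f N X] ij by (simp add: mat_fps_def)
  from has_fps_expansion_imp_sums_complex[OF this, of "ereal R" z] show ?thesis
    using nc_slice_holomorphic[OF f N X R ij] z by simp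
qed

lemma one_smult_mat [simp]: "(1 :: complex) \<cdot>\<^sub>m A = A"
  by (intro eq_matI) auto

lemma nc_taylor_sums_1:
  assumes f: "nc_holo g' g p q f" and N: "N \<ge> 1" and X: "X \<in> nc_int_ball g' g N"
    and ij: "i < p * N" "j < q * N"
  shows "(\<lambda>\<alpha>. nc_taylor p q f N X \<alpha> $$ (i, j)) sums (f N X $$ (i, j))"
proof -
  have X': "X \<in> carrier_mat (g' * N) (g * N)" "op_norm X < 1" using X by (auto simp: nc_int_ball_def)
  have n: "op_norm X \<ge> 0" using op_norm_nonneg[OF X'(1)] .
  have radius: "0 < 2 / (1 + t)" "2 / (1 + t) * t \<le> 1" "1 < 2 / (1 + t)" if "0 \<le> t" "t < 1" for t :: real
    using that by (auto simp: field_simps)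
  show ?thesis
    using nc_taylor_sums[OF f N X'(1) radius(1,2)[OF n X'(2)] ij, of 1] radius(3)[OF n X'(2)] by simp
qed

lemma op_norm_tendsto_0_iff:
  assumes "eventually (\<lambda>x. A x \<in> carrier_mat m n) F" and L: "L \<in> carrier_mat m n"
  shows "mat_tendsto A L F \<longleftrightarrow> (\<forall>i<m. \<forall>j<n. ((\<lambda>x. A x $$ (i, j)) \<longlongrightarrow> L $$ (i, j)) F)"
proof
  assume lim: "mat_tendsto A L F"
  show "\<forall>i<m. \<forall>j<n. ((\<lambda>x. A x $$ (i, j)) \<longlongrightarrow> L $$ (i, j)) F"
  proof (intro allI impI)
    fix i j assume ij: "i < m" "j < n"
    have "((\<lambda>x. A x $$ (i, j) - L $$ (i, j)) \<longlongrightarrow> 0) F"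
    proof (rule Lim_null_comparison[OF _ lim[unfolded mat_tendsto_def]])
      show "eventually (\<lambda>x. cmod (A x $$ (i, j) - L $$ (i, j)) \<le> op_norm (A x - L)) F"
        using assms(1)
      proof eventually_elim
        case (elim x)
        then show ?case
          using norm_entry_le_op_norm[OF minus_carrier_mat[OF L] ij, of "A x"] ij L by simp
      qed
    qed
    then show "((\<lambda>x. A x $$ (i, j)) \<longlongrightarrow> L $$ (i, j)) F" by (simp only: LIM_zero_iff)
  qed
next
  assume lim: "\<forall>i<m. \<forall>j<n. ((\<lambda>x. A x $$ (i, j)) \<longlongrightarrow> L $$ (i, j)) F"
  have "((\<lambda>x. \<Sum>i<m. \<Sum>j<n. cmod (A x $$ (i, j) - L $$ (i, j))) \<longlongrightarrow> (\<Sum>i<m. \<Sum>j<n. 0)) F"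
    using lim by (intro tendsto_sum tendsto_norm_zero) (simp add: LIM_zero)
  then have S: "((\<lambda>x. \<Sum>i<m. \<Sum>j<n. cmod (A x $$ (i, j) - L $$ (i, j))) \<longlongrightarrow> 0) F" by simp
  show "mat_tendsto A L F"
    unfolding mat_tendsto_def
  proof (rule Lim_null_comparison[OF _ S])
    show "eventually (\<lambda>x. norm (op_norm (A x - L)) \<le> (\<Sum>i<m. \<Sum>j<n. cmod (A x $$ (i, j) - L $$ (i, j)))) F"
      using assms(1)
    proof eventually_elim
      case (elim x)
      have "op_norm (A x - L) \<le> (\<Sum>i<m. \<Sum>j<n. cmod ((A x - L) $$ (i, j)))"
        by (rule op_norm_le_sum[OF minus_carrier_mat[OF L]])
      also have "\<dots> = (\<Sum>i<m. \<Sum>j<n. cmod (A x $$ (i, j) - L $$ (i, j)))"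
        using L by simp
      finally show ?case using op_norm_nonneg[OF minus_carrier_mat[OF L], of "A x"] by simp
    qed
  qed
qed

lemma nc_partial_sum_homog:
  "nc_partial_sum g' g p q a N X n = msum (p * N) (q * N) {..<n} (\<lambda>\<alpha>. homog g' g p q a N X \<alpha>)"
  unfolding nc_partial_sum_def msum_def homog_def
  by (intro eq_matI) auto

text \<open>An expansion near the origin determines all Taylor coefficients, hence converges on the whole
  open ball; conversely, homogeneous Taylor coefficients give an expansion.\<close>

lemma nc_expansion_taylor:
  assumes f: "nc_holo g' g p q f" and e: "nc_expansion g' g p q f a \<epsilon>" and N: "N \<ge> 1"
    and X: "X \<in> carrier_mat (g' * N) (g * N)"
  shows "nc_taylor p q f N X \<alpha> = homog g' g p q a N X \<alpha>"
proof (rule mat_fps_unique[OF nc_taylor_mat_fps[OF f N X]])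
  have a: "\<And>w. a w \<in> carrier_mat p q" and \<epsilon>: "\<epsilon> > 0" using e by (auto simp: nc_expansion_def)
  obtain R where R: "0 < R" "R * op_norm X \<le> 1" by (rule exists_slice_radius[OF X])
  have n: "op_norm X \<ge> 0" using op_norm_nonneg[OF X] .
  define \<rho> where "\<rho> = min R (\<epsilon> / (1 + op_norm X))"
  have \<rho>: "\<rho> > 0" using R \<epsilon> n by (simp add: \<rho>_def)
  show "mat_fps (p * N) (q * N) (\<lambda>z. f N (z \<cdot>\<^sub>m X)) (homog g' g p q a N X)"
    unfolding mat_fps_def
  proof (intro conjI allI impI homog_carrier)
    fix i j assume ij: "i < p * N" "j < q * N"
    have "(\<lambda>\<alpha>. homog g' g p q a N X \<alpha> $$ (i, j) * z ^ \<alpha>) sums (f N (z \<cdot>\<^sub>m X) $$ (i, j))"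
      if z: "cmod z < \<rho>" for z
    proof -
      have ball: "z \<cdot>\<^sub>m X \<in> nc_int_ball g' g N"
        using z by (intro smult_int_ball[OF X R]) (simp add: \<rho>_def)
      have "op_norm (z \<cdot>\<^sub>m X) \<le> cmod z * op_norm X" by (rule op_norm_smult_le[OF X])
      also have "\<dots> \<le> cmod z * (1 + op_norm X)" by (intro mult_left_mono) auto
      also have "\<dots> < \<epsilon>"
      proof -
        have "cmod z < \<epsilon> / (1 + op_norm X)" using z by (simp add: \<rho>_def)
        then show ?thesis using n by (simp add: pos_less_divide_eq)
      qed
      finally have "mat_tendsto (nc_partial_sum g' g p q a N (z \<cdot>\<^sub>m X)) (f N (z \<cdot>\<^sub>m X)) sequentially"
        using e N ball by (auto simp: nc_expansion_def)
      then have "(\<lambda>n. nc_partial_sum g' g p q a N (z \<cdot>\<^sub>m X) n $$ (i, j)) \<longlonglongrightarrow> f N (z \<cdot>\<^sub>m X) $$ (i, j)"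
        using op_norm_tendsto_0_iff[of "nc_partial_sum g' g p q a N (z \<cdot>\<^sub>m X)" "p * N" "q * N" sequentially]
          nc_holo_carrier[OF f N ball] ij by (simp add: nc_partial_sum_homog)
      moreover have "nc_partial_sum g' g p q a N (z \<cdot>\<^sub>m X) n $$ (i, j)
          = (\<Sum>\<alpha><n. homog g' g p q a N X \<alpha> $$ (i, j) * z ^ \<alpha>)" for n
        using ij by (simp add: nc_partial_sum_homog homog_smult[OF a X] mult.commute)
      ultimately show ?thesis by (simp add: sums_def)
    qed
    then show "(\<lambda>z. f N (z \<cdot>\<^sub>m X) $$ (i, j)) has_fps_expansion Abs_fps (\<lambda>\<alpha>. homog g' g p q a N X \<alpha> $$ (i, j))"
      unfolding eventually_nhds_metric using \<rho>
      by (intro has_fps_expansionI) (auto simp: eventually_nhds_metric dist_norm)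
  qed
qed

lemma nc_taylor_expansion:
  assumes f: "nc_holo g' g p q f" and a: "\<And>w. a w \<in> carrier_mat p q"
    and hom: "\<And>N X \<alpha>. N \<ge> 1 \<Longrightarrow> X \<in> carrier_mat (g' * N) (g * N) \<Longrightarrow>
      nc_taylor p q f N X \<alpha> = homog g' g p q a N X \<alpha>"
  shows "nc_expansion g' g p q f a 1"
  unfolding nc_expansion_def
proof (intro conjI allI impI ballI a)
  fix N and X :: "complex mat" assume N: "1 \<le> N" and X: "X \<in> nc_int_ball g' g N"
  have X': "X \<in> carrier_mat (g' * N) (g * N)" using X by (simp add: nc_int_ball_def)
  have "(\<lambda>n. nc_partial_sum g' g p q a N X n $$ (i, j)) \<longlonglongrightarrow> f N X $$ (i, j)"
    if ij: "i < p * N" "j < q * N" for i j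
    using nc_taylor_sums_1[OF f N X ij] ij
    by (simp add: nc_partial_sum_homog sums_def hom[OF N X'])
  then show "mat_tendsto (nc_partial_sum g' g p q a N X) (f N X) sequentially"
    using op_norm_tendsto_0_iff[of "nc_partial_sum g' g p q a N X" "p * N" "q * N" sequentially]
      nc_holo_carrier[OF f N X] by (simp add: nc_partial_sum_homog)
qed simp

text \<open>This splits NC analyticity into a part that is preserved by rational operations on the values and
  the condition that the Taylor coefficients along lines are homogeneous NC polynomials.  The latter
  can be checked degree by degree.\<close>

lemma nc_analytic_iff_taylor:
  "nc_analytic g' g p q f \<longleftrightarrow> nc_holo g' g p q f \<and> (\<forall>\<alpha>. nc_hom g' g p q \<alpha> (\<lambda>N X. nc_taylor p q f N X \<alpha>))"
proof
  assume "nc_analytic g' g p q f"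
  then obtain a \<epsilon> where f: "nc_holo g' g p q f" and e: "nc_expansion g' g p q f a \<epsilon>"
    by (auto simp: nc_analytic_iff)
  then have "\<And>w. a w \<in> carrier_mat p q" by (simp add: nc_expansion_def)
  then show "nc_holo g' g p q f \<and> (\<forall>\<alpha>. nc_hom g' g p q \<alpha> (\<lambda>N X. nc_taylor p q f N X \<alpha>))"
    using nc_expansion_taylor[OF f e] f unfolding nc_hom_def by blast
next
  assume *: "nc_holo g' g p q f \<and> (\<forall>\<alpha>. nc_hom g' g p q \<alpha> (\<lambda>N X. nc_taylor p q f N X \<alpha>))"
  then obtain c where "\<And>w. c w \<in> carrier_mat p q"
    "\<And>N X \<alpha>. N \<ge> 1 \<Longrightarrow> X \<in> carrier_mat (g' * N) (g * N) \<Longrightarrow> nc_taylor p q f N X \<alpha> = homog g' g p q c N X \<alpha>"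
    using nc_hom_coefficients[of g' g p q "\<lambda>N X \<alpha>. nc_taylor p q f N X \<alpha>"] by metis
  then have "nc_expansion g' g p q f c 1"
    by (intro nc_taylor_expansion[OF *[THEN conjunct1]])
  then show "nc_analytic g' g p q f" unfolding nc_analytic_iff using * by blast
qed

section \<open>Composition of NC analytic functions with linear fractional maps\<close>

lemma mat_cancel:
  fixes A B C :: "complex mat"
  assumes "A \<in> carrier_mat m n" "B \<in> carrier_mat m n" "C \<in> carrier_mat m n"
  shows "(A - B) + B = A" "(A + (C + B)) - B = A + C"
  using assms by (auto intro!: eq_matI)

lemma msum_insert:
  assumes "finite I" "k \<notin> I" "A k \<in> carrier_mat p q"
  shows "msum p q (insert k I) A = msum p q I A + A k"
  using assms by (intro eq_matI) (auto simp: add.commute)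

text \<open>If \<open>h(X)\<close> is a rational expression in \<open>f(X)\<close>, then \<open>h\<close> inherits analyticity and continuity: the
  assumption says that passing from \<open>f\<close> to \<open>h\<close> respects every algebra of functions.\<close>

lemma nc_holo_transform:
  assumes f: "nc_holo g' g p q f"
    and carr: "\<And>N X. N \<ge> 1 \<Longrightarrow> X \<in> nc_int_ball g' g N \<Longrightarrow> h N X \<in> carrier_mat (r * N) (s * N)"
    and T: "\<And>N S (P :: ((nat \<Rightarrow> complex) \<Rightarrow> complex) \<Rightarrow> bool) a. N \<ge> 1 \<Longrightarrow> function_algebra S P \<Longrightarrow>
      (\<And>z. z \<in> S \<Longrightarrow> a z \<in> nc_int_ball g' g N) \<Longrightarrow>
      function_algebra.mat_in S P (p * N) (q * N) (\<lambda>z. f N (a z)) \<Longrightarrow>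
      function_algebra.mat_in S P (r * N) (s * N) (\<lambda>z. h N (a z))"
  shows "nc_holo g' g r s h"
  unfolding nc_holo_def
proof (intro conjI allI impI ballI carr)
  fix N K :: nat and W :: "(nat \<Rightarrow> complex) set" and a :: "(nat \<Rightarrow> complex) \<Rightarrow> complex mat"
  assume N: "1 \<le> N" and K: "1 \<le> K"
    and a: "domain_CK K W \<and> a ` W \<subseteq> nc_int_ball g' g N \<and> mat_analytic_CK K W (g' * N) (g * N) a"
  note fa = f[unfolded nc_holo_def, THEN conjunct2, rule_format, OF N K a]
  have aW: "a z \<in> nc_int_ball g' g N" if "z \<in> W" for z using a that by blast
  have fW: "f N (a z) \<in> carrier_mat (p * N) (q * N)" if "z \<in> W" for z
    by (rule nc_holo_carrier[OF f N aW[OF that]])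
  interpret A: function_algebra W "analytic_CK K W" by (rule analytic_CK_function_algebra)
  have "A.mat_in (p * N) (q * N) (\<lambda>z. f N (a z))"
    using fa fW by (simp add: A.mat_in_def mat_analytic_CK_def)
  from T[OF N A.function_algebra_axioms aW this] show "mat_analytic_CK K W (r * N) (s * N) (h N \<circ> a)"
    by (simp add: A.mat_in_def mat_analytic_CK_def)
  assume c: "a ` (CK K closure_of W) \<subseteq> nc_int_ball g' g N
     \<and> mat_continuous_CK K (CK K closure_of W) (g' * N) (g * N) a"
  define C where "C = CK K closure_of W"
  define Z where "Z = subtopology (CK K) C"
  have C: "topspace Z = C"
    unfolding Z_def topspace_subtopology C_def using closure_of_subset_topspace[of "CK K" W] by auto
  have aC: "a z \<in> nc_int_ball g' g N" if "z \<in> topspace Z" for z using c that C by (auto simp: C_def)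
  have fC: "f N (a z) \<in> carrier_mat (p * N) (q * N)" if "z \<in> topspace Z" for z
    by (rule nc_holo_carrier[OF f N aC[OF that]])
  have "mat_continuous_CK K C (p * N) (q * N) (f N \<circ> a)"
    using fa c unfolding C_def by blast
  then have cont: "continuous_map Z euclidean (\<lambda>z. f N (a z) $$ (i, j))" if "i < p * N" "j < q * N" for i j
    using that by (simp add: mat_continuous_CK_def Z_def)
  interpret B: function_algebra "topspace Z" "\<lambda>h :: (nat \<Rightarrow> complex) \<Rightarrow> complex. continuous_map Z euclidean h"
    by (rule continuous_map_function_algebra)
  have "B.mat_in (p * N) (q * N) (\<lambda>z. f N (a z))"
    using cont fC by (simp add: B.mat_in_def)
  from T[OF N B.function_algebra_axioms aC this]
  have "continuous_map Z euclidean (\<lambda>z. h N (a z) $$ (i, j))" if "i < r * N" "j < s * N" for i j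
    using that by (simp add: B.mat_in_def)
  then show "mat_continuous_CK K (CK K closure_of W) (r * N) (s * N) (h N \<circ> a)"
    by (simp add: mat_continuous_CK_def Z_def C_def)
qed

lemma nc_analytic_kron_mult:
  assumes f: "nc_analytic g' g p q f" and A: "A \<in> carrier_mat r p" and B: "B \<in> carrier_mat q s"
  defines "h \<equiv> \<lambda>N X. kron A (1\<^sub>m N) * f N X * kron B (1\<^sub>m N)"
  shows "nc_analytic g' g r s h"
proof -
  have fh: "nc_holo g' g p q f" using f by (simp add: nc_analytic_iff_taylor)
  have AN: "kron A (1\<^sub>m N) \<in> carrier_mat (r * N) (p * N)" for N using A by simp
  have BN: "kron B (1\<^sub>m N) \<in> carrier_mat (q * N) (s * N)" for N using B by simp
  have h: "nc_holo g' g r s h"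
  proof (rule nc_holo_transform[OF fh])
    fix N and X :: "complex mat" assume "N \<ge> 1" "X \<in> nc_int_ball g' g N"
    then show "h N X \<in> carrier_mat (r * N) (s * N)"
      unfolding h_def by (intro mult_carrier_mat[OF mult_carrier_mat[OF AN nc_holo_carrier[OF fh]] BN])
  next
    fix N S and P :: "((nat \<Rightarrow> complex) \<Rightarrow> complex) \<Rightarrow> bool" and a
    assume "function_algebra S P" and f: "function_algebra.mat_in S P (p * N) (q * N) (\<lambda>z. f N (a z))"
    then interpret function_algebra S P by simp
    show "mat_in (r * N) (s * N) (\<lambda>z. h N (a z))"
      unfolding h_def by (intro mat_in_mult[OF mat_in_mult[OF mat_in_const[OF AN] f] mat_in_const[OF BN]])
  qed
  have "nc_hom g' g r s \<alpha> (\<lambda>N X. nc_taylor r s h N X \<alpha>)" for \<alpha>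
  proof -
    have F: "nc_hom g' g p q \<alpha> (\<lambda>N X. nc_taylor p q f N X \<alpha>)"
      using f by (simp add: nc_analytic_iff_taylor)
    have 1: "nc_hom g' g r s (0 + \<alpha> + 0) (\<lambda>N X. kron A (1\<^sub>m N) * nc_taylor p q f N X \<alpha> * kron B (1\<^sub>m N))"
      by (rule nc_hom_mult[OF nc_hom_mult[OF nc_hom_const[OF A] F] nc_hom_const[OF B]])
    show ?thesis
    proof (rule nc_hom_cong[OF 1[simplified]])
      fix N and X :: "complex mat" assume N: "N \<ge> 1" and X: "X \<in> carrier_mat (g' * N) (g * N)"
      obtain R where R: "0 < R" "R * op_norm X \<le> 1" by (rule exists_slice_radius[OF X])
      have carr: "f N (z \<cdot>\<^sub>m X) \<in> carrier_mat (p * N) (q * N)" if "cmod z < R" for z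
        by (rule nc_holo_carrier[OF fh N smult_int_ball[OF X R that]])
      have "mat_fps (r * N) (s * N) (\<lambda>z. h N (z \<cdot>\<^sub>m X))
          (\<lambda>\<alpha>. kron A (1\<^sub>m N) * nc_taylor p q f N X \<alpha> * kron B (1\<^sub>m N))"
        unfolding h_def
        by (rule mat_fps_mult_right[OF mat_fps_mult_left[OF AN nc_taylor_mat_fps[OF fh N X] R(1) carr] BN R(1)
              mult_carrier_mat[OF AN carr]])
      from mat_fps_unique[OF this nc_taylor_mat_fps[OF h N X]]
      show "kron A (1\<^sub>m N) * nc_taylor p q f N X \<alpha> * kron B (1\<^sub>m N) = nc_taylor r s h N X \<alpha>" .
    qed
  qed
  then show ?thesis using h by (simp add: nc_analytic_iff_taylor)
qed

lemma nc_taylor_0: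
  assumes "nc_analytic g' g p q f" and N: "N \<ge> 1" and X: "X \<in> carrier_mat (g' * N) (g * N)"
  shows "nc_taylor p q f N X 0 = kron (nc_at_zero g' g f) (1\<^sub>m N)"
proof -
  obtain a \<epsilon> where f: "nc_holo g' g p q f" and e: "nc_expansion g' g p q f a \<epsilon>"
    using assms(1) by (auto simp: nc_analytic_iff)
  then have "\<And>w. a w \<in> carrier_mat p q" by (simp add: nc_expansion_def)
  then show ?thesis
    using nc_expansion_taylor[OF f e N X, of 0] nc_at_zero_eq[OF assms(1) e] by (simp add: homog_0)
qed

lemma zero_mem_nc_int_ball: "0\<^sub>m (g' * N) (g * N) \<in> nc_int_ball g' g N"
  by (simp add: nc_int_ball_def op_norm_zero_mat)

lemma nc_at_zero_carrier:
  assumes "nc_analytic g' g p q f"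
  shows "nc_at_zero g' g f \<in> carrier_mat p q"
  using nc_holo_carrier[of g' g p q f 1 "0\<^sub>m g' g"] assms zero_mem_nc_int_ball[of g' 1 g]
  by (simp add: nc_analytic_iff nc_at_zero_def)

text \<open>The recursion behind the composition: \<open>\<omega> = f (1 - c\<^sup>* f)\<^sup>-\<^sup>1\<close> satisfies
  \<open>\<omega> = f + \<omega> c\<^sup>* f\<close>, and since \<open>f(0) = c\<close> has norm less than one, comparison of coefficients expresses
  each Taylor coefficient of \<open>\<omega>\<close> through the preceding ones.\<close>

lemma nc_analytic_right_quotient:
  assumes f: "nc_analytic g' g p q f" and v: "v = nc_at_zero g' g f" "op_norm v < 1"
    and contr: "\<And>N X. N \<ge> 1 \<Longrightarrow> X \<in> nc_int_ball g' g N \<Longrightarrow> op_norm (f N X) \<le> 1"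
  defines "h \<equiv> \<lambda>N X. f N X * the (mat_inverse (1\<^sub>m (q * N) - mat_adjoint (kron v (1\<^sub>m N)) * f N X))"
  shows "nc_analytic g' g p q h"
proof -
  have fh: "nc_holo g' g p q f" using f by (simp add: nc_analytic_iff_taylor)
  have vc: "v \<in> carrier_mat p q" unfolding v(1) by (rule nc_at_zero_carrier[OF f])
  define c where "c N = kron v (1\<^sub>m N)" for N
  have c: "c N \<in> carrier_mat (p * N) (q * N)" "op_norm (c N) < 1" for N
    using vc v(2) by (auto simp: c_def op_norm_kron_1_lt)
  have cs: "mat_adjoint (c N) \<in> carrier_mat (q * N) (p * N)" for N using c(1) by simp
  have cs_kron: "mat_adjoint (c N) = kron (mat_adjoint v) (1\<^sub>m N)" for N
    unfolding c_def by (rule kron_adjoint_1[OF vc])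
  define K where "K N X = 1\<^sub>m (q * N) - mat_adjoint (c N) * f N X" for N X
  have h_eq: "h N X = f N X * the (mat_inverse (K N X))" for N X
    by (simp add: h_def K_def c_def)
  have fc: "f N X \<in> carrier_mat (p * N) (q * N)" if "N \<ge> 1" "X \<in> nc_int_ball g' g N" for N X
    by (rule nc_holo_carrier[OF fh that])
  note inv = mat_moebius_inverse[OF c fc contr, folded K_def]
  have hc: "h N X \<in> carrier_mat (p * N) (q * N)" if "N \<ge> 1" "X \<in> nc_int_ball g' g N" for N X
    unfolding h_eq by (rule mult_carrier_mat[OF fc[OF that] inv(2)[OF that that]])
  have hh: "nc_holo g' g p q h"
  proof (rule nc_holo_transform[OF fh hc])
    fix N S and P :: "((nat \<Rightarrow> complex) \<Rightarrow> complex) \<Rightarrow> bool" and a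
    assume N: "N \<ge> 1" and "function_algebra S P" and a: "\<And>z. z \<in> S \<Longrightarrow> a z \<in> nc_int_ball g' g N"
      and f: "function_algebra.mat_in S P (p * N) (q * N) (\<lambda>z. f N (a z))"
    then interpret function_algebra S P by simp
    have K: "mat_in (q * N) (q * N) (\<lambda>z. K N (a z))"
      unfolding K_def by (intro mat_in_minus mat_in_mult[OF mat_in_const[OF cs] f] mat_in_const) simp
    have "mat_in (q * N) (q * N) (\<lambda>z. the (mat_inverse (K N (a z))))"
      by (rule mat_in_inverse[OF K]) (use inv(2,3)[OF N a N a] in blast)+
    then show "mat_in (p * N) (q * N) (\<lambda>z. h N (a z))"
      unfolding h_eq by (rule mat_in_mult[OF f])
  qed
  define E where "E = the (mat_inverse (1\<^sub>m q - mat_adjoint v * v))"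
  note E = mat_moebius_inverse[OF vc v(2) vc less_imp_le[OF v(2)], folded E_def]
  have VV: "mat_adjoint v * v \<in> carrier_mat q q" using vc by (intro mult_carrier_mat) auto
  define F where "F N X \<alpha> = nc_taylor p q f N X \<alpha>" for N X \<alpha>
  define H where "H N X \<alpha> = nc_taylor p q h N X \<alpha>" for N X \<alpha>
  have rec: "H N X \<alpha> = (F N X \<alpha> + msum (p * N) (q * N) {..<\<alpha>} (\<lambda>\<beta>. H N X \<beta> * (mat_adjoint (c N) * F N X (\<alpha> - \<beta>))))
      * kron E (1\<^sub>m N)" if N: "N \<ge> 1" and X: "X \<in> carrier_mat (g' * N) (g * N)" for N X \<alpha>
  proof -
    obtain R where R: "0 < R" "R * op_norm X \<le> 1" by (rule exists_slice_radius[OF X])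
    have ball: "z \<cdot>\<^sub>m X \<in> nc_int_ball g' g N" if "cmod z < R" for z
      by (rule smult_int_ball[OF X R that])
    note fcz = fc[OF N ball] and hcz = hc[OF N ball]
    note cfz = mult_carrier_mat[OF cs fcz]
    have eqz: "f N (z \<cdot>\<^sub>m X) + h N (z \<cdot>\<^sub>m X) * (mat_adjoint (c N) * f N (z \<cdot>\<^sub>m X)) = h N (z \<cdot>\<^sub>m X)" if z: "cmod z < R" for z
    proof -
      have "h N (z \<cdot>\<^sub>m X) * K N (z \<cdot>\<^sub>m X) = f N (z \<cdot>\<^sub>m X)"
        unfolding h_eq using assoc_mult_mat[OF fcz[OF z] inv(2,1)[OF N ball[OF z] N ball[OF z]]]
          inv(4)[OF N ball[OF z] N ball[OF z]] right_mult_one_mat[OF fcz[OF z]] by simp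
      then have "f N (z \<cdot>\<^sub>m X) = h N (z \<cdot>\<^sub>m X) - h N (z \<cdot>\<^sub>m X) * (mat_adjoint (c N) * f N (z \<cdot>\<^sub>m X))"
        unfolding K_def mult_minus_distrib_mat[OF hcz[OF z] one_carrier_mat cfz[OF z]] right_mult_one_mat[OF hcz[OF z]]
        by (rule sym)
      then have "f N (z \<cdot>\<^sub>m X) + h N (z \<cdot>\<^sub>m X) * (mat_adjoint (c N) * f N (z \<cdot>\<^sub>m X))
          = (h N (z \<cdot>\<^sub>m X) - h N (z \<cdot>\<^sub>m X) * (mat_adjoint (c N) * f N (z \<cdot>\<^sub>m X)))
            + h N (z \<cdot>\<^sub>m X) * (mat_adjoint (c N) * f N (z \<cdot>\<^sub>m X))"
        by (rule arg_cong2[OF _ refl])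
      also have "\<dots> = h N (z \<cdot>\<^sub>m X)"
        by (rule mat_cancel(1)[OF hcz[OF z] mult_carrier_mat[OF hcz[OF z] cfz[OF z]] hcz[OF z]])
      finally show ?thesis .
    qed
    have "mat_fps (p * N) (q * N) (\<lambda>z. f N (z \<cdot>\<^sub>m X) + h N (z \<cdot>\<^sub>m X) * (mat_adjoint (c N) * f N (z \<cdot>\<^sub>m X)))
        (\<lambda>\<alpha>. F N X \<alpha> + msum (p * N) (q * N) {0..\<alpha>} (\<lambda>\<beta>. H N X \<beta> * (mat_adjoint (c N) * F N X (\<alpha> - \<beta>))))"
      unfolding F_def H_def
      by (rule mat_fps_add[OF nc_taylor_mat_fps[OF fh N X]
            mat_fps_mult[OF nc_taylor_mat_fps[OF hh N X]
              mat_fps_mult_left[OF cs nc_taylor_mat_fps[OF fh N X] R(1) fcz] R(1) hcz cfz]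
            R(1) fcz mult_carrier_mat[OF hcz cfz]])
    from mat_fps_cong[OF this R(1) eqz]
    have "mat_fps (p * N) (q * N) (\<lambda>z. h N (z \<cdot>\<^sub>m X))
        (\<lambda>\<alpha>. F N X \<alpha> + msum (p * N) (q * N) {0..\<alpha>} (\<lambda>\<beta>. H N X \<beta> * (mat_adjoint (c N) * F N X (\<alpha> - \<beta>))))" .
    from mat_fps_unique[OF nc_taylor_mat_fps[OF hh N X] this, of \<alpha>]
    have 1: "H N X \<alpha> = F N X \<alpha> + msum (p * N) (q * N) {0..\<alpha>} (\<lambda>\<beta>. H N X \<beta> * (mat_adjoint (c N) * F N X (\<alpha> - \<beta>)))"
      by (simp add: H_def)
    have Hc: "H N X \<beta> \<in> carrier_mat (p * N) (q * N)" for \<beta>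
      unfolding H_def by (rule mat_fps_carrier[OF nc_taylor_mat_fps[OF hh N X]])
    have Fc: "F N X \<beta> \<in> carrier_mat (p * N) (q * N)" for \<beta>
      unfolding F_def by (rule mat_fps_carrier[OF nc_taylor_mat_fps[OF fh N X]])
    have F0: "F N X 0 = c N"
      using nc_taylor_0[OF f N X] by (simp add: F_def c_def v(1))
    define M where "M = msum (p * N) (q * N) {..<\<alpha>} (\<lambda>\<beta>. H N X \<beta> * (mat_adjoint (c N) * F N X (\<alpha> - \<beta>)))"
    have Mc: "M \<in> carrier_mat (p * N) (q * N)" by (simp add: M_def)
    have cc: "mat_adjoint (c N) * c N \<in> carrier_mat (q * N) (q * N)"
      by (rule mult_carrier_mat[OF cs c(1)])
    note Hcc = mult_carrier_mat[OF Hc cc]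
    have split: "{0..\<alpha>} = insert \<alpha> {..<\<alpha>}" by auto
    have "msum (p * N) (q * N) {0..\<alpha>} (\<lambda>\<beta>. H N X \<beta> * (mat_adjoint (c N) * F N X (\<alpha> - \<beta>)))
        = M + H N X \<alpha> * (mat_adjoint (c N) * c N)"
      using msum_insert[of "{..<\<alpha>}" \<alpha> "\<lambda>\<beta>. H N X \<beta> * (mat_adjoint (c N) * F N X (\<alpha> - \<beta>))" "p * N" "q * N"] Hcc[of \<alpha>]
      by (simp only: split M_def F0 finite_lessThan lessThan_iff less_irrefl not_False_eq_True diff_self_eq_0)
    with 1 have 2: "H N X \<alpha> = F N X \<alpha> + (M + H N X \<alpha> * (mat_adjoint (c N) * c N))" by simp
    have "H N X \<alpha> * (1\<^sub>m (q * N) - mat_adjoint (c N) * c N) = H N X \<alpha> - H N X \<alpha> * (mat_adjoint (c N) * c N)"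
      unfolding mult_minus_distrib_mat[OF Hc one_carrier_mat cc] right_mult_one_mat[OF Hc] ..
    also have "\<dots> = (F N X \<alpha> + (M + H N X \<alpha> * (mat_adjoint (c N) * c N))) - H N X \<alpha> * (mat_adjoint (c N) * c N)"
      by (rule arg_cong2[OF 2 refl])
    also have "\<dots> = F N X \<alpha> + M"
      by (rule mat_cancel(2)[OF Fc Hcc Mc])
    finally have 3: "H N X \<alpha> * (1\<^sub>m (q * N) - mat_adjoint (c N) * c N) = F N X \<alpha> + M" .
    have 4: "1\<^sub>m (q * N) - mat_adjoint (c N) * c N = kron (1\<^sub>m q - mat_adjoint v * v) (1\<^sub>m N)"
      unfolding cs_kron unfolding c_def kron_1_mult[OF mat_adjoint_carrier[OF vc] vc]
        kron_minus_left[OF one_carrier_mat VV] kron_one_one ..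
    have EN: "kron E (1\<^sub>m N) \<in> carrier_mat (q * N) (q * N)" using E(2) by simp
    have "H N X \<alpha> = H N X \<alpha> * ((1\<^sub>m (q * N) - mat_adjoint (c N) * c N) * kron E (1\<^sub>m N))"
      unfolding 4 kron_1_mult[OF E(1,2)] E(3) kron_one_one right_mult_one_mat[OF Hc] ..
    also have "\<dots> = (F N X \<alpha> + M) * kron E (1\<^sub>m N)"
      unfolding 3[symmetric] by (rule assoc_mult_mat[OF Hc minus_carrier_mat[OF cc] EN, symmetric])
    finally show ?thesis unfolding M_def .
  qed
  have "nc_hom g' g p q \<alpha> (\<lambda>N X. H N X \<alpha>)" for \<alpha>
  proof (induction \<alpha> rule: less_induct)
    case (less \<alpha>)
    have F: "nc_hom g' g p q \<beta> (\<lambda>N X. F N X \<beta>)" for \<beta>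
      using f by (simp add: nc_analytic_iff_taylor F_def)
    have cs': "nc_hom g' g q p 0 (\<lambda>N X. mat_adjoint (c N))"
      unfolding cs_kron by (rule nc_hom_const) (use vc in simp)
    have "nc_hom g' g p q \<alpha> (\<lambda>N X. H N X \<beta> * (mat_adjoint (c N) * F N X (\<alpha> - \<beta>)))" if "\<beta> \<in> {..<\<alpha>}" for \<beta>
      using nc_hom_mult[OF less.IH nc_hom_mult[OF cs' F], of \<beta> "\<alpha> - \<beta>"] that by simp
    then have 1: "nc_hom g' g p q (\<alpha> + 0) (\<lambda>N X. (F N X \<alpha>
        + msum (p * N) (q * N) {..<\<alpha>} (\<lambda>\<beta>. H N X \<beta> * (mat_adjoint (c N) * F N X (\<alpha> - \<beta>)))) * kron E (1\<^sub>m N))"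
      by (rule nc_hom_mult[OF nc_hom_add[OF F nc_hom_msum] nc_hom_const[OF E(2)]])
    show ?case by (rule nc_hom_cong[OF 1[simplified]]) (rule rec[symmetric])
  qed
  then show ?thesis using hh by (simp add: nc_analytic_iff_taylor H_def)
qed

lemma nc_analytic_const_minus:
  assumes f: "nc_analytic g' g p q f" and A: "A \<in> carrier_mat p q"
  shows "nc_analytic g' g p q (\<lambda>N X. kron A (1\<^sub>m N) - f N X)"
proof -
  define h where "h N X = kron A (1\<^sub>m N) - f N X" for N X
  have fh: "nc_holo g' g p q f" using f by (simp add: nc_analytic_iff_taylor)
  have AN: "kron A (1\<^sub>m N) \<in> carrier_mat (p * N) (q * N)" for N using A by simp
  have hh: "nc_holo g' g p q h"
  proof (rule nc_holo_transform[OF fh])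
    fix N and X :: "complex mat" assume "N \<ge> 1" "X \<in> nc_int_ball g' g N"
    then show "h N X \<in> carrier_mat (p * N) (q * N)"
      unfolding h_def by (intro minus_carrier_mat nc_holo_carrier[OF fh])
  next
    fix N S and P :: "((nat \<Rightarrow> complex) \<Rightarrow> complex) \<Rightarrow> bool" and a
    assume "function_algebra S P" and f: "function_algebra.mat_in S P (p * N) (q * N) (\<lambda>z. f N (a z))"
    then interpret function_algebra S P by simp
    show "mat_in (p * N) (q * N) (\<lambda>z. h N (a z))"
      unfolding h_def by (intro mat_in_minus[OF mat_in_const[OF AN] f])
  qed
  have "nc_hom g' g p q \<alpha> (\<lambda>N X. nc_taylor p q h N X \<alpha>)" for \<alpha>
  proof -
    define J where "J N = kron (0\<^sub>m p p - 1\<^sub>m p) (1\<^sub>m N)" for N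
    have Jc: "J N \<in> carrier_mat (p * N) (p * N)" for N unfolding J_def by (intro kron_carrier minus_carrier_mat) auto
    have JN: "J N * B = 0\<^sub>m (p * N) (q * N) - B" if B: "B \<in> carrier_mat (p * N) (q * N)" for B N
      unfolding J_def kron_minus_left[OF zero_carrier_mat one_carrier_mat] kron_zero_left kron_one_one
        minus_mult_distrib_mat[OF zero_carrier_mat one_carrier_mat B] left_mult_zero_mat[OF B] left_mult_one_mat[OF B] ..
    define C where "C N \<alpha> = (if \<alpha> = 0 then kron A (1\<^sub>m N) else 0\<^sub>m (p * N) (q * N))" for N and \<alpha> :: nat
    have Cc: "C N \<alpha> \<in> carrier_mat (p * N) (q * N)" for N using AN by (simp add: C_def)
    have F: "nc_hom g' g p q \<alpha> (\<lambda>N X. nc_taylor p q f N X \<alpha>)"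
      using f by (simp add: nc_analytic_iff_taylor)
    have C: "nc_hom g' g p q \<alpha> (\<lambda>N X. C N \<alpha>)"
    proof (cases "\<alpha> = 0")
      case True
      show ?thesis unfolding C_def True using nc_hom_const[OF A] by simp
    next
      case False
      then show ?thesis unfolding C_def using nc_hom_zero by simp
    qed
    have J: "nc_hom g' g p q (0 + \<alpha>) (\<lambda>N X. J N * nc_taylor p q f N X \<alpha>)"
      unfolding J_def by (rule nc_hom_mult[OF nc_hom_const[OF minus_carrier_mat[OF one_carrier_mat]] F])
    show ?thesis
    proof (rule nc_hom_cong[OF nc_hom_add[OF C J[simplified]]])
      fix N and X :: "complex mat" assume N: "N \<ge> 1" and X: "X \<in> carrier_mat (g' * N) (g * N)"
      obtain R where R: "0 < R" "R * op_norm X \<le> 1" by (rule exists_slice_radius[OF X])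
      have carr: "f N (z \<cdot>\<^sub>m X) \<in> carrier_mat (p * N) (q * N)" if "cmod z < R" for z
        by (rule nc_holo_carrier[OF fh N smult_int_ball[OF X R that]])
      have 1: "mat_fps (p * N) (q * N) (\<lambda>z. kron A (1\<^sub>m N) + J N * f N (z \<cdot>\<^sub>m X))
          (\<lambda>\<alpha>. C N \<alpha> + J N * nc_taylor p q f N X \<alpha>)"
        unfolding C_def
        by (rule mat_fps_add[OF mat_fps_const[OF AN] mat_fps_mult_left[OF Jc nc_taylor_mat_fps[OF fh N X] R(1) carr]
              R(1) AN mult_carrier_mat[OF Jc carr]])
      have "mat_fps (p * N) (q * N) (\<lambda>z. h N (z \<cdot>\<^sub>m X)) (\<lambda>\<alpha>. C N \<alpha> + J N * nc_taylor p q f N X \<alpha>)"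
      proof (rule mat_fps_cong[OF 1 R(1)])
        fix z assume z: "cmod z < R"
        show "kron A (1\<^sub>m N) + J N * f N (z \<cdot>\<^sub>m X) = h N (z \<cdot>\<^sub>m X)"
          unfolding JN[OF carr[OF z]] h_def using AN[of N] carr[OF z] by (intro eq_matI) simp_all
      qed
      from mat_fps_unique[OF this nc_taylor_mat_fps[OF hh N X]]
      show "C N \<alpha> + J N * nc_taylor p q f N X \<alpha> = nc_taylor p q h N X \<alpha>" .
    qed
  qed
  then have "nc_analytic g' g p q h" using hh by (simp add: nc_analytic_iff_taylor)
  then show ?thesis by (simp add: h_def[abs_def])
qed

text \<open>With \<open>\<omega> = f (1 - c\<^sup>* f)\<^sup>-\<^sup>1\<close>, \<open>\<F>\<^sub>c(f) = c - D' \<omega> D\<close> for the constant defect operators \<open>D\<close>, \<open>D'\<close> of \<open>c\<close> and \<open>c\<^sup>*\<close>.\<close>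

lemma nc_analytic_mat_moebius:
  assumes f: "nc_analytic g' g p q f" and v: "v = nc_at_zero g' g f" "op_norm v < 1"
    and contr: "\<And>N X. N \<ge> 1 \<Longrightarrow> X \<in> nc_int_ball g' g N \<Longrightarrow> op_norm (f N X) \<le> 1"
  shows "nc_analytic g' g p q (\<lambda>N X. mat_moebius (kron v (1\<^sub>m N)) (f N X))"
proof -
  have vc: "v \<in> carrier_mat p q" unfolding v(1) by (rule nc_at_zero_carrier[OF f])
  have vs: "mat_adjoint v \<in> carrier_mat q p" "op_norm (mat_adjoint v) < 1"
    using vc v(2) op_norm_adjoint[OF vc] by auto
  define h where "h = (\<lambda>N X. f N X * the (mat_inverse (1\<^sub>m (q * N) - mat_adjoint (kron v (1\<^sub>m N)) * f N X)))"
  have h: "nc_analytic g' g p q h"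
    unfolding h_def by (rule nc_analytic_right_quotient[OF f v contr])
  have D: "defect v \<in> carrier_mat q q" and D': "defect (mat_adjoint v) \<in> carrier_mat p p"
    by (rule defect_carrier[OF vc], rule defect_carrier[OF vs(1)])
  have A: "nc_analytic g' g p q (\<lambda>N X. kron v (1\<^sub>m N)
      - kron (defect (mat_adjoint v)) (1\<^sub>m N) * h N X * kron (defect v) (1\<^sub>m N))"
    by (rule nc_analytic_const_minus[OF nc_analytic_kron_mult[OF h D' D] vc])
  have fh: "nc_holo g' g p q f" using f by (simp add: nc_analytic_iff_taylor)
  have eq: "kron v (1\<^sub>m N) - kron (defect (mat_adjoint v)) (1\<^sub>m N) * h N X * kron (defect v) (1\<^sub>m N)
      = mat_moebius (kron v (1\<^sub>m N)) (f N X)" if N: "N \<ge> 1" "X \<in> nc_int_ball g' g N" for N X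
  proof -
    have c: "kron v (1\<^sub>m N) \<in> carrier_mat (p * N) (q * N)" "op_norm (kron v (1\<^sub>m N)) < 1"
      using vc v(2) by (auto simp: op_norm_kron_1_lt)
    have dim: "dim_col (kron v (1\<^sub>m N)) = q * N" using vc by simp
    note fc = nc_holo_carrier[OF fh N]
    have D'N: "kron (defect (mat_adjoint v)) (1\<^sub>m N) \<in> carrier_mat (p * N) (p * N)" using D' by simp
    note inv = mat_moebius_inverse[OF c fc contr[OF N]]
    show ?thesis
      unfolding mat_moebius_def dim defect_kron[OF vc v(2)] kron_adjoint_1[OF vc] defect_kron[OF vs]
        h_def assoc_mult_mat[OF D'N fc inv(2)[unfolded kron_adjoint_1[OF vc]], symmetric] ..
  qed
  show ?thesis
  proof -
    have sub: "nc_analytic g' g p q h2" if h1: "nc_analytic g' g p q h1"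
      and eq: "\<And>N X. N \<ge> 1 \<Longrightarrow> X \<in> nc_int_ball g' g N \<Longrightarrow> h1 N X = h2 N X" for h1 h2
    proof -
      have hh: "nc_holo g' g p q h1" using h1 by (simp add: nc_analytic_iff)
      have h2: "nc_holo g' g p q h2"
      proof (rule nc_holo_transform[OF hh])
        fix N and X :: "complex mat" assume "N \<ge> 1" "X \<in> nc_int_ball g' g N"
        then show "h2 N X \<in> carrier_mat (p * N) (q * N)" using nc_holo_carrier[OF hh] eq by metis
      next
        fix N S and P :: "((nat \<Rightarrow> complex) \<Rightarrow> complex) \<Rightarrow> bool" and a
        assume N: "N \<ge> 1" and "function_algebra S P" and a: "\<And>z. z \<in> S \<Longrightarrow> a z \<in> nc_int_ball g' g N"
          and 1: "function_algebra.mat_in S P (p * N) (q * N) (\<lambda>z. h1 N (a z))"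
        then interpret function_algebra S P by simp
        have e: "h1 N (a z) = h2 N (a z)" if "z \<in> S" for z by (rule eq[OF N a[OF that]])
        have "P (\<lambda>z. h2 N (a z) $$ (i, j))" if "i < p * N" "j < q * N" for i j
          by (rule cong[of "\<lambda>z. h1 N (a z) $$ (i, j)"]) (use 1 that e in \<open>auto simp: mat_in_def\<close>)
        then show "mat_in (p * N) (q * N) (\<lambda>z. h2 N (a z))"
          using 1 e by (auto simp: mat_in_def)
      qed
      obtain a \<epsilon> where "nc_expansion g' g p q h1 a \<epsilon>" using h1 by (auto simp: nc_analytic_iff)
      then have "nc_expansion g' g p q h2 a \<epsilon>" using eq by (simp add: nc_expansion_def)
      then show ?thesis using h2 by (auto simp: nc_analytic_iff)
    qed
    show ?thesis by (rule sub[OF A eq])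
  qed
qed

section \<open>Parseval's inequality for polynomials bounded on the disc\<close>

lemma sum_roots_of_unity_orthogonal:
  assumes m: "m > 0" and ab: "\<alpha> < m" "\<beta> < m"
  defines "\<omega> \<equiv> \<lambda>k. exp (2 * of_real pi * \<i> * of_nat k / of_nat m)"
  shows "(\<Sum>k<m. \<omega> k ^ \<alpha> * cnj (\<omega> k ^ \<beta>)) = (if \<alpha> = \<beta> then of_nat m else 0)"
proof -
  have cnj_\<omega>: "cnj (\<omega> k) = inverse (\<omega> k)" for k
    by (simp add: \<omega>_def exp_cnj exp_minus flip: exp_minus)
  have swap: "\<omega> k ^ \<alpha> = \<omega> \<alpha> ^ k" for k \<alpha>
    by (simp add: \<omega>_def flip: exp_of_nat_mult) (simp add: mult_ac)
  have nz: "\<omega> k \<noteq> 0" for k by (simp add: \<omega>_def)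
  define x where "x = \<omega> \<alpha> / \<omega> \<beta>"
  have eq: "\<omega> k ^ \<alpha> * cnj (\<omega> k ^ \<beta>) = x ^ k" for k
    by (simp add: cnj_\<omega> swap[of k] x_def divide_inverse power_mult_distrib power_inverse)
  show ?thesis
  proof (cases "\<alpha> = \<beta>")
    case True
    then have "x = 1" using nz by (simp add: x_def)
    then show ?thesis unfolding eq using True by simp
  next
    case False
    have "\<omega> \<alpha> \<noteq> \<omega> \<beta>"
      using False ab m complex_root_unity_eq[of m \<alpha> \<beta>] by (simp add: \<omega>_def cong_def)
    then have x1: "x \<noteq> 1" using nz by (simp add: x_def)
    have "\<omega> k ^ m = 1" for k
      unfolding \<omega>_def by (rule complex_root_unity) (use m in simp)
    then have "x ^ m = 1" by (simp add: x_def power_divide)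
    then show ?thesis unfolding eq using False x1 geometric_sum[of x m] by simp
  qed
qed

text \<open>The mean over the \<open>m\<close>-th roots of unity on the circle of radius \<open>r < 1\<close> replaces integration; then
  \<open>r\<close> tends to one.\<close>

lemma Parseval_disc:
  fixes c :: "nat \<Rightarrow> nat \<Rightarrow> complex"
  assumes "\<And>z. cmod z < 1 \<Longrightarrow> (\<Sum>i<n. (cmod (\<Sum>\<alpha><m. c \<alpha> i * z ^ \<alpha>))\<^sup>2) \<le> M"
  shows "(\<Sum>\<alpha><m. \<Sum>i<n. (cmod (c \<alpha> i))\<^sup>2) \<le> M"
proof (cases "m = 0")
  case True
  then show ?thesis using assms[of 0] by simp
next
  case False
  then have m: "m > 0" by simp
  define \<omega> where "\<omega> k = exp (2 * of_real pi * \<i> * of_nat k / of_nat m)" for k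
  have norm_\<omega>: "cmod (\<omega> k) = 1" for k by (simp add: \<omega>_def norm_exp_eq_Re)
  have r: "(\<Sum>\<alpha><m. \<Sum>i<n. (cmod (c \<alpha> i))\<^sup>2 * r ^ (2 * \<alpha>)) \<le> M" if r: "0 \<le> r" "r < 1" for r :: real
  proof -
    define b where "b \<alpha> i = c \<alpha> i * of_real r ^ \<alpha>" for \<alpha> i
    have one: "(\<Sum>k<m. (cmod (\<Sum>\<alpha><m. b \<alpha> i * \<omega> k ^ \<alpha>))\<^sup>2) = of_nat m * (\<Sum>\<alpha><m. (cmod (b \<alpha> i))\<^sup>2)" for i
    proof -
      have "complex_of_real (\<Sum>k<m. (cmod (\<Sum>\<alpha><m. b \<alpha> i * \<omega> k ^ \<alpha>))\<^sup>2)
          = (\<Sum>k<m. (\<Sum>\<alpha><m. b \<alpha> i * \<omega> k ^ \<alpha>) * cnj (\<Sum>\<alpha><m. b \<alpha> i * \<omega> k ^ \<alpha>))"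
        by (simp add: complex_norm_square del: of_real_power)
      also have "\<dots> = (\<Sum>k<m. \<Sum>\<alpha><m. \<Sum>\<beta><m. (b \<alpha> i * cnj (b \<beta> i)) * (\<omega> k ^ \<alpha> * cnj (\<omega> k ^ \<beta>)))"
        by (simp add: sum_product cnj_sum mult_ac)
      also have "\<dots> = (\<Sum>\<alpha><m. \<Sum>\<beta><m. \<Sum>k<m. (b \<alpha> i * cnj (b \<beta> i)) * (\<omega> k ^ \<alpha> * cnj (\<omega> k ^ \<beta>)))"
        by (rule trans[OF sum.swap], rule sum.cong[OF refl], rule sum.swap)
      also have "\<dots> = (\<Sum>\<alpha><m. \<Sum>\<beta><m. (b \<alpha> i * cnj (b \<beta> i)) * (if \<alpha> = \<beta> then of_nat m else 0))"
        unfolding sum_distrib_left[symmetric] \<omega>_def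
        by (intro sum.cong refl arg_cong2[where f = "(*)"] sum_roots_of_unity_orthogonal[OF m]) auto
      also have "\<dots> = (\<Sum>\<alpha><m. of_nat m * (b \<alpha> i * cnj (b \<alpha> i)))"
        by (intro sum.cong refl) (simp add: if_distrib sum.delta cong: if_cong)
      also have "\<dots> = complex_of_real (of_nat m * (\<Sum>\<alpha><m. (cmod (b \<alpha> i))\<^sup>2))"
        by (simp add: complex_norm_square sum_distrib_left del: of_real_power)
      finally show ?thesis by (simp only: of_real_eq_iff)
    qed
    have "of_nat m * (\<Sum>\<alpha><m. \<Sum>i<n. (cmod (b \<alpha> i))\<^sup>2) = (\<Sum>i<n. of_nat m * (\<Sum>\<alpha><m. (cmod (b \<alpha> i))\<^sup>2))"
      by (subst sum.swap) (simp only: sum_distrib_left)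
    also have "\<dots> = (\<Sum>k<m. \<Sum>i<n. (cmod (\<Sum>\<alpha><m. b \<alpha> i * \<omega> k ^ \<alpha>))\<^sup>2)"
      by (subst sum.swap) (simp only: one)
    also have "\<dots> = (\<Sum>k<m. \<Sum>i<n. (cmod (\<Sum>\<alpha><m. c \<alpha> i * (of_real r * \<omega> k) ^ \<alpha>))\<^sup>2)"
      by (simp add: b_def power_mult_distrib mult.assoc)
    also have "\<dots> \<le> (\<Sum>k<m. M)"
      using r by (intro sum_mono assms) (simp add: norm_mult norm_\<omega>)
    finally have "(\<Sum>\<alpha><m. \<Sum>i<n. (cmod (b \<alpha> i))\<^sup>2) \<le> M" using m by simp
    then show ?thesis
      using r by (simp add: b_def norm_mult norm_power power_mult_distrib mult.commute[of 2] flip: power_mult)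
  qed
  have "((\<lambda>r :: real. \<Sum>\<alpha><m. \<Sum>i<n. (cmod (c \<alpha> i))\<^sup>2 * r ^ (2 * \<alpha>))
      \<longlongrightarrow> (\<Sum>\<alpha><m. \<Sum>i<n. (cmod (c \<alpha> i))\<^sup>2 * 1 ^ (2 * \<alpha>))) (at_left 1)"
    by (intro tendsto_intros)
  moreover have "eventually (\<lambda>r :: real. (\<Sum>\<alpha><m. \<Sum>i<n. (cmod (c \<alpha> i))\<^sup>2 * r ^ (2 * \<alpha>)) \<le> M) (at_left 1)"
  proof -
    have "(0 :: real) < 1" by simp
    from eventually_at_left_real[OF this] show ?thesis
      by eventually_elim (use r in auto)
  qed
  ultimately have "(\<Sum>\<alpha><m. \<Sum>i<n. (cmod (c \<alpha> i))\<^sup>2 * 1 ^ (2 * \<alpha>)) \<le> M"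
    by (rule tendsto_upperbound) simp
  then show ?thesis by simp
qed

section \<open>Maps of the ball fixing the origin, evaluated at nilpotent matrices\<close>

text \<open>If the entries of all blocks strictly increase a level function, then long words vanish.\<close>

lemma word_eval_level:
  assumes lev: "\<And>jl x y. jl \<in> {..<g'} \<times> {..<g} \<Longrightarrow> x < N \<Longrightarrow> y < N \<Longrightarrow> nc_block N X jl $$ (x, y) \<noteq> 0 \<Longrightarrow> lev x < (lev y :: nat)"
    and w: "set w \<subseteq> {..<g'} \<times> {..<g}" and xy: "x < N" "y < N" and nz: "word_eval N w X $$ (x, y) \<noteq> 0"
  shows "lev x + length w \<le> lev y"
  using w xy(1) nz
proof (induction w arbitrary: x)
  case Nil
  then show ?case using xy(2) by (auto split: if_splits)
next
  case (Cons jl w)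
  have "word_eval N (jl # w) X $$ (x, y) = (\<Sum>c<N. nc_block N X jl $$ (x, c) * word_eval N w X $$ (c, y))"
    unfolding word_eval_Cons by (rule mat_mult_index_sum[OF nc_block_carrier word_eval_carrier Cons.prems(2) xy(2)])
  with Cons.prems(3) have "(\<Sum>c<N. nc_block N X jl $$ (x, c) * word_eval N w X $$ (c, y)) \<noteq> 0" by simp
  then obtain c where c: "c < N" "nc_block N X jl $$ (x, c) * word_eval N w X $$ (c, y) \<noteq> 0"
    by (auto elim: sum.not_neutral_contains_not_neutral)
  have "lev x < lev c" using lev[of jl x c] Cons.prems c by auto
  moreover have "lev c + length w \<le> lev y" using Cons.IH[of c] Cons.prems c by auto
  ultimately show ?case by simp
qed

text \<open>A contraction-valued NC analytic map that fixes the origin and whose existing boundary values along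
  radii have norm one.  The coefficients \<open>a\<close> are those of an expansion of \<open>\<phi>\<close>.\<close>

locale normalized_ball_map =
  fixes g' g p q :: nat and \<phi> :: nc_map and a :: "nc_word \<Rightarrow> complex mat" and \<epsilon> :: real
  assumes pos: "g' \<ge> 1" "g \<ge> 1"
    and analytic: "nc_analytic g' g p q \<phi>"
    and expansion: "nc_expansion g' g p q \<phi> a \<epsilon>"
    and contraction: "\<And>N X. N \<ge> 1 \<Longrightarrow> X \<in> nc_int_ball g' g N \<Longrightarrow> op_norm (\<phi> N X) \<le> 1"
    and zero: "a [] = 0\<^sub>m p q"
    and boundary: "\<And>N X L. N \<ge> 1 \<Longrightarrow> X \<in> nc_bdry_ball g' g N \<Longrightarrow> L \<in> carrier_mat (p * N) (q * N) \<Longrightarrow>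
      mat_tendsto (\<lambda>r. \<phi> N (complex_of_real r \<cdot>\<^sub>m X)) L (at_left 1) \<Longrightarrow> op_norm L = 1"
begin

lemma holo: "nc_holo g' g p q \<phi>"
  using analytic by (simp add: nc_analytic_iff)

lemma a_carrier [simp]: "a w \<in> carrier_mat p q"
  using expansion by (simp add: nc_expansion_def)

abbreviation hom where "hom N X \<alpha> \<equiv> homog g' g p q a N X \<alpha>"

text \<open>If all long words vanish at \<open>X\<close>, then \<open>z \<mapsto> \<phi>(z X)\<close> is a polynomial on the unit disc.\<close>

lemma slice_nilpotent:
  assumes N: "N \<ge> 1" and X: "X \<in> carrier_mat (g' * N) (g * N)" "op_norm X \<le> 1"
    and nil: "\<And>w. set w \<subseteq> {..<g'} \<times> {..<g} \<Longrightarrow> M \<le> length w \<Longrightarrow> word_eval N w X = 0\<^sub>m N N"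
    and ij: "i < p * N" "j < q * N" and z: "cmod z < 1"
  shows "\<phi> N (z \<cdot>\<^sub>m X) $$ (i, j) = (\<Sum>\<alpha><M. hom N X \<alpha> $$ (i, j) * z ^ \<alpha>)"
proof -
  have 0: "hom N X \<alpha> = 0\<^sub>m (p * N) (q * N)" if "\<alpha> \<notin> {..<M}" for \<alpha>
  proof (rule block_eq_matI[of _ p N q N])
    fix i x k y assume i: "i < p" "x < N" "k < q" "y < N"
    show "hom N X \<alpha> $$ (i * N + x, k * N + y) = 0\<^sub>m (p * N) (q * N) $$ (i * N + x, k * N + y)"
      using i that nil block_index_less[OF i(1,2)] block_index_less[OF i(3,4)]
      by (auto simp: homog_index nc_words_def intro!: sum.neutral)
  qed auto
  have "(\<lambda>\<alpha>. hom N X \<alpha> $$ (i, j) * z ^ \<alpha>) sums (\<phi> N (z \<cdot>\<^sub>m X) $$ (i, j))"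
    using nc_taylor_sums[OF holo N X(1) _ _ ij z] X(2) nc_expansion_taylor[OF holo expansion N X(1)] by simp
  moreover have "(\<lambda>\<alpha>. hom N X \<alpha> $$ (i, j) * z ^ \<alpha>) sums (\<Sum>\<alpha><M. hom N X \<alpha> $$ (i, j) * z ^ \<alpha>)"
    by (rule sums_finite) (use 0 ij in auto)
  ultimately show ?thesis by (rule sums_unique2)
qed

lemma slice_contraction:
  assumes "N \<ge> 1" "X \<in> carrier_mat (g' * N) (g * N)" "op_norm X \<le> 1" "cmod z < 1"
  shows "\<phi> N (z \<cdot>\<^sub>m X) \<in> carrier_mat (p * N) (q * N)" "op_norm (\<phi> N (z \<cdot>\<^sub>m X)) \<le> 1"
proof -
  have "z \<cdot>\<^sub>m X \<in> nc_int_ball g' g N"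
    using assms by (intro smult_int_ball[of X g' N g 1]) auto
  then show "\<phi> N (z \<cdot>\<^sub>m X) \<in> carrier_mat (p * N) (q * N)" "op_norm (\<phi> N (z \<cdot>\<^sub>m X)) \<le> 1"
    using nc_holo_carrier[OF holo assms(1)] contraction[OF assms(1)] by auto
qed

text \<open>Since \<open>\<phi>(z X) x\<close> is a polynomial in \<open>z\<close> bounded by \<open>\<parallel>x\<parallel>\<close> on the disc, its coefficients are
  orthogonal in the mean.\<close>

lemma column_Parseval:
  assumes N: "N \<ge> 1" and X: "X \<in> carrier_mat (g' * N) (g * N)" "op_norm X \<le> 1"
    and nil: "\<And>w. set w \<subseteq> {..<g'} \<times> {..<g} \<Longrightarrow> M \<le> length w \<Longrightarrow> word_eval N w X = 0\<^sub>m N N"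
    and x: "x \<in> carrier_vec (q * N)"
  shows "(\<Sum>\<alpha><M. sqn (hom N X \<alpha> *\<^sub>v x)) \<le> sqn x"
proof -
  have "(\<Sum>\<alpha><M. \<Sum>i<p * N. (cmod ((hom N X \<alpha> *\<^sub>v x) $ i))\<^sup>2) \<le> sqn x"
  proof (rule Parseval_disc)
    fix z :: complex assume z: "cmod z < 1"
    note c = slice_contraction[OF N X z]
    have "(\<phi> N (z \<cdot>\<^sub>m X) *\<^sub>v x) $ i = (\<Sum>\<alpha><M. (hom N X \<alpha> *\<^sub>v x) $ i * z ^ \<alpha>)" if i: "i < p * N" for i
    proof -
      have "(\<phi> N (z \<cdot>\<^sub>m X) *\<^sub>v x) $ i = (\<Sum>j<q * N. \<phi> N (z \<cdot>\<^sub>m X) $$ (i, j) * x $ j)"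
        by (rule mult_mat_vec_index_sum[OF c(1) x i])
      also have "\<dots> = (\<Sum>j<q * N. \<Sum>\<alpha><M. (hom N X \<alpha> $$ (i, j) * x $ j) * z ^ \<alpha>)"
        by (intro sum.cong refl) (simp add: slice_nilpotent[OF N X nil i _ z] sum_distrib_right sum_distrib_left mult_ac)
      also have "\<dots> = (\<Sum>\<alpha><M. (\<Sum>j<q * N. hom N X \<alpha> $$ (i, j) * x $ j) * z ^ \<alpha>)"
        by (subst sum.swap) (simp add: sum_distrib_right)
      also have "\<dots> = (\<Sum>\<alpha><M. (hom N X \<alpha> *\<^sub>v x) $ i * z ^ \<alpha>)"
        by (simp only: mult_mat_vec_index_sum[OF homog_carrier x i])
      finally show ?thesis .
    qed
    then have "(\<Sum>i<p * N. (cmod (\<Sum>\<alpha><M. (hom N X \<alpha> *\<^sub>v x) $ i * z ^ \<alpha>))\<^sup>2) = sqn (\<phi> N (z \<cdot>\<^sub>m X) *\<^sub>v x)"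
      using c(1) by (simp add: sqn_def del: index_mult_mat_vec)
    also have "\<dots> \<le> sqn x" by (rule contractionD[OF c x])
    finally show "(\<Sum>i<p * N. (cmod (\<Sum>\<alpha><M. (hom N X \<alpha> *\<^sub>v x) $ i * z ^ \<alpha>))\<^sup>2) \<le> sqn x" .
  qed
  then show ?thesis by (simp add: sqn_def del: index_mult_mat_vec)
qed

lemma row_Parseval:
  assumes N: "N \<ge> 1" and X: "X \<in> carrier_mat (g' * N) (g * N)" "op_norm X \<le> 1"
    and nil: "\<And>w. set w \<subseteq> {..<g'} \<times> {..<g} \<Longrightarrow> M \<le> length w \<Longrightarrow> word_eval N w X = 0\<^sub>m N N"
    and y: "y \<in> carrier_vec (p * N)"
  shows "(\<Sum>\<alpha><M. sqn (mat_adjoint (hom N X \<alpha>) *\<^sub>v y)) \<le> sqn y"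
proof -
  have adj: "cnj ((mat_adjoint A *\<^sub>v y) $ j) = (\<Sum>i<p * N. A $$ (i, j) * cnj (y $ i))"
    if A: "A \<in> carrier_mat (p * N) (q * N)" and j: "j < q * N" for A j
    using mult_mat_vec_index_sum[OF mat_adjoint_carrier[OF A] y j] A j by (simp del: index_mult_mat_vec)
  have "(\<Sum>\<alpha><M. \<Sum>j<q * N. (cmod (cnj ((mat_adjoint (hom N X \<alpha>) *\<^sub>v y) $ j)))\<^sup>2) \<le> sqn y"
  proof (rule Parseval_disc)
    fix z :: complex assume z: "cmod z < 1"
    note c = slice_contraction[OF N X z]
    have "cnj ((mat_adjoint (\<phi> N (z \<cdot>\<^sub>m X)) *\<^sub>v y) $ j) = (\<Sum>\<alpha><M. cnj ((mat_adjoint (hom N X \<alpha>) *\<^sub>v y) $ j) * z ^ \<alpha>)"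
      if j: "j < q * N" for j
    proof -
      have "cnj ((mat_adjoint (\<phi> N (z \<cdot>\<^sub>m X)) *\<^sub>v y) $ j) = (\<Sum>i<p * N. \<phi> N (z \<cdot>\<^sub>m X) $$ (i, j) * cnj (y $ i))"
        by (rule adj[OF c(1) j])
      also have "\<dots> = (\<Sum>i<p * N. \<Sum>\<alpha><M. (hom N X \<alpha> $$ (i, j) * cnj (y $ i)) * z ^ \<alpha>)"
        by (intro sum.cong refl) (simp add: slice_nilpotent[OF N X nil _ j z] sum_distrib_right sum_distrib_left mult_ac)
      also have "\<dots> = (\<Sum>\<alpha><M. (\<Sum>i<p * N. hom N X \<alpha> $$ (i, j) * cnj (y $ i)) * z ^ \<alpha>)"
        by (subst sum.swap) (simp add: sum_distrib_right)
      also have "\<dots> = (\<Sum>\<alpha><M. cnj ((mat_adjoint (hom N X \<alpha>) *\<^sub>v y) $ j) * z ^ \<alpha>)"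
        by (simp only: adj[OF homog_carrier j])
      finally show ?thesis .
    qed
    then have "(\<Sum>j<q * N. (cmod (\<Sum>\<alpha><M. cnj ((mat_adjoint (hom N X \<alpha>) *\<^sub>v y) $ j) * z ^ \<alpha>))\<^sup>2)
        = (\<Sum>j<q * N. (cmod (cnj ((mat_adjoint (\<phi> N (z \<cdot>\<^sub>m X)) *\<^sub>v y) $ j)))\<^sup>2)"
      by (intro sum.cong refl) (simp only: lessThan_iff)
    also have "\<dots> = sqn (mat_adjoint (\<phi> N (z \<cdot>\<^sub>m X)) *\<^sub>v y)"
      using c(1) by (simp add: sqn_def del: index_mult_mat_vec)
    also have "\<dots> \<le> sqn y" by (rule contraction_adjointD[OF c y])
    finally show "(\<Sum>j<q * N. (cmod (\<Sum>\<alpha><M. cnj ((mat_adjoint (hom N X \<alpha>) *\<^sub>v y) $ j) * z ^ \<alpha>))\<^sup>2) \<le> sqn y" .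
  qed
  then show ?thesis by (simp add: sqn_def del: index_mult_mat_vec)
qed

lemma sum_nc_words_1:
  "(\<Sum>w\<in>nc_words g' g (Suc 0). F w) = (\<Sum>j<g'. \<Sum>l<g. F [(j, l)])"
proof -
  have "nc_words g' g (Suc 0) = (\<lambda>jl. [jl]) ` ({..<g'} \<times> {..<g})"
    by (auto simp: nc_words_def length_Suc_conv)
  then have "(\<Sum>w\<in>nc_words g' g (Suc 0). F w) = (\<Sum>jl\<in>{..<g'} \<times> {..<g}. F [jl])"
    by (simp add: sum.reindex inj_on_def)
  then show ?thesis by (simp add: sum.cartesian_product case_prod_beta)
qed

lemma word_eval_single: "word_eval N [jl] X = nc_block N X jl"
  by (simp add: word_eval_Cons right_mult_one_mat[OF nc_block_carrier])

end

text \<open>A matrix given by its blocks.\<close>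

definition block_mat :: "nat \<Rightarrow> nat \<Rightarrow> nat \<Rightarrow> (nat \<Rightarrow> nat \<Rightarrow> nat \<Rightarrow> nat \<Rightarrow> complex) \<Rightarrow> complex mat" where
  "block_mat p q N B = mat (p * N) (q * N) (\<lambda>(r, c). B (r div N) (c div N) (r mod N) (c mod N))"

lemma block_mat_carrier [simp]: "block_mat p q N B \<in> carrier_mat (p * N) (q * N)"
  by (simp add: block_mat_def)

lemma block_mat_index:
  "i < p \<Longrightarrow> x < N \<Longrightarrow> k < q \<Longrightarrow> y < N \<Longrightarrow> block_mat p q N B $$ (i * N + x, k * N + y) = B i k x y"
  by (simp add: block_mat_def block_index_less)

lemma nc_block_block_mat:
  "j < g' \<Longrightarrow> l < g \<Longrightarrow> x < N \<Longrightarrow> y < N \<Longrightarrow> nc_block N (block_mat g' g N B) (j, l) $$ (x, y) = B j l x y"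
  by (simp add: nc_block_def block_mat_index)

section \<open>Path matrices\<close>

text \<open>Blocks of a zero-one matrix of size \<open>n + 3\<close>, \<open>n = length v\<close>.  The edges \<open>x \<rightarrow> x + 1\<close> for \<open>x < n\<close>
  carry the letters of the word \<open>v\<close>, so that \<open>v\<close> is the only word with a nonzero \<open>(0, n)\<close> entry.
  Further edges \<open>0 \<rightarrow> n + 1\<close> and \<open>n + 2 \<rightarrow> n\<close> provide the row letter \<open>k\<close> at \<open>0\<close> and the
  column letter \<open>m\<close> at \<open>n\<close>, unless \<open>v\<close> does so already.\<close>

definition path_block :: "nc_word \<Rightarrow> nat \<Rightarrow> nat \<Rightarrow> nat \<Rightarrow> nat \<Rightarrow> nat \<Rightarrow> nat \<Rightarrow> complex" where
  "path_block v k m j l x y = of_bool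
     ((x < length v \<and> y = x + 1 \<and> v ! x = (j, l))
      \<or> (x = 0 \<and> y = length v + 1 \<and> j = k \<and> l = 0 \<and> fst (v ! 0) \<noteq> k)
      \<or> (x = length v + 2 \<and> y = length v \<and> j = 0 \<and> l = m \<and> snd (v ! (length v - 1)) \<noteq> m))"

definition path_mat :: "nat \<Rightarrow> nat \<Rightarrow> nc_word \<Rightarrow> nat \<Rightarrow> nat \<Rightarrow> complex mat" where
  "path_mat g' g v k m = block_mat g' g (length v + 3) (path_block v k m)"

lemma path_mat_carrier [simp]:
  "path_mat g' g v k m \<in> carrier_mat (g' * (length v + 3)) (g * (length v + 3))"
  by (simp add: path_mat_def)

lemma nc_block_path_mat:
  "j < g' \<Longrightarrow> l < g \<Longrightarrow> x < length v + 3 \<Longrightarrow> y < length v + 3 \<Longrightarrow>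
    nc_block (length v + 3) (path_mat g' g v k m) (j, l) $$ (x, y) = path_block v k m j l x y"
  unfolding path_mat_def by (rule nc_block_block_mat)

lemma path_block_row_unique:
  assumes "path_block v k m j l x y \<noteq> 0" "path_block v k m j l' x y' \<noteq> 0"
  shows "l = l' \<and> y = y'"
  using assms by (auto simp: path_block_def)

lemma path_block_col_unique:
  assumes "path_block v k m j l x y \<noteq> 0" "path_block v k m j' l x' y \<noteq> 0"
  shows "j = j' \<and> x = x'"
proof -
  have "length v - Suc 0 = x" if "Suc x = length v" for x using that by simp
  then show ?thesis using assms by (auto simp: path_block_def)
qed

lemma op_norm_path_mat: "op_norm (path_mat g' g v k m) \<le> 1"
proof (rule op_norm_partial_permutation[OF path_mat_carrier])
  define N where "N = length v + 3"
  have X: "path_mat g' g v k m $$ (i * N + x, l * N + y) = path_block v k m i l x y"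
    if "i < g'" "x < N" "l < g" "y < N" for i x l y
    using that unfolding path_mat_def N_def by (rule block_mat_index)
  fix i j assume i: "i < g' * (length v + 3)" and j: "j < g * (length v + 3)"
  obtain r x where r: "r < g'" "x < N" "i = r * N + x" using block_index_cases i unfolding N_def .
  obtain l y where l: "l < g" "y < N" "j = l * N + y" using block_index_cases j unfolding N_def .
  show "path_mat g' g v k m $$ (i, j) \<in> {0, 1}"
  proof -
    have "of_bool P \<in> {0, 1 :: complex}" for P by (cases P) simp_all
    then show ?thesis unfolding r(3) l(3) X[OF r(1,2) l(1,2)] path_block_def .
  qed
  { fix j' assume j': "j' < g * (length v + 3)"
    obtain l' y' where l': "l' < g" "y' < N" "j' = l' * N + y'" using block_index_cases j' unfolding N_def .
    assume "path_mat g' g v k m $$ (i, j) \<noteq> 0" "path_mat g' g v k m $$ (i, j') \<noteq> 0"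
    then have "l = l' \<and> y = y'"
      unfolding r(3) l(3) l'(3) X[OF r(1,2) l(1,2)] X[OF r(1,2) l'(1,2)] by (rule path_block_row_unique)
    then show "j = j'" by (simp add: l l') }
  { fix i' assume i': "i' < g' * (length v + 3)"
    obtain r' x' where r': "r' < g'" "x' < N" "i' = r' * N + x'" using block_index_cases i' unfolding N_def .
    assume "path_mat g' g v k m $$ (i, j) \<noteq> 0" "path_mat g' g v k m $$ (i', j) \<noteq> 0"
    then have "r = r' \<and> x = x'"
      unfolding r(3) l(3) r'(3) X[OF r(1,2) l(1,2)] X[OF r'(1,2) l(1,2)] by (rule path_block_col_unique)
    then show "i = i'" by (simp add: r r') }
qed

lemma word_eval_path_mat_nilpotent:
  assumes w: "set w \<subseteq> {..<g'} \<times> {..<g}" "length v + 3 \<le> length w"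
  shows "word_eval (length v + 3) w (path_mat g' g v k m) = 0\<^sub>m (length v + 3) (length v + 3)"
proof (rule eq_matI)
  let ?N = "length v + 3"
  let ?lev = "\<lambda>x. if x = length v + 2 then 0 else x + 1"
  fix x y assume "x < dim_row (0\<^sub>m ?N ?N :: complex mat)" "y < dim_col (0\<^sub>m ?N ?N :: complex mat)"
  then have xy: "x < ?N" "y < ?N" by auto
  have lev: "?lev x < ?lev y"
    if "jl \<in> {..<g'} \<times> {..<g}" "x < ?N" "y < ?N" "nc_block ?N (path_mat g' g v k m) jl $$ (x, y) \<noteq> 0" for jl x y
    using that nc_block_path_mat[of "fst jl" g' "snd jl" g x v y k m] by (auto simp: path_block_def split: if_splits)
  show "word_eval ?N w (path_mat g' g v k m) $$ (x, y) = 0\<^sub>m ?N ?N $$ (x, y)"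
  proof (rule ccontr)
    assume "\<not> ?thesis"
    then have "word_eval ?N w (path_mat g' g v k m) $$ (x, y) \<noteq> 0" using xy by simp
    from word_eval_level[OF lev w(1) xy this] have "?lev x + length w \<le> ?lev y" .
    then show False using w(2) xy by (auto split: if_splits)
  qed
qed auto

text \<open>The last column but two of \<open>w(X)\<close>: from the vertex \<open>x\<close> the word \<open>w\<close> leads to \<open>n = length v\<close> just
  if \<open>w\<close> is the tail of \<open>v\<close> starting there.\<close>

lemma word_eval_path_mat:
  assumes w: "set w \<subseteq> {..<g'} \<times> {..<g}" and v: "v \<noteq> []"
  shows "x \<le> length v \<Longrightarrow> word_eval (length v + 3) w (path_mat g' g v k m) $$ (x, length v) = of_bool (w = drop x v)"
    and "word_eval (length v + 3) w (path_mat g' g v k m) $$ (length v + 1, length v) = 0"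
  using w
proof (induction w arbitrary: x)
  case Nil
  { case 1 then show ?case by auto }
  { case 2 then show ?case by simp }
next
  case (Cons jl w)
  let ?N = "length v + 3" and ?n = "length v"
  have jl: "fst jl < g'" "snd jl < g" and w: "set w \<subseteq> {..<g'} \<times> {..<g}" if "set (jl # w) \<subseteq> {..<g'} \<times> {..<g}"
    using that by auto
  have e: "word_eval ?N (jl # w) (path_mat g' g v k m) $$ (x, ?n)
      = (\<Sum>c<?N. path_block v k m (fst jl) (snd jl) x c * word_eval ?N w (path_mat g' g v k m) $$ (c, ?n))"
    if "set (jl # w) \<subseteq> {..<g'} \<times> {..<g}" "x < ?N" for x
    unfolding word_eval_Cons
    using mat_mult_index_sum[OF nc_block_carrier word_eval_carrier that(2), of ?n]
      nc_block_path_mat[OF jl[OF that(1)] that(2)] by simp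
  { case 1
    note IH1 = Cons.IH(1)[OF _ w[OF 1(2)]] and IH2 = Cons.IH(2)[OF w[OF 1(2)]]
    show ?case
    proof (cases "x < ?n")
      case True
      have "path_block v k m (fst jl) (snd jl) x c * word_eval ?N w (path_mat g' g v k m) $$ (c, ?n)
          = (if c = x + 1 then of_bool (v ! x = jl \<and> w = drop (x + 1) v) else 0)" if "c < ?N" for c
      proof (cases "c = x + 1")
        case c: True
        have "path_block v k m (fst jl) (snd jl) x (x + 1) = of_bool (v ! x = jl)"
          using True by (auto simp: path_block_def)
        moreover have "word_eval ?N w (path_mat g' g v k m) $$ (x + 1, ?n) = of_bool (w = drop (x + 1) v)"
          by (rule IH1) (use True in simp)
        ultimately show ?thesis by (simp add: c of_bool_conj)
      next
        case False
        have "path_block v k m (fst jl) (snd jl) x c = 0 \<or> c = ?n + 1"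
          using True False by (auto simp: path_block_def)
        then show ?thesis using False IH2 by auto
      qed
      then have "(\<Sum>c<?N. path_block v k m (fst jl) (snd jl) x c * word_eval ?N w (path_mat g' g v k m) $$ (c, ?n))
          = (\<Sum>c<?N. if c = x + 1 then of_bool (v ! x = jl \<and> w = drop (x + 1) v) else 0)"
        by (intro sum.cong refl) simp
      moreover have "x < ?N" using True by simp
      ultimately have "word_eval ?N (jl # w) (path_mat g' g v k m) $$ (x, ?n)
          = (\<Sum>c<?N. if c = x + 1 then of_bool (v ! x = jl \<and> w = drop (x + 1) v) else 0)"
        using e[OF 1(2)] by simp
      also have "\<dots> = of_bool (v ! x = jl \<and> w = drop (x + 1) v)" using True by simp
      also have "\<dots> = of_bool (jl # w = drop x v)"
      proof -
        have "drop x v = v ! x # drop (x + 1) v" using Cons_nth_drop_Suc[OF True] by simp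
        then show ?thesis by auto
      qed
      finally show ?thesis .
    next
      case False
      then have x: "x = ?n" using 1 by simp
      have "path_block v k m (fst jl) (snd jl) x c = 0" for c
        using v by (auto simp: path_block_def x)
      then show ?thesis using e[OF 1(2), of x] x by simp
    qed }
  { case 2
    have "path_block v k m (fst jl) (snd jl) (?n + 1) c = 0" for c by (auto simp: path_block_def)
    then show ?case using e[OF 2, of "?n + 1"] by simp }
qed

lemma sum_two_le:
  fixes F :: "'i \<Rightarrow> real"
  assumes "finite I" "i \<in> I" "j \<in> I" "i \<noteq> j" "\<And>k. k \<in> I \<Longrightarrow> 0 \<le> F k"
  shows "F i + F j \<le> sum F I"
proof -
  have "sum F {i, j} \<le> sum F I" using assms by (intro sum_mono2) auto
  then show ?thesis using assms(4) by simp
qed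

context normalized_ball_map
begin

text \<open>The vector \<open>\<xi> \<otimes> e\<^sub>n\<close> with \<open>e\<^sub>n\<close> a unit vector of \<open>\<complex>\<^sup>N\<close>.\<close>

definition column_vec :: "nat \<Rightarrow> nat \<Rightarrow> nat \<Rightarrow> complex vec \<Rightarrow> complex vec" where
  "column_vec r N n \<xi> = vec (r * N) (\<lambda>c. if c mod N = n then \<xi> $ (c div N) else 0)"

lemma column_vec_carrier [simp]: "column_vec r N n \<xi> \<in> carrier_vec (r * N)"
  by (simp add: column_vec_def)

lemma column_vec_index:
  "k < r \<Longrightarrow> b < N \<Longrightarrow> column_vec r N n \<xi> $ (k * N + b) = (if b = n then \<xi> $ k else 0)"
  by (simp add: column_vec_def block_index_less)

lemma sqn_column_vec:
  assumes "n < N" "\<xi> \<in> carrier_vec r"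
  shows "sqn (column_vec r N n \<xi>) = sqn \<xi>"
proof -
  have "sqn (column_vec r N n \<xi>) = (\<Sum>k<r. \<Sum>b<N. (cmod (column_vec r N n \<xi> $ (k * N + b)))\<^sup>2)"
    unfolding sqn_def carrier_vecD[OF column_vec_carrier] by (rule sum_lessThan_mult)
  also have "\<dots> = (\<Sum>k<r. \<Sum>b<N. if b = n then (cmod (\<xi> $ k))\<^sup>2 else 0)"
    by (intro sum.cong refl) (simp add: column_vec_index)
  also have "\<dots> = sqn \<xi>" using assms by (simp add: sqn_def)
  finally show ?thesis .
qed

lemma hom_column_vec:
  assumes i: "i < p" "b < N" and n: "n < N" and \<xi>: "\<xi> \<in> carrier_vec q"
  shows "(hom N X \<alpha> *\<^sub>v column_vec q N n \<xi>) $ (i * N + b)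
    = (\<Sum>w\<in>nc_words g' g \<alpha>. (a w *\<^sub>v \<xi>) $ i * word_eval N w X $$ (b, n))"
proof -
  have "(hom N X \<alpha> *\<^sub>v column_vec q N n \<xi>) $ (i * N + b)
      = (\<Sum>k<q. \<Sum>c<N. hom N X \<alpha> $$ (i * N + b, k * N + c) * column_vec q N n \<xi> $ (k * N + c))"
    using mult_mat_vec_index_sum[OF homog_carrier column_vec_carrier block_index_less[OF i]]
    by (simp only: sum_lessThan_mult)
  also have "\<dots> = (\<Sum>k<q. \<Sum>c<N. if c = n then hom N X \<alpha> $$ (i * N + b, k * N + n) * \<xi> $ k else 0)"
    by (intro sum.cong refl) (simp add: column_vec_index)
  also have "\<dots> = (\<Sum>k<q. hom N X \<alpha> $$ (i * N + b, k * N + n) * \<xi> $ k)"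
    using n by simp
  also have "\<dots> = (\<Sum>k<q. \<Sum>w\<in>nc_words g' g \<alpha>. (a w $$ (i, k) * \<xi> $ k) * word_eval N w X $$ (b, n))"
  proof (rule sum.cong[OF refl])
    fix k assume "k \<in> {..<q}"
    then have k: "k < q" by simp
    show "hom N X \<alpha> $$ (i * N + b, k * N + n) * \<xi> $ k
        = (\<Sum>w\<in>nc_words g' g \<alpha>. (a w $$ (i, k) * \<xi> $ k) * word_eval N w X $$ (b, n))"
      unfolding homog_index[OF a_carrier i k n] sum_distrib_right
      by (rule sum.cong[OF refl]) (simp only: mult_ac)
  qed
  also have "\<dots> = (\<Sum>w\<in>nc_words g' g \<alpha>. (\<Sum>k<q. a w $$ (i, k) * \<xi> $ k) * word_eval N w X $$ (b, n))"
    by (subst sum.swap) (simp add: sum_distrib_right)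
  also have "\<dots> = (\<Sum>w\<in>nc_words g' g \<alpha>. (a w *\<^sub>v \<xi>) $ i * word_eval N w X $$ (b, n))"
    by (simp only: mult_mat_vec_index_sum[OF a_carrier \<xi> i(1)])
  finally show ?thesis .
qed

lemma adjoint_hom_column_vec:
  assumes k: "k < q" "b < N" and n: "n < N" and \<zeta>: "\<zeta> \<in> carrier_vec p"
  shows "(mat_adjoint (hom N X \<alpha>) *\<^sub>v column_vec p N n \<zeta>) $ (k * N + b)
    = (\<Sum>w\<in>nc_words g' g \<alpha>. (mat_adjoint (a w) *\<^sub>v \<zeta>) $ k * cnj (word_eval N w X $$ (n, b)))"
proof -
  have "(mat_adjoint (hom N X \<alpha>) *\<^sub>v column_vec p N n \<zeta>) $ (k * N + b)
      = (\<Sum>i<p. \<Sum>c<N. mat_adjoint (hom N X \<alpha>) $$ (k * N + b, i * N + c) * column_vec p N n \<zeta> $ (i * N + c))"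
    using mult_mat_vec_index_sum[OF mat_adjoint_carrier[OF homog_carrier] column_vec_carrier block_index_less[OF k]]
    by (simp only: sum_lessThan_mult)
  also have "\<dots> = (\<Sum>i<p. \<Sum>c<N. if c = n then mat_adjoint (hom N X \<alpha>) $$ (k * N + b, i * N + n) * \<zeta> $ i else 0)"
    by (intro sum.cong refl) (simp add: column_vec_index)
  also have "\<dots> = (\<Sum>i<p. mat_adjoint (hom N X \<alpha>) $$ (k * N + b, i * N + n) * \<zeta> $ i)"
    using n by simp
  also have "\<dots> = (\<Sum>i<p. cnj (hom N X \<alpha> $$ (i * N + n, k * N + b)) * \<zeta> $ i)"
  proof (rule sum.cong[OF refl])
    fix i assume "i \<in> {..<p}"
    then have "i * N + n < p * N" using block_index_less[of i p n N] n by simp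
    then show "mat_adjoint (hom N X \<alpha>) $$ (k * N + b, i * N + n) * \<zeta> $ i = cnj (hom N X \<alpha> $$ (i * N + n, k * N + b)) * \<zeta> $ i"
      using mat_adjoint_index[of "k * N + b" "hom N X \<alpha>" "i * N + n"] block_index_less[OF k]
      by (simp only: dim_homog)
  qed
  also have "\<dots> = (\<Sum>i<p. \<Sum>w\<in>nc_words g' g \<alpha>. (cnj (a w $$ (i, k)) * \<zeta> $ i) * cnj (word_eval N w X $$ (n, b)))"
  proof (rule sum.cong[OF refl])
    fix i assume "i \<in> {..<p}"
    then have i: "i < p" by simp
    show "cnj (hom N X \<alpha> $$ (i * N + n, k * N + b)) * \<zeta> $ i
        = (\<Sum>w\<in>nc_words g' g \<alpha>. (cnj (a w $$ (i, k)) * \<zeta> $ i) * cnj (word_eval N w X $$ (n, b)))"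
      unfolding homog_index[OF a_carrier i n k] cnj_sum sum_distrib_right
      by (rule sum.cong[OF refl]) (simp only: complex_cnj_mult mult_ac)
  qed
  also have "\<dots> = (\<Sum>w\<in>nc_words g' g \<alpha>. (\<Sum>i<p. cnj (a w $$ (i, k)) * \<zeta> $ i) * cnj (word_eval N w X $$ (n, b)))"
    by (subst sum.swap) (simp add: sum_distrib_right)
  also have "\<dots> = (\<Sum>w\<in>nc_words g' g \<alpha>. (mat_adjoint (a w) *\<^sub>v \<zeta>) $ k * cnj (word_eval N w X $$ (n, b)))"
  proof (rule sum.cong[OF refl], rule arg_cong2[where f = "(*)", OF _ refl])
    fix w
    have "(mat_adjoint (a w) *\<^sub>v \<zeta>) $ k = (\<Sum>i<p. mat_adjoint (a w) $$ (k, i) * \<zeta> $ i)"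
      by (rule mult_mat_vec_index_sum[OF mat_adjoint_carrier[OF a_carrier] \<zeta> k(1)])
    also have "\<dots> = (\<Sum>i<p. cnj (a w $$ (i, k)) * \<zeta> $ i)"
      using k(1) carrier_matD[OF a_carrier] by (intro sum.cong refl) simp
    finally show "(\<Sum>i<p. cnj (a w $$ (i, k)) * \<zeta> $ i) = (mat_adjoint (a w) *\<^sub>v \<zeta>) $ k" by (rule sym)
  qed
  finally show ?thesis .
qed

lemma sum_word_delta:
  assumes v: "v \<in> nc_words g' g \<alpha>" and F: "\<And>w. w \<in> nc_words g' g \<alpha> \<Longrightarrow> F w = (of_bool (w = v) :: complex)"
  shows "(\<Sum>w\<in>nc_words g' g \<alpha>. h w * F w) = h v"
proof -
  have "(\<Sum>w\<in>nc_words g' g \<alpha>. h w * F w) = (\<Sum>w\<in>nc_words g' g \<alpha>. if w = v then h v else 0)"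
    by (intro sum.cong refl) (simp add: F)
  also have "\<dots> = h v" using v by (simp add: sum.delta)
  finally show ?thesis .
qed

text \<open>Evaluation at the path matrix of \<open>v\<close>, applied to \<open>\<xi> \<otimes> e\<^sub>n\<close> with \<open>n = length v\<close>: the degree \<open>n\<close> part
  contributes \<open>a\<^sub>v \<xi>\<close> at \<open>e\<^sub>0\<close>, and the degree one part contributes \<open>a\<^bsub>(j,m)\<^esub> \<xi>\<close> at the start of the edge
  into \<open>n\<close> with label \<open>(j, m)\<close>.  These two components are different unless \<open>v\<close> is a single letter of
  column \<open>m\<close>, and the sum of their squares is bounded by the Parseval inequality.\<close>

lemma column_bound:
  assumes v: "set v \<subseteq> {..<g'} \<times> {..<g}" "v \<noteq> []" and m: "m < g" and \<xi>: "\<xi> \<in> carrier_vec q"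
  shows "sqn (a v *\<^sub>v \<xi>) \<le> sqn \<xi>"
    and "(\<And>j. v \<noteq> [(j, m)]) \<Longrightarrow> \<exists>j<g'. sqn (a v *\<^sub>v \<xi>) + sqn (a [(j, m)] *\<^sub>v \<xi>) \<le> sqn \<xi>"
proof -
  define n where "n = length v"
  define N where "N = n + 3"
  define X where "X = path_mat g' g v 0 m"
  have X: "X \<in> carrier_mat (g' * N) (g * N)" "op_norm X \<le> 1"
    unfolding X_def N_def n_def by (rule path_mat_carrier, rule op_norm_path_mat)
  have nil: "word_eval N w X = 0\<^sub>m N N" if "set w \<subseteq> {..<g'} \<times> {..<g}" "N \<le> length w" for w
    using that unfolding X_def N_def n_def by (rule word_eval_path_mat_nilpotent)
  have N: "N \<ge> 1" "n < N" "0 < N" by (simp_all add: N_def)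
  define T where "T \<alpha> b = (\<Sum>i<p. (cmod ((hom N X \<alpha> *\<^sub>v column_vec q N n \<xi>) $ (i * N + b)))\<^sup>2)" for \<alpha> b
  have T0: "T \<alpha> b \<ge> 0" for \<alpha> b by (simp add: T_def sum_nonneg)
  have "(\<Sum>\<alpha><N. sqn (hom N X \<alpha> *\<^sub>v column_vec q N n \<xi>)) \<le> sqn (column_vec q N n \<xi>)"
    by (rule column_Parseval[OF N(1) X nil column_vec_carrier])
  also have "(\<Sum>\<alpha><N. sqn (hom N X \<alpha> *\<^sub>v column_vec q N n \<xi>)) = (\<Sum>\<alpha><N. \<Sum>b<N. T \<alpha> b)"
  proof (rule sum.cong[OF refl])
    fix \<alpha>
    have "sqn (hom N X \<alpha> *\<^sub>v column_vec q N n \<xi>) = (\<Sum>i<p. \<Sum>b<N. (cmod ((hom N X \<alpha> *\<^sub>v column_vec q N n \<xi>) $ (i * N + b)))\<^sup>2)"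
      unfolding sqn_def carrier_vecD[OF mult_mat_vec_carrier[OF homog_carrier column_vec_carrier]]
      by (rule sum_lessThan_mult)
    then show "sqn (hom N X \<alpha> *\<^sub>v column_vec q N n \<xi>) = (\<Sum>b<N. T \<alpha> b)"
      unfolding T_def by (rule trans[OF _ sum.swap])
  qed
  also have "\<dots> = (\<Sum>c\<in>{..<N} \<times> {..<N}. T (fst c) (snd c))"
    by (simp add: sum.cartesian_product case_prod_beta)
  also have "sqn (column_vec q N n \<xi>) = sqn \<xi>" by (rule sqn_column_vec[OF N(2) \<xi>])
  finally have total: "(\<Sum>c\<in>{..<N} \<times> {..<N}. T (fst c) (snd c)) \<le> sqn \<xi>" .
  have Tn: "T n 0 = sqn (a v *\<^sub>v \<xi>)"
  proof -
    have vn: "v \<in> nc_words g' g n" using v by (simp add: nc_words_def n_def)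
    have "(hom N X n *\<^sub>v column_vec q N n \<xi>) $ (i * N + 0) = (a v *\<^sub>v \<xi>) $ i" if i: "i < p" for i
    proof -
      have w: "word_eval N w X $$ (0, n) = of_bool (w = v)" if "w \<in> nc_words g' g n" for w
        using word_eval_path_mat(1)[of w g' g v 0 0 m] that v(2)
        by (simp add: nc_words_def X_def N_def n_def)
      show ?thesis
        unfolding hom_column_vec[OF i N(3) N(2) \<xi>]
        by (rule sum_word_delta[OF vn w])
    qed
    moreover have "dim_vec (a v *\<^sub>v \<xi>) = p" using carrier_matD[OF a_carrier] by simp
    ultimately show ?thesis by (simp add: T_def sqn_def del: index_mult_mat_vec)
  qed
  show "sqn (a v *\<^sub>v \<xi>) \<le> sqn \<xi>"
  proof -
    have "T n 0 \<le> (\<Sum>c\<in>{..<N} \<times> {..<N}. T (fst c) (snd c))"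
      using member_le_sum[of "(n, 0)" "{..<N} \<times> {..<N}" "\<lambda>c. T (fst c) (snd c)"] T0 N by simp
    then show ?thesis using total Tn by simp
  qed
  assume ne: "\<And>j. v \<noteq> [(j, m)]"
  have T1: "T 1 b = sqn (a [(j, m)] *\<^sub>v \<xi>)"
    if b: "b < N" and j: "j < g'" and B: "\<And>j' l'. path_block v 0 m j' l' b n = of_bool (j' = j \<and> l' = m)" for b j
  proof -
    have jm: "[(j, m)] \<in> nc_words g' g 1" using j m by (simp add: nc_words_def)
    have "(hom N X 1 *\<^sub>v column_vec q N n \<xi>) $ (i * N + b) = (a [(j, m)] *\<^sub>v \<xi>) $ i" if i: "i < p" for i
    proof -
      have w: "word_eval N w X $$ (b, n) = of_bool (w = [(j, m)])" if w1: "w \<in> nc_words g' g 1" for w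
      proof -
        obtain j' l' where w: "w = [(j', l')]" "j' < g'" "l' < g"
          using w1 by (auto simp: nc_words_def length_Suc_conv)
        have "word_eval N w X $$ (b, n) = path_block v 0 m j' l' b n"
          unfolding w(1) word_eval_single
          using nc_block_path_mat[OF w(2,3), of b v n 0 m] b N(2) by (simp add: X_def N_def n_def)
        then show ?thesis by (simp add: B w(1))
      qed
      show ?thesis
        unfolding hom_column_vec[OF i b N(2) \<xi>] by (rule sum_word_delta[OF jm w])
    qed
    moreover have "dim_vec (a [(j, m)] *\<^sub>v \<xi>) = p" using carrier_matD[OF a_carrier] by simp
    ultimately show ?thesis by (simp add: T_def sqn_def del: index_mult_mat_vec One_nat_def)
  qed
  have conclude: "\<exists>j<g'. sqn (a v *\<^sub>v \<xi>) + sqn (a [(j, m)] *\<^sub>v \<xi>) \<le> sqn \<xi>"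
    if b: "b < N" and j: "j < g'" and B: "\<And>j' l'. path_block v 0 m j' l' b n = of_bool (j' = j \<and> l' = m)"
      and dist: "(n, 0) \<noteq> (1, b)" for b j
  proof -
    have "T n 0 + T 1 b \<le> (\<Sum>c\<in>{..<N} \<times> {..<N}. T (fst c) (snd c))"
      using sum_two_le[where F = "\<lambda>c. T (fst c) (snd c)" and i = "(n, 0)" and j = "(1, b)" and I = "{..<N} \<times> {..<N}"]
        dist b N T0 by (auto simp: N_def)
    then show ?thesis using total Tn T1[OF b j B] j by auto
  qed
  have n0: "n > 0" using v(2) by (simp add: n_def)
  show "\<exists>j<g'. sqn (a v *\<^sub>v \<xi>) + sqn (a [(j, m)] *\<^sub>v \<xi>) \<le> sqn \<xi>"
  proof (cases "snd (v ! (n - 1)) = m")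
    case True
    \<comment> \<open>The last edge of the path already has column \<open>m\<close>; it starts at \<open>n - 1\<close>, and \<open>n > 1\<close>.\<close>
    define j where "j = fst (v ! (n - 1))"
    have vl: "v ! (n - 1) = (j, m)" using True by (simp add: j_def prod_eq_iff)
    have "v ! (n - 1) \<in> set v" using n0 by (simp add: n_def)
    then have j: "j < g'" using v(1) vl by auto
    have n1: "n \<noteq> 1"
    proof
      assume "n = 1"
      then have "v = [(j, m)]" using vl by (cases v) (auto simp: n_def)
      then show False using ne by blast
    qed
    show ?thesis
    proof (rule conclude[OF _ j])
      show "n - 1 < N" by (simp add: N_def)
      show "path_block v 0 m j' l' (n - 1) n = of_bool (j' = j \<and> l' = m)" for j' l'
        using n0 vl by (auto simp: path_block_def n_def)
    qed (use n1 in auto)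
  next
    case False
    \<comment> \<open>The extra edge from \<open>n + 2\<close> to \<open>n\<close> is present, with the letter \<open>(0, m)\<close>.\<close>
    show ?thesis
    proof (rule conclude)
      show "n + 2 < N" by (simp add: N_def)
      show "0 < g'" using pos by simp
      show "path_block v 0 m j' l' (n + 2) n = of_bool (j' = 0 \<and> l' = m)" for j' l'
        using False by (auto simp: path_block_def n_def)
    qed auto
  qed
qed

text \<open>The same for the adjoints, with the edge out of \<open>0\<close> that carries a letter of row \<open>k\<close>.\<close>

lemma row_bound:
  assumes v: "set v \<subseteq> {..<g'} \<times> {..<g}" "v \<noteq> []" and k: "k < g'" and \<zeta>: "\<zeta> \<in> carrier_vec p"
    and ne: "\<And>l. v \<noteq> [(k, l)]"
  shows "\<exists>l<g. sqn (mat_adjoint (a v) *\<^sub>v \<zeta>) + sqn (mat_adjoint (a [(k, l)]) *\<^sub>v \<zeta>) \<le> sqn \<zeta>"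
proof -
  define n where "n = length v"
  define N where "N = n + 3"
  define X where "X = path_mat g' g v k 0"
  have X: "X \<in> carrier_mat (g' * N) (g * N)" "op_norm X \<le> 1"
    unfolding X_def N_def n_def by (rule path_mat_carrier, rule op_norm_path_mat)
  have nil: "word_eval N w X = 0\<^sub>m N N" if "set w \<subseteq> {..<g'} \<times> {..<g}" "N \<le> length w" for w
    using that unfolding X_def N_def n_def by (rule word_eval_path_mat_nilpotent)
  have N: "N \<ge> 1" "n < N" "0 < N" by (simp_all add: N_def)
  define T where "T \<alpha> b = (\<Sum>i<q. (cmod ((mat_adjoint (hom N X \<alpha>) *\<^sub>v column_vec p N 0 \<zeta>) $ (i * N + b)))\<^sup>2)" for \<alpha> b
  have T0: "T \<alpha> b \<ge> 0" for \<alpha> b by (simp add: T_def sum_nonneg)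
  have "(\<Sum>\<alpha><N. sqn (mat_adjoint (hom N X \<alpha>) *\<^sub>v column_vec p N 0 \<zeta>)) \<le> sqn (column_vec p N 0 \<zeta>)"
    by (rule row_Parseval[OF N(1) X nil column_vec_carrier])
  also have "(\<Sum>\<alpha><N. sqn (mat_adjoint (hom N X \<alpha>) *\<^sub>v column_vec p N 0 \<zeta>)) = (\<Sum>\<alpha><N. \<Sum>b<N. T \<alpha> b)"
  proof (rule sum.cong[OF refl])
    fix \<alpha>
    have "sqn (mat_adjoint (hom N X \<alpha>) *\<^sub>v column_vec p N 0 \<zeta>)
        = (\<Sum>i<q. \<Sum>b<N. (cmod ((mat_adjoint (hom N X \<alpha>) *\<^sub>v column_vec p N 0 \<zeta>) $ (i * N + b)))\<^sup>2)"
      unfolding sqn_def carrier_vecD[OF mult_mat_vec_carrier[OF mat_adjoint_carrier[OF homog_carrier] column_vec_carrier]]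
      by (rule sum_lessThan_mult)
    then show "sqn (mat_adjoint (hom N X \<alpha>) *\<^sub>v column_vec p N 0 \<zeta>) = (\<Sum>b<N. T \<alpha> b)"
      unfolding T_def by (rule trans[OF _ sum.swap])
  qed
  also have "\<dots> = (\<Sum>c\<in>{..<N} \<times> {..<N}. T (fst c) (snd c))"
    by (simp add: sum.cartesian_product case_prod_beta)
  also have "sqn (column_vec p N 0 \<zeta>) = sqn \<zeta>" by (rule sqn_column_vec[OF N(3) \<zeta>])
  finally have total: "(\<Sum>c\<in>{..<N} \<times> {..<N}. T (fst c) (snd c)) \<le> sqn \<zeta>" .
  have dim: "dim_col (a w) = q" for w
    by (rule carrier_matD(2)[OF a_carrier])
  have Tn: "T n n = sqn (mat_adjoint (a v) *\<^sub>v \<zeta>)"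
  proof -
    have vn: "v \<in> nc_words g' g n" using v by (simp add: nc_words_def n_def)
    have "(mat_adjoint (hom N X n) *\<^sub>v column_vec p N 0 \<zeta>) $ (i * N + n) = (mat_adjoint (a v) *\<^sub>v \<zeta>) $ i" if i: "i < q" for i
    proof -
      have w: "cnj (word_eval N w X $$ (0, n)) = of_bool (w = v)" if "w \<in> nc_words g' g n" for w
        using word_eval_path_mat(1)[of w g' g v 0 k 0] that v(2)
        by (simp add: nc_words_def X_def N_def n_def)
      show ?thesis
        unfolding adjoint_hom_column_vec[OF i N(2) N(3) \<zeta>] by (rule sum_word_delta[OF vn w])
    qed
    then show ?thesis by (simp add: T_def sqn_def dim del: index_mult_mat_vec)
  qed
  have T1: "T 1 b = sqn (mat_adjoint (a [(k, l)]) *\<^sub>v \<zeta>)"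
    if b: "b < N" and l: "l < g" and B: "\<And>j' l'. path_block v k 0 j' l' 0 b = of_bool (j' = k \<and> l' = l)" for b l
  proof -
    have kl: "[(k, l)] \<in> nc_words g' g 1" using l k by (simp add: nc_words_def)
    have "(mat_adjoint (hom N X 1) *\<^sub>v column_vec p N 0 \<zeta>) $ (i * N + b) = (mat_adjoint (a [(k, l)]) *\<^sub>v \<zeta>) $ i"
      if i: "i < q" for i
    proof -
      have w: "cnj (word_eval N w X $$ (0, b)) = of_bool (w = [(k, l)])" if w1: "w \<in> nc_words g' g 1" for w
      proof -
        obtain j' l' where w: "w = [(j', l')]" "j' < g'" "l' < g"
          using w1 by (auto simp: nc_words_def length_Suc_conv)
        have "word_eval N w X $$ (0, b) = path_block v k 0 j' l' 0 b"
          unfolding w(1) word_eval_single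
          using nc_block_path_mat[OF w(2,3), of 0 v b k 0] b by (simp add: X_def N_def n_def)
        then show ?thesis by (simp add: B w(1))
      qed
      show ?thesis
        unfolding adjoint_hom_column_vec[OF i b N(3) \<zeta>] by (rule sum_word_delta[OF kl w])
    qed
    then show ?thesis by (simp add: T_def sqn_def dim del: index_mult_mat_vec One_nat_def)
  qed
  have conclude: ?thesis
    if b: "b < N" and l: "l < g" and B: "\<And>j' l'. path_block v k 0 j' l' 0 b = of_bool (j' = k \<and> l' = l)"
      and dist: "(n, n) \<noteq> (1, b)" for b l
  proof -
    have "T n n + T 1 b \<le> (\<Sum>c\<in>{..<N} \<times> {..<N}. T (fst c) (snd c))"
      using sum_two_le[where F = "\<lambda>c. T (fst c) (snd c)" and i = "(n, n)" and j = "(1, b)" and I = "{..<N} \<times> {..<N}"]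
        dist b N T0 by (auto simp: N_def)
    then show ?thesis using total Tn T1[OF b l B] l by auto
  qed
  have n0: "n > 0" using v(2) by (simp add: n_def)
  show ?thesis
  proof (cases "fst (v ! 0) = k")
    case True
    define l where "l = snd (v ! 0)"
    have vl: "v ! 0 = (k, l)" using True by (simp add: l_def prod_eq_iff)
    have "v ! 0 \<in> set v" using n0 by (simp add: n_def)
    then have l: "l < g" using v(1) vl by auto
    have n1: "n \<noteq> 1"
    proof
      assume "n = 1"
      then have "v = [(k, l)]" using vl by (cases v) (auto simp: n_def)
      then show False using ne by blast
    qed
    show ?thesis
    proof (rule conclude[OF _ l])
      show "1 < N" by (simp add: N_def)
      show "path_block v k 0 j' l' 0 1 = of_bool (j' = k \<and> l' = l)" for j' l'
        using n0 vl by (auto simp: path_block_def n_def)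
    qed (use n1 in auto)
  next
    case False
    show ?thesis
    proof (rule conclude)
      show "n + 1 < N" by (simp add: N_def)
      show "0 < g" using pos by simp
      show "path_block v k 0 j' l' 0 (n + 1) = of_bool (j' = k \<and> l' = 0)" for j' l'
        using False n0 by (auto simp: path_block_def n_def)
    qed (use n0 in auto)
  qed
qed

end

section \<open>Extremal vectors of the linear part\<close>

lemma Lagrange_identity_complex:
  fixes c :: "nat \<Rightarrow> complex"
  shows "(\<Sum>l<g. \<Sum>m<g. (cmod (c l - c m))\<^sup>2) = 2 * real g * (\<Sum>l<g. (cmod (c l))\<^sup>2) - 2 * (cmod (\<Sum>l<g. c l))\<^sup>2"
proof -
  have "complex_of_real (\<Sum>l<g. \<Sum>m<g. (cmod (c l - c m))\<^sup>2) = (\<Sum>l<g. \<Sum>m<g. (c l - c m) * cnj (c l - c m))"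
    by (simp add: complex_norm_square del: of_real_power)
  also have "\<dots> = (\<Sum>l<g. \<Sum>m<g. c l * cnj (c l)) + (\<Sum>l<g. \<Sum>m<g. c m * cnj (c m))
      - (\<Sum>l<g. \<Sum>m<g. c l * cnj (c m)) - (\<Sum>l<g. \<Sum>m<g. c m * cnj (c l))"
    by (simp add: algebra_simps sum.distrib sum_subtractf)
  also have "(\<Sum>l<g. \<Sum>m<g. c m * cnj (c l)) = (\<Sum>l<g. \<Sum>m<g. c l * cnj (c m))"
    by (rule sum.swap)
  also have "(\<Sum>l<g. \<Sum>m<g. c l * cnj (c m)) = (\<Sum>l<g. c l) * cnj (\<Sum>l<g. c l)"
    by (simp add: sum_product cnj_sum)
  also have "(\<Sum>l<g. \<Sum>m<g. c l * cnj (c l)) = of_nat g * (\<Sum>l<g. c l * cnj (c l))"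
    by (simp add: sum_distrib_left)
  also have "(\<Sum>l<g. \<Sum>m<g. c m * cnj (c m)) = of_nat g * (\<Sum>l<g. c l * cnj (c l))"
    by simp
  also have "of_nat g * (\<Sum>l<g. c l * cnj (c l)) + of_nat g * (\<Sum>l<g. c l * cnj (c l))
      - (\<Sum>l<g. c l) * cnj (\<Sum>l<g. c l) - (\<Sum>l<g. c l) * cnj (\<Sum>l<g. c l)
      = complex_of_real (2 * real g * (\<Sum>l<g. (cmod (c l))\<^sup>2) - 2 * (cmod (\<Sum>l<g. c l))\<^sup>2)"
    by (simp add: complex_norm_square del: of_real_power)
  finally show ?thesis by (simp only: of_real_eq_iff)
qed

text \<open>Equality throughout
  \<open>\<Sum>\<^sub>j \<parallel>\<Sum>\<^sub>l b\<^sub>j\<^sub>l\<parallel>\<^sup>2 \<le> g \<Sum>\<^sub>j \<Sum>\<^sub>l \<parallel>b\<^sub>j\<^sub>l\<parallel>\<^sup>2 \<le> g \<Sum>\<^sub>j \<Sum>\<^sub>l t\<^sub>l \<le> g' g\<close> forces \<open>b\<^sub>j\<^sub>l\<close> not to depend on \<open>l\<close>.\<close>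

lemma Cauchy_Schwarz_equality_case:
  fixes b :: "nat \<Rightarrow> nat \<Rightarrow> nat \<Rightarrow> complex" and t :: "nat \<Rightarrow> real"
  assumes pos: "g' \<ge> 1" "g \<ge> 1"
    and le: "\<And>j l. j < g' \<Longrightarrow> l < g \<Longrightarrow> (\<Sum>i<p. (cmod (b j l i))\<^sup>2) \<le> t l"
    and tot: "(\<Sum>l<g. t l) \<le> 1"
    and eq: "(\<Sum>j<g'. \<Sum>i<p. (cmod (\<Sum>l<g. b j l i))\<^sup>2) = real (g' * g)"
  shows "\<And>j l m i. j < g' \<Longrightarrow> l < g \<Longrightarrow> m < g \<Longrightarrow> i < p \<Longrightarrow> b j l i = b j m i"
    and "\<And>j l. j < g' \<Longrightarrow> l < g \<Longrightarrow> (\<Sum>i<p. (cmod (b j l i))\<^sup>2) = 1 / g"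
    and "\<And>l. l < g \<Longrightarrow> t l = 1 / g"
proof -
  define D where "D j i = (\<Sum>l<g. \<Sum>m<g. (cmod (b j l i - b j m i))\<^sup>2)" for j i
  have D0: "D j i \<ge> 0" for j i by (simp add: D_def sum_nonneg)
  have "(\<Sum>j<g'. \<Sum>i<p. D j i)
      = 2 * real g * (\<Sum>j<g'. \<Sum>i<p. \<Sum>l<g. (cmod (b j l i))\<^sup>2) - 2 * real (g' * g)"
    unfolding D_def Lagrange_identity_complex eq[symmetric]
    by (simp add: sum_subtractf sum_distrib_left)
  also have "(\<Sum>j<g'. \<Sum>i<p. \<Sum>l<g. (cmod (b j l i))\<^sup>2) = (\<Sum>j<g'. \<Sum>l<g. \<Sum>i<p. (cmod (b j l i))\<^sup>2)"
    by (rule sum.cong[OF refl], rule sum.swap)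
  also have "2 * real g * (\<Sum>j<g'. \<Sum>l<g. \<Sum>i<p. (cmod (b j l i))\<^sup>2) - 2 * real (g' * g) \<le> 0"
  proof -
    have "(\<Sum>j<g'. \<Sum>l<g. \<Sum>i<p. (cmod (b j l i))\<^sup>2) \<le> (\<Sum>j<g'. \<Sum>l<g. t l)"
      by (intro sum_mono le) auto
    also have "\<dots> \<le> (\<Sum>j<g'. 1)" by (intro sum_mono tot)
    finally have "2 * real g * (\<Sum>j<g'. \<Sum>l<g. \<Sum>i<p. (cmod (b j l i))\<^sup>2) \<le> 2 * real g * real g'"
      by (intro mult_left_mono) auto
    moreover have "2 * real (g' * g) = 2 * real g * real g'" by simp
    ultimately show ?thesis by linarith
  qed
  finally have le0: "(\<Sum>j<g'. \<Sum>i<p. D j i) \<le> 0" .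
  have Dji: "D j i = 0" if j: "j < g'" "i < p" for j i
  proof -
    have "D j i \<le> (\<Sum>i<p. D j i)" using j D0 by (intro member_le_sum) auto
    also have "\<dots> \<le> (\<Sum>j<g'. \<Sum>i<p. D j i)"
      using j D0 by (intro member_le_sum[of j _ "\<lambda>j. \<Sum>i<p. D j i"]) (auto simp: sum_nonneg)
    finally show ?thesis using le0 D0[of j i] by linarith
  qed
  show const: "b j l i = b j m i" if j: "j < g'" "l < g" "m < g" "i < p" for j l m i
  proof -
    have "(cmod (b j l i - b j m i))\<^sup>2 \<le> (\<Sum>m<g. (cmod (b j l i - b j m i))\<^sup>2)"
      using j by (intro member_le_sum[of m _ "\<lambda>m. (cmod (b j l i - b j m i))\<^sup>2"]) auto
    also have "\<dots> \<le> D j i"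
      unfolding D_def using j
      by (intro member_le_sum[of l _ "\<lambda>l. \<Sum>m<g. (cmod (b j l i - b j m i))\<^sup>2"]) (auto simp: sum_nonneg)
    finally have "(cmod (b j l i - b j m i))\<^sup>2 \<le> 0" using Dji j by simp
    then show ?thesis by simp
  qed
  define S where "S j = (\<Sum>i<p. (cmod (b j 0 i))\<^sup>2)" for j
  have Sl: "(\<Sum>i<p. (cmod (b j l i))\<^sup>2) = S j" if "j < g'" "l < g" for j l
    unfolding S_def using const[of j l 0] that pos by (intro sum.cong refl) simp
  have "(\<Sum>j<g'. \<Sum>i<p. (cmod (\<Sum>l<g. b j l i))\<^sup>2) = (\<Sum>j<g'. (real g)\<^sup>2 * S j)"
  proof (rule sum.cong[OF refl])
    fix j assume "j \<in> {..<g'}"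
    then have j: "j < g'" by simp
    have "(cmod (\<Sum>l<g. b j l i))\<^sup>2 = (real g)\<^sup>2 * (cmod (b j 0 i))\<^sup>2" if i: "i < p" for i
    proof -
      have "(\<Sum>l<g. b j l i) = (\<Sum>l<g. b j 0 i)"
        by (rule sum.cong[OF refl], rule const[OF j _ _ i]) (use pos in auto)
      then show ?thesis by (simp add: norm_mult power_mult_distrib)
    qed
    then show "(\<Sum>i<p. (cmod (\<Sum>l<g. b j l i))\<^sup>2) = (real g)\<^sup>2 * S j"
      by (simp add: S_def sum_distrib_left)
  qed
  then have "(real g)\<^sup>2 * (\<Sum>j<g'. S j) = real g' * real g"
    using eq by (simp add: sum_distrib_left)
  then have sumS: "real g * (\<Sum>j<g'. S j) = real g'"
    using pos by (simp add: power2_eq_square)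
  have gS: "real g * S j \<le> 1" if j: "j < g'" for j
  proof -
    have "real g * S j = (\<Sum>l<g. S j)" by simp
    also have "\<dots> \<le> (\<Sum>l<g. t l)" using le[OF j] Sl[OF j] by (intro sum_mono) auto
    finally show ?thesis using tot by simp
  qed
  have gS1: "real g * S j = 1" if j: "j < g'" for j
  proof -
    have "1 - real g * S j \<le> (\<Sum>j<g'. 1 - real g * S j)"
      using j gS by (intro member_le_sum[of j _ "\<lambda>j. 1 - real g * S j"]) auto
    also have "\<dots> = 0" using sumS by (simp add: sum_subtractf sum_distrib_left)
    finally show ?thesis using gS[OF j] by simp
  qed
  show S1: "(\<Sum>i<p. (cmod (b j l i))\<^sup>2) = 1 / g" if j: "j < g'" "l < g" for j l
    using gS1[OF j(1)] Sl[OF j] pos by (simp add: field_simps)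
  have tl: "1 / g \<le> t l" if l: "l < g" for l
    using le[of 0 l] S1[of 0 l] pos l by simp
  show "t l = 1 / g" if l: "l < g" for l
  proof -
    have "t l - 1 / g \<le> (\<Sum>l<g. t l - 1 / g)"
      using l tl by (intro member_le_sum[of l _ "\<lambda>l. t l - 1 / g"]) auto
    also have "\<dots> \<le> 0" using tot pos by (simp add: sum_subtractf)
    finally show ?thesis using tl[OF l] by simp
  qed
qed

context normalized_ball_map
begin

text \<open>The test matrix is the rank one matrix of size \<open>g' + g\<close> with blocks
  \<open>(g' g)\<^sup>-\<^sup>1\<^sup>/\<^sup>2 e\<^sub>j (e\<^bsub>g'+l\<^esub>)\<^sup>*\<close>.  Its blocks have zero products, so that the boundary condition says that the
  linear part there has norm one.\<close>

lemma extremal_vectors: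
  obtains \<xi> \<zeta> where "\<And>l. l < g \<Longrightarrow> \<xi> l \<in> carrier_vec q" "\<And>l. l < g \<Longrightarrow> sqn (\<xi> l) = 1"
    "\<And>j. j < g' \<Longrightarrow> \<zeta> j \<in> carrier_vec p" "\<And>j. j < g' \<Longrightarrow> sqn (\<zeta> j) = 1"
    "\<And>j l. j < g' \<Longrightarrow> l < g \<Longrightarrow> a [(j, l)] *\<^sub>v \<xi> l = \<zeta> j"
proof -
  define N where "N = g' + g"
  define s where "s = 1 / sqrt (real (g' * g))"
  have s: "s > 0" "s\<^sup>2 = 1 / real (g' * g)" using pos by (simp_all add: s_def power_divide)
  define B where "B j l x y = (if x = j \<and> y = g' + l then complex_of_real s else 0)" for j l x y :: nat
  define X where "X = block_mat g' g N B"
  have Xc: "X \<in> carrier_mat (g' * N) (g * N)" by (simp add: X_def)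
  have Xi: "X $$ (j * N + x, l * N + y) = B j l x y" if "j < g'" "x < N" "l < g" "y < N" for j l x y
    using that unfolding X_def by (rule block_mat_index)
  have N1: "N \<ge> 1" using pos by (simp add: N_def)
  have le: "op_norm X \<le> 1"
  proof (rule op_norm_Frobenius[OF Xc])
    have "(\<Sum>r<g' * N. \<Sum>c<g * N. (cmod (X $$ (r, c)))\<^sup>2)
        = (\<Sum>j<g'. \<Sum>x<N. \<Sum>l<g. \<Sum>y<N. (cmod (B j l x y))\<^sup>2)"
      unfolding sum_lessThan_mult by (intro sum.cong refl) (simp add: Xi)
    also have "\<dots> = (\<Sum>j<g'. \<Sum>x<N. if x = j then real g * s\<^sup>2 else 0)"
    proof (intro sum.cong refl)
      fix j x
      have "(\<Sum>y<N. (cmod (B j l x y))\<^sup>2) = (if x = j then s\<^sup>2 else 0)" if "l < g" for l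
      proof -
        have "(\<Sum>y<N. (cmod (B j l x y))\<^sup>2) = (\<Sum>y<N. if y = g' + l then (if x = j then s\<^sup>2 else 0) else 0)"
          by (intro sum.cong refl) (simp add: B_def)
        then show ?thesis using that by (simp add: N_def)
      qed
      then show "(\<Sum>l<g. \<Sum>y<N. (cmod (B j l x y))\<^sup>2) = (if x = j then real g * s\<^sup>2 else 0)" by simp
    qed
    also have "\<dots> = real g' * (real g * s\<^sup>2)" by (simp add: N_def)
    finally show "(\<Sum>r<g' * N. \<Sum>c<g * N. (cmod (X $$ (r, c)))\<^sup>2) \<le> 1\<^sup>2"
      using s(2) pos by simp
  qed simp
  define e where "e = vec (g * N) (\<lambda>c. if c mod N = g' + c div N then (1 :: complex) else 0)"
  have e: "e \<in> carrier_vec (g * N)" by (simp add: e_def)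
  have ei: "e $ (l * N + y) = (if y = g' + l then 1 else 0)" if "l < g" "y < N" for l y
    using that by (simp add: e_def block_index_less)
  have se: "sqn e = real g"
  proof -
    have "sqn e = (\<Sum>l<g. \<Sum>y<N. (cmod (e $ (l * N + y)))\<^sup>2)"
      unfolding sqn_def carrier_vecD[OF e] by (rule sum_lessThan_mult)
    also have "\<dots> = (\<Sum>l<g. \<Sum>y<N. if y = g' + l then 1 else 0)"
      by (intro sum.cong refl) (simp add: ei)
    also have "\<dots> = real g" by (simp add: N_def)
    finally show ?thesis .
  qed
  have Xe: "(X *\<^sub>v e) $ (j * N + x) = (if x = j then of_real (real g * s) else 0)" if j: "j < g'" "x < N" for j x
  proof -
    have "(X *\<^sub>v e) $ (j * N + x) = (\<Sum>l<g. \<Sum>y<N. X $$ (j * N + x, l * N + y) * e $ (l * N + y))"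
      using mult_mat_vec_index_sum[OF Xc e block_index_less[OF j]] by (simp only: sum_lessThan_mult)
    also have "\<dots> = (\<Sum>l<g. \<Sum>y<N. if y = g' + l then (if x = j then of_real s else 0) else 0)"
      using j by (intro sum.cong refl) (simp add: Xi ei B_def)
    also have "\<dots> = (if x = j then of_real (real g * s) else 0)" by (simp add: N_def)
    finally show ?thesis .
  qed
  have sXe: "sqn (X *\<^sub>v e) = real g"
  proof -
    have "sqn (X *\<^sub>v e) = (\<Sum>j<g'. \<Sum>x<N. (cmod ((X *\<^sub>v e) $ (j * N + x)))\<^sup>2)"
      unfolding sqn_def carrier_vecD[OF mult_mat_vec_carrier[OF Xc e]] by (rule sum_lessThan_mult)
    also have "\<dots> = (\<Sum>j<g'. \<Sum>x<N. if x = j then (real g * s)\<^sup>2 else 0)"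
    proof (intro sum.cong refl)
      fix j x assume "j \<in> {..<g'}" "x \<in> {..<N}"
      then show "(cmod ((X *\<^sub>v e) $ (j * N + x)))\<^sup>2 = (if x = j then (real g * s)\<^sup>2 else 0)"
        using Xe[of j x] s(1) by (simp add: norm_mult power_mult_distrib del: index_mult_mat_vec)
    qed
    also have "\<dots> = real g' * (real g * s)\<^sup>2" by (simp add: N_def)
    also have "\<dots> = real g" using pos by (simp add: power_mult_distrib s(2)) (simp add: power2_eq_square field_simps)
    finally show ?thesis .
  qed
  have "e \<noteq> 0\<^sub>v (g * N)" using se pos by auto
  then have "1 \<le> op_norm X" by (rule op_norm_ge_1I[OF Xc e]) (simp add: se sXe)
  then have X1: "op_norm X = 1" using le by simp
  have nil: "word_eval N w X = 0\<^sub>m N N" if w: "set w \<subseteq> {..<g'} \<times> {..<g}" "2 \<le> length w" for w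
  proof (rule eq_matI)
    let ?lev = "\<lambda>x. if x < g' then 0 else (1 :: nat)"
    fix x y assume "x < dim_row (0\<^sub>m N N :: complex mat)" "y < dim_col (0\<^sub>m N N :: complex mat)"
    then have xy: "x < N" "y < N" by auto
    have lev: "?lev x < ?lev y"
      if "jl \<in> {..<g'} \<times> {..<g}" "x < N" "y < N" "nc_block N X jl $$ (x, y) \<noteq> 0" for jl x y
      using that nc_block_block_mat[of "fst jl" g' "snd jl" g x N y B]
      by (auto simp: X_def B_def split: if_splits)
    show "word_eval N w X $$ (x, y) = 0\<^sub>m N N $$ (x, y)"
    proof (rule ccontr)
      assume "\<not> ?thesis"
      then have "word_eval N w X $$ (x, y) \<noteq> 0" using xy by simp
      from word_eval_level[OF lev w(1) xy this] have "?lev x + length w \<le> ?lev y" .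
      then show False using w(2) by (auto split: if_splits)
    qed
  qed auto
  define L where "L = hom N X 1"
  have Lc: "L \<in> carrier_mat (p * N) (q * N)" by (simp add: L_def)
  have slice: "\<phi> N (complex_of_real r \<cdot>\<^sub>m X) $$ (i, j) = L $$ (i, j) * complex_of_real r"
    if r: "r \<in> {0<..<1}" and ij: "i < p * N" "j < q * N" for r i j
  proof -
    have h0: "hom N X 0 $$ (i, j) = 0" using ij by (simp add: homog_0 zero)
    have z: "cmod (complex_of_real r) < 1" using r by simp
    have "\<phi> N (complex_of_real r \<cdot>\<^sub>m X) $$ (i, j) = (\<Sum>\<alpha><2. hom N X \<alpha> $$ (i, j) * complex_of_real r ^ \<alpha>)"
      by (rule slice_nilpotent[OF N1 Xc le nil ij z])
    also have "{..<2 :: nat} = {0, 1}" by auto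
    finally show ?thesis using h0 by (simp add: L_def)
  qed
  have "(0 :: real) < 1" by simp
  note ev = eventually_at_left_real[OF this]
  have evc: "eventually (\<lambda>r. \<phi> N (complex_of_real r \<cdot>\<^sub>m X) \<in> carrier_mat (p * N) (q * N)) (at_left 1)"
    using ev by eventually_elim (rule slice_contraction(1)[OF N1 Xc le], simp)
  have "mat_tendsto (\<lambda>r. \<phi> N (complex_of_real r \<cdot>\<^sub>m X)) L (at_left 1)"
    unfolding op_norm_tendsto_0_iff[OF evc Lc]
  proof (intro allI impI)
    fix i j assume ij: "i < p * N" "j < q * N"
    have "((\<lambda>r. L $$ (i, j) * complex_of_real r) \<longlongrightarrow> L $$ (i, j) * complex_of_real 1) (at_left 1)"
      by (intro tendsto_intros)
    moreover have "eventually (\<lambda>r. L $$ (i, j) * complex_of_real r = \<phi> N (complex_of_real r \<cdot>\<^sub>m X) $$ (i, j)) (at_left 1)"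
      using ev by eventually_elim (simp add: slice[OF _ ij])
    ultimately show "((\<lambda>r. \<phi> N (complex_of_real r \<cdot>\<^sub>m X) $$ (i, j)) \<longlongrightarrow> L $$ (i, j)) (at_left 1)"
      by (auto intro: Lim_transform_eventually)
  qed
  then have L1: "op_norm L = 1"
    by (intro boundary[OF N1 _ Lc]) (simp_all add: nc_bdry_ball_def Xc X1)
  obtain u where u: "u \<in> carrier_vec (q * N)" "sqn u = 1" "sqn (L *\<^sub>v u) = 1"
    using op_norm_1_attained[OF Lc L1] .
  define \<xi> where "\<xi> l = vec q (\<lambda>k. u $ (k * N + (g' + l)))" for l
  have \<xi>: "\<xi> l \<in> carrier_vec q" for l by (simp add: \<xi>_def)
  define b where "b j l i = (a [(j, l)] *\<^sub>v \<xi> l) $ i" for j l i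
  have b_sum: "b j l i = (\<Sum>k<q. a [(j, l)] $$ (i, k) * u $ (k * N + (g' + l)))" if "i < p" for j l i
    unfolding b_def by (subst mult_mat_vec_index_sum[OF a_carrier \<xi> that]) (simp add: \<xi>_def)
  have Li: "L $$ (i * N + x, k * N + y) = (\<Sum>j<g'. \<Sum>l<g. a [(j, l)] $$ (i, k) * B j l x y)"
    if i: "i < p" "x < N" "k < q" "y < N" for i x k y
    unfolding L_def One_nat_def homog_index[OF a_carrier i] sum_nc_words_1 word_eval_single X_def
    using i by (intro sum.cong refl) (simp add: nc_block_block_mat)
  have Lu: "(L *\<^sub>v u) $ (i * N + x) = (if x < g' then of_real s * (\<Sum>l<g. b x l i) else 0)"
    if i: "i < p" "x < N" for i x
  proof -
    have "(L *\<^sub>v u) $ (i * N + x) = (\<Sum>k<q. \<Sum>y<N. L $$ (i * N + x, k * N + y) * u $ (k * N + y))"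
      using mult_mat_vec_index_sum[OF Lc u(1) block_index_less[OF i]] by (simp only: sum_lessThan_mult)
    also have "\<dots> = (\<Sum>k<q. \<Sum>y<N. \<Sum>j<g'. \<Sum>l<g. a [(j, l)] $$ (i, k) * B j l x y * u $ (k * N + y))"
      using i by (intro sum.cong refl) (simp add: Li sum_distrib_right)
    also have "\<dots> = (\<Sum>k<q. \<Sum>y<N. \<Sum>j<g'. if j = x then (\<Sum>l<g. if y = g' + l then a [(x, l)] $$ (i, k) * of_real s * u $ (k * N + y) else 0) else 0)"
      by (intro sum.cong refl) (auto simp: B_def intro!: sum.cong sum.neutral)
    also have "\<dots> = (\<Sum>k<q. \<Sum>y<N. if x < g' then (\<Sum>l<g. if y = g' + l then a [(x, l)] $$ (i, k) * of_real s * u $ (k * N + y) else 0) else 0)"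
      by (intro sum.cong refl) (simp add: sum.delta)
    also have "\<dots> = (if x < g' then of_real s * (\<Sum>l<g. b x l i) else 0)"
    proof (cases "x < g'")
      case True
      have "(\<Sum>k<q. \<Sum>y<N. \<Sum>l<g. if y = g' + l then a [(x, l)] $$ (i, k) * of_real s * u $ (k * N + y) else 0)
          = (\<Sum>k<q. \<Sum>l<g. \<Sum>y<N. if y = g' + l then a [(x, l)] $$ (i, k) * of_real s * u $ (k * N + y) else 0)"
        by (rule sum.cong[OF refl], rule sum.swap)
      also have "\<dots> = (\<Sum>k<q. \<Sum>l<g. a [(x, l)] $$ (i, k) * of_real s * u $ (k * N + (g' + l)))"
        by (intro sum.cong refl) (simp add: N_def)
      also have "\<dots> = (\<Sum>l<g. \<Sum>k<q. of_real s * (a [(x, l)] $$ (i, k) * u $ (k * N + (g' + l))))"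
        by (rule trans[OF sum.swap]) (intro sum.cong refl, simp)
      also have "\<dots> = of_real s * (\<Sum>l<g. b x l i)"
        by (simp add: b_sum[OF i(1)] sum_distrib_left)
      finally show ?thesis using True by simp
    qed simp
    finally show ?thesis .
  qed
  have "1 = (\<Sum>i<p. \<Sum>x<N. (cmod ((L *\<^sub>v u) $ (i * N + x)))\<^sup>2)"
    unfolding u(3)[symmetric] unfolding sqn_def carrier_vecD[OF mult_mat_vec_carrier[OF Lc u(1)]]
    by (rule sum_lessThan_mult)
  also have "\<dots> = (\<Sum>i<p. \<Sum>x<N. if x < g' then s\<^sup>2 * (cmod (\<Sum>l<g. b x l i))\<^sup>2 else 0)"
  proof (intro sum.cong refl)
    fix i x assume "i \<in> {..<p}" "x \<in> {..<N}"
    then show "(cmod ((L *\<^sub>v u) $ (i * N + x)))\<^sup>2 = (if x < g' then s\<^sup>2 * (cmod (\<Sum>l<g. b x l i))\<^sup>2 else 0)"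
      using Lu[of i x] by (simp add: norm_mult power_mult_distrib del: index_mult_mat_vec)
  qed
  also have "\<dots> = (\<Sum>i<p. \<Sum>x<g'. s\<^sup>2 * (cmod (\<Sum>l<g. b x l i))\<^sup>2)"
    by (intro sum.cong refl sum.mono_neutral_cong_right) (auto simp: N_def)
  also have "\<dots> = s\<^sup>2 * (\<Sum>j<g'. \<Sum>i<p. (cmod (\<Sum>l<g. b j l i))\<^sup>2)"
    by (subst sum.swap) (simp add: sum_distrib_left)
  finally have tot: "(\<Sum>j<g'. \<Sum>i<p. (cmod (\<Sum>l<g. b j l i))\<^sup>2) = real (g' * g)"
    using s(2) pos by (simp add: field_simps)
  have sq: "(\<Sum>i<p. (cmod (b j l i))\<^sup>2) = sqn (a [(j, l)] *\<^sub>v \<xi> l)" for j l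
    using carrier_matD(1)[OF a_carrier[of "[(j, l)]"]] by (simp add: b_def sqn_def del: index_mult_mat_vec)
  have bound: "(\<Sum>i<p. (cmod (b j l i))\<^sup>2) \<le> sqn (\<xi> l)" if "j < g'" "l < g" for j l
    unfolding sq by (rule column_bound(1)[of _ l]) (use that \<xi> in auto)
  have sum1: "(\<Sum>l<g. sqn (\<xi> l)) \<le> 1"
  proof -
    have "(\<Sum>l<g. sqn (\<xi> l)) = (\<Sum>k<q. \<Sum>l<g. (cmod (u $ (k * N + (g' + l))))\<^sup>2)"
      by (simp add: sqn_def \<xi>_def) (rule sum.swap)
    also have "\<dots> \<le> (\<Sum>k<q. \<Sum>y<N. (cmod (u $ (k * N + y)))\<^sup>2)"
    proof (rule sum_mono)
      fix k
      have "(\<Sum>l<g. (cmod (u $ (k * N + (g' + l))))\<^sup>2) = (\<Sum>y\<in>(\<lambda>l. g' + l) ` {..<g}. (cmod (u $ (k * N + y)))\<^sup>2)"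
        by (subst sum.reindex) (auto simp: inj_on_def)
      also have "\<dots> \<le> (\<Sum>y<N. (cmod (u $ (k * N + y)))\<^sup>2)"
        by (rule sum_mono2) (auto simp: N_def)
      finally show "(\<Sum>l<g. (cmod (u $ (k * N + (g' + l))))\<^sup>2) \<le> (\<Sum>y<N. (cmod (u $ (k * N + y)))\<^sup>2)" .
    qed
    also have "\<dots> = sqn u"
      unfolding sqn_def carrier_vecD[OF u(1)] by (rule sum_lessThan_mult[symmetric])
    finally show ?thesis using u(2) by simp
  qed
  note eqs = Cauchy_Schwarz_equality_case[OF pos bound sum1 tot]
  define c where "c = complex_of_real (sqrt (real g))"
  have c2: "(cmod c)\<^sup>2 = real g" by (simp add: c_def)
  show ?thesis
  proof (rule that[of "\<lambda>l. c \<cdot>\<^sub>v \<xi> l" "\<lambda>j. a [(j, 0)] *\<^sub>v (c \<cdot>\<^sub>v \<xi> 0)"])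
    fix j l
    show "c \<cdot>\<^sub>v \<xi> l \<in> carrier_vec q" using \<xi> by simp
    show "l < g \<Longrightarrow> sqn (c \<cdot>\<^sub>v \<xi> l) = 1" using eqs(3)[of l] pos by (simp add: sqn_smult c2)
    show "a [(j, 0)] *\<^sub>v (c \<cdot>\<^sub>v \<xi> 0) \<in> carrier_vec p"
      by (rule mult_mat_vec_carrier[OF a_carrier]) (use \<xi> in simp)
    have av: "a w *\<^sub>v (c \<cdot>\<^sub>v \<xi> l) = c \<cdot>\<^sub>v (a w *\<^sub>v \<xi> l)" for w l
      by (rule mult_mat_vec[OF a_carrier \<xi>])
    show "sqn (a [(j, 0)] *\<^sub>v (c \<cdot>\<^sub>v \<xi> 0)) = 1" if "j < g'"
      using eqs(2)[of j 0] that pos by (simp add: av sqn_smult c2 sq)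
    assume jl: "j < g'" "l < g"
    have "a [(j, l)] *\<^sub>v \<xi> l = a [(j, 0)] *\<^sub>v \<xi> 0"
    proof (rule eq_vecI)
      fix i assume "i < dim_vec (a [(j, 0)] *\<^sub>v \<xi> 0)"
      then have "i < p" using carrier_matD(1)[OF a_carrier[of "[(j, 0)]"]] by simp
      then show "(a [(j, l)] *\<^sub>v \<xi> l) $ i = (a [(j, 0)] *\<^sub>v \<xi> 0) $ i"
        using eqs(1)[of j l 0 i] jl pos unfolding b_def by simp
    qed (use carrier_matD(1)[OF a_carrier] in simp)
    then show "a [(j, l)] *\<^sub>v (c \<cdot>\<^sub>v \<xi> l) = a [(j, 0)] *\<^sub>v (c \<cdot>\<^sub>v \<xi> 0)"
      by (simp only: av)
  qed
qed

text \<open>On the extremal vectors the map is \<open>x\<close>, and no other word contributes.\<close>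

lemma extremal_structure:
  obtains \<xi> \<zeta> where "\<And>l. l < g \<Longrightarrow> \<xi> l \<in> carrier_vec q" "\<And>j. j < g' \<Longrightarrow> \<zeta> j \<in> carrier_vec p"
    "\<And>l m. l < g \<Longrightarrow> m < g \<Longrightarrow> \<xi> l \<bullet>c \<xi> m = of_bool (l = m)"
    "\<And>j k. j < g' \<Longrightarrow> k < g' \<Longrightarrow> \<zeta> j \<bullet>c \<zeta> k = of_bool (j = k)"
    "\<And>j l. j < g' \<Longrightarrow> l < g \<Longrightarrow> a [(j, l)] *\<^sub>v \<xi> l = \<zeta> j"
    "\<And>j l. j < g' \<Longrightarrow> l < g \<Longrightarrow> mat_adjoint (a [(j, l)]) *\<^sub>v \<zeta> j = \<xi> l"
    "\<And>w m. set w \<subseteq> {..<g'} \<times> {..<g} \<Longrightarrow> m < g \<Longrightarrow> (\<And>j. w \<noteq> [(j, m)]) \<Longrightarrow> a w *\<^sub>v \<xi> m = 0\<^sub>v p"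
    "\<And>w k. set w \<subseteq> {..<g'} \<times> {..<g} \<Longrightarrow> k < g' \<Longrightarrow> (\<And>l. w \<noteq> [(k, l)]) \<Longrightarrow> mat_adjoint (a w) *\<^sub>v \<zeta> k = 0\<^sub>v q"
proof -
  obtain \<xi> \<zeta> where \<xi>: "\<And>l. l < g \<Longrightarrow> \<xi> l \<in> carrier_vec q" "\<And>l. l < g \<Longrightarrow> sqn (\<xi> l) = 1"
    and \<zeta>: "\<And>j. j < g' \<Longrightarrow> \<zeta> j \<in> carrier_vec p" "\<And>j. j < g' \<Longrightarrow> sqn (\<zeta> j) = 1"
    and a\<xi>: "\<And>j l. j < g' \<Longrightarrow> l < g \<Longrightarrow> a [(j, l)] *\<^sub>v \<xi> l = \<zeta> j"
    using extremal_vectors by blast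
  have contr: "op_norm (a [(j, l)]) \<le> 1" if "j < g'" "l < g" for j l
    unfolding contraction_iff[OF a_carrier]
    by (intro ballI column_bound(1)[of "[(j, l)]" 0]) (use that pos in auto)
  have a\<zeta>: "mat_adjoint (a [(j, l)]) *\<^sub>v \<zeta> j = \<xi> l" if "j < g'" "l < g" for j l
    using contraction_isometric_vec[OF a_carrier contr[OF that] \<xi>(1)[OF that(2)]] a\<xi>[OF that] \<xi>(2)[OF that(2)] \<zeta>(2)[OF that(1)]
    by simp
  have col0: "a w *\<^sub>v \<xi> m = 0\<^sub>v p"
    if w: "set w \<subseteq> {..<g'} \<times> {..<g}" and m: "m < g" and ne: "\<And>j. w \<noteq> [(j, m)]" for w m
  proof (cases "w = []")
    case True
    then show ?thesis using zero_mat_mult_vec[OF \<xi>(1)[OF m]] by (simp add: zero)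
  next
    case False
    obtain j where "j < g'" "sqn (a w *\<^sub>v \<xi> m) + sqn (a [(j, m)] *\<^sub>v \<xi> m) \<le> sqn (\<xi> m)"
      using column_bound(2)[OF w False m \<xi>(1)[OF m] ne] by blast
    then have "sqn (a w *\<^sub>v \<xi> m) = 0"
      using a\<xi>[of j m] \<zeta>(2)[of j] \<xi>(2)[OF m] m sqn_nonneg[of "a w *\<^sub>v \<xi> m"] by simp
    then show ?thesis
      by (simp only: sqn_0_iff[OF mult_mat_vec_carrier[OF a_carrier \<xi>(1)[OF m]]])
  qed
  have row0: "mat_adjoint (a w) *\<^sub>v \<zeta> k = 0\<^sub>v q"
    if w: "set w \<subseteq> {..<g'} \<times> {..<g}" and k: "k < g'" and ne: "\<And>l. w \<noteq> [(k, l)]" for w k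
  proof (cases "w = []")
    case True
    have "mat_adjoint (0\<^sub>m p q :: complex mat) = 0\<^sub>m q p" by (intro eq_matI) auto
    then show ?thesis using zero_mat_mult_vec[OF \<zeta>(1)[OF k], of q] True by (simp add: zero)
  next
    case False
    obtain l where "l < g" "sqn (mat_adjoint (a w) *\<^sub>v \<zeta> k) + sqn (mat_adjoint (a [(k, l)]) *\<^sub>v \<zeta> k) \<le> sqn (\<zeta> k)"
      using row_bound[OF w False k \<zeta>(1)[OF k] ne] by blast
    then have "sqn (mat_adjoint (a w) *\<^sub>v \<zeta> k) = 0"
      using a\<zeta>[of k l] \<xi>(2)[of l] \<zeta>(2)[OF k] k sqn_nonneg[of "mat_adjoint (a w) *\<^sub>v \<zeta> k"] by simp
    then show ?thesis
      by (simp only: sqn_0_iff[OF mult_mat_vec_carrier[OF mat_adjoint_carrier[OF a_carrier] \<zeta>(1)[OF k]]])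
  qed
  have orth\<xi>: "\<xi> l \<bullet>c \<xi> m = of_bool (l = m)" if lm: "l < g" "m < g" for l m
  proof (cases "l = m")
    case True
    then show ?thesis using \<xi>(2)[OF lm(1)] by (simp add: cscalar_prod_self)
  next
    case False
    have j: "0 < g'" using pos by simp
    have "\<xi> m \<bullet>c \<xi> l = \<xi> m \<bullet>c (mat_adjoint (a [(0, l)]) *\<^sub>v \<zeta> 0)" by (simp only: a\<zeta>[OF j lm(1)])
    also have "\<dots> = (a [(0, l)] *\<^sub>v \<xi> m) \<bullet>c \<zeta> 0"
      by (rule cscalar_prod_adjoint[OF a_carrier \<xi>(1)[OF lm(2)] \<zeta>(1)[OF j], symmetric])
    also have "a [(0, l)] *\<^sub>v \<xi> m = 0\<^sub>v p" by (rule col0) (use False lm j in auto)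
    also have "0\<^sub>v p \<bullet>c \<zeta> 0 = 0" using \<zeta>(1)[OF j] by simp
    finally show ?thesis
      using cscalar_prod_commute[OF \<xi>(1)[OF lm(2)] \<xi>(1)[OF lm(1)]] False by simp
  qed
  have orth\<zeta>: "\<zeta> j \<bullet>c \<zeta> k = of_bool (j = k)" if jk: "j < g'" "k < g'" for j k
  proof (cases "j = k")
    case True
    then show ?thesis using \<zeta>(2)[OF jk(1)] by (simp add: cscalar_prod_self)
  next
    case False
    have l: "0 < g" using pos by simp
    have "\<zeta> j \<bullet>c \<zeta> k = (a [(j, 0)] *\<^sub>v \<xi> 0) \<bullet>c \<zeta> k" by (simp only: a\<xi>[OF jk(1) l])
    also have "\<dots> = \<xi> 0 \<bullet>c (mat_adjoint (a [(j, 0)]) *\<^sub>v \<zeta> k)"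
      by (rule cscalar_prod_adjoint[OF a_carrier \<xi>(1)[OF l] \<zeta>(1)[OF jk(2)]])
    also have "mat_adjoint (a [(j, 0)]) *\<^sub>v \<zeta> k = 0\<^sub>v q" by (rule row0) (use False jk l in auto)
    also have "\<xi> 0 \<bullet>c 0\<^sub>v q = 0" using \<xi>(1)[OF l] by simp
    finally show ?thesis using False by simp
  qed
  show ?thesis by (rule that[OF \<xi>(1) \<zeta>(1) orth\<xi> orth\<zeta> a\<xi> a\<zeta> col0 row0])
qed

end

section \<open>Unitary matrices and compressions\<close>

text \<open>Square matrices with a zero row produce both the bound on the size of an orthonormal family and its
  extension by one vector.\<close>

lemma zero_row_kernel:
  fixes A :: "complex mat"
  assumes A: "A \<in> carrier_mat n n" and i: "i < n" and row: "\<And>j. j < n \<Longrightarrow> A $$ (i, j) = 0"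
  obtains v where "v \<in> carrier_vec n" "v \<noteq> 0\<^sub>v n" "A *\<^sub>v v = 0\<^sub>v n"
proof -
  have "transpose_mat A *\<^sub>v unit_vec n i = 0\<^sub>v n"
    using A i row by (intro eq_vecI) (auto simp: mult_mat_vec_def)
  moreover have "(unit_vec n i :: complex vec) \<noteq> 0\<^sub>v n"
    using i by (metis index_unit_vec(1) index_zero_vec(1) zero_neq_one)
  ultimately have "\<exists>v. v \<in> carrier_vec n \<and> v \<noteq> 0\<^sub>v n \<and> transpose_mat A *\<^sub>v v = 0\<^sub>v n"
    by (intro exI[of _ "unit_vec n i"] conjI unit_vec_carrier)
  then have "det (transpose_mat A) = 0"
    using det_0_iff_vec_prod_zero_field[OF transpose_carrier_mat[THEN iffD2, OF A]] by blast
  then have "det A = 0" using det_transpose[OF A] by simp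
  then show ?thesis using det_0_iff_vec_prod_zero_field[OF A] that by blast
qed

lemma orthonormal_card_le:
  fixes e :: "nat \<Rightarrow> complex vec"
  assumes e: "\<And>l. l < m \<Longrightarrow> e l \<in> carrier_vec n"
    and on: "\<And>l k. l < m \<Longrightarrow> k < m \<Longrightarrow> e l \<bullet>c e k = of_bool (l = k)"
  shows "m \<le> n"
proof (rule ccontr)
  assume "\<not> m \<le> n"
  then have nm: "n < m" by simp
  define A where "A = Matrix.mat m m (\<lambda>(i, j). if i < n then e j $ i else 0)"
  have A: "A \<in> carrier_mat m m" by (simp add: A_def)
  have row: "A $$ (n, j) = 0" if "j < m" for j using that nm by (simp add: A_def)
  obtain v where v: "v \<in> carrier_vec m" "v \<noteq> 0\<^sub>v m" "A *\<^sub>v v = 0\<^sub>v m"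
    using zero_row_kernel[OF A nm row] .
  have "v $ k = 0" if k: "k < m" for k
  proof -
    have "(\<Sum>j<m. e j $ i * v $ j) = 0" if i: "i < n" for i
    proof -
      have "(A *\<^sub>v v) $ i = 0" using v(3) i nm by simp
      then have "(\<Sum>j<m. A $$ (i, j) * v $ j) = 0"
        using mult_mat_vec_index_sum[OF A v(1), of i] i nm by simp
      moreover have "(\<Sum>j<m. A $$ (i, j) * v $ j) = (\<Sum>j<m. e j $ i * v $ j)"
        by (rule sum.cong[OF refl]) (use i nm in \<open>simp add: A_def\<close>)
      ultimately show ?thesis by simp
    qed
    then have "0 = (\<Sum>i<n. (\<Sum>j<m. e j $ i * v $ j) * cnj (e k $ i))" by simp
    also have "\<dots> = (\<Sum>i<n. \<Sum>j<m. e j $ i * v $ j * cnj (e k $ i))"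
      by (simp only: sum_distrib_right)
    also have "\<dots> = (\<Sum>j<m. \<Sum>i<n. e j $ i * v $ j * cnj (e k $ i))" by (rule sum.swap)
    also have "\<dots> = (\<Sum>j<m. v $ j * (e j \<bullet>c e k))"
      by (rule sum.cong[OF refl])
         (use e k in \<open>simp add: cscalar_prod_sum[of _ n] sum_distrib_left mult.commute mult.left_commute\<close>)
    also have "\<dots> = (\<Sum>j<m. if j = k then v $ j else 0)"
      by (rule sum.cong[OF refl]) (use on k in simp)
    also have "\<dots> = v $ k" using k by simp
    finally show ?thesis by simp
  qed
  then have "v = 0\<^sub>v m" using v(1) by (intro eq_vecI) auto
  then show False using v(2) by simp
qed

lemma orthonormal_extend_1:
  fixes e :: "nat \<Rightarrow> complex vec"
  assumes e: "\<And>l. l < m \<Longrightarrow> e l \<in> carrier_vec n" and mn: "m < n"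
  obtains v where "v \<in> carrier_vec n" "sqn v = 1" "\<And>l. l < m \<Longrightarrow> v \<bullet>c e l = 0"
proof -
  define A where "A = Matrix.mat n n (\<lambda>(i, j). if i < m then cnj (e i $ j) else 0)"
  have A: "A \<in> carrier_mat n n" by (simp add: A_def)
  have row: "A $$ (m, j) = 0" if "j < n" for j using that mn by (simp add: A_def)
  obtain v where v: "v \<in> carrier_vec n" "v \<noteq> 0\<^sub>v n" "A *\<^sub>v v = 0\<^sub>v n"
    using zero_row_kernel[OF A mn row] .
  have v0: "v \<bullet>c e l = 0" if l: "l < m" for l
  proof -
    have "v \<bullet>c e l = (\<Sum>j<n. v $ j * cnj (e l $ j))" by (rule cscalar_prod_sum[OF v(1) e[OF l]])
    also have "\<dots> = (\<Sum>j<n. A $$ (l, j) * v $ j)"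
      by (rule sum.cong[OF refl]) (use l mn in \<open>simp add: A_def\<close>)
    also have "\<dots> = (A *\<^sub>v v) $ l" using mult_mat_vec_index_sum[OF A v(1), of l] l mn by simp
    also have "\<dots> = 0" using v(3) l mn by simp
    finally show ?thesis .
  qed
  have pos: "sqn v > 0" using v sqn_0_iff[OF v(1)] sqn_nonneg[of v] by linarith
  define c where "c = complex_of_real (1 / sqrt (sqn v))"
  have c: "(cmod c)\<^sup>2 * sqn v = 1"
    using pos by (simp add: c_def norm_divide power_divide)
  show ?thesis
  proof (rule that[of "c \<cdot>\<^sub>v v"])
    show "c \<cdot>\<^sub>v v \<in> carrier_vec n" using v by simp
    show "sqn (c \<cdot>\<^sub>v v) = 1" using c by (simp add: sqn_smult)
    fix l assume l: "l < m"
    have "(c \<cdot>\<^sub>v v) \<bullet>c e l = c * (v \<bullet>c e l)"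
      using v(1) e[OF l] by (simp add: cscalar_prod_sum[of _ n] sum_distrib_left mult.assoc)
    then show "(c \<cdot>\<^sub>v v) \<bullet>c e l = 0" using v0[OF l] by simp
  qed
qed

lemma orthonormal_extend:
  fixes e :: "nat \<Rightarrow> complex vec"
  assumes "\<And>l. l < m \<Longrightarrow> e l \<in> carrier_vec n"
    and "\<And>l k. l < m \<Longrightarrow> k < m \<Longrightarrow> e l \<bullet>c e k = of_bool (l = k)"
    and "m \<le> n"
  shows "\<exists>b. (\<forall>l<n. b l \<in> carrier_vec n) \<and> (\<forall>l<n. \<forall>k<n. b l \<bullet>c b k = of_bool (l = k)) \<and> (\<forall>l<m. b l = e l)"
  using assms
proof (induction "n - m" arbitrary: m e)
  case 0
  then have "m = n" by simp
  then show ?case using 0 by (intro exI[of _ e]) auto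
next
  case (Suc r)
  then have mn: "m < n" by simp
  obtain v where v: "v \<in> carrier_vec n" "sqn v = 1" "\<And>l. l < m \<Longrightarrow> v \<bullet>c e l = 0"
    by (rule orthonormal_extend_1[of m e n]) (use Suc.prems(1) mn that in blast)+
  define e' where "e' l = (if l < m then e l else v)" for l
  have v': "e l \<bullet>c v = 0" if "l < m" for l
    using cscalar_prod_commute[OF v(1) Suc.prems(1)[OF that]] v(3)[OF that] by simp
  have vv: "v \<bullet>c v = 1" by (simp add: cscalar_prod_self v(2))
  have "\<exists>b. (\<forall>l<n. b l \<in> carrier_vec n) \<and> (\<forall>l<n. \<forall>k<n. b l \<bullet>c b k = of_bool (l = k)) \<and> (\<forall>l<Suc m. b l = e' l)"
  proof (rule Suc.hyps(1))
    show "r = n - Suc m" using Suc.hyps(2) by simp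
    show "e' l \<in> carrier_vec n" if "l < Suc m" for l using Suc.prems(1) v(1) by (simp add: e'_def)
    show "e' l \<bullet>c e' k = of_bool (l = k)" if "l < Suc m" "k < Suc m" for l k
      using that Suc.prems(2)[of l k] v(3)[of k] v'[of l] vv by (auto simp: e'_def less_Suc_eq)
    show "Suc m \<le> n" using mn by simp
  qed
  then obtain b where b: "\<forall>l<n. b l \<in> carrier_vec n" "\<forall>l<n. \<forall>k<n. b l \<bullet>c b k = of_bool (l = k)"
    "\<forall>l<Suc m. b l = e' l" by blast
  have "\<forall>l<m. b l = e l" using b(3) by (simp add: e'_def)
  then show ?case using b(1,2) by blast
qed

lemma unitary_completion:
  fixes e :: "nat \<Rightarrow> complex vec"
  assumes e: "\<And>l. l < m \<Longrightarrow> e l \<in> carrier_vec n"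
    and on: "\<And>l k. l < m \<Longrightarrow> k < m \<Longrightarrow> e l \<bullet>c e k = of_bool (l = k)"
  obtains U where "m \<le> n" "unitary_mat n U" "\<And>i l. i < n \<Longrightarrow> l < m \<Longrightarrow> U $$ (i, l) = e l $ i"
proof -
  have mn: "m \<le> n" by (rule orthonormal_card_le[OF e on])
  obtain b where b: "\<And>l. l < n \<Longrightarrow> b l \<in> carrier_vec n"
    "\<And>l k. l < n \<Longrightarrow> k < n \<Longrightarrow> b l \<bullet>c b k = of_bool (l = k)" "\<And>l. l < m \<Longrightarrow> b l = e l"
    using orthonormal_extend[of m e n] e on mn by blast
  define U where "U = Matrix.mat n n (\<lambda>(i, j). b j $ i)"
  have U: "U \<in> carrier_mat n n" by (simp add: U_def)
  have Us: "mat_adjoint U \<in> carrier_mat n n" using U by (rule mat_adjoint_carrier)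
  have 1: "mat_adjoint U * U = 1\<^sub>m n"
  proof (rule eq_matI)
    fix i j assume "i < dim_row (1\<^sub>m n :: complex mat)" "j < dim_col (1\<^sub>m n :: complex mat)"
    then have ij: "i < n" "j < n" by auto
    have "(mat_adjoint U * U) $$ (i, j) = (\<Sum>k<n. mat_adjoint U $$ (i, k) * U $$ (k, j))"
      by (rule mat_mult_index_sum[OF Us U ij])
    also have "\<dots> = (\<Sum>k<n. b j $ k * cnj (b i $ k))"
      by (rule sum.cong[OF refl]) (use ij in \<open>simp add: U_def mult.commute\<close>)
    also have "\<dots> = b j \<bullet>c b i" by (rule cscalar_prod_sum[symmetric, OF b(1) b(1)]) (use ij in auto)
    finally show "(mat_adjoint U * U) $$ (i, j) = 1\<^sub>m n $$ (i, j)" using b(2) ij by auto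
  qed (use U in auto)
  have "U * mat_adjoint U = 1\<^sub>m n" by (rule mat_mult_left_right_inverse[OF Us U 1])
  then have "unitary_mat n U" using U 1 by (simp add: unitary_mat_def)
  moreover have "U $$ (i, l) = e l $ i" if "i < n" "l < m" for i l
    using that mn b(3) by (simp add: U_def)
  ultimately show ?thesis using that mn by blast
qed

lemma unitary_mat_contraction:
  assumes "unitary_mat n U"
  shows "op_norm U \<le> 1"
proof -
  have U: "U \<in> carrier_mat n n" and UU: "mat_adjoint U * U = 1\<^sub>m n" using assms by (auto simp: unitary_mat_def)
  note Us = mat_adjoint_carrier[OF U]
  have "sqn (U *\<^sub>v x) \<le> sqn x" if x: "x \<in> carrier_vec n" for x
  proof -
    have "mat_adjoint U *\<^sub>v (U *\<^sub>v x) = x"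
      by (simp only: assoc_mult_mat_vec[OF Us U x, symmetric] UU one_mult_mat_vec[OF x])
    then have "(U *\<^sub>v x) \<bullet>c (U *\<^sub>v x) = x \<bullet>c x"
      by (simp only: cscalar_prod_adjoint[OF U x mult_mat_vec_carrier[OF U x]])
    then show ?thesis by (simp add: cscalar_prod_self)
  qed
  then show ?thesis using contraction_iff[OF U] by blast
qed

lemma unitary_mat_kron:
  assumes "unitary_mat n U"
  shows "unitary_mat (n * N) (kron U (1\<^sub>m N))"
proof -
  have U: "U \<in> carrier_mat n n" and UU: "U * mat_adjoint U = 1\<^sub>m n" "mat_adjoint U * U = 1\<^sub>m n"
    using assms by (auto simp: unitary_mat_def)
  note Us = mat_adjoint_carrier[OF U]
  have 1: "(1\<^sub>m N :: complex mat) \<in> carrier_mat N N" by simp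
  show ?thesis
    unfolding unitary_mat_def kron_adjoint_1[OF U] kron_mult[OF U Us 1 1] kron_mult[OF Us U 1 1] UU
    using U by (simp add: kron_one_one)
qed

lemma mat_mult_assoc_5:
  assumes A: "A \<in> carrier_mat n0 n1" and B: "B \<in> carrier_mat n1 n2" and M: "M \<in> carrier_mat n2 n3"
    and C: "C \<in> carrier_mat n3 n4" and D: "D \<in> carrier_mat n4 n5"
  shows "A * (B * M * C) * D = (A * B) * M * (C * D)"
proof -
  have BM: "B * M \<in> carrier_mat n1 n3" by (rule mult_carrier_mat[OF B M])
  have ABM: "A * (B * M) \<in> carrier_mat n0 n3" by (rule mult_carrier_mat[OF A BM])
  show ?thesis
    by (simp only: assoc_mult_mat[OF A B M] assoc_mult_mat[OF ABM C D, symmetric] assoc_mult_mat[OF A BM C])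
qed

lemma unitary_conj_iff:
  assumes V: "unitary_mat m V" and U: "unitary_mat n U" and A: "A \<in> carrier_mat m n" and B: "B \<in> carrier_mat m n"
  shows "A = V * B * mat_adjoint U \<longleftrightarrow> mat_adjoint V * A * U = B"
proof -
  have Vc: "V \<in> carrier_mat m m" and VV: "V * mat_adjoint V = 1\<^sub>m m" "mat_adjoint V * V = 1\<^sub>m m"
    and Uc: "U \<in> carrier_mat n n" and UU: "U * mat_adjoint U = 1\<^sub>m n" "mat_adjoint U * U = 1\<^sub>m n"
    using U V by (auto simp: unitary_mat_def)
  note Vs = mat_adjoint_carrier[OF Vc] and Us = mat_adjoint_carrier[OF Uc]
  have "mat_adjoint V * (V * B * mat_adjoint U) * U = B"
    unfolding mat_mult_assoc_5[OF Vs Vc B Us Uc] VV UU using B by simp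
  moreover have "V * (mat_adjoint V * A * U) * mat_adjoint U = A"
    unfolding mat_mult_assoc_5[OF Vc Vs A Uc Us] VV UU using A by simp
  ultimately show ?thesis by auto
qed

lemma kron_compress:
  assumes S: "S \<in> carrier_mat p r" and V: "V \<in> carrier_mat p p" and M: "M \<in> carrier_mat (p * N) (q * N)"
    and U: "U \<in> carrier_mat q q" and T: "T \<in> carrier_mat q t"
  shows "kron (mat_adjoint S * mat_adjoint V) (1\<^sub>m N) * M * kron (U * T) (1\<^sub>m N)
    = kron (mat_adjoint S) (1\<^sub>m N) * (mat_adjoint (kron V (1\<^sub>m N)) * M * kron U (1\<^sub>m N)) * kron T (1\<^sub>m N)"
proof -
  have 1: "(1\<^sub>m N :: complex mat) \<in> carrier_mat N N" by simp
  note Ss = mat_adjoint_carrier[OF S] and Vs = mat_adjoint_carrier[OF V]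
  have k: "kron (mat_adjoint S * mat_adjoint V) (1\<^sub>m N) = kron (mat_adjoint S) (1\<^sub>m N) * kron (mat_adjoint V) (1\<^sub>m N)"
    "kron (U * T) (1\<^sub>m N) = kron U (1\<^sub>m N) * kron T (1\<^sub>m N)"
    by (simp_all add: kron_mult[OF Ss Vs 1 1] kron_mult[OF U T 1 1])
  show ?thesis
    unfolding k kron_adjoint_1[OF V]
    by (rule mat_mult_assoc_5[OF kron_carrier[OF Ss 1] kron_carrier[OF Vs 1] M kron_carrier[OF U 1] kron_carrier[OF T 1], symmetric])
qed

lemma kron_sandwich_index:
  assumes A: "A \<in> carrier_mat r p" and M: "M \<in> carrier_mat (p * N) (q * N)" and B: "B \<in> carrier_mat q s"
    and i: "i < r" "x < N" "k < s" "y < N"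
  shows "(kron A (1\<^sub>m N) * M * kron B (1\<^sub>m N)) $$ (i * N + x, k * N + y)
    = (\<Sum>l<q. (\<Sum>j<p. A $$ (i, j) * M $$ (j * N + x, l * N + y)) * B $$ (l, k))"
proof -
  have 1: "(1\<^sub>m N :: complex mat) \<in> carrier_mat N N" by simp
  have AN: "kron A (1\<^sub>m N) \<in> carrier_mat (r * N) (p * N)" and BN: "kron B (1\<^sub>m N) \<in> carrier_mat (q * N) (s * N)"
    using A B by auto
  note ix = block_index_less[OF i(1,2)] and ky = block_index_less[OF i(3,4)]
  have L: "(kron A (1\<^sub>m N) * M) $$ (i * N + x, c) = (\<Sum>j<p. A $$ (i, j) * M $$ (j * N + x, c))"
    if c: "c < q * N" for c
  proof -
    have "(kron A (1\<^sub>m N) * M) $$ (i * N + x, c)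
        = (\<Sum>j<p. \<Sum>z<N. kron A (1\<^sub>m N) $$ (i * N + x, j * N + z) * M $$ (j * N + z, c))"
      unfolding mat_mult_index_sum[OF AN M ix c] by (rule sum_lessThan_mult)
    also have "\<dots> = (\<Sum>j<p. \<Sum>z<N. if z = x then A $$ (i, j) * M $$ (j * N + z, c) else 0)"
      by (rule sum.cong[OF refl], rule sum.cong[OF refl])
         (use i in \<open>simp add: kron_index[OF A 1]\<close>)
    also have "\<dots> = (\<Sum>j<p. A $$ (i, j) * M $$ (j * N + x, c))" using i by simp
    finally show ?thesis .
  qed
  have "(kron A (1\<^sub>m N) * M * kron B (1\<^sub>m N)) $$ (i * N + x, k * N + y)
      = (\<Sum>l<q. \<Sum>z<N. (kron A (1\<^sub>m N) * M) $$ (i * N + x, l * N + z) * kron B (1\<^sub>m N) $$ (l * N + z, k * N + y))"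
    unfolding mat_mult_index_sum[OF mult_carrier_mat[OF AN M] BN ix ky] by (rule sum_lessThan_mult)
  also have "\<dots> = (\<Sum>l<q. \<Sum>z<N. if z = y then (\<Sum>j<p. A $$ (i, j) * M $$ (j * N + x, l * N + z)) * B $$ (l, k) else 0)"
  proof (rule sum.cong[OF refl], rule sum.cong[OF refl])
    fix l z assume "l \<in> {..<q}" "z \<in> {..<N}"
    then have lz: "l < q" "z < N" by auto
    show "(kron A (1\<^sub>m N) * M) $$ (i * N + x, l * N + z) * kron B (1\<^sub>m N) $$ (l * N + z, k * N + y)
        = (if z = y then (\<Sum>j<p. A $$ (i, j) * M $$ (j * N + x, l * N + z)) * B $$ (l, k) else 0)"
      unfolding L[OF block_index_less[OF lz]] kron_index[OF B 1 lz i(3,4)] using lz i by simp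
  qed
  also have "\<dots> = (\<Sum>l<q. (\<Sum>j<p. A $$ (i, j) * M $$ (j * N + x, l * N + y)) * B $$ (l, k))"
    using i by simp
  finally show ?thesis .
qed

text \<open>The coordinate embedding of \<open>\<complex>\<^sup>k\<close> into \<open>\<complex>\<^sup>n\<close> that skips the first \<open>s\<close> coordinates.\<close>

definition shift_mat :: "nat \<Rightarrow> nat \<Rightarrow> nat \<Rightarrow> complex mat" where
  "shift_mat n s k = Matrix.mat n k (\<lambda>(i, j). of_bool (i = s + j))"

lemma shift_mat_carrier [simp]: "shift_mat n s k \<in> carrier_mat n k"
  by (simp add: shift_mat_def)

lemma op_norm_shift_mat: "op_norm (shift_mat n s k) \<le> 1"
  by (rule op_norm_partial_permutation[OF shift_mat_carrier]) (auto simp: shift_mat_def split: if_splits)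

lemma op_norm_shift_mat_adjoint: "op_norm (mat_adjoint (shift_mat n s k)) \<le> 1"
  by (rule contraction_adjoint[OF shift_mat_carrier op_norm_shift_mat])

text \<open>Sandwiching between coordinate embeddings picks out a block of rows and columns.\<close>

lemma kron_shift_index:
  assumes M: "M \<in> carrier_mat (p * N) (q * N)" and le: "s + r \<le> p" "s' + t \<le> q"
    and i: "i < r" "x < N" "k < t" "y < N"
  shows "(kron (mat_adjoint (shift_mat p s r)) (1\<^sub>m N) * M * kron (shift_mat q s' t) (1\<^sub>m N)) $$ (i * N + x, k * N + y)
    = M $$ ((s + i) * N + x, (s' + k) * N + y)"
proof -
  have "(\<Sum>j<p. mat_adjoint (shift_mat p s r) $$ (i, j) * M $$ (j * N + x, l * N + y))
      = M $$ ((s + i) * N + x, l * N + y)" for l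
  proof -
    have "(\<Sum>j<p. mat_adjoint (shift_mat p s r) $$ (i, j) * M $$ (j * N + x, l * N + y))
        = (\<Sum>j<p. if j = s + i then M $$ (j * N + x, l * N + y) else 0)"
      by (rule sum.cong[OF refl]) (use i in \<open>simp add: shift_mat_def\<close>)
    also have "\<dots> = M $$ ((s + i) * N + x, l * N + y)" using i le by simp
    finally show ?thesis .
  qed
  then have "(kron (mat_adjoint (shift_mat p s r)) (1\<^sub>m N) * M * kron (shift_mat q s' t) (1\<^sub>m N)) $$ (i * N + x, k * N + y)
      = (\<Sum>l<q. M $$ ((s + i) * N + x, l * N + y) * shift_mat q s' t $$ (l, k))"
    by (simp add: kron_sandwich_index[OF mat_adjoint_carrier[OF shift_mat_carrier] M shift_mat_carrier i])
  also have "\<dots> = (\<Sum>l<q. if l = s' + k then M $$ ((s + i) * N + x, l * N + y) else 0)"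
    by (rule sum.cong[OF refl]) (use i in \<open>simp add: shift_mat_def\<close>)
  also have "\<dots> = M $$ ((s + i) * N + x, (s' + k) * N + y)" using i le by simp
  finally show ?thesis .
qed

lemma op_norm_kron_sandwich_le:
  assumes A: "A \<in> carrier_mat r p" "op_norm A \<le> 1" and M: "M \<in> carrier_mat (p * N) (q * N)"
    and B: "B \<in> carrier_mat q s" "op_norm B \<le> 1"
  shows "op_norm (kron A (1\<^sub>m N) * M * kron B (1\<^sub>m N)) \<le> op_norm M"
proof -
  have AN: "kron A (1\<^sub>m N) \<in> carrier_mat (r * N) (p * N)" and BN: "kron B (1\<^sub>m N) \<in> carrier_mat (q * N) (s * N)"
    using A B by auto
  have A1: "op_norm (kron A (1\<^sub>m N)) \<le> 1" using op_norm_kron_1_le[OF A(1), of N] A(2) by linarith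
  have B1: "op_norm (kron B (1\<^sub>m N)) \<le> 1" using op_norm_kron_1_le[OF B(1), of N] B(2) by linarith
  have M0: "op_norm M \<ge> 0" by (rule op_norm_nonneg[OF M])
  have "op_norm (kron A (1\<^sub>m N) * M * kron B (1\<^sub>m N)) \<le> op_norm (kron A (1\<^sub>m N) * M) * op_norm (kron B (1\<^sub>m N))"
    by (rule op_norm_mult_le[OF mult_carrier_mat[OF AN M] BN])
  also have "\<dots> \<le> op_norm (kron A (1\<^sub>m N) * M)"
    by (rule mult_left_le[OF B1 op_norm_nonneg[OF mult_carrier_mat[OF AN M]]])
  also have "\<dots> \<le> op_norm (kron A (1\<^sub>m N)) * op_norm M" by (rule op_norm_mult_le[OF AN M])
  also have "\<dots> \<le> op_norm M" by (rule mult_left_le_one_le[OF M0 op_norm_nonneg[OF AN] A1])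
  finally show ?thesis .
qed

lemma nc_block_diag_carrier:
  assumes "g' \<le> d'" "g \<le> d" "X \<in> carrier_mat (g' * N) (g * N)" "Y \<in> carrier_mat ((d' - g') * N) ((d - g) * N)"
  shows "nc_block_diag g' g d' d N X Y \<in> carrier_mat (d' * N) (d * N)"
proof -
  have "g' * N + (d' - g') * N = d' * N" "g * N + (d - g) * N = d * N"
    using assms by (simp_all add: distrib_right[symmetric])
  then show ?thesis using assms unfolding nc_block_diag_def by (metis four_block_carrier_mat)
qed

lemma nc_block_diag_index:
  assumes le: "g' \<le> d'" "g \<le> d" and X: "X \<in> carrier_mat (g' * N) (g * N)"
    and Y: "Y \<in> carrier_mat ((d' - g') * N) ((d - g) * N)"
    and i: "i < d'" "x < N" "k < d" "y < N"
  shows "nc_block_diag g' g d' d N X Y $$ (i * N + x, k * N + y) =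
    (if i < g' then if k < g then X $$ (i * N + x, k * N + y) else 0
     else if k < g then 0 else Y $$ ((i - g') * N + x, (k - g) * N + y))"
proof -
  have e: "i * N + x < g' * N \<longleftrightarrow> i < g'" "k * N + y < g * N \<longleftrightarrow> k < g"
    using block_index_less[of i g' x N] block_index_less[of k g y N] i
      mult_le_mono1[of g' i N] mult_le_mono1[of g k N] by (meson leD le_trans le_add1 not_less)+
  have D: "g' * N + (d' - g') * N = d' * N" "g * N + (d - g) * N = d * N"
    using le by (simp_all add: distrib_right[symmetric])
  have s: "i * N + x - g' * N = (i - g') * N + x" if "g' \<le> i"
    using that by (simp add: diff_mult_distrib mult_le_mono1)
  have s': "k * N + y - g * N = (k - g) * N + y" if "g \<le> k"
    using that by (simp add: diff_mult_distrib mult_le_mono1)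
  have "i * N + x < d' * N" "k * N + y < d * N" using block_index_less i by auto
  moreover have "(i - g') * N + x < (d' - g') * N" if "g' \<le> i"
    using that i by (intro block_index_less) auto
  moreover have "(k - g) * N + y < (d - g) * N" if "g \<le> k"
    using that i by (intro block_index_less) auto
  ultimately show ?thesis
    unfolding nc_block_diag_def using X Y D e s s' by (auto simp: not_less)
qed

lemma sqn_append_vec: "sqn (x @\<^sub>v y) = sqn x + sqn y"
proof -
  have split: "(\<Sum>i<a + b. f i) = (\<Sum>i<a. f i) + (\<Sum>i<b. f (a + i))" for a b and f :: "nat \<Rightarrow> real"
    by (induction b) (simp_all add: add.assoc)
  show ?thesis by (simp add: sqn_def split)
qed

lemma nc_block_diag_contraction:
  assumes le: "g' \<le> d'" "g \<le> d" and X: "X \<in> carrier_mat (g' * N) (g * N)" "op_norm X \<le> 1"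
    and Y: "Y \<in> carrier_mat ((d' - g') * N) ((d - g) * N)" "op_norm Y \<le> 1"
  shows "op_norm (nc_block_diag g' g d' d N X Y) \<le> 1"
proof (subst contraction_iff[OF nc_block_diag_carrier[OF le X(1) Y(1)]], intro ballI)
  fix z :: "complex vec" assume z: "z \<in> carrier_vec (d * N)"
  have D: "g * N + (d - g) * N = d * N" using le by (simp add: distrib_right[symmetric])
  define u where "u = vec_first z (g * N)"
  define v where "v = vec_last z ((d - g) * N)"
  have u: "u \<in> carrier_vec (g * N)" and v: "v \<in> carrier_vec ((d - g) * N)" by (simp_all add: u_def v_def)
  have zuv: "z = u @\<^sub>v v" using z by (simp add: u_def v_def D)
  have Xu: "X *\<^sub>v u \<in> carrier_vec (g' * N)" and Yv: "Y *\<^sub>v v \<in> carrier_vec ((d' - g') * N)"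
    by (rule mult_mat_vec_carrier[OF X(1) u], rule mult_mat_vec_carrier[OF Y(1) v])
  have "nc_block_diag g' g d' d N X Y *\<^sub>v z = (X *\<^sub>v u) @\<^sub>v (Y *\<^sub>v v)"
    unfolding nc_block_diag_def zuv
    by (subst four_block_mat_mult_vec[OF X(1) zero_carrier_mat zero_carrier_mat Y(1) u v])
       (simp only: zero_mat_mult_vec[OF u] zero_mat_mult_vec[OF v] right_zero_vec[OF Xu] left_zero_vec[OF Yv])
  then show "sqn (nc_block_diag g' g d' d N X Y *\<^sub>v z) \<le> sqn z"
    using contractionD[OF X u] contractionD[OF Y v] unfolding zuv by (simp add: sqn_append_vec)
qed

section \<open>Boundary values and the normal form\<close>

lemma mat_tendsto_contraction:
  assumes ev: "eventually (\<lambda>r. u r \<in> carrier_mat m n \<and> op_norm (u r) \<le> 1) F" and F: "F \<noteq> bot"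
    and L: "L \<in> carrier_mat m n" and lim: "mat_tendsto u L F"
  shows "op_norm L \<le> 1"
proof (subst contraction_iff[OF L], intro ballI)
  fix x :: "complex vec" assume x: "x \<in> carrier_vec n"
  have evc: "eventually (\<lambda>r. u r \<in> carrier_mat m n) F" using ev by eventually_elim simp
  have entry: "((\<lambda>r. u r $$ (i, j)) \<longlongrightarrow> L $$ (i, j)) F" if "i < m" "j < n" for i j
    using lim that unfolding op_norm_tendsto_0_iff[OF evc L] by blast
  define E where "E A = (\<Sum>i<m. (cmod (\<Sum>j<n. A $$ (i, j) * x $ j))\<^sup>2)" for A
  have E: "sqn (A *\<^sub>v x) = E A" if A: "A \<in> carrier_mat m n" for A
    unfolding sqn_def E_def carrier_vecD[OF mult_mat_vec_carrier[OF A x]]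
    by (rule sum.cong[OF refl]) (simp only: lessThan_iff mult_mat_vec_index_sum[OF A x])
  have "((\<lambda>r. E (u r)) \<longlongrightarrow> E L) F"
    unfolding E_def by (intro tendsto_intros entry) auto
  moreover have "eventually (\<lambda>r. E (u r) \<le> sqn x) F"
    using ev by eventually_elim (metis E contractionD x)
  ultimately have "E L \<le> sqn x" by (rule tendsto_upperbound[OF _ _ F])
  then show "sqn (L *\<^sub>v x) \<le> sqn x" by (simp only: E[OF L])
qed

lemma mat_moebius_tendsto:
  fixes F :: "'r filter"
  assumes c: "c \<in> carrier_mat m n" "op_norm c < 1"
    and ev: "eventually (\<lambda>r. u r \<in> carrier_mat m n \<and> op_norm (u r) \<le> 1) F" and F: "F \<noteq> bot"
    and L: "L \<in> carrier_mat m n" and lim: "mat_tendsto u L F"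
  shows "mat_tendsto (\<lambda>r. mat_moebius c (u r)) (mat_moebius c L) F"
proof -
  have evc: "eventually (\<lambda>r. u r \<in> carrier_mat m n) F" using ev by eventually_elim simp
  have L1: "op_norm L \<le> 1" by (rule mat_tendsto_contraction[OF ev F L lim])
  define R where "R = {r. u r \<in> carrier_mat m n \<and> op_norm (u r) \<le> 1}"
  have evR: "eventually (\<lambda>r. r \<in> R) F" using ev by (simp add: R_def)
  define u' where "u' = case_option L u"
  interpret A: function_algebra "insert None (Some ` R)" "\<lambda>h :: 'r option \<Rightarrow> complex. ((\<lambda>r. h (Some r)) \<longlongrightarrow> h None) F"
    by (rule tendsto_function_algebra[OF evR])
  have u': "A.mat_in m n u'"
    using lim L unfolding op_norm_tendsto_0_iff[OF evc L] A.mat_in_def by (auto simp: u'_def R_def)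
  have "op_norm (u' z) \<le> 1" if "z \<in> insert None (Some ` R)" for z
    using that L1 by (auto simp: u'_def R_def)
  then have "A.mat_in m n (\<lambda>z. mat_moebius c (u' z))" by (rule A.mat_in_mat_moebius[OF c u'])
  then have "\<forall>i<m. \<forall>j<n. ((\<lambda>r. mat_moebius c (u r) $$ (i, j)) \<longlongrightarrow> mat_moebius c L $$ (i, j)) F"
    by (simp add: A.mat_in_def u'_def)
  then show ?thesis
    by (subst op_norm_tendsto_0_iff[of _ m n]) (simp_all add: c)
qed

lemma kron_sandwich_tendsto:
  assumes A: "A \<in> carrier_mat r p" and B: "B \<in> carrier_mat q s"
    and evc: "eventually (\<lambda>z. u z \<in> carrier_mat (p * N) (q * N)) F"
    and L: "L \<in> carrier_mat (p * N) (q * N)" and lim: "mat_tendsto u L F"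
    and i: "i < r" "x < N" "k < s" "y < N"
  shows "((\<lambda>z. (kron A (1\<^sub>m N) * u z * kron B (1\<^sub>m N)) $$ (i * N + x, k * N + y))
    \<longlongrightarrow> (kron A (1\<^sub>m N) * L * kron B (1\<^sub>m N)) $$ (i * N + x, k * N + y)) F"
proof -
  have entry: "((\<lambda>z. u z $$ (j * N + x, l * N + y)) \<longlongrightarrow> L $$ (j * N + x, l * N + y)) F" if "j < p" "l < q" for j l
    using lim block_index_less[OF that(1) i(2)] block_index_less[OF that(2) i(4)]
    unfolding op_norm_tendsto_0_iff[OF evc L] by blast
  define E where "E M = (\<Sum>l<q. (\<Sum>j<p. A $$ (i, j) * M $$ (j * N + x, l * N + y)) * B $$ (l, k))" for M
  have "((\<lambda>z. E (u z)) \<longlongrightarrow> E L) F" unfolding E_def by (intro tendsto_intros entry) auto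
  moreover have "eventually (\<lambda>z. E (u z) = (kron A (1\<^sub>m N) * u z * kron B (1\<^sub>m N)) $$ (i * N + x, k * N + y)) F"
    using evc by eventually_elim (simp add: E_def kron_sandwich_index[OF A _ B i])
  ultimately show ?thesis
    unfolding kron_sandwich_index[OF A L B i] E_def[symmetric] by (rule Lim_transform_eventually)
qed

text \<open>The radial points of a boundary matrix are interior.\<close>

lemma radial_int_ball:
  assumes X: "X \<in> nc_bdry_ball g' g N"
  shows "eventually (\<lambda>r. (complex_of_real r * cis t) \<cdot>\<^sub>m X \<in> nc_int_ball g' g N) (at_left 1)"
proof -
  have Xc: "X \<in> carrier_mat (g' * N) (g * N)" "op_norm X = 1" using X by (auto simp: nc_bdry_ball_def)
  have "(0 :: real) < 1" by simp
  from eventually_at_left_real[OF this] show ?thesis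
  proof eventually_elim
    case (elim r)
    then have "cmod (complex_of_real r * cis t) < 1" by (simp add: norm_mult)
    then show ?case using smult_int_ball[OF Xc(1), of 1 "complex_of_real r * cis t"] Xc(2) by simp
  qed
qed

text \<open>The normal form writes \<open>f\<close> as \<open>\<F>\<^sub>v(\<Phi>)\<close> with a contraction \<open>\<Phi>\<close> that has \<open>X\<close> as a corner.  A radial limit
  of \<open>f\<close> is therefore a contraction, and it is carried by \<open>\<F>\<^sub>v\<close> to a contraction with a corner of norm one.\<close>

lemma nc_ball_normal_form_imp_nc_ball_map:
  assumes an: "nc_analytic g' g d' d f" and nf: "nc_ball_normal_form g' g d' d f U V \<psi>"
  shows "nc_ball_map g' g d' d f"
proof -
  define v where "v = nc_at_zero g' g f"
  have vc: "v \<in> carrier_mat d' d" unfolding v_def by (rule nc_at_zero_carrier[OF an])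
  have v1: "op_norm v < 1" and le: "g' \<le> d'" "g \<le> d" and U: "unitary_mat d U" and V: "unitary_mat d' V"
    and \<psi>: "nc_analytic g' g (d' - g') (d - g) \<psi>" "nc_contraction_valued g' g \<psi>"
    and form: "\<And>N X. N \<ge> 1 \<Longrightarrow> X \<in> nc_int_ball g' g N \<Longrightarrow>
        f N X = lin_frac d' d v N (lin_frac d' d v N (f N X)) \<and>
        lin_frac d' d v N (f N X) = kron V (1\<^sub>m N) * nc_block_diag g' g d' d N X (\<psi> N X) * mat_adjoint (kron U (1\<^sub>m N))"
    using nf unfolding nc_ball_normal_form_def Let_def v_def by blast+
  have Uc: "U \<in> carrier_mat d d" and Vc: "V \<in> carrier_mat d' d'" using U V by (auto simp: unitary_mat_def)
  define c where "c N = kron v (1\<^sub>m N)" for N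
  have c: "c N \<in> carrier_mat (d' * N) (d * N)" "op_norm (c N) < 1" for N
    using vc op_norm_kron_1_lt[OF vc v1] by (auto simp: c_def)
  define D where "D N X = nc_block_diag g' g d' d N X (\<psi> N X)" for N X
  define \<Phi> where "\<Phi> N X = kron V (1\<^sub>m N) * D N X * mat_adjoint (kron U (1\<^sub>m N))" for N X
  have VN: "unitary_mat (d' * N) (kron V (1\<^sub>m N))" and UN: "unitary_mat (d * N) (kron U (1\<^sub>m N))" for N
    by (rule unitary_mat_kron[OF V], rule unitary_mat_kron[OF U])
  have VNc: "kron V (1\<^sub>m N) \<in> carrier_mat (d' * N) (d' * N)" and UNc: "kron U (1\<^sub>m N) \<in> carrier_mat (d * N) (d * N)" for N
    using VN UN by (auto simp: unitary_mat_def)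
  have inner: "D N X \<in> carrier_mat (d' * N) (d * N)" "\<Phi> N X \<in> carrier_mat (d' * N) (d * N)" "op_norm (\<Phi> N X) \<le> 1"
    "\<psi> N X \<in> carrier_mat ((d' - g') * N) ((d - g) * N)" "X \<in> carrier_mat (g' * N) (g * N)"
    if N: "N \<ge> 1" and X: "X \<in> nc_int_ball g' g N" for N X
  proof -
    show Xc: "X \<in> carrier_mat (g' * N) (g * N)" using X by (simp add: nc_int_ball_def)
    have X1: "op_norm X \<le> 1" using X by (simp add: nc_int_ball_def)
    show Yc: "\<psi> N X \<in> carrier_mat ((d' - g') * N) ((d - g) * N)" using \<psi>(1) N X by (simp add: nc_analytic_def)
    have Y1: "op_norm (\<psi> N X) \<le> 1" using \<psi>(2) N X by (simp add: nc_contraction_valued_def)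
    show Dc: "D N X \<in> carrier_mat (d' * N) (d * N)"
      unfolding D_def by (rule nc_block_diag_carrier[OF le Xc Yc])
    have D1: "op_norm (D N X) \<le> 1" unfolding D_def by (rule nc_block_diag_contraction[OF le Xc X1 Yc Y1])
    note VD = mult_carrier_mat[OF VNc Dc] and Us = mat_adjoint_carrier[OF UNc]
    show "\<Phi> N X \<in> carrier_mat (d' * N) (d * N)"
      unfolding \<Phi>_def by (rule mult_carrier_mat[OF VD Us])
    have "op_norm (kron V (1\<^sub>m N) * D N X) \<le> 1"
      by (rule contraction_mult[OF VNc unitary_mat_contraction[OF VN] Dc D1])
    then show "op_norm (\<Phi> N X) \<le> 1"
      unfolding \<Phi>_def
      by (rule contraction_mult[OF VD _ Us contraction_adjoint[OF UNc unitary_mat_contraction[OF UN]]])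
  qed
  have f\<Phi>: "f N X = mat_moebius (c N) (\<Phi> N X)" if "N \<ge> 1" "X \<in> nc_int_ball g' g N" for N X
  proof -
    have e: "lin_frac d' d v N (f N X) = \<Phi> N X" using form[OF that] by (simp only: \<Phi>_def D_def)
    have "f N X = lin_frac d' d v N (\<Phi> N X)" using form[OF that] unfolding e by blast
    then show ?thesis by (simp only: lin_frac_eq_mat_moebius[OF vc v1] c_def)
  qed
  have fc: "f N X \<in> carrier_mat (d' * N) (d * N)" and f1: "op_norm (f N X) \<le> 1"
    and \<Phi>f: "mat_moebius (c N) (f N X) = \<Phi> N X"
    if "N \<ge> 1" "X \<in> nc_int_ball g' g N" for N X
    unfolding f\<Phi>[OF that] using mat_moebius_carrier[OF c(1)] mat_moebius_contraction[OF c inner(2,3)[OF that]]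
      mat_moebius_involution[OF c inner(2,3)[OF that]] by auto
  define A where "A = mat_adjoint (shift_mat d' 0 g') * mat_adjoint V"
  define B where "B = U * shift_mat d 0 g"
  have A: "A \<in> carrier_mat g' d'" "op_norm A \<le> 1"
    unfolding A_def
    using mult_carrier_mat[OF mat_adjoint_carrier[OF shift_mat_carrier] mat_adjoint_carrier[OF Vc]]
      contraction_mult[OF mat_adjoint_carrier[OF shift_mat_carrier] op_norm_shift_mat_adjoint
        mat_adjoint_carrier[OF Vc] contraction_adjoint[OF Vc unitary_mat_contraction[OF V]]] by auto
  have B: "B \<in> carrier_mat d g" "op_norm B \<le> 1"
    unfolding B_def
    using mult_carrier_mat[OF Uc shift_mat_carrier]
      contraction_mult[OF Uc unitary_mat_contraction[OF U] shift_mat_carrier op_norm_shift_mat] by auto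
  have corner: "(kron A (1\<^sub>m N) * \<Phi> N X * kron B (1\<^sub>m N)) $$ (i * N + x, k * N + y) = X $$ (i * N + x, k * N + y)"
    if N: "N \<ge> 1" and X: "X \<in> nc_int_ball g' g N" and i: "i < g'" "x < N" "k < g" "y < N" for N X i x k y
  proof -
    have DN: "mat_adjoint (kron V (1\<^sub>m N)) * \<Phi> N X * kron U (1\<^sub>m N) = D N X"
      using unitary_conj_iff[OF VN UN inner(2,1)[OF N X]] by (simp add: \<Phi>_def)
    have "(kron A (1\<^sub>m N) * \<Phi> N X * kron B (1\<^sub>m N)) $$ (i * N + x, k * N + y) = D N X $$ ((0 + i) * N + x, (0 + k) * N + y)"
      unfolding A_def B_def kron_compress[OF shift_mat_carrier Vc inner(2)[OF N X] Uc shift_mat_carrier] DN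
      by (rule kron_shift_index[OF inner(1)[OF N X] _ _ i]) (use le in auto)
    also have "\<dots> = X $$ (i * N + x, k * N + y)"
      using nc_block_diag_index[OF le inner(5,4)[OF N X], of i x k y] i le by (simp add: D_def)
    finally show ?thesis .
  qed
  show ?thesis
    unfolding nc_ball_map_def
  proof (intro conjI allI ballI impI an)
    fix N and X :: "complex mat" assume "1 \<le> N" "X \<in> nc_int_ball g' g N"
    then show "f N X \<in> nc_ball d' d N" using fc f1 by (simp add: nc_ball_def)
  next
    fix N and X :: "complex mat" and t :: real and L :: "complex mat"
    let ?Z = "\<lambda>r. (complex_of_real r * cis t) \<cdot>\<^sub>m X"
    assume N: "1 \<le> N" and X: "X \<in> nc_bdry_ball g' g N" and L: "L \<in> carrier_mat (d' * N) (d * N)"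
      and lim: "mat_tendsto (\<lambda>r. f N (?Z r)) L (at_left 1)"
    have Xc: "X \<in> carrier_mat (g' * N) (g * N)" "op_norm X = 1" using X by (auto simp: nc_bdry_ball_def)
    have nt: "at_left (1 :: real) \<noteq> bot" by simp
    have ev: "eventually (\<lambda>r. ?Z r \<in> nc_int_ball g' g N) (at_left 1)" by (rule radial_int_ball[OF X])
    have evf: "eventually (\<lambda>r. f N (?Z r) \<in> carrier_mat (d' * N) (d * N) \<and> op_norm (f N (?Z r)) \<le> 1) (at_left 1)"
      using ev by eventually_elim (use fc f1 N in blast)
    have L1: "op_norm L \<le> 1" by (rule mat_tendsto_contraction[OF evf nt L lim])
    define M where "M = mat_moebius (c N) L"
    have Mc: "M \<in> carrier_mat (d' * N) (d * N)" unfolding M_def by (rule mat_moebius_carrier[OF c(1)])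
    have M1: "op_norm M \<le> 1" unfolding M_def by (rule mat_moebius_contraction[OF c L L1])
    have limM: "mat_tendsto (\<lambda>r. mat_moebius (c N) (f N (?Z r))) M (at_left 1)"
      unfolding M_def by (rule mat_moebius_tendsto[OF c evf nt L lim])
    have evM: "eventually (\<lambda>r. mat_moebius (c N) (f N (?Z r)) \<in> carrier_mat (d' * N) (d * N)) (at_left 1)"
      by (intro always_eventually allI mat_moebius_carrier[OF c(1)])
    \<comment> \<open>The upper left corner of \<open>\<phi>\<close> is the argument itself, so its boundary value has norm one.\<close>
    have KM: "kron A (1\<^sub>m N) * M * kron B (1\<^sub>m N) \<in> carrier_mat (g' * N) (g * N)"
      using kron_carrier[OF A(1) one_carrier_mat] kron_carrier[OF B(1) one_carrier_mat] Mc
      by (intro mult_carrier_mat[of _ "g' * N" "d * N"] mult_carrier_mat[of _ "g' * N" "d' * N"]) auto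
    have K: "kron A (1\<^sub>m N) * M * kron B (1\<^sub>m N) = cis t \<cdot>\<^sub>m X"
    proof (rule block_eq_matI[OF KM])
      show "cis t \<cdot>\<^sub>m X \<in> carrier_mat (g' * N) (g * N)" using Xc by simp
      fix i x k y assume i: "i < g'" "x < N" "k < g" "y < N"
      have ij: "i * N + x < g' * N" "k * N + y < g * N" using i by (auto intro: block_index_less)
      have "eventually (\<lambda>r. (kron A (1\<^sub>m N) * mat_moebius (c N) (f N (?Z r)) * kron B (1\<^sub>m N)) $$ (i * N + x, k * N + y)
          = complex_of_real r * cis t * X $$ (i * N + x, k * N + y)) (at_left 1)"
        using ev
      proof eventually_elim
        case (elim r)
        show ?case unfolding \<Phi>f[OF N elim] corner[OF N elim i] using Xc ij by simp
      qed
      then have "((\<lambda>r. complex_of_real r * cis t * X $$ (i * N + x, k * N + y))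
          \<longlongrightarrow> (kron A (1\<^sub>m N) * M * kron B (1\<^sub>m N)) $$ (i * N + x, k * N + y)) (at_left 1)"
        by (rule Lim_transform_eventually[OF kron_sandwich_tendsto[OF A(1) B(1) evM Mc limM i]])
      moreover have "((\<lambda>r. complex_of_real r * cis t * X $$ (i * N + x, k * N + y))
          \<longlongrightarrow> complex_of_real 1 * cis t * X $$ (i * N + x, k * N + y)) (at_left 1)"
        by (intro tendsto_intros)
      ultimately have "(kron A (1\<^sub>m N) * M * kron B (1\<^sub>m N)) $$ (i * N + x, k * N + y)
          = complex_of_real 1 * cis t * X $$ (i * N + x, k * N + y)"
        by (rule tendsto_unique[OF nt])
      then show "(kron A (1\<^sub>m N) * M * kron B (1\<^sub>m N)) $$ (i * N + x, k * N + y) = (cis t \<cdot>\<^sub>m X) $$ (i * N + x, k * N + y)"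
        using Xc ij by simp
    qed
    have "X = cis (- t) \<cdot>\<^sub>m (cis t \<cdot>\<^sub>m X)"
      using Xc by (intro eq_matI) (auto simp: mult.assoc[symmetric] cis_mult)
    then have "1 \<le> cmod (cis (- t)) * op_norm (cis t \<cdot>\<^sub>m X)"
      using op_norm_smult_le[of "cis t \<cdot>\<^sub>m X" "g' * N" "g * N" "cis (- t)"] Xc by simp
    also have "\<dots> \<le> op_norm M"
      unfolding K[symmetric] using op_norm_kron_sandwich_le[OF A Mc B] by simp
    finally have "op_norm M = 1" using M1 by simp
    then have "op_norm (mat_moebius (c N) M) = 1" by (rule mat_moebius_norm_1[OF c Mc])
    then show "op_norm L = 1" unfolding M_def mat_moebius_involution[OF c L L1] .
  qed
qed

context normalized_ball_map
begin

text \<open>In coordinates extending the extremal vectors to orthonormal bases, the coefficients in the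
  first \<open>g'\<close> rows and the first \<open>g\<close> columns are those of \<open>x\<close>.\<close>

lemma normal_form:
  obtains U V where "g' \<le> p" "g \<le> q" "unitary_mat q U" "unitary_mat p V"
    "\<And>N X i x k y. N \<ge> 1 \<Longrightarrow> X \<in> nc_int_ball g' g N \<Longrightarrow> i < p \<Longrightarrow> x < N \<Longrightarrow> k < q \<Longrightarrow> y < N \<Longrightarrow> i < g' \<or> k < g \<Longrightarrow>
      (kron (mat_adjoint V) (1\<^sub>m N) * \<phi> N X * kron U (1\<^sub>m N)) $$ (i * N + x, k * N + y)
      = (if i < g' \<and> k < g then X $$ (i * N + x, k * N + y) else 0)"
proof (rule extremal_structure)
  fix \<xi> \<zeta>
  assume \<xi>: "\<And>l. l < g \<Longrightarrow> \<xi> l \<in> carrier_vec q" and \<zeta>: "\<And>j. j < g' \<Longrightarrow> \<zeta> j \<in> carrier_vec p"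
    and on: "\<And>l m. l < g \<Longrightarrow> m < g \<Longrightarrow> \<xi> l \<bullet>c \<xi> m = of_bool (l = m)"
      "\<And>j k. j < g' \<Longrightarrow> k < g' \<Longrightarrow> \<zeta> j \<bullet>c \<zeta> k = of_bool (j = k)"
    and a1: "\<And>j l. j < g' \<Longrightarrow> l < g \<Longrightarrow> a [(j, l)] *\<^sub>v \<xi> l = \<zeta> j"
      "\<And>j l. j < g' \<Longrightarrow> l < g \<Longrightarrow> mat_adjoint (a [(j, l)]) *\<^sub>v \<zeta> j = \<xi> l"
    and a0: "\<And>w m. set w \<subseteq> {..<g'} \<times> {..<g} \<Longrightarrow> m < g \<Longrightarrow> (\<And>j. w \<noteq> [(j, m)]) \<Longrightarrow> a w *\<^sub>v \<xi> m = 0\<^sub>v p"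
      "\<And>w k. set w \<subseteq> {..<g'} \<times> {..<g} \<Longrightarrow> k < g' \<Longrightarrow> (\<And>l. w \<noteq> [(k, l)]) \<Longrightarrow> mat_adjoint (a w) *\<^sub>v \<zeta> k = 0\<^sub>v q"
  obtain U where gq: "g \<le> q" and U: "unitary_mat q U" and U\<xi>: "\<And>i l. i < q \<Longrightarrow> l < g \<Longrightarrow> U $$ (i, l) = \<xi> l $ i"
    by (rule unitary_completion[of g \<xi> q]) (assumption | rule \<xi> on(1) that | blast)+
  obtain V where gp: "g' \<le> p" and V: "unitary_mat p V" and V\<zeta>: "\<And>i l. i < p \<Longrightarrow> l < g' \<Longrightarrow> V $$ (i, l) = \<zeta> l $ i"
    by (rule unitary_completion[of g' \<zeta> p]) (assumption | rule \<zeta> on(2) that | blast)+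
  have Uc: "U \<in> carrier_mat q q" and UU: "mat_adjoint U * U = 1\<^sub>m q" using U by (auto simp: unitary_mat_def)
  have Vc: "V \<in> carrier_mat p p" and VV: "mat_adjoint V * V = 1\<^sub>m p" using V by (auto simp: unitary_mat_def)
  note Us = mat_adjoint_carrier[OF Uc] and Vs = mat_adjoint_carrier[OF Vc]
  \<comment> \<open>The entries of the coefficients \<open>V\<^sup>* a\<^sub>w U\<close> in the new coordinates.\<close>
  define b where "b w i k = (\<Sum>l<q. (\<Sum>j<p. mat_adjoint V $$ (i, j) * a w $$ (j, l)) * U $$ (l, k))" for w i k
  have b_row: "b w i k = of_bool (w = [(i, k)])"
    if w: "set w \<subseteq> {..<g'} \<times> {..<g}" and i: "i < g'" and k: "k < q" for w i k
  proof -
    have r: "(\<Sum>j<p. mat_adjoint V $$ (i, j) * a w $$ (j, l)) = cnj ((mat_adjoint (a w) *\<^sub>v \<zeta> i) $ l)" if l: "l < q" for l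
    proof -
      have "(mat_adjoint (a w) *\<^sub>v \<zeta> i) $ l = (\<Sum>j<p. mat_adjoint (a w) $$ (l, j) * \<zeta> i $ j)"
        by (rule mult_mat_vec_index_sum[OF mat_adjoint_carrier[OF a_carrier] \<zeta>[OF i] l])
      also have "\<dots> = (\<Sum>j<p. cnj (mat_adjoint V $$ (i, j) * a w $$ (j, l)))"
        by (rule sum.cong[OF refl])
           (use i l gp Vc carrier_matD[OF a_carrier[of w]] in \<open>simp add: V\<zeta>\<close>)
      finally show ?thesis by (simp only: complex_cnj_cnj flip: cnj_sum)
    qed
    have bw: "b w i k = (\<Sum>l<q. cnj ((mat_adjoint (a w) *\<^sub>v \<zeta> i) $ l) * U $$ (l, k))"
      unfolding b_def by (rule sum.cong[OF refl]) (simp only: lessThan_iff r)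
    show ?thesis
    proof (cases "\<exists>m. w = [(i, m)]")
      case True
      then obtain m where m: "w = [(i, m)]" by blast
      then have mg: "m < g" using w by simp
      have "b w i k = (\<Sum>l<q. mat_adjoint U $$ (m, l) * U $$ (l, k))"
        unfolding bw unfolding m a1(2)[OF i mg]
        by (rule sum.cong[OF refl]) (use mg gq Uc in \<open>simp add: U\<xi>\<close>)
      also have "\<dots> = (mat_adjoint U * U) $$ (m, k)"
        by (rule mat_mult_index_sum[OF Us Uc, symmetric]) (use mg gq k in auto)
      finally show ?thesis unfolding UU using mg gq k m by auto
    next
      case False
      then have z: "mat_adjoint (a w) *\<^sub>v \<zeta> i = 0\<^sub>v q" by (intro a0(2)[OF w i]) blast
      have "b w i k = 0" unfolding bw z by simp
      then show ?thesis using False by auto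
    qed
  qed
  have b_col: "b w i k = of_bool (w = [(i, k)])"
    if w: "set w \<subseteq> {..<g'} \<times> {..<g}" and i: "i < p" and k: "k < g" for w i k
  proof -
    have "b w i k = (\<Sum>l<q. \<Sum>j<p. mat_adjoint V $$ (i, j) * (a w $$ (j, l) * U $$ (l, k)))"
      unfolding b_def by (simp only: sum_distrib_right mult.assoc)
    also have "\<dots> = (\<Sum>j<p. \<Sum>l<q. mat_adjoint V $$ (i, j) * (a w $$ (j, l) * U $$ (l, k)))" by (rule sum.swap)
    also have "\<dots> = (\<Sum>j<p. mat_adjoint V $$ (i, j) * (\<Sum>l<q. a w $$ (j, l) * U $$ (l, k)))"
      by (simp only: sum_distrib_left)
    also have "\<dots> = (\<Sum>j<p. mat_adjoint V $$ (i, j) * (a w *\<^sub>v \<xi> k) $ j)"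
    proof (rule sum.cong[OF refl])
      fix j assume "j \<in> {..<p}"
      then have j: "j < p" by simp
      have "(\<Sum>l<q. a w $$ (j, l) * U $$ (l, k)) = (\<Sum>l<q. a w $$ (j, l) * \<xi> k $ l)"
        by (rule sum.cong[OF refl]) (use k in \<open>simp add: U\<xi>\<close>)
      then show "mat_adjoint V $$ (i, j) * (\<Sum>l<q. a w $$ (j, l) * U $$ (l, k))
          = mat_adjoint V $$ (i, j) * (a w *\<^sub>v \<xi> k) $ j"
        by (simp only: mult_mat_vec_index_sum[OF a_carrier \<xi>[OF k] j])
    qed
    finally have bw: "b w i k = (\<Sum>j<p. mat_adjoint V $$ (i, j) * (a w *\<^sub>v \<xi> k) $ j)" .
    show ?thesis
    proof (cases "\<exists>m. w = [(m, k)]")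
      case True
      then obtain m where m: "w = [(m, k)]" by blast
      then have mg: "m < g'" using w by simp
      have "b w i k = (\<Sum>j<p. mat_adjoint V $$ (i, j) * V $$ (j, m))"
        unfolding bw unfolding m a1(1)[OF mg k]
        by (rule sum.cong[OF refl]) (use mg gp in \<open>simp add: V\<zeta>\<close>)
      also have "\<dots> = (mat_adjoint V * V) $$ (i, m)"
        by (rule mat_mult_index_sum[OF Vs Vc, symmetric]) (use mg gp i in auto)
      finally show ?thesis unfolding VV using mg gp i m by auto
    next
      case False
      then have z: "a w *\<^sub>v \<xi> k = 0\<^sub>v p" by (intro a0(1)[OF w k]) blast
      have "b w i k = 0" unfolding bw z by simp
      then show ?thesis using False by auto
    qed
  qed
  show ?thesis
  proof (rule that[OF gp gq U V])
    fix N and X :: "complex mat" and i x k y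
    assume N: "N \<ge> 1" and X: "X \<in> nc_int_ball g' g N" and i: "i < p" "x < N" "k < q" "y < N" and ik: "i < g' \<or> k < g"
    have Xc: "X \<in> carrier_mat (g' * N) (g * N)" using X by (simp add: nc_int_ball_def)
    have \<phi>c: "\<phi> N X \<in> carrier_mat (p * N) (q * N)" by (rule nc_holo_carrier[OF holo N X])
    have b: "b w i k = of_bool (w = [(i, k)])" if "w \<in> nc_words g' g \<alpha>" for w \<alpha>
      using that ik b_row[of w i k] b_col[of w i k] i by (auto simp: nc_words_def)
    \<comment> \<open>The contribution of degree \<open>\<alpha>\<close> to the entry; only degree one survives.\<close>
    define t where "t \<alpha> = (\<Sum>l<q. (\<Sum>j<p. mat_adjoint V $$ (i, j) * hom N X \<alpha> $$ (j * N + x, l * N + y)) * U $$ (l, k))" for \<alpha>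
    have "t sums (\<Sum>l<q. (\<Sum>j<p. mat_adjoint V $$ (i, j) * \<phi> N X $$ (j * N + x, l * N + y)) * U $$ (l, k))"
      unfolding t_def
    proof (intro sums_sum sums_mult2 sums_mult)
      fix l j assume "l \<in> {..<q}" "j \<in> {..<p}"
      then have "j * N + x < p * N" "l * N + y < q * N" using i by (auto intro: block_index_less)
      from nc_taylor_sums_1[OF holo N X this]
      show "(\<lambda>\<alpha>. hom N X \<alpha> $$ (j * N + x, l * N + y)) sums \<phi> N X $$ (j * N + x, l * N + y)"
        by (simp only: nc_expansion_taylor[OF holo expansion N Xc])
    qed
    then have s1: "t sums (kron (mat_adjoint V) (1\<^sub>m N) * \<phi> N X * kron U (1\<^sub>m N)) $$ (i * N + x, k * N + y)"
      by (simp only: kron_sandwich_index[OF Vs \<phi>c Uc i])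
    have "t \<alpha> = (if \<alpha> = 1 then if i < g' \<and> k < g then X $$ (i * N + x, k * N + y) else 0 else 0)" for \<alpha>
    proof -
      have "t \<alpha> = (\<Sum>l<q. (\<Sum>j<p. mat_adjoint V $$ (i, j) * (\<Sum>w\<in>nc_words g' g \<alpha>. a w $$ (j, l) * word_eval N w X $$ (x, y))) * U $$ (l, k))"
        unfolding t_def
        by (rule sum.cong[OF refl], rule arg_cong2[where f = "(*)", OF _ refl], rule sum.cong[OF refl])
           (use i in \<open>simp add: homog_index[OF a_carrier]\<close>)
      also have "\<dots> = (\<Sum>l<q. \<Sum>j<p. \<Sum>w\<in>nc_words g' g \<alpha>. mat_adjoint V $$ (i, j) * a w $$ (j, l) * U $$ (l, k) * word_eval N w X $$ (x, y))"
        by (simp add: sum_distrib_left sum_distrib_right mult.assoc mult.left_commute mult.commute)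
      also have "\<dots> = (\<Sum>l<q. \<Sum>w\<in>nc_words g' g \<alpha>. \<Sum>j<p. mat_adjoint V $$ (i, j) * a w $$ (j, l) * U $$ (l, k) * word_eval N w X $$ (x, y))"
        by (rule sum.cong[OF refl], rule sum.swap)
      also have "\<dots> = (\<Sum>w\<in>nc_words g' g \<alpha>. \<Sum>l<q. \<Sum>j<p. mat_adjoint V $$ (i, j) * a w $$ (j, l) * U $$ (l, k) * word_eval N w X $$ (x, y))"
        by (rule sum.swap)
      also have "\<dots> = (\<Sum>w\<in>nc_words g' g \<alpha>. b w i k * word_eval N w X $$ (x, y))"
        unfolding b_def by (simp only: sum_distrib_right)
      also have "\<dots> = (\<Sum>w\<in>nc_words g' g \<alpha>. if w = [(i, k)] then word_eval N w X $$ (x, y) else 0)"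
        by (rule sum.cong[OF refl]) (simp add: b)
      also have "\<dots> = (if [(i, k)] \<in> nc_words g' g \<alpha> then word_eval N [(i, k)] X $$ (x, y) else 0)"
        by (rule sum.delta[OF finite_nc_words])
      also have "\<dots> = (if \<alpha> = 1 then if i < g' \<and> k < g then X $$ (i * N + x, k * N + y) else 0 else 0)"
        using i by (auto simp: nc_words_def word_eval_single nc_block_def)
      finally show ?thesis .
    qed
    then have "t = (\<lambda>\<alpha>. if \<alpha> = 1 then if i < g' \<and> k < g then X $$ (i * N + x, k * N + y) else 0 else 0)" by (intro ext)
    then have "t sums (if i < g' \<and> k < g then X $$ (i * N + x, k * N + y) else 0)"
      using sums_single[of 1 "\<lambda>_. if i < g' \<and> k < g then X $$ (i * N + x, k * N + y) else 0"] by simp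
    then show "(kron (mat_adjoint V) (1\<^sub>m N) * \<phi> N X * kron U (1\<^sub>m N)) $$ (i * N + x, k * N + y)
      = (if i < g' \<and> k < g then X $$ (i * N + x, k * N + y) else 0)"
      using s1 sums_unique2 by blast
  qed
qed

end

text \<open>Composition with \<open>\<F>\<^sub>v\<close>, \<open>v = f(0)\<close>, moves \<open>f(0)\<close> to the origin and preserves the boundary condition;
  the remaining corner of the resulting map, after the change of coordinates, is \<open>\<psi>\<close>.\<close>

lemma nc_ball_map_normal_form:
  assumes pos: "g' \<ge> 1" "g \<ge> 1" and ball: "nc_ball_map g' g d' d f" and v: "nc_at_zero g' g f \<notin> nc_bdry_ball d' d 1"
  shows "\<exists>U V \<psi>. nc_ball_normal_form g' g d' d f U V \<psi>"
proof -
  have an: "nc_analytic g' g d' d f" using ball by (simp add: nc_ball_map_def)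
  have fc: "f N X \<in> carrier_mat (d' * N) (d * N)" and f1: "op_norm (f N X) \<le> 1"
    if "N \<ge> 1" "X \<in> nc_int_ball g' g N" for N X
    using ball that by (auto simp: nc_ball_map_def nc_ball_def)
  define v where "v = nc_at_zero g' g f"
  have vc: "v \<in> carrier_mat d' d" unfolding v_def by (rule nc_at_zero_carrier[OF an])
  have v1: "op_norm v < 1"
    using f1[of 1 "0\<^sub>m g' g"] zero_mem_nc_int_ball[of g' 1 g] v vc
    by (auto simp: v_def nc_at_zero_def nc_bdry_ball_def)
  define c where "c N = kron v (1\<^sub>m N)" for N
  have c: "c N \<in> carrier_mat (d' * N) (d * N)" "op_norm (c N) < 1" for N
    using vc op_norm_kron_1_lt[OF vc v1] by (auto simp: c_def)
  define \<phi> where "\<phi> N X = mat_moebius (c N) (f N X)" for N X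
  have \<phi>: "nc_analytic g' g d' d \<phi>"
    unfolding \<phi>_def c_def by (rule nc_analytic_mat_moebius[OF an v_def v1 f1])
  have \<phi>c: "\<phi> N X \<in> carrier_mat (d' * N) (d * N)" for N X
    unfolding \<phi>_def by (rule mat_moebius_carrier[OF c(1)])
  have \<phi>1: "op_norm (\<phi> N X) \<le> 1" and \<phi>f: "mat_moebius (c N) (\<phi> N X) = f N X"
    if "N \<ge> 1" "X \<in> nc_int_ball g' g N" for N X
    unfolding \<phi>_def by (rule mat_moebius_contraction[OF c fc[OF that] f1[OF that]],
      rule mat_moebius_involution[OF c fc[OF that] f1[OF that]])
  obtain a \<epsilon> where a: "nc_expansion g' g d' d \<phi> a \<epsilon>" using \<phi> by (auto simp: nc_analytic_def)
  have \<phi>0: "nc_at_zero g' g \<phi> = 0\<^sub>m d' d"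
    using mat_moebius_self[OF vc v1] kron_1_size_1[OF vc] by (simp add: nc_at_zero_def \<phi>_def c_def v_def)
  interpret normalized_ball_map g' g d' d \<phi> a \<epsilon>
  proof
    show "a [] = 0\<^sub>m d' d" using nc_at_zero_eq[OF \<phi> a] \<phi>0 by simp
    fix N and X L :: "complex mat"
    assume N: "N \<ge> 1" and X: "X \<in> nc_bdry_ball g' g N" and L: "L \<in> carrier_mat (d' * N) (d * N)"
      and lim: "mat_tendsto (\<lambda>r. \<phi> N (complex_of_real r \<cdot>\<^sub>m X)) L (at_left 1)"
    have nt: "at_left (1 :: real) \<noteq> bot" by simp
    have ev: "eventually (\<lambda>r. complex_of_real r \<cdot>\<^sub>m X \<in> nc_int_ball g' g N) (at_left 1)"
      using radial_int_ball[OF X, of 0] by simp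
    have ev\<phi>: "eventually (\<lambda>r. \<phi> N (complex_of_real r \<cdot>\<^sub>m X) \<in> carrier_mat (d' * N) (d * N)
        \<and> op_norm (\<phi> N (complex_of_real r \<cdot>\<^sub>m X)) \<le> 1) (at_left 1)"
      using ev by eventually_elim (use \<phi>c \<phi>1 N in blast)
    have L1: "op_norm L \<le> 1" by (rule mat_tendsto_contraction[OF ev\<phi> nt L lim])
    define M where "M = mat_moebius (c N) L"
    have Mc: "M \<in> carrier_mat (d' * N) (d * N)" unfolding M_def by (rule mat_moebius_carrier[OF c(1)])
    have "mat_tendsto (\<lambda>r. mat_moebius (c N) (\<phi> N (complex_of_real r \<cdot>\<^sub>m X))) M (at_left 1)"
      unfolding M_def by (rule mat_moebius_tendsto[OF c ev\<phi> nt L lim])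
    moreover have "eventually (\<lambda>r. op_norm (mat_moebius (c N) (\<phi> N (complex_of_real r \<cdot>\<^sub>m X)) - M)
        = op_norm (f N ((complex_of_real r * cis 0) \<cdot>\<^sub>m X) - M)) (at_left 1)"
      using ev by eventually_elim (simp add: \<phi>f[OF N])
    ultimately have "mat_tendsto (\<lambda>r. f N ((complex_of_real r * cis 0) \<cdot>\<^sub>m X)) M (at_left 1)"
      unfolding mat_tendsto_def by (rule Lim_transform_eventually)
    then have "op_norm M = 1" using ball N X Mc unfolding nc_ball_map_def by blast
    then have "op_norm (mat_moebius (c N) M) = 1" by (rule mat_moebius_norm_1[OF c Mc])
    then show "op_norm L = 1" unfolding M_def mat_moebius_involution[OF c L L1] .
  qed (use pos \<phi> a \<phi>1 in auto)
  obtain U V where le: "g' \<le> d'" "g \<le> d" and U: "unitary_mat d U" and V: "unitary_mat d' V"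
    and corner: "\<And>N X i x k y. N \<ge> 1 \<Longrightarrow> X \<in> nc_int_ball g' g N \<Longrightarrow> i < d' \<Longrightarrow> x < N \<Longrightarrow> k < d \<Longrightarrow> y < N \<Longrightarrow> i < g' \<or> k < g \<Longrightarrow>
      (kron (mat_adjoint V) (1\<^sub>m N) * \<phi> N X * kron U (1\<^sub>m N)) $$ (i * N + x, k * N + y)
      = (if i < g' \<and> k < g then X $$ (i * N + x, k * N + y) else 0)"
    by (rule normal_form) blast
  have Uc: "U \<in> carrier_mat d d" and Vc: "V \<in> carrier_mat d' d'" using U V by (auto simp: unitary_mat_def)
  have VN: "unitary_mat (d' * N) (kron V (1\<^sub>m N))" and UN: "unitary_mat (d * N) (kron U (1\<^sub>m N))" for N
    by (rule unitary_mat_kron[OF V], rule unitary_mat_kron[OF U])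
  define P where "P = mat_adjoint (shift_mat d' g' (d' - g')) * mat_adjoint V"
  define Q where "Q = U * shift_mat d g (d - g)"
  have P: "P \<in> carrier_mat (d' - g') d'" "op_norm P \<le> 1"
    unfolding P_def
    using mult_carrier_mat[OF mat_adjoint_carrier[OF shift_mat_carrier] mat_adjoint_carrier[OF Vc]]
      contraction_mult[OF mat_adjoint_carrier[OF shift_mat_carrier] op_norm_shift_mat_adjoint
        mat_adjoint_carrier[OF Vc] contraction_adjoint[OF Vc unitary_mat_contraction[OF V]]] by auto
  have Q: "Q \<in> carrier_mat d (d - g)" "op_norm Q \<le> 1"
    unfolding Q_def
    using mult_carrier_mat[OF Uc shift_mat_carrier]
      contraction_mult[OF Uc unitary_mat_contraction[OF U] shift_mat_carrier op_norm_shift_mat] by auto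
  define \<psi> where "\<psi> = (\<lambda>N X. kron P (1\<^sub>m N) * \<phi> N X * kron Q (1\<^sub>m N))"
  have \<psi>: "nc_analytic g' g (d' - g') (d - g) \<psi>"
    unfolding \<psi>_def by (rule nc_analytic_kron_mult[OF \<phi> P(1) Q(1)])
  have \<psi>1: "op_norm (\<psi> N X) \<le> op_norm (\<phi> N X)" for N X
    unfolding \<psi>_def by (rule op_norm_kron_sandwich_le[OF P \<phi>c Q])
  have \<psi>c: "\<psi> N X \<in> carrier_mat ((d' - g') * N) ((d - g) * N)" for N X
    unfolding \<psi>_def
    by (rule mult_carrier_mat[OF mult_carrier_mat[OF kron_carrier[OF P(1) one_carrier_mat] \<phi>c] kron_carrier[OF Q(1) one_carrier_mat]])
  have form: "\<phi> N X = kron V (1\<^sub>m N) * nc_block_diag g' g d' d N X (\<psi> N X) * mat_adjoint (kron U (1\<^sub>m N))"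
    if N: "N \<ge> 1" and X: "X \<in> nc_int_ball g' g N" for N X
  proof -
    have Xc: "X \<in> carrier_mat (g' * N) (g * N)" using X by (simp add: nc_int_ball_def)
    define C where "C = kron (mat_adjoint V) (1\<^sub>m N) * \<phi> N X * kron U (1\<^sub>m N)"
    have Cc: "C \<in> carrier_mat (d' * N) (d * N)"
      unfolding C_def
      by (rule mult_carrier_mat[OF mult_carrier_mat[OF kron_carrier[OF mat_adjoint_carrier[OF Vc] one_carrier_mat] \<phi>c] kron_carrier[OF Uc one_carrier_mat]])
    note Dc = nc_block_diag_carrier[OF le Xc \<psi>c[of N X]]
    have "C = nc_block_diag g' g d' d N X (\<psi> N X)"
    proof (rule block_eq_matI[OF Cc Dc])
      fix i x k y assume i: "i < d'" "x < N" "k < d" "y < N"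
      show "C $$ (i * N + x, k * N + y) = nc_block_diag g' g d' d N X (\<psi> N X) $$ (i * N + x, k * N + y)"
      proof (cases "i < g' \<or> k < g")
        case True
        then show ?thesis
          unfolding nc_block_diag_index[OF le Xc \<psi>c i] C_def corner[OF N X i True] by auto
      next
        case False
        then have i': "i - g' < d' - g'" "k - g < d - g" and e: "g' + (i - g') = i" "g + (k - g) = k" using i by auto
        have "\<psi> N X $$ ((i - g') * N + x, (k - g) * N + y) = C $$ ((g' + (i - g')) * N + x, (g + (k - g)) * N + y)"
          unfolding \<psi>_def P_def Q_def kron_compress[OF shift_mat_carrier Vc \<phi>c Uc shift_mat_carrier]
            kron_adjoint_1[OF Vc] C_def[symmetric]
          by (rule kron_shift_index[OF Cc _ _ i'(1) i(2) i'(2) i(4)]) (use le in auto)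
        then show ?thesis unfolding nc_block_diag_index[OF le Xc \<psi>c i] e using False by simp
      qed
    qed
    then have "mat_adjoint (kron V (1\<^sub>m N)) * \<phi> N X * kron U (1\<^sub>m N) = nc_block_diag g' g d' d N X (\<psi> N X)"
      by (simp only: C_def kron_adjoint_1[OF Vc])
    then show ?thesis using unitary_conj_iff[OF VN UN \<phi>c Dc] by blast
  qed
  have "nc_ball_normal_form g' g d' d f U V \<psi>"
    unfolding nc_ball_normal_form_def Let_def v_def[symmetric] lin_frac_eq_mat_moebius[OF vc v1] c_def[symmetric] \<phi>_def[symmetric]
  proof (intro conjI allI ballI impI v1 le U V \<psi>)
    show "nc_contraction_valued g' g \<psi>"
      unfolding nc_contraction_valued_def using \<psi>1 \<phi>1 order_trans by blast
    have "op_norm (\<psi> 1 (0\<^sub>m g' g)) \<le> 0"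
      using \<psi>1[of 1 "0\<^sub>m g' g"] \<phi>0 by (simp add: nc_at_zero_def op_norm_zero_mat)
    then show "op_norm (nc_at_zero g' g \<psi>) < 1" by (simp add: nc_at_zero_def)
    fix N and X :: "complex mat" assume NX: "N \<ge> 1" "X \<in> nc_int_ball g' g N"
    show "f N X = mat_moebius (c N) (\<phi> N X)" by (rule \<phi>f[OF NX, symmetric])
    show "\<phi> N X = kron V (1\<^sub>m N) * nc_block_diag g' g d' d N X (\<psi> N X) * mat_adjoint (kron U (1\<^sub>m N))"
      by (rule form[OF NX])
  qed
  then show ?thesis by blast
qed

theorem theorem1p7:
  fixes g' g d' d :: nat and f :: nc_map
  assumes "g' \<ge> 1" "g \<ge> 1" "d' \<ge> 1" "d \<ge> 1"
  shows "(nc_ball_map g' g d' d f \<and> nc_at_zero g' g f \<notin> nc_bdry_ball d' d 1 \<longrightarrow>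
            (\<exists>U V \<psi>. nc_ball_normal_form g' g d' d f U V \<psi>))
       \<and> (nc_analytic g' g d' d f \<and> (\<exists>U V \<psi>. nc_ball_normal_form g' g d' d f U V \<psi>) \<longrightarrow>
            nc_ball_map g' g d' d f \<and> nc_at_zero g' g f \<notin> nc_bdry_ball d' d 1)"
proof (intro conjI impI)
  assume "nc_ball_map g' g d' d f \<and> nc_at_zero g' g f \<notin> nc_bdry_ball d' d 1"
  then show "\<exists>U V \<psi>. nc_ball_normal_form g' g d' d f U V \<psi>"
    using nc_ball_map_normal_form[OF assms(1,2)] by blast
next
  assume "nc_analytic g' g d' d f \<and> (\<exists>U V \<psi>. nc_ball_normal_form g' g d' d f U V \<psi>)"
  then obtain U V \<psi> where *: "nc_analytic g' g d' d f" "nc_ball_normal_form g' g d' d f U V \<psi>" by blast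
  show "nc_ball_map g' g d' d f" by (rule nc_ball_normal_form_imp_nc_ball_map[OF *])
  show "nc_at_zero g' g f \<notin> nc_bdry_ball d' d 1"
    using *(2) by (simp add: nc_ball_normal_form_def nc_bdry_ball_def)
qed

end
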